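(* Let $H\in(1/2,1)$, $\alpha\in(1-H,1)$, $T>0$, $\sigma>0$, $x_0\in\mathbb R$, and let $b:\mathbb R\to\mathbb R$ belong to $C^{1,3}_{b,p}$. Let $x$ be the unique strong solution on $[0,T]$ of $$x(t)=x_0+\frac{1}{\Gamma(\alpha)}\int_0^t (t-s)^{\alpha-1}b(x(s))\,\mathrm ds+\frac{\sigma}{\Gamma(\alpha)}\int_0^t (t-s)^{\alpha-1}\,\mathrm dW_H(s).$$ For an integer $N\ge 2$, let $h=T/N$, $t_n=nh$, and define the Euler method $$x_n=x_0+\frac{1}{\Gamma(\alpha)}\sum_{j=1}^n b(x_{j-1})\int_{t_{j-1}}^{t_j}(t_n-s)^{\alpha-1}\,\mathrm ds+G(t_n),\quad n=1,\dots,N,$$ where $G(t)=\frac{\sigma}{\Gamma(\alpha)}\int_0^t (t-s)^{\alpha-1}\,\mathrm dW_H(s)$. Then there is a constant $C>0$ independent of $h$ such that $$\sup_{n\le T/h}\|x_n-x(t_n)\|_{L^2(\Omega)}\le C\,\mathcal R_{H,\alpha}(h),$$ where $\mathcal R_{H,\alpha}(h)=h^{2(H+\alpha-1)}$ if $\alpha\in(1-H,2-2H)$, $\mathcal R_{H,\alpha}(h)=(|\ln h|\vee\ln T)\,h^{2-2H}$ if $\alpha=2-2H$, and $\mathcal R_{H,\alpha}(h)=h^{\alpha}$ if $\alpha\in(2-2H,1)$.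
   Context: $W_H$ is a one-dimensional fractional Brownian motion with Hurst index $H$ on a complete filtered probability space; the stochastic integrals against $W_H$ of deterministic integrands are Wiener (Riemann–Stieltjes) integrals. $C^1_b$ denotes (not necessarily bounded) real functions with continuous bounded first derivative; $C^3_p$ denotes three times continuously differentiable real functions whose derivatives up to order 3 have at most polynomial growth; $C^{1,3}_{b,p}=C^1_b\cap C^3_p$. $a\vee b=\max\{a,b\}$. *)

theory Defs
  imports "HOL-Probability.Probability"
begin

definition fbm_cov :: "real \<Rightarrow> real \<Rightarrow> real \<Rightarrow> real" where
  "fbm_cov H s t = (s powr (2*H) + t powr (2*H) - \<bar>t - s\<bar> powr (2*H)) / 2"

definition centered_gaussian :: "'a measure \<Rightarrow> ('a \<Rightarrow> real) \<Rightarrow> real \<Rightarrow> bool" where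
  "centered_gaussian M X v \<longleftrightarrow>
     (v = 0 \<and> X \<in> borel_measurable M \<and> (AE \<omega> in M. X \<omega> = 0)) \<or>
     (v > 0 \<and> distributed M lborel X (normal_density 0 (sqrt v)))"

text \<open>W is a (continuous) fractional Brownian motion with Hurst index H on [0,\<infinity>) under
  the probability measure M: a centered Gaussian process with covariance fbm_cov H.
  Joint Gaussianity is expressed by: every finite linear combination is centered Gaussian
  with the variance dictated by the covariance.\<close>
definition is_fbm :: "'a measure \<Rightarrow> real \<Rightarrow> (real \<Rightarrow> 'a \<Rightarrow> real) \<Rightarrow> bool" where
  "is_fbm M H W \<longleftrightarrow>
     prob_space M \<and>
     (\<forall>t. W t \<in> borel_measurable M) \<and>
     (\<forall>\<omega>\<in>space M. continuous_on {0..} (\<lambda>t. W t \<omega>)) \<and>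
     (\<forall>(ts::real list) (cs::real list). length ts = length cs \<longrightarrow> (\<forall>t\<in>set ts. 0 \<le> t) \<longrightarrow>
        centered_gaussian M (\<lambda>\<omega>. \<Sum>i<length ts. cs!i * W (ts!i) \<omega>)
          (\<Sum>i<length ts. \<Sum>j<length ts. cs!i * cs!j * fbm_cov H (ts!i) (ts!j)))"

definition rs_sum :: "(real \<Rightarrow> 'a \<Rightarrow> real) \<Rightarrow> (real \<Rightarrow> real) \<Rightarrow> real \<Rightarrow> real \<Rightarrow> nat \<Rightarrow> 'a \<Rightarrow> real" where
  "rs_sum W f a b n \<omega> =
     (\<Sum>k<n. f (a + real k * (b - a) / real n) *
              (W (a + real (Suc k) * (b - a) / real n) \<omega> - W (a + real k * (b - a) / real n) \<omega>))"

definition is_wiener_integral ::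
  "'a measure \<Rightarrow> (real \<Rightarrow> 'a \<Rightarrow> real) \<Rightarrow> (real \<Rightarrow> real) \<Rightarrow> real \<Rightarrow> real \<Rightarrow> ('a \<Rightarrow> real) \<Rightarrow> bool" where
  "is_wiener_integral M W f a b I \<longleftrightarrow>
     I \<in> borel_measurable M \<and>
     (\<lambda>n. \<integral>\<^sup>+\<omega>. ennreal ((rs_sum W f a b n \<omega> - I \<omega>)\<^sup>2) \<partial>M) \<longlonglongrightarrow> 0"

definition C13bp :: "(real \<Rightarrow> real) \<Rightarrow> bool" where
  "C13bp b \<longleftrightarrow>
     (\<exists>b1 b2 b3 K (m::nat).
        (\<forall>x. (b has_real_derivative b1 x) (at x)) \<and>
        (\<forall>x. (b1 has_real_derivative b2 x) (at x)) \<and>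
        (\<forall>x. (b2 has_real_derivative b3 x) (at x)) \<and>
        continuous_on UNIV b3 \<and>
        bounded (range b1) \<and>
        (\<forall>x. \<bar>b x\<bar> \<le> K * (1 + \<bar>x\<bar> ^ m) \<and> \<bar>b1 x\<bar> \<le> K * (1 + \<bar>x\<bar> ^ m) \<and>
             \<bar>b2 x\<bar> \<le> K * (1 + \<bar>x\<bar> ^ m) \<and> \<bar>b3 x\<bar> \<le> K * (1 + \<bar>x\<bar> ^ m)))"

definition rate :: "real \<Rightarrow> real \<Rightarrow> real \<Rightarrow> real \<Rightarrow> real" where
  "rate H \<alpha> T h =
     (if \<alpha> < 2 - 2*H then h powr (2*(H + \<alpha> - 1))
      else if \<alpha> = 2 - 2*H then max \<bar>ln h\<bar> (ln T) * h powr (2 - 2*H)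
      else h powr \<alpha>)"

end

theory Submission
  imports Defs
begin

text \<open>The error satisfies a linear Volterra inequality whose inhomogeneity, after a Taylor expansion at the
  frozen point \<open>\<lfloor>s\<rfloor>\<close> of the grid, is the integral of \<open>(t - s) powr (\<alpha> - 1)\<close> against
  \<open>b1 (X \<lfloor>s\<rfloor>) * (G s - G \<lfloor>s\<rfloor>)\<close>, up to terms of the size of the rate. The increments of
  \<open>G\<close> alone are too large in \<open>L\<^sup>2\<close>, but those at times \<open>s\<close> and \<open>s'\<close> have
  covariance \<open>O(rate\<^sup>2 * \<bar>s - s'\<bar> powr (2*H - 2))\<close>, and this is integrable against the two kernels.
  The random weights \<open>b1 (X \<lfloor>s\<rfloor>)\<close> keep that decay. Instead of Malliavin integration by parts,
  the Gaussian space is reflected along the two increments: the law is invariant and the increments change sign,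
  so the covariance becomes an expectation of a mixed second difference of the Euler scheme, which is controlled by a
  discrete Gronwall inequality and by the covariances of the increments with \<open>G\<close>, themselves
  of the size of the rate.\<close>

section \<open>Integral bounds for power kernels\<close>

text \<open>The three regimes of the rate come from one potential: integrating
  \<open>fk \<alpha> u a\<close> against \<open>\<bar>a - b\<bar> powr (2*H - 2)\<close> gives, up
  to constants, \<open>\<bar>u - b\<bar> powr (\<alpha> + 2*H - 2)\<close>, which is singular,
  logarithmic or bounded according as \<alpha> is below, at or above 2 - 2H. Paired with the kernel
  of an increment over a step h, of mass of order \<open>h powr \<alpha>\<close>, it bounds the
  covariance of that increment with any value of \<open>G\<close> by the rate. Hence the variance of
  an increment is O(rate) and its L2 size only the square root of the rate: quadratic Taylor terms
  are affordable, linear ones are not. Reflection asks no smoothness of the functional and no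
  quantitative lower bound on variances. If the two directions have variances v and u, reflecting
  moves the noise by O(rate / sqrt v) and O(rate / sqrt u), the mixed difference is of the order of
  the product, and the sizes sqrt v and sqrt u of the two directions cancel the denominators.
  Constants must be uniform in the grid, and the solution comes without moments; hence estimates for
  indexed families and Gronwall arguments with cutoffs.\<close>

abbreviation jointly_measurable :: "'a measure \<Rightarrow> (real \<Rightarrow> 'a \<Rightarrow> real) \<Rightarrow> bool" where
  "jointly_measurable M Y \<equiv> (\<lambda>p. Y (fst p) (snd p)) \<in> borel_measurable (lborel \<Otimes>\<^sub>M M)"

text \<open>Packs measurability, pointwise nonnegativity and an integral bound together, so that
  integrability and the size of the integral are obtained at once. \<open>0 \<le> A\<close> is
  included because \<open>ennreal\<close> truncates negative numbers to 0.\<close>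

definition ibound :: "'a measure \<Rightarrow> ('a \<Rightarrow> real) \<Rightarrow> real \<Rightarrow> bool" where
  "ibound M f A \<longleftrightarrow> f \<in> borel_measurable M \<and> (\<forall>x. 0 \<le> f x) \<and> 0 \<le> A \<and>
     (\<integral>\<^sup>+x. ennreal (f x) \<partial>M) \<le> ennreal A"

lemma ibound_add:
  assumes "ibound M f A" "ibound M g B"
  shows "ibound M (\<lambda>x. f x + g x) (A + B)"
proof -
  have "(\<integral>\<^sup>+x. ennreal (f x + g x) \<partial>M) = (\<integral>\<^sup>+x. ennreal (f x) + ennreal (g x) \<partial>M)"
    using assms by (intro nn_integral_cong) (auto simp: ibound_def)
  also have "\<dots> = (\<integral>\<^sup>+x. ennreal (f x) \<partial>M) + (\<integral>\<^sup>+x. ennreal (g x) \<partial>M)"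
    using assms by (intro nn_integral_add) (auto simp: ibound_def)
  also have "\<dots> \<le> ennreal A + ennreal B"
    using assms by (intro add_mono) (auto simp: ibound_def)
  also have "\<dots> = ennreal (A + B)"
    using assms by (auto simp: ibound_def)
  finally have "(\<integral>\<^sup>+x. ennreal (f x + g x) \<partial>M) \<le> ennreal (A + B)" .
  then show ?thesis
    using assms unfolding ibound_def by (intro conjI) (auto intro: add_nonneg_nonneg)
qed

lemma ibound_cmult:
  assumes "ibound M f A" "0 \<le> c"
  shows "ibound M (\<lambda>x. c * f x) (c * A)"
proof -
  have "(\<integral>\<^sup>+x. ennreal (c * f x) \<partial>M) = (\<integral>\<^sup>+x. ennreal c * ennreal (f x) \<partial>M)"
    using assms by (intro nn_integral_cong) (auto simp: ibound_def ennreal_mult)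
  also have "\<dots> = ennreal c * (\<integral>\<^sup>+x. ennreal (f x) \<partial>M)"
    using assms by (intro nn_integral_cmult) (auto simp: ibound_def)
  also have "\<dots> \<le> ennreal c * ennreal A"
    using assms by (intro mult_left_mono) (auto simp: ibound_def)
  also have "\<dots> = ennreal (c * A)"
    using assms by (auto simp: ibound_def ennreal_mult)
  finally show ?thesis
    using assms by (auto simp: ibound_def)
qed

lemma ibound_mono:
  assumes "ibound M f A" "\<And>x. 0 \<le> g x" "AE x in M. g x \<le> f x" "g \<in> borel_measurable M" "A \<le> B"
  shows "ibound M g B"
proof -
  have "(\<integral>\<^sup>+x. ennreal (g x) \<partial>M) \<le> (\<integral>\<^sup>+x. ennreal (f x) \<partial>M)"
    using assms by (intro nn_integral_mono_AE) (auto simp: ennreal_leI)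
  also have "\<dots> \<le> ennreal B"
    using assms by (auto simp: ibound_def intro: order_trans ennreal_leI)
  finally show ?thesis using assms by (auto simp: ibound_def)
qed

lemma ibound_integrable:
  assumes "ibound M f A"
  shows "integrable M f" "integral\<^sup>L M f \<le> A" "0 \<le> integral\<^sup>L M f"
proof -
  show i: "integrable M f"
    using assms by (intro integrableI_nonneg) (auto simp: ibound_def intro: le_less_trans)
  have "ennreal (integral\<^sup>L M f) \<le> ennreal A"
    using assms nn_integral_eq_integral[OF i] by (auto simp: ibound_def)
  then show "integral\<^sup>L M f \<le> A" using assms by (auto simp: ibound_def)
  show "0 \<le> integral\<^sup>L M f" using assms by (auto simp: ibound_def)
qed

lemma integral_ibound:
  assumes "integrable M f" "\<And>x. 0 \<le> f x" "integral\<^sup>L M f \<le> A"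
  shows "ibound M f A"
proof -
  have "0 \<le> integral\<^sup>L M f" using assms by simp
  then have "0 \<le> A" using assms(3) by linarith
  then show ?thesis using assms nn_integral_eq_integral[OF assms(1)]
    by (auto simp: ibound_def ennreal_leI)
qed

lemma ibound_reflect:
  fixes c :: real
  assumes "ibound lborel f A"
  shows "ibound lborel (\<lambda>x. f (c - x)) A"
proof -
  have "(\<integral>\<^sup>+x. ennreal (f x) \<partial>lborel) = (\<integral>\<^sup>+x. ennreal (f (c - x)) \<partial>lborel)"
    using assms by (subst nn_integral_real_affine[of _ "-1" c]) (auto simp: ibound_def)
  moreover have "(\<lambda>x. f (c - x)) \<in> borel_measurable lborel"
    using assms measurable_compose[of "\<lambda>x. c - x" lborel borel f borel] by (auto simp: ibound_def)
  ultimately show ?thesis using assms by (auto simp: ibound_def)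
qed

lemma has_integral_indicator:
  fixes f :: "real \<Rightarrow> real"
  assumes "(f has_integral I) S"
  shows "((\<lambda>x. indicator S x * f x) has_integral I) UNIV"
proof -
  have "(\<lambda>x. indicator S x * f x) = (\<lambda>x. if x \<in> S then f x else 0)"
    by (auto simp: indicator_def)
  then show ?thesis using assms by (simp only: has_integral_restrict_UNIV)
qed

lemma ibound_powr_Icc:
  fixes \<gamma> l :: real
  assumes "\<gamma> < 1" "0 \<le> l"
  shows "ibound lborel (\<lambda>x. indicator {0..l} x * x powr (-\<gamma>)) (l powr (1-\<gamma>) / (1-\<gamma>))"
proof -
  have *: "((\<lambda>x. x powr (-\<gamma>)) has_integral (l powr (1-\<gamma>) / (1-\<gamma>))) {0..l}"
    using has_integral_powr_from_0[of "-\<gamma>" l] assms by simp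
  have "((\<lambda>x. indicator {0..l} x * x powr (-\<gamma>)) has_integral (l powr (1-\<gamma>) / (1-\<gamma>))) UNIV"
    using * by (rule has_integral_indicator)
  then have "(\<integral>\<^sup>+x. ennreal (indicator {0..l} x * x powr (-\<gamma>)) \<partial>lborel) = ennreal (l powr (1-\<gamma>) / (1-\<gamma>))"
    by (intro nn_integral_has_integral_lborel) auto
  then show ?thesis using assms by (auto simp: ibound_def)
qed

lemma ibound_powr_ball:
  fixes \<gamma> l :: real
  assumes "\<gamma> < 1" "0 \<le> l"
  shows "ibound lborel (\<lambda>x. indicator {c-l..c+l} x * \<bar>x - c\<bar> powr (-\<gamma>)) (2 * (l powr (1-\<gamma>) / (1-\<gamma>)))"
proof -
  let ?g = "\<lambda>x. indicator {0..l} x * x powr (-\<gamma>)"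
  have 1: "ibound lborel (\<lambda>x. ?g (c - x)) (l powr (1-\<gamma>) / (1-\<gamma>))"
    by (intro ibound_reflect ibound_powr_Icc assms)
  have 2: "ibound lborel (\<lambda>x. ?g (x - c)) (l powr (1-\<gamma>) / (1-\<gamma>))"
  proof -
    have "ibound lborel (\<lambda>x. ?g (0 - (c - x))) (l powr (1-\<gamma>) / (1-\<gamma>))"
      using ibound_reflect[OF ibound_reflect[OF ibound_powr_Icc[OF assms], of 0], of c] by simp
    then show ?thesis by (simp add: minus_diff_eq)
  qed
  show ?thesis
    by (rule ibound_mono[OF ibound_add[OF 1 2]]) (auto simp: indicator_def abs_if)
qed

lemma ibound_powr_tail:
  fixes \<kappa> d :: real
  assumes "1 < \<kappa>" "0 < d"
  shows "ibound lborel (\<lambda>x. indicator {d..} x * x powr (-\<kappa>)) (d powr (1-\<kappa>) / (\<kappa>-1))"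
proof -
  have *: "((\<lambda>x. x powr (-\<kappa>)) has_integral (d powr (1-\<kappa>) / (\<kappa>-1))) {d..}"
  proof -
    have "- (d powr (1 - \<kappa>) / (1 - \<kappa>)) = d powr (1-\<kappa>) / (\<kappa>-1)"
      by (metis minus_diff_eq minus_divide_right)
    then show ?thesis using has_integral_powr_to_inf[of "-\<kappa>" d] assms by simp
  qed
  have "((\<lambda>x. indicator {d..} x * x powr (-\<kappa>)) has_integral (d powr (1-\<kappa>) / (\<kappa>-1))) UNIV"
    using * by (rule has_integral_indicator)
  then have "(\<integral>\<^sup>+x. ennreal (indicator {d..} x * x powr (-\<kappa>)) \<partial>lborel) = ennreal (d powr (1-\<kappa>) / (\<kappa>-1))"
    by (intro nn_integral_has_integral_lborel) auto
  then show ?thesis using assms by (auto simp: ibound_def)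
qed

lemma ibound_inverse_Icc:
  fixes d T :: real
  assumes "0 < d" "d \<le> T"
  shows "ibound lborel (\<lambda>x. indicator {d..T} x * x powr (-1)) (ln (T / d))"
proof -
  have "((\<lambda>x. x powr (-1)) has_integral (ln T - ln d)) {d..T}"
    using assms by (intro fundamental_theorem_of_calculus)
      (auto simp: has_real_derivative_iff_has_vector_derivative[symmetric] powr_minus inverse_eq_divide
         intro!: derivative_eq_intros)
  then have "((\<lambda>x. indicator {d..T} x * x powr (-1)) has_integral (ln T - ln d)) UNIV"
    by (rule has_integral_indicator)
  then have "(\<integral>\<^sup>+x. ennreal (indicator {d..T} x * x powr (-1)) \<partial>lborel) = ennreal (ln T - ln d)"
    by (intro nn_integral_has_integral_lborel) auto
  then show ?thesis using assms by (auto simp: ibound_def ln_div)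
qed

text \<open>The singularity s may lie anywhere relative to the window around u: outside the ball of
  radius h about s the integrand is at most \<open>h powr (-\<gamma>)\<close>, inside it the ball
  estimate applies. The bound is therefore uniform in s and u.\<close>

lemma ibound_powr_window:
  fixes \<gamma> h :: real
  assumes "0 \<le> \<gamma>" "\<gamma> < 1" "0 < h"
  shows "ibound lborel (\<lambda>x. indicator {u-h..u+h} x * \<bar>x - s\<bar> powr (-\<gamma>)) ((2 + 2 / (1-\<gamma>)) * h powr (1-\<gamma>))"
proof -
  \<comment> \<open>The length of the window is the exponent-0 case of the ball estimate. Since
    \<open>0 powr 0 = 0\<close>, the centre u has to be discarded as a null set.\<close>
  have 1: "ibound lborel (\<lambda>x. indicator {u-h..u+h} x * \<bar>x - u\<bar> powr (-0)) (2 * (h powr (1-0) / (1-0)))"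
    using assms by (intro ibound_powr_ball) auto
  have 1: "ibound lborel (\<lambda>x. indicator {u-h..u+h} x :: real) (2 * h)"
    apply (rule ibound_mono[OF 1])
        using assms AE_lborel_singleton[of u] by (auto elim!: eventually_mono simp: indicator_def)
  have 2: "ibound lborel (\<lambda>x. indicator {s-h..s+h} x * \<bar>x - s\<bar> powr (-\<gamma>)) (2 * (h powr (1-\<gamma>) / (1-\<gamma>)))"
    using assms by (intro ibound_powr_ball) auto
  have 3: "ibound lborel (\<lambda>x. h powr (-\<gamma>) * indicator {u-h..u+h} x + indicator {s-h..s+h} x * \<bar>x - s\<bar> powr (-\<gamma>))
     (h powr (-\<gamma>) * (2 * h) + 2 * (h powr (1-\<gamma>) / (1-\<gamma>)))"
    by (intro ibound_add ibound_cmult 1 2) auto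
  have pw: "\<bar>x - s\<bar> powr (-\<gamma>) \<le> h powr (-\<gamma>)" if "x \<notin> {s-h..s+h}" for x
    using that assms by (intro powr_mono2') auto
  show ?thesis
  proof (rule ibound_mono[OF 3])
    show "AE x in lborel. indicator {u-h..u+h} x * \<bar>x - s\<bar> powr (-\<gamma>)
       \<le> h powr (-\<gamma>) * indicator {u-h..u+h} x + indicator {s-h..s+h} x * \<bar>x - s\<bar> powr (-\<gamma>)"
      using pw by (intro AE_I2) (auto simp: indicator_def split: if_splits)
    have "h powr (-\<gamma>) * h = h powr (1 - \<gamma>)"
      using assms by (metis diff_add_cancel diff_minus_eq_add less_imp_le powr_mult_base mult.commute uminus_add_conv_diff)
    then show "h powr (-\<gamma>) * (2 * h) + 2 * (h powr (1-\<gamma>) / (1-\<gamma>)) \<le> (2 + 2 / (1-\<gamma>)) * h powr (1-\<gamma>)"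
      using assms by (simp add: algebra_simps)
  qed (use assms in auto)
qed

text \<open>The smaller base can carry both exponents. This decouples two singularities at different
  points into a sum of single ones.\<close>

lemma powr_mult_le_add:
  fixes x y p q :: real
  assumes "0 \<le> x" "0 \<le> y" "0 \<le> p" "0 \<le> q"
  shows "x powr (-p) * y powr (-q) \<le> x powr (-(p+q)) + y powr (-(p+q))"
proof (cases "x = 0 \<or> y = 0")
  case True then show ?thesis by auto
next
  case False
  then have xy: "0 < x" "0 < y" using assms by auto
  show ?thesis
  proof (cases "x \<le> y")
    case True
    then have "y powr (-q) \<le> x powr (-q)" using xy assms by (intro powr_mono2') auto
    then have "x powr (-p) * y powr (-q) \<le> x powr (-p) * x powr (-q)" by (intro mult_left_mono) auto
    also have "\<dots> = x powr (-(p+q))" by (simp add: powr_add[symmetric])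
    finally show ?thesis by (simp add: add_increasing2)
  next
    case False
    then have "x powr (-p) \<le> y powr (-p)" using xy assms by (intro powr_mono2') auto
    then have "x powr (-p) * y powr (-q) \<le> y powr (-p) * y powr (-q)" by (intro mult_right_mono) auto
    also have "\<dots> = y powr (-(p+q))" by (simp add: powr_add[symmetric])
    finally show ?thesis by (simp add: add_increasing)
  qed
qed

text \<open>The Riemann-Liouville kernel without its Gamma factor. The extension by 0 lets all
  integrals run over the whole line and builds the upper limit t into the kernel.\<close>

definition fk :: "real \<Rightarrow> real \<Rightarrow> real \<Rightarrow> real" where
  "fk \<alpha> t s = (if 0 \<le> s \<and> s < t then (t - s) powr (\<alpha> - 1) else 0)"

lemma fk_nonneg [simp]: "0 \<le> fk \<alpha> t s"
  by (simp add: fk_def)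

lemma fk_measurable [measurable]: "fk \<alpha> t \<in> borel_measurable borel"
  unfolding fk_def[abs_def] by measurable

lemma fk_measurable_pair [measurable]: "(\<lambda>p. fk \<alpha> (fst p) (snd p)) \<in> borel_measurable (borel \<Otimes>\<^sub>M borel)"
  unfolding fk_def[abs_def] by measurable

lemma fk_le: "fk \<alpha> t s \<le> \<bar>s - t\<bar> powr (-(1 - \<alpha>))"
  by (auto simp: fk_def abs_if)

lemma ibound_fk:
  assumes "0 < \<alpha>" "0 \<le> t"
  shows "ibound lborel (fk \<alpha> t) (t powr \<alpha> / \<alpha>)"
proof -
  have 1: "ibound lborel (\<lambda>x. indicator {0..t} (t - x) * (t - x) powr (-(1-\<alpha>))) (t powr (1-(1-\<alpha>)) / (1-(1-\<alpha>)))"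
    using assms by (intro ibound_reflect[where f="\<lambda>x. indicator {0..t} x * x powr (-(1-\<alpha>))"] ibound_powr_Icc) auto
  show ?thesis
    by (rule ibound_mono[OF 1]) (use assms in \<open>auto simp: fk_def indicator_def\<close>)
qed

lemma has_bochner_integral_fk:
  assumes "0 < \<alpha>" "0 \<le> t"
  shows "has_bochner_integral lborel (fk \<alpha> t) (t powr \<alpha> / \<alpha>)"
proof -
  let ?g = "\<lambda>x. indicator {0..t} x * x powr (-(1-\<alpha>))"
  have *: "((\<lambda>x. x powr (-(1-\<alpha>))) has_integral (t powr (1-(1-\<alpha>)) / (1-(1-\<alpha>)))) {0..t}"
    using has_integral_powr_from_0[of "-(1-\<alpha>)" t] assms by simp
  have **: "(?g has_integral (t powr (1-(1-\<alpha>)) / (1-(1-\<alpha>)))) UNIV"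
    using * by (rule has_integral_indicator)
  have "(\<integral>\<^sup>+x. ennreal (?g x) \<partial>lborel) = ennreal (t powr (1-(1-\<alpha>)) / (1-(1-\<alpha>)))"
    by (rule nn_integral_has_integral_lborel[OF _ _ **]) auto
  then have "(\<integral>\<^sup>+x. ennreal (?g (t - x)) \<partial>lborel) = ennreal (t powr \<alpha> / \<alpha>)"
    by (subst (asm) nn_integral_real_affine[of _ "-1" t]) auto
  moreover have "(\<integral>\<^sup>+x. ennreal (?g (t - x)) \<partial>lborel) = (\<integral>\<^sup>+x. ennreal (fk \<alpha> t x) \<partial>lborel)"
    using AE_lborel_singleton[of t]
    by (intro nn_integral_cong_AE) (auto elim!: eventually_mono simp: fk_def indicator_def)
  ultimately show ?thesis
    using assms by (intro has_bochner_integral_nn_integral) auto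
qed

text \<open>The exponential weight makes the Volterra operator a contraction.\<close>
lemma fk_exp_weight:
  assumes "0 < \<alpha>" "\<alpha> < 1" "0 < T" "0 < \<epsilon>"
  shows "\<exists>w>0. \<forall>t\<in>{0..T}. ibound lborel (\<lambda>s. fk \<alpha> t s * exp (w * s)) (\<epsilon> * exp (w * t))"
proof -
  define K where "K = T powr (\<alpha>/2) / (\<alpha>/2)"
  have K: "K > 0" using assms by (simp add: K_def)
  \<comment> \<open>Half of the integrability margin is spent on
    \<open>exp (-y) \<le> y powr (-(\<alpha>/2))\<close>. This leaves the kernel of order
    \<open>\<alpha>/2\<close>, of mass at most \<open>K\<close>, times
    \<open>w powr (-(\<alpha>/2))\<close>; \<open>w\<close> solves
    \<open>w powr (-(\<alpha>/2)) * K = \<epsilon>\<close>.\<close>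
  define w where "w = (K / \<epsilon>) powr (2/\<alpha>)"
  have w: "w > 0" using K assms by (simp add: w_def)
  have lK: "w powr (-(\<alpha>/2)) * K = \<epsilon>"
    using K assms by (simp add: w_def powr_powr powr_minus)
  have key: "exp (-y) \<le> y powr (-(\<alpha>/2))" if "0 < y" for y :: real
  proof -
    have "y powr (\<alpha>/2) \<le> exp y"
    proof (cases "y \<le> 1")
      case True
      then have "y powr (\<alpha>/2) \<le> 1" using that assms by (intro powr_le1) auto
      then show ?thesis using that by (meson one_le_exp_iff order_trans less_imp_le)
    next
      case False
      then have "y powr (\<alpha>/2) \<le> y powr 1" using assms by (intro powr_mono) auto
      also have "\<dots> \<le> exp y"
        using that exp_ge_add_one_self[of y] powr_one[of y] by linarith
      finally show ?thesis .
    qed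
    then show ?thesis using that by (simp add: exp_minus powr_minus le_imp_inverse_le)
  qed
  show ?thesis
  proof (intro exI[of _ w] conjI ballI w)
    fix t assume t: "t \<in> {0..T}"
    have 1: "ibound lborel (fk (\<alpha>/2) t) (t powr (\<alpha>/2) / (\<alpha>/2))"
      using t assms by (intro ibound_fk) auto
    have 2: "ibound lborel (\<lambda>s. (exp (w * t) * w powr (-(\<alpha>/2))) * fk (\<alpha>/2) t s)
        ((exp (w * t) * w powr (-(\<alpha>/2))) * (t powr (\<alpha>/2) / (\<alpha>/2)))"
      by (intro ibound_cmult 1) auto
    show "ibound lborel (\<lambda>s. fk \<alpha> t s * exp (w * s)) (\<epsilon> * exp (w * t))"
    proof (rule ibound_mono[OF 2])
      show "AE s in lborel. fk \<alpha> t s * exp (w * s) \<le> exp (w * t) * w powr (- (\<alpha>/2)) * fk (\<alpha>/2) t s"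
      proof (intro AE_I2)
        fix s
        show "fk \<alpha> t s * exp (w * s) \<le> exp (w * t) * w powr (- (\<alpha>/2)) * fk (\<alpha>/2) t s"
        proof (cases "0 \<le> s \<and> s < t")
          case True
          have "exp (- (w * (t - s))) \<le> (w * (t - s)) powr (-(\<alpha>/2))"
            using True w by (intro key) auto
          also have "\<dots> = w powr (-(\<alpha>/2)) * (t - s) powr (-(\<alpha>/2))"
            using True w by (simp add: powr_mult)
          finally have "(t - s) powr (\<alpha> - 1) * exp (- (w * (t - s))) \<le>
              (t - s) powr (\<alpha> - 1) * (w powr (-(\<alpha>/2)) * (t - s) powr (-(\<alpha>/2)))"
            by (intro mult_left_mono) auto
          also have "\<dots> = w powr (-(\<alpha>/2)) * ((t - s) powr (\<alpha> - 1) * (t - s) powr (-(\<alpha>/2)))" by simp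
          also have "(t - s) powr (\<alpha> - 1) * (t - s) powr (-(\<alpha>/2)) = (t - s) powr (\<alpha>/2 - 1)"
            by (simp add: powr_add[symmetric])
          finally have "exp (w * t) * ((t - s) powr (\<alpha> - 1) * exp (- (w * (t - s)))) \<le>
               exp (w * t) * (w powr (-(\<alpha>/2)) * (t - s) powr (\<alpha>/2 - 1))"
            by (intro mult_left_mono) auto
          moreover have "exp (w * s) = exp (w * t) * exp (- (w * (t - s)))"
            by (simp add: exp_add[symmetric] algebra_simps)
          ultimately show ?thesis using True by (simp add: fk_def mult_ac)
        next
          case False
          then have "fk \<alpha> t s = 0" "fk (\<alpha>/2) t s = 0" by (auto simp: fk_def)
          then show ?thesis by simp
        qed
      qed
      have "exp (w * t) * w powr (-(\<alpha>/2)) * (t powr (\<alpha>/2) / (\<alpha>/2)) \<le> exp (w * t) * w powr (-(\<alpha>/2)) * K"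
        using t assms unfolding K_def by (intro mult_left_mono divide_right_mono powr_mono2) auto
      also have "\<dots> = \<epsilon> * exp (w * t)" using lK by (simp add: mult_ac)
      finally show "exp (w * t) * w powr (-(\<alpha>/2)) * (t powr (\<alpha>/2) / (\<alpha>/2)) \<le> \<epsilon> * exp (w * t)" .
    qed auto
  qed
qed

section \<open>Energies of fractional kernels\<close>

text \<open>Modulus of the integrand of the noise increment from r to s, up to the constant factor.
  Only the cancellation between the two kernels is kept; all later bounds are for positive
  integrands.\<close>

definition fd :: "real \<Rightarrow> real \<Rightarrow> real \<Rightarrow> real \<Rightarrow> real" where
  "fd \<alpha> r s a = \<bar>fk \<alpha> s a - fk \<alpha> r a\<bar>"

lemma fd_nonneg [simp]: "0 \<le> fd \<alpha> r s a"
  by (simp add: fd_def)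

lemma fd_measurable [measurable]: "fd \<alpha> r s \<in> borel_measurable borel"
  unfolding fd_def[abs_def] by measurable

lemma fd_le: "fd \<alpha> r s a \<le> fk \<alpha> s a + fk \<alpha> r a"
  using fk_nonneg[of \<alpha> s a] fk_nonneg[of \<alpha> r a] unfolding fd_def by linarith

lemma fd_eq_0: "r \<le> s \<Longrightarrow> a < 0 \<or> s \<le> a \<Longrightarrow> fd \<alpha> r s a = 0"
  by (auto simp: fd_def fk_def)

text \<open>On [0,r) the kernel ending at s lies below the one ending at r, so \<open>fd\<close> is
  the difference of the kernels with the sign reversed on [r,s). The total masses contribute
  \<open>r powr \<alpha> - s powr \<alpha> \<le> 0\<close>, and twice the mass of the new piece
  remains.\<close>

lemma ibound_fd:
  assumes "0 < \<alpha>" "\<alpha> < 1" "0 \<le> r" "r \<le> s"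
  shows "ibound lborel (fd \<alpha> r s) (2 * (s - r) powr \<alpha> / \<alpha>)"
proof -
  \<comment> \<open>The part of \<open>fk \<alpha> s\<close> living on [r,s), written as a translate
    of a kernel so that its mass is known.\<close>
  define g where "g a = fk \<alpha> (s - r) (a - r)" for a
  have "(\<integral>\<^sup>+a. ennreal (fk \<alpha> (s - r) a) \<partial>lborel) = (\<integral>\<^sup>+a. ennreal (g a) \<partial>lborel)"
    using assms by (subst nn_integral_real_affine[of _ 1 "-r"]) (auto simp: g_def)
  moreover have "(\<integral>\<^sup>+a. ennreal (fk \<alpha> (s - r) a) \<partial>lborel) = ennreal ((s - r) powr \<alpha> / \<alpha>)"
    using has_bochner_integral_fk[of \<alpha> "s-r"] assms
    by (subst nn_integral_eq_integral) (auto simp: has_bochner_integral_iff)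
  ultimately have g: "has_bochner_integral lborel g ((s - r) powr \<alpha> / \<alpha>)"
    using assms by (intro has_bochner_integral_nn_integral) (auto simp: g_def[abs_def])
  have fr: "has_bochner_integral lborel (fk \<alpha> r) (r powr \<alpha> / \<alpha>)"
   and fs: "has_bochner_integral lborel (fk \<alpha> s) (s powr \<alpha> / \<alpha>)"
    using assms by (auto intro!: has_bochner_integral_fk)
  have eq: "fd \<alpha> r s a = fk \<alpha> r a - fk \<alpha> s a + 2 * g a" for a
  proof (cases "0 \<le> a \<and> a < r")
    case True
    then have "(s - a) powr (\<alpha> - 1) \<le> (r - a) powr (\<alpha> - 1)"
      using assms by (intro powr_mono2') auto
    then show ?thesis using True assms by (auto simp: fd_def fk_def g_def)
  next
    case False
    then show ?thesis using assms by (auto simp: fd_def fk_def g_def)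
  qed
  have "has_bochner_integral lborel (\<lambda>a. fk \<alpha> r a - fk \<alpha> s a + 2 * g a)
     (r powr \<alpha> / \<alpha> - s powr \<alpha> / \<alpha> + 2 * ((s - r) powr \<alpha> / \<alpha>))"
    by (intro has_bochner_integral_add has_bochner_integral_diff has_bochner_integral_mult_right g fr fs)
  then have "has_bochner_integral lborel (fd \<alpha> r s) (r powr \<alpha> / \<alpha> - s powr \<alpha> / \<alpha> + 2 * ((s - r) powr \<alpha> / \<alpha>))"
    by (simp add: eq[abs_def])
  moreover have "r powr \<alpha> / \<alpha> \<le> s powr \<alpha> / \<alpha>"
    using assms by (intro divide_right_mono powr_mono2) auto
  ultimately show ?thesis
    by (intro integral_ibound) (auto simp: has_bochner_integral_iff)
qed

lemma ibound_fd_h: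
  assumes "0 < \<alpha>" "\<alpha> < 1" "0 \<le> r" "r \<le> s" "s - r \<le> h"
  shows "ibound lborel (fd \<alpha> r s) (2 * h powr \<alpha> / \<alpha>)"
proof (rule ibound_mono[OF ibound_fd[of \<alpha> r s]])
  show "2 * (s - r) powr \<alpha> / \<alpha> \<le> 2 * h powr \<alpha> / \<alpha>"
    using assms by (intro divide_right_mono mult_left_mono powr_mono2) auto
qed (use assms in auto)

text \<open>At distance more than h from u the weight is at most \<open>h powr (-\<beta>)\<close>
  and the mass of \<open>fd\<close> supplies \<open>h powr \<alpha>\<close>. Inside the window the
  product of two singularities is decoupled into exponent 1 - \<alpha> + \<beta>, which is
  integrable because \<beta> < \<alpha>.\<close>

lemma ibound_fd_powr:
  assumes \<alpha>: "0 < \<alpha>" "\<alpha> < 1" and rs: "0 \<le> r" "r \<le> s" "s - r \<le> h" and h: "0 < h" and \<beta>: "0 \<le> \<beta>" "\<beta> < \<alpha>"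
  shows "ibound lborel (\<lambda>a. fd \<alpha> r s a * \<bar>a - u\<bar> powr (-\<beta>)) ((2/\<alpha> + 4 * (2 + 2/(\<alpha>-\<beta>))) * h powr (\<alpha> - \<beta>))"
proof -
  let ?\<gamma> = "1 - \<alpha> + \<beta>"
  let ?W = "\<lambda>x a. indicator {u-h..u+h} a * \<bar>a - x\<bar> powr (-?\<gamma>)"
  let ?K = "(2 + 2 / (1-?\<gamma>)) * h powr (1-?\<gamma>)"
  have W: "ibound lborel (?W x) ?K" for x
    using \<alpha> \<beta> h by (intro ibound_powr_window) auto
  have tot: "ibound lborel (\<lambda>a. h powr (-\<beta>) * fd \<alpha> r s a + (?W s a + (?W r a + 2 * ?W u a)))
     (h powr (-\<beta>) * (2 * h powr \<alpha> / \<alpha>) + (?K + (?K + 2 * ?K)))"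
    using \<alpha> rs by (intro ibound_add ibound_cmult W ibound_fd_h) auto
  show ?thesis
  proof (rule ibound_mono[OF tot])
    show "AE a in lborel. fd \<alpha> r s a * \<bar>a - u\<bar> powr (-\<beta>) \<le>
       h powr (-\<beta>) * fd \<alpha> r s a + (?W s a + (?W r a + 2 * ?W u a))"
    proof (intro AE_I2)
      fix a
      show "fd \<alpha> r s a * \<bar>a - u\<bar> powr (-\<beta>) \<le>
        h powr (-\<beta>) * fd \<alpha> r s a + (?W s a + (?W r a + 2 * ?W u a))"
      proof (cases "a \<in> {u-h..u+h}")
        case False
        then have "\<bar>a - u\<bar> powr (-\<beta>) \<le> h powr (-\<beta>)" using h \<beta> by (intro powr_mono2') auto
        then have "fd \<alpha> r s a * \<bar>a - u\<bar> powr (-\<beta>) \<le> fd \<alpha> r s a * h powr (-\<beta>)"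
          by (intro mult_left_mono) auto
        then show ?thesis using False by (simp add: mult_ac)
      next
        case True
        have b: "fk \<alpha> x a * \<bar>a - u\<bar> powr (-\<beta>) \<le> ?W x a + ?W u a" for x
        proof -
          have "fk \<alpha> x a * \<bar>a - u\<bar> powr (-\<beta>) \<le> \<bar>a - x\<bar> powr (-(1-\<alpha>)) * \<bar>a - u\<bar> powr (-\<beta>)"
            by (intro mult_right_mono fk_le) auto
          also have "\<dots> \<le> \<bar>a - x\<bar> powr (-?\<gamma>) + \<bar>a - u\<bar> powr (-?\<gamma>)"
            using \<alpha> \<beta> by (intro powr_mult_le_add) auto
          finally show ?thesis using True by simp
        qed
        have "fd \<alpha> r s a * \<bar>a - u\<bar> powr (-\<beta>) \<le> (fk \<alpha> s a + fk \<alpha> r a) * \<bar>a - u\<bar> powr (-\<beta>)"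
          by (intro mult_right_mono fd_le) auto
        also have "\<dots> \<le> ?W s a + (?W r a + 2 * ?W u a)"
          using b[of s] b[of r] by (simp add: ring_distribs)
        finally show ?thesis by (simp add: add_increasing)
      qed
    qed
    have "h powr (-\<beta>) * h powr \<alpha> = h powr (\<alpha> - \<beta>)" by (simp add: powr_add[symmetric])
    then have 1: "h powr (-\<beta>) * (2 * h powr \<alpha> / \<alpha>) = 2 / \<alpha> * h powr (\<alpha> - \<beta>)"
      by (simp add: field_simps)
    show "h powr (-\<beta>) * (2 * h powr \<alpha> / \<alpha>) + (?K + (?K + 2 * ?K)) \<le> (2/\<alpha> + 4 * (2 + 2/(\<alpha>-\<beta>))) * h powr (\<alpha> - \<beta>)"
      unfolding 1 by (simp add: algebra_simps)
  qed (auto)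
qed

text \<open>Mean value theorem for the kernel. Since \<open>2 * h \<le> s - a\<close>, also
  \<open>r - a \<ge> (s - a) / 2\<close>, which is where the factor 1/2 comes from.\<close>

lemma fd_tail:
  assumes "0 < \<alpha>" "\<alpha> < 1" "r \<le> s" "s - r \<le> h" "2 * h \<le> s - a" "0 < h"
  shows "fd \<alpha> r s a \<le> h * ((s - a) / 2) powr (\<alpha> - 2)"
proof (cases "0 \<le> a")
  case False
  then show ?thesis using assms by (simp add: fd_def fk_def)
next
  case True
  have ra: "0 < r - a" using assms by linarith
  show ?thesis
  proof (cases "r = s")
    case True then show ?thesis using assms by (simp add: fd_def)
  next
    case False
    then have rs: "r - a < s - a" using assms by auto
    have "\<exists>z>r - a. z < s - a \<and> (s - a) powr (\<alpha>-1) - (r - a) powr (\<alpha>-1) = (s - a - (r - a)) * ((\<alpha>-1) * z powr (\<alpha> - 1 - 1))"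
      using rs ra by (intro MVT2) (auto intro!: derivative_eq_intros)
    then obtain z where z: "r - a < z" "z < s - a"
      "(s - a) powr (\<alpha>-1) - (r - a) powr (\<alpha>-1) = (s - r) * ((\<alpha>-1) * z powr (\<alpha> - 2))" by (auto simp: algebra_simps)
    have zz: "z powr (\<alpha> - 2) \<le> ((s - a) / 2) powr (\<alpha> - 2)"
      using z assms by (intro powr_mono2') auto
    have "fd \<alpha> r s a = \<bar>(s - r) * ((\<alpha>-1) * z powr (\<alpha> - 2))\<bar>"
      using True assms ra z(3) by (simp add: fd_def fk_def)
    also have "\<dots> = (s - r) * ((1 - \<alpha>) * z powr (\<alpha> - 2))"
      using assms True by (simp add: abs_mult)
    also have "\<dots> \<le> h * (1 * ((s - a) / 2) powr (\<alpha> - 2))"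
      using assms True zz by (intro mult_mono) auto
    finally show ?thesis by simp
  qed
qed

section \<open>Parameters, and comparison of powers of the step with the rate\<close>

locale fpar =
  fixes H \<alpha> T :: real
  assumes H: "1/2 < H" "H < 1" and \<alpha>: "1 - H < \<alpha>" "\<alpha> < 1" and T: "0 < T"
begin

lemma \<alpha>0: "0 < \<alpha>" using H \<alpha> by linarith

abbreviation "\<rho> \<equiv> rate H \<alpha> T"
abbreviation "rt N \<equiv> \<rho> (T / real N)"

text \<open>\<open>T/h \<ge> 2\<close> forces \<open>ln (T/h) \<ge> ln 2\<close>, and this logarithm
  is at most twice the maximum. So the logarithmic factor of the rate stays away from 0; this is
  where at least two grid steps are needed.\<close>

lemma log_rate:
  assumes "0 < h" "h \<le> T/2"
  shows "ln (T/h) \<le> 2 * max \<bar>ln h\<bar> (ln T)" "ln 2 / 2 \<le> max \<bar>ln h\<bar> (ln T)"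
proof -
  have "ln (T/h) = ln T - ln h" using assms T by (simp add: ln_div)
  then show 1: "ln (T/h) \<le> 2 * max \<bar>ln h\<bar> (ln T)" by linarith
  have "ln 2 \<le> ln (T/h)" using assms T by (intro ln_mono) (auto simp: field_simps)
  then show "ln 2 / 2 \<le> max \<bar>ln h\<bar> (ln T)" using 1 by linarith
qed

lemma rate_pos: "0 < h \<Longrightarrow> h \<le> T/2 \<Longrightarrow> 0 < \<rho> h"
proof -
  assume h: "0 < h" "h \<le> T/2"
  have "0 < max \<bar>ln h\<bar> (ln T)"
    using log_rate(2)[OF h] ln_gt_zero[of "2::real"] by linarith
  then show ?thesis using h unfolding rate_def by (auto intro!: mult_pos_pos simp del: less_max_iff_disj)
qed

lemma powr_le_const:
  assumes "0 < h" "h \<le> T" "a \<ge> b"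
  shows "h powr a \<le> T powr (a - b) * h powr b"
proof -
  have "h powr a = h powr (a-b) * h powr b" by (simp add: powr_add[symmetric])
  also have "\<dots> \<le> T powr (a - b) * h powr b"
    using assms by (intro mult_right_mono powr_mono2) auto
  finally show ?thesis .
qed

text \<open>One comparison for all three regimes: the exponent of the rate must not exceed e. The
  disjunctions let the second and third conditions hold for free outside the regime they
  concern.\<close>

lemma rate_ge_powr_aux:
  assumes "2 * (H + \<alpha> - 1) \<le> e" "\<alpha> \<le> e \<or> \<alpha> \<le> 2 - 2*H" "2 - 2*H \<le> e \<or> \<alpha> \<noteq> 2 - 2*H"
  shows "\<exists>C>0. \<forall>h. 0 < h \<and> h \<le> T/2 \<longrightarrow> h powr e \<le> C * \<rho> h"
proof -
  consider "\<alpha> < 2 - 2*H" | "\<alpha> = 2 - 2*H" | "\<alpha> > 2 - 2*H" by linarith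
  then show ?thesis
  proof cases
    case 1
    then show ?thesis using assms T
      by (intro exI[of _ "T powr (e - 2 * (H + \<alpha> - 1))"]) (auto simp: rate_def intro!: powr_le_const)
  next
    case 2
    have "h powr e \<le> (T powr (e - (2-2*H)) * (2 / ln 2)) * \<rho> h" if h: "0 < h \<and> h \<le> T/2" for h
    proof -
      have "h powr e \<le> T powr (e - (2 - 2*H)) * h powr (2 - 2*H)"
        using h assms 2 T by (intro powr_le_const) auto
      also have "\<dots> \<le> T powr (e - (2 - 2*H)) * ((2 / ln 2 * max \<bar>ln h\<bar> (ln T)) * h powr (2 - 2*H))"
      proof -
        have "1 \<le> 2 / ln 2 * max \<bar>ln h\<bar> (ln T)" using log_rate(2)[of h] h by (simp add: field_simps)
        then have "1 * h powr (2 - 2*H) \<le> (2 / ln 2 * max \<bar>ln h\<bar> (ln T)) * h powr (2 - 2*H)"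
          by (intro mult_right_mono) auto
        then show ?thesis by (intro mult_left_mono) auto
      qed
      finally show ?thesis using 2 by (simp add: rate_def mult_ac)
    qed
    then show ?thesis using T by (intro exI[of _ "T powr (e - (2-2*H)) * (2 / ln 2)"]) auto
  next
    case 3
    then show ?thesis using assms T
      by (intro exI[of _ "T powr (e - \<alpha>)"]) (auto simp: rate_def intro!: powr_le_const)
  qed
qed

text \<open>\<open>2 * (H + \<alpha> - 1) \<le> \<alpha>\<close> holds exactly when
  \<open>\<alpha> \<le> 2 - 2*H\<close>; beyond that the rate is \<open>h powr \<alpha>\<close>
  itself. So drift increments over one step, of order \<open>h powr \<alpha>\<close>, are always
  within the rate.\<close>

lemma rate_ge: "\<exists>C>0. \<forall>h. 0 < h \<and> h \<le> T/2 \<longrightarrow> h powr \<alpha> \<le> C * \<rho> h"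
proof (cases "\<alpha> \<le> 2 - 2*H")
  case True then show ?thesis by (intro rate_ge_powr_aux) auto
next
  case False
  then show ?thesis by (intro exI[of _ 1]) (auto simp: rate_def)
qed

lemma rate_ge': "\<alpha> \<le> 2 - 2*H \<Longrightarrow> \<exists>C>0. \<forall>h. 0 < h \<and> h \<le> T/2 \<longrightarrow> h powr (2-2*H) \<le> C * \<rho> h"
  by (intro rate_ge_powr_aux) auto

text \<open>Three zones, with D half the distance of u and b: close to u, close to b, and away from
  both. The first two give \<open>D powr (\<alpha>+2*H-2)\<close>. In the third the product is
  decoupled into exponent 3 - \<alpha> - 2H, which is critical exactly at \<alpha> = 2 - 2H; its
  integral is left as the parameter J so that each regime can supply its own.\<close>

lemma potential_aux:
  assumes u: "0 \<le> u" "u \<le> T" and b: "0 \<le> b" "b \<le> T" and ne: "u \<noteq> b"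
    and J: "ibound lborel (\<lambda>z. indicator {\<bar>u-b\<bar>/2..T} z * z powr (-(3-\<alpha>-2*H))) J"
  shows "ibound lborel (\<lambda>a. fk \<alpha> u a * \<bar>a - b\<bar> powr (-(2-2*H)))
    ((\<bar>u-b\<bar>/2) powr (\<alpha>+2*H-2) * (2/\<alpha> + 2/(2*H-1)) + 3 * J)"
proof -
  define D where "D = \<bar>u-b\<bar>/2"
  define q where "q = 2 - 2*H"
  define p where "p = 1 - \<alpha>"
  define K where "K z = indicator {D..T} z * z powr (-(p+q))" for z
  have D: "0 < D" using ne by (simp add: D_def)
  have pq: "0 < p" "p < 1" "0 < q" "q < 1" using H \<alpha> \<alpha>0 by (auto simp: p_def q_def)
  have K: "ibound lborel K J" using J by (simp add: K_def[abs_def] p_def q_def D_def algebra_simps)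
  have K1: "ibound lborel (\<lambda>a. K (x - a)) J" for x
    by (rule ibound_reflect[OF K])
  have K2: "ibound lborel (\<lambda>a. K (a - x)) J" for x
  proof -
    have "ibound lborel (\<lambda>a. K (0 - (x - a))) J" using ibound_reflect[OF ibound_reflect[OF K, of 0], of x] by simp
    then show ?thesis by simp
  qed
  have tot: "ibound lborel (\<lambda>a. D powr (-q) * (indicator {u-D..u+D} a * \<bar>a-u\<bar> powr (-p)) +
      (D powr (-p) * (indicator {b-D..b+D} a * \<bar>a-b\<bar> powr (-q)) + (K (u - a) + (K (a - b) + K (b - a)))))
     (D powr (-q) * (2 * (D powr (1-p) / (1-p))) + (D powr (-p) * (2 * (D powr (1-q) / (1-q))) + (J + (J + J))))"
    using pq D by (intro ibound_add ibound_cmult K1 K2 ibound_powr_ball) auto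
  have Knn: "0 \<le> K z" for z by (simp add: K_def)
  show ?thesis
    unfolding D_def[symmetric] q_def[symmetric]
  proof (rule ibound_mono[OF tot])
    show "AE a in lborel. fk \<alpha> u a * \<bar>a-b\<bar> powr (-q) \<le> D powr (-q) * (indicator {u-D..u+D} a * \<bar>a-u\<bar> powr (-p)) +
      (D powr (-p) * (indicator {b-D..b+D} a * \<bar>a-b\<bar> powr (-q)) + (K (u - a) + (K (a - b) + K (b - a))))"
    proof (intro AE_I2)
      fix a
      let ?A = "D powr (-q) * (indicator {u-D..u+D} a * \<bar>a-u\<bar> powr (-p))"
      let ?B = "D powr (-p) * (indicator {b-D..b+D} a * \<bar>a-b\<bar> powr (-q))"
      have nn: "0 \<le> ?A" "0 \<le> ?B" "0 \<le> K (u-a)" "0 \<le> K (a - b)" "0 \<le> K (b - a)" by (auto simp: Knn)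
      have sum: "2 * D \<le> \<bar>a-u\<bar> + \<bar>a-b\<bar>" by (simp add: D_def)
      have fk: "fk \<alpha> u a \<le> \<bar>a-u\<bar> powr (-p)" unfolding p_def by (rule fk_le)
      show "fk \<alpha> u a * \<bar>a-b\<bar> powr (-q) \<le> ?A + (?B + (K (u - a) + (K (a - b) + K (b - a))))"
      proof (cases "0 \<le> a \<and> a < u")
        case False
        then show ?thesis using nn by (auto simp: fk_def)
      next
        case True
        consider "\<bar>a-u\<bar> \<le> D" | "\<bar>a-b\<bar> \<le> D" | "D < \<bar>a-u\<bar>" "D < \<bar>a-b\<bar>" by linarith
        then show ?thesis
        proof cases
          case 1
          then have "\<bar>a-b\<bar> powr (-q) \<le> D powr (-q)" using sum D pq by (intro powr_mono2') auto
          then have "fk \<alpha> u a * \<bar>a-b\<bar> powr (-q) \<le> \<bar>a-u\<bar> powr (-p) * D powr (-q)"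
            using fk by (intro mult_mono) auto
          also have "\<dots> = ?A" using 1 by (auto simp: indicator_def abs_le_iff)
          finally show ?thesis using nn by linarith
        next
          case 2
          then have "\<bar>a-u\<bar> powr (-p) \<le> D powr (-p)" using sum D pq by (intro powr_mono2') auto
          then have "fk \<alpha> u a * \<bar>a-b\<bar> powr (-q) \<le> D powr (-p) * \<bar>a-b\<bar> powr (-q)"
            using fk by (intro mult_mono) auto
          also have "\<dots> = ?B" using 2 by (auto simp: indicator_def abs_le_iff)
          finally show ?thesis using nn by linarith
        next
          case 3
          have "fk \<alpha> u a * \<bar>a-b\<bar> powr (-q) \<le> \<bar>a-u\<bar> powr (-p) * \<bar>a-b\<bar> powr (-q)"
            using fk by (intro mult_mono) auto
          also have "\<dots> \<le> \<bar>a-u\<bar> powr (-(p+q)) + \<bar>a-b\<bar> powr (-(p+q))"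
            using pq by (intro powr_mult_le_add) auto
          also have "\<bar>a-u\<bar> powr (-(p+q)) = K (u - a)"
            using 3 True u by (auto simp: K_def indicator_def abs_if)
          also have "\<bar>a-b\<bar> powr (-(p+q)) \<le> K (a - b) + K (b - a)"
          proof (cases "a \<le> b")
            case True
            then have "\<bar>a-b\<bar> = b - a" by simp
            then show ?thesis using 3 \<open>0 \<le> a \<and> a < u\<close> b by (simp add: K_def)
          next
            case False
            then have "\<bar>a-b\<bar> = a - b" by simp
            then show ?thesis using 3 \<open>0 \<le> a \<and> a < u\<close> b u by (simp add: K_def)
          qed
          finally show ?thesis using nn by linarith
        qed
      qed
    qed
    have e1: "D powr (-q) * D powr (1-p) = D powr (\<alpha>+2*H-2)" "D powr (-p) * D powr (1-q) = D powr (\<alpha>+2*H-2)"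
      by (simp_all only: powr_add[symmetric]) (simp_all add: p_def q_def algebra_simps)
    have "D powr (-q) * (2 * (D powr (1-p) / (1-p))) = (D powr (-q) * D powr (1-p)) * (2/\<alpha>)"
         "D powr (-p) * (2 * (D powr (1-q) / (1-q))) = (D powr (-p) * D powr (1-q)) * (2/(2*H-1))"
      by (simp_all add: p_def q_def)
    then show "D powr (-q) * (2 * (D powr (1-p) / (1-p))) + (D powr (-p) * (2 * (D powr (1-q) / (1-q))) + (J + (J + J)))
       \<le> D powr (\<alpha>+2*H-2) * (2/\<alpha> + 2/(2*H-1)) + 3 * J"
      unfolding e1 by (simp add: algebra_simps)
  qed auto
qed

text \<open>Uniform form of the three regimes at an arbitrary reference scale h:
  \<open>\<rho> h * h powr (-\<alpha>)\<close> is the order of the potential at distance h, and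
  \<open>h powr \<beta> * \<bar>b - u\<bar> powr (-\<beta>)\<close> compares the actual distance
  with h. Here \<beta> is 2 - 2H - \<alpha>, \<alpha>/2 and 0 in the singular, logarithmic and
  bounded regime.\<close>

lemma potential_bound:
  obtains C \<beta> where "C > 0" "0 \<le> \<beta>" "\<beta> < \<alpha>"
    "\<And>h u b. 0 < h \<Longrightarrow> h \<le> T/2 \<Longrightarrow> u \<in> {0..T} \<Longrightarrow> b \<in> {0..T} \<Longrightarrow> u \<noteq> b \<Longrightarrow>
       ibound lborel (\<lambda>a. fk \<alpha> u a * \<bar>a - b\<bar> powr (-(2-2*H)))
        (C * (\<rho> h * h powr (-\<alpha>)) * (1 + h powr \<beta> * \<bar>b - u\<bar> powr (-\<beta>)))"
proof -
  define c where "c = 2/\<alpha> + 2/(2*H-1)"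
  have c: "0 < c" using \<alpha>0 H by (simp add: c_def add_pos_pos)
  consider "\<alpha> < 2 - 2*H" | "\<alpha> = 2 - 2*H" | "\<alpha> > 2 - 2*H" by linarith
  then show thesis
  proof cases
    case 1
    define \<beta> where "\<beta> = 2 - 2*H - \<alpha>"
    \<comment> \<open>\<open>\<beta> < \<alpha>\<close> is exactly \<open>1 - H < \<alpha>\<close>:
      the singularity left by the potential is still integrable against the kernel of an
      increment.\<close>
    have \<beta>: "0 < \<beta>" "\<beta> < \<alpha>" using 1 \<alpha> by (auto simp: \<beta>_def)
    show thesis
    proof (rule that[of "2 powr \<beta> * (c + 3/\<beta>)" \<beta>])
      fix h u b assume h: "0 < h" "h \<le> T/2" and u: "u \<in> {0..T}" and b: "b \<in> {0..T}" and ub: "u \<noteq> b"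
      let ?D = "\<bar>u-b\<bar>/2"
      have J: "ibound lborel (\<lambda>z. indicator {?D..T} z * z powr (-(3-\<alpha>-2*H))) (?D powr (-\<beta>) / \<beta>)"
      proof (rule ibound_mono)
        show "ibound lborel (\<lambda>z. indicator {?D..} z * z powr (-(1+\<beta>))) (?D powr (1-(1+\<beta>)) / (1+\<beta>-1))"
          using ub \<beta> by (intro ibound_powr_tail) auto
        have e: "3-\<alpha>-2*H = 1 + \<beta>" by (simp add: \<beta>_def)
        show "AE z in lborel. indicator {?D..T} z * z powr (-(3-\<alpha>-2*H)) \<le> indicator {?D..} z * z powr (-(1+\<beta>))"
          unfolding e by (auto simp: indicator_def)
      qed (auto simp: indicator_def)
      show "ibound lborel (\<lambda>a. fk \<alpha> u a * \<bar>a - b\<bar> powr (-(2-2*H)))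
        (2 powr \<beta> * (c + 3/\<beta>) * (\<rho> h * h powr (-\<alpha>)) * (1 + h powr \<beta> * \<bar>b - u\<bar> powr (-\<beta>)))"
      proof (rule ibound_mono[OF potential_aux[OF _ _ _ _ ub J]])
        have rh: "\<rho> h * h powr (-\<alpha>) = h powr (-\<beta>)" using 1 by (simp add: rate_def powr_add[symmetric] \<beta>_def algebra_simps)
        have hh: "h powr (-\<beta>) * h powr \<beta> = 1" using h by (simp add: powr_add[symmetric])
        have D: "?D powr (-\<beta>) = 2 powr \<beta> * \<bar>b-u\<bar> powr (-\<beta>)"
        proof -
          have "?D powr (-\<beta>) = \<bar>b-u\<bar> powr (-\<beta>) / 2 powr (-\<beta>)"
            by (subst abs_minus_commute) (simp add: powr_divide)
          then show ?thesis by (simp add: powr_minus field_simps)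
        qed
        have "?D powr (\<alpha>+2*H-2) * c + 3 * (?D powr (-\<beta>) / \<beta>) = ?D powr (-\<beta>) * (c + 3/\<beta>)"
          by (simp add: \<beta>_def algebra_simps)
        also have "\<dots> = 2 powr \<beta> * (c + 3/\<beta>) * (h powr (-\<beta>) * h powr \<beta> * \<bar>b - u\<bar> powr (-\<beta>))"
          unfolding hh D by simp
        also have "\<dots> \<le> 2 powr \<beta> * (c + 3/\<beta>) * (h powr (-\<beta>) * (1 + h powr \<beta> * \<bar>b - u\<bar> powr (-\<beta>)))"
          using c \<beta> by (intro mult_left_mono) (auto simp: algebra_simps)
        finally show "?D powr (\<alpha>+2*H-2) * (2/\<alpha> + 2/(2*H-1)) + 3 * (?D powr (-\<beta>) / \<beta>)
           \<le> 2 powr \<beta> * (c + 3/\<beta>) * (\<rho> h * h powr (-\<alpha>)) * (1 + h powr \<beta> * \<bar>b - u\<bar> powr (-\<beta>))"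
          unfolding rh c_def by (simp add: mult_ac)
      qed (use u b in auto)
    qed (use \<beta> c in \<open>auto intro!: add_pos_pos mult_pos_pos\<close>)
  next
    case 2
    \<comment> \<open>Any exponent strictly between 0 and \<alpha> would do: the logarithm of the
      ratio of h to the distance is absorbed by
      \<open>ln y \<le> y powr \<beta> / \<beta>\<close>.\<close>
    define \<beta> where "\<beta> = \<alpha>/2"
    have \<beta>: "0 < \<beta>" "\<beta> < \<alpha>" using \<alpha>0 by (auto simp: \<beta>_def)
    define l where "l = ln (2::real)"
    have l: "0 < l" by (simp add: l_def)
    define C where "C = (c + 3*l) * (2/l) + 6 + (3/\<beta>) * (2/l)"
    show thesis
    proof (rule that[of C \<beta>])
      fix h u b assume h: "0 < h" "h \<le> T/2" and u: "u \<in> {0..T}" and b: "b \<in> {0..T}" and ub: "u \<noteq> b"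
      let ?D = "\<bar>u-b\<bar>/2"
      define L where "L = max \<bar>ln h\<bar> (ln T)"
      define y where "y = h / \<bar>b - u\<bar>"
      have y: "0 < y" using h ub by (auto simp: y_def)
      have ey: "h powr \<beta> * \<bar>b - u\<bar> powr (-\<beta>) = y powr \<beta>"
        using h by (simp add: y_def powr_divide powr_minus field_simps)
      have L: "l / 2 \<le> L" "ln (T/h) \<le> 2 * L" using log_rate[OF h] by (auto simp: L_def l_def)
      have J: "ibound lborel (\<lambda>z. indicator {?D..T} z * z powr (-(3-\<alpha>-2*H))) (ln (T / ?D))"
      proof -
        have "3 - \<alpha> - 2*H = 1" using 2 by simp
        moreover have "ibound lborel (\<lambda>z. indicator {?D..T} z * z powr (-1)) (ln (T / ?D))"
          using u b ub by (intro ibound_inverse_Icc) auto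
        ultimately show ?thesis by (simp only:)
      qed
      show "ibound lborel (\<lambda>a. fk \<alpha> u a * \<bar>a - b\<bar> powr (-(2-2*H)))
        (C * (\<rho> h * h powr (-\<alpha>)) * (1 + h powr \<beta> * \<bar>b - u\<bar> powr (-\<beta>)))"
      proof (rule ibound_mono[OF potential_aux[OF _ _ _ _ ub J]])
        have rh: "\<rho> h * h powr (-\<alpha>) = L"
          using 2 h by (simp add: rate_def L_def powr_add[symmetric])
        have "ln (y powr \<beta>) \<le> y powr \<beta> - 1" using y by (intro ln_le_minus_one) auto
        then have lny: "ln y \<le> y powr \<beta> / \<beta>" using \<beta> y by (simp add: ln_powr field_simps)
        have "T / ?D = 2 * ((T/h) * y)" using h ub by (auto simp: y_def abs_minus_commute field_simps)
        then have lnT: "ln (T / ?D) = l + (ln (T/h) + ln y)"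
        proof -
          have "ln (2 * ((T/h) * y)) = ln 2 + ln ((T/h) * y)" using h T y by (intro ln_mult_pos) auto
          also have "ln ((T/h) * y) = ln (T/h) + ln y" using h T y by (intro ln_mult_pos) auto
          finally show ?thesis using \<open>T / ?D = 2 * ((T/h) * y)\<close> by (simp add: l_def)
        qed
        have "?D powr (\<alpha>+2*H-2) = 1" using 2 ub by simp
        then have "?D powr (\<alpha>+2*H-2) * c + 3 * ln (T / ?D) \<le> c + 3 * l + 6 * L + 3/\<beta> * y powr \<beta>"
          using lnT L lny by (simp add: field_simps)
        also have "\<dots> \<le> (c + 3 * l) * ((2/l) * L) + 6 * L + 3/\<beta> * ((2/l * L) * y powr \<beta>)"
        proof -
          have L1: "1 \<le> (2/l) * L" using L l by (simp add: field_simps)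
          have "(c + 3 * l) * 1 \<le> (c + 3 * l) * ((2/l) * L)" using L1 c l by (intro mult_left_mono) auto
          moreover have "3/\<beta> * (1 * y powr \<beta>) \<le> 3/\<beta> * ((2/l * L) * y powr \<beta>)"
            using L1 \<beta> by (intro mult_left_mono mult_right_mono) auto
          ultimately show ?thesis by simp
        qed
        also have "\<dots> \<le> C * L * (1 + y powr \<beta>)"
        proof -
          define p where "p = (c + 3*l) * (2/l)"
          define r where "r = 3/\<beta> * (2/l)"
          have "0 \<le> p" "0 \<le> r" "0 \<le> L" using L l c \<beta> by (auto simp: p_def r_def)
          then have "0 \<le> p * L * y powr \<beta> + 6 * L * y powr \<beta> + r * L" by simp
          then have "p * L + 6 * L + r * L * y powr \<beta> \<le> (p + 6 + r) * L * (1 + y powr \<beta>)"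
            by (simp add: algebra_simps)
          moreover have "C = p + 6 + r" by (simp only: C_def p_def r_def)
          moreover have "(c + 3 * l) * ((2/l) * L) + 6 * L + 3/\<beta> * ((2/l * L) * y powr \<beta>) = p * L + 6 * L + r * L * y powr \<beta>"
            by (simp only: p_def r_def mult.assoc)
          ultimately show ?thesis by (simp only:)
        qed
        finally show "?D powr (\<alpha>+2*H-2) * (2/\<alpha> + 2/(2*H-1)) + 3 * ln (T / ?D)
           \<le> C * (\<rho> h * h powr (-\<alpha>)) * (1 + h powr \<beta> * \<bar>b - u\<bar> powr (-\<beta>))"
          unfolding rh c_def ey by simp
      qed (use u b in auto)
    qed (use \<beta> c l in \<open>auto simp: C_def intro!: add_pos_pos mult_pos_pos\<close>)
  next
    case 3
    define \<kappa> where "\<kappa> = 3 - \<alpha> - 2*H"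
    have \<kappa>: "\<kappa> < 1" using 3 by (simp add: \<kappa>_def)
    define C where "C = T powr (1-\<kappa>) * c + 3 * (T powr (1-\<kappa>) / (1-\<kappa>))"
    show thesis
    proof (rule that[of C 0])
      show "C > 0" using c \<kappa> T by (auto simp: C_def intro!: add_pos_pos)
      fix h u b assume h: "0 < h" "h \<le> T/2" and u: "u \<in> {0..T}" and b: "b \<in> {0..T}" and ub: "u \<noteq> b"
      let ?D = "\<bar>u-b\<bar>/2"
      have J: "ibound lborel (\<lambda>z. indicator {?D..T} z * z powr (-(3-\<alpha>-2*H))) (T powr (1-\<kappa>) / (1-\<kappa>))"
        using \<kappa> T unfolding \<kappa>_def[symmetric]
        by (intro ibound_mono[OF ibound_powr_Icc[of \<kappa> T]]) (auto simp: indicator_def)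
      show "ibound lborel (\<lambda>a. fk \<alpha> u a * \<bar>a - b\<bar> powr (-(2-2*H)))
        (C * (\<rho> h * h powr (-\<alpha>)) * (1 + h powr 0 * \<bar>b - u\<bar> powr (-0)))"
      proof (rule ibound_mono[OF potential_aux[OF _ _ _ _ ub J]])
        have rh: "\<rho> h * h powr (-\<alpha>) = 1" using 3 h by (simp add: rate_def powr_add[symmetric])
        have "?D powr (\<alpha>+2*H-2) \<le> T powr (1-\<kappa>)"
        proof -
          have "?D powr (1-\<kappa>) \<le> T powr (1-\<kappa>)" using u b \<kappa> by (intro powr_mono2) auto
          then show ?thesis by (simp add: \<kappa>_def algebra_simps)
        qed
        then have "?D powr (\<alpha>+2*H-2) * c + 3 * (T powr (1-\<kappa>) / (1-\<kappa>)) \<le> C"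
          using c by (simp add: C_def)
        also have "\<dots> \<le> C * 1 * (1 + h powr 0 * \<bar>b - u\<bar> powr (-0))" using \<open>C > 0\<close> by simp
        finally show "?D powr (\<alpha>+2*H-2) * (2/\<alpha> + 2/(2*H-1)) + 3 * (T powr (1-\<kappa>) / (1-\<kappa>))
           \<le> C * (\<rho> h * h powr (-\<alpha>)) * (1 + h powr 0 * \<bar>b - u\<bar> powr (-0))"
          unfolding rh c_def .
      qed (use u b in auto)
    qed (use \<alpha>0 in auto)
  qed
qed

text \<open>The mutual energy of f and g: up to H(2H-1) it is the covariance of their Wiener
  integrals. With values in ennreal it can be estimated before it is known to be finite.\<close>

definition en :: "(real \<Rightarrow> real) \<Rightarrow> (real \<Rightarrow> real) \<Rightarrow> ennreal" where
  "en f g = (\<integral>\<^sup>+b. (\<integral>\<^sup>+a. ennreal (f a * g b * \<bar>a - b\<bar> powr (-(2-2*H))) \<partial>lborel) \<partial>lborel)"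

lemma en_mono:
  assumes "\<And>a. 0 \<le> f a" "\<And>a. 0 \<le> g a" "\<And>a. f a \<le> f' a" "\<And>a. g a \<le> g' a"
  shows "en f g \<le> en f' g'"
proof -
  have "0 \<le> f' a" "0 \<le> g' a" for a using assms order_trans by blast+
  then show ?thesis unfolding en_def using assms
    by (intro nn_integral_mono ennreal_leI mult_mono) auto
qed

lemma en_add_left:
  assumes [measurable]: "f \<in> borel_measurable borel" "f' \<in> borel_measurable borel" "g \<in> borel_measurable borel"
   and nn: "\<And>a. 0 \<le> f a" "\<And>a. 0 \<le> f' a" "\<And>a. 0 \<le> g a"
  shows "en (\<lambda>a. f a + f' a) g = en f g + en f' g"
proof -
  have "en (\<lambda>a. f a + f' a) g = (\<integral>\<^sup>+b. (\<integral>\<^sup>+a. ennreal (f a * g b * \<bar>a - b\<bar> powr (-(2-2*H)))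
       + ennreal (f' a * g b * \<bar>a - b\<bar> powr (-(2-2*H))) \<partial>lborel) \<partial>lborel)"
    unfolding en_def using nn by (intro nn_integral_cong) (simp add: ring_distribs ennreal_plus[symmetric] del: ennreal_plus)
  also have "\<dots> = (\<integral>\<^sup>+b. ((\<integral>\<^sup>+a. ennreal (f a * g b * \<bar>a - b\<bar> powr (-(2-2*H))) \<partial>lborel)
       + (\<integral>\<^sup>+a. ennreal (f' a * g b * \<bar>a - b\<bar> powr (-(2-2*H))) \<partial>lborel)) \<partial>lborel)"
    by (intro nn_integral_cong nn_integral_add) measurable
  also have "\<dots> = en f g + en f' g"
    unfolding en_def by (intro nn_integral_add) measurable
  finally show ?thesis .
qed

text \<open>The potential is asked for only where g does not vanish and off a null set, since
  \<open>potential_bound\<close> concerns points of [0,T] different from u.\<close>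

lemma en_le:
  assumes nn: "\<And>a. 0 \<le> f a" "\<And>b. 0 \<le> g b"
   and B: "AE b in lborel. g b \<noteq> 0 \<longrightarrow> ibound lborel (\<lambda>a. f a * \<bar>a - b\<bar> powr (-(2-2*H))) (B b)"
   and A: "ibound lborel (\<lambda>b. g b * B b) A"
  shows "en f g \<le> ennreal A"
proof -
  have "en f g \<le> (\<integral>\<^sup>+b. ennreal (g b * B b) \<partial>lborel)"
    unfolding en_def
  proof (intro nn_integral_mono_AE, use B in \<open>elim eventually_mono\<close>)
    fix b assume b: "g b \<noteq> 0 \<longrightarrow> ibound lborel (\<lambda>a. f a * \<bar>a - b\<bar> powr (-(2-2*H))) (B b)"
    show "(\<integral>\<^sup>+a. ennreal (f a * g b * \<bar>a - b\<bar> powr (-(2-2*H))) \<partial>lborel) \<le> ennreal (g b * B b)"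
    proof (cases "g b = 0")
      case True then show ?thesis by simp
    next
      case False
      with b have "ibound lborel (\<lambda>a. g b * (f a * \<bar>a - b\<bar> powr (-(2-2*H)))) (g b * B b)"
        using nn by (intro ibound_cmult) auto
      then show ?thesis unfolding ibound_def by (simp add: mult_ac)
    qed
  qed
  also have "\<dots> \<le> ennreal A" using A by (simp add: ibound_def)
  finally show ?thesis .
qed

text \<open>Integrating the potential against \<open>fd\<close>: its mass
  \<open>h powr \<alpha>\<close> cancels \<open>h powr (-\<alpha>)\<close>, and the singular part
  costs \<open>h powr \<beta> * h powr (\<alpha> - \<beta>)\<close>, the same order. What remains is
  the rate.\<close>

lemma en_fk_fd:
  "\<exists>C>0. \<forall>h r s u. 0 < h \<and> h \<le> T/2 \<and> 0 \<le> r \<and> r \<le> s \<and> s \<le> T \<and> s - r \<le> h \<and> u \<in> {0..T} \<longrightarrow>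
     en (fk \<alpha> u) (fd \<alpha> r s) \<le> ennreal (C * \<rho> h)"
proof -
  obtain C \<beta> where C: "C > 0" "0 \<le> \<beta>" "\<beta> < \<alpha>" and P:
    "\<And>h u b. 0 < h \<Longrightarrow> h \<le> T/2 \<Longrightarrow> u \<in> {0..T} \<Longrightarrow> b \<in> {0..T} \<Longrightarrow> u \<noteq> b \<Longrightarrow>
       ibound lborel (\<lambda>a. fk \<alpha> u a * \<bar>a - b\<bar> powr (-(2-2*H)))
        (C * (\<rho> h * h powr (-\<alpha>)) * (1 + h powr \<beta> * \<bar>b - u\<bar> powr (-\<beta>)))" by (rule potential_bound, rule that)
  define c1 where "c1 = 2/\<alpha> + 4 * (2 + 2/(\<alpha>-\<beta>))"
  have c1: "c1 > 0" using C \<alpha>0 by (auto simp: c1_def intro!: add_pos_pos)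
  have "en (fk \<alpha> u) (fd \<alpha> r s) \<le> ennreal (C * (2/\<alpha> + c1) * \<rho> h)"
    if h: "0 < h" "h \<le> T/2" and rs: "0 \<le> r" "r \<le> s" "s \<le> T" "s - r \<le> h" and u: "u \<in> {0..T}" for h r s u
  proof (rule en_le)
    define R where "R = C * (\<rho> h * h powr (-\<alpha>))"
    have R: "0 \<le> R" using C rate_pos[OF h] by (simp add: R_def)
    let ?B = "\<lambda>b. R * (1 + h powr \<beta> * \<bar>b - u\<bar> powr (-\<beta>))"
    show "AE b in lborel. fd \<alpha> r s b \<noteq> 0 \<longrightarrow> ibound lborel (\<lambda>a. fk \<alpha> u a * \<bar>a - b\<bar> powr (-(2-2*H))) (?B b)"
      using AE_lborel_singleton[of u]
    proof eventually_elim
      case (elim b)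
      show ?case unfolding R_def using elim h u rs fd_eq_0[of r s b \<alpha>]
        by (intro impI P) force+
    qed
    have 1: "ibound lborel (\<lambda>b. R * (fd \<alpha> r s b + h powr \<beta> * (fd \<alpha> r s b * \<bar>b - u\<bar> powr (-\<beta>))))
        (R * (2 * h powr \<alpha> / \<alpha> + h powr \<beta> * (c1 * h powr (\<alpha> - \<beta>))))"
      unfolding c1_def using R \<alpha>0 \<alpha> rs h C
      by (intro ibound_cmult ibound_add ibound_fd_h ibound_fd_powr) auto
    show "ibound lborel (\<lambda>b. fd \<alpha> r s b * ?B b) (C * (2/\<alpha> + c1) * \<rho> h)"
    proof (rule ibound_mono[OF 1])
      have "h powr \<beta> * h powr (\<alpha>-\<beta>) = h powr \<alpha>" "h powr (-\<alpha>) * h powr \<alpha> = 1"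
        using h by (simp_all add: powr_add[symmetric])
      then have e: "R * (2 * h powr \<alpha> / \<alpha>) = C * (2/\<alpha>) * \<rho> h" "R * (h powr \<beta> * (c1 * h powr (\<alpha> - \<beta>))) = C * c1 * \<rho> h"
        by (simp_all add: R_def mult_ac)
      show "R * (2 * h powr \<alpha> / \<alpha> + h powr \<beta> * (c1 * h powr (\<alpha> - \<beta>))) \<le> C * (2/\<alpha> + c1) * \<rho> h"
        unfolding ring_distribs e by (simp add: algebra_simps)
    qed (use R in \<open>auto simp: algebra_simps\<close>)
  qed auto
  moreover have "C * (2/\<alpha> + c1) > 0" using C c1 \<alpha>0 by (intro mult_pos_pos add_pos_pos) auto
  ultimately show ?thesis by blast
qed

lemma en_fk_fk:
  "\<exists>C>0. \<forall>t\<in>{0..T}. \<forall>t'\<in>{0..T}. en (fk \<alpha> t) (fk \<alpha> t') \<le> ennreal C"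
proof -
  obtain C \<beta> where C: "C > 0" "0 \<le> \<beta>" "\<beta> < \<alpha>" and P:
    "\<And>h u b. 0 < h \<Longrightarrow> h \<le> T/2 \<Longrightarrow> u \<in> {0..T} \<Longrightarrow> b \<in> {0..T} \<Longrightarrow> u \<noteq> b \<Longrightarrow>
       ibound lborel (\<lambda>a. fk \<alpha> u a * \<bar>a - b\<bar> powr (-(2-2*H)))
        (C * (\<rho> h * h powr (-\<alpha>)) * (1 + h powr \<beta> * \<bar>b - u\<bar> powr (-\<beta>)))" by (rule potential_bound, rule that)
  \<comment> \<open>Only finiteness is wanted here, so the free scale of the potential bound is
    fixed once and for all. The summand 1 in the constant below just makes it positive.\<close>
  define h where "h = T/2"
  have h: "0 < h" "h \<le> T/2" using T by (auto simp: h_def)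
  define R where "R = C * (\<rho> h * h powr (-\<alpha>))"
  have R: "0 \<le> R" using C rate_pos[OF h] by (simp add: R_def)
  define \<gamma> where "\<gamma> = 1 - \<alpha> + \<beta>"
  have \<gamma>: "0 < \<gamma>" "\<gamma> < 1" using C \<alpha> by (auto simp: \<gamma>_def)
  define c2 where "c2 = 2 * (T powr (1-\<gamma>) / (1-\<gamma>))"
  have c2: "0 \<le> c2" using \<gamma> T by (simp add: c2_def)
  have "en (fk \<alpha> u) (fk \<alpha> t) \<le> ennreal (R * (T powr \<alpha> / \<alpha> + h powr \<beta> * (c2 + c2)) + 1)"
    if u: "u \<in> {0..T}" and t: "t \<in> {0..T}" for u t
  proof (rule en_le)
    let ?B = "\<lambda>b. R * (1 + h powr \<beta> * \<bar>b - u\<bar> powr (-\<beta>))"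
    show "AE b in lborel. fk \<alpha> t b \<noteq> 0 \<longrightarrow> ibound lborel (\<lambda>a. fk \<alpha> u a * \<bar>a - b\<bar> powr (-(2-2*H))) (?B b)"
      using AE_lborel_singleton[of u]
    proof eventually_elim
      case (elim b)
      show ?case unfolding R_def using elim h u t
        by (intro impI P) (auto simp: fk_def split: if_splits)
    qed
    let ?W = "\<lambda>x b. indicator {x-T..x+T} b * \<bar>b - x\<bar> powr (-\<gamma>)"
    have W: "ibound lborel (?W x) c2" for x
      unfolding c2_def using \<gamma> T by (intro ibound_powr_ball) auto
    have 1: "ibound lborel (\<lambda>b. R * (fk \<alpha> t b + h powr \<beta> * (?W t b + ?W u b)))
        (R * (t powr \<alpha> / \<alpha> + h powr \<beta> * (c2 + c2)))"
      using R \<alpha>0 t by (intro ibound_cmult ibound_add ibound_fk W) auto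
    show "ibound lborel (\<lambda>b. fk \<alpha> t b * ?B b) (R * (T powr \<alpha> / \<alpha> + h powr \<beta> * (c2 + c2)) + 1)"
    proof (rule ibound_mono[OF 1])
      show "AE b in lborel. fk \<alpha> t b * ?B b \<le> R * (fk \<alpha> t b + h powr \<beta> * (?W t b + ?W u b))"
      proof (intro AE_I2)
        fix b
        have "fk \<alpha> t b * \<bar>b - u\<bar> powr (-\<beta>) \<le> ?W t b + ?W u b"
        proof (cases "0 \<le> b \<and> b < t")
          case False then show ?thesis by (auto simp: fk_def)
        next
          case True
          have "fk \<alpha> t b * \<bar>b - u\<bar> powr (-\<beta>) \<le> \<bar>b - t\<bar> powr (-(1-\<alpha>)) * \<bar>b - u\<bar> powr (-\<beta>)"
            by (intro mult_right_mono fk_le) auto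
          also have "\<dots> \<le> \<bar>b - t\<bar> powr (-\<gamma>) + \<bar>b - u\<bar> powr (-\<gamma>)"
            unfolding \<gamma>_def using C \<alpha> by (intro powr_mult_le_add) auto
          finally show ?thesis using True t u by (auto simp: indicator_def)
        qed
        then have "fk \<alpha> t b + h powr \<beta> * (fk \<alpha> t b * \<bar>b - u\<bar> powr (-\<beta>)) \<le> fk \<alpha> t b + h powr \<beta> * (?W t b + ?W u b)"
          by (intro add_left_mono mult_left_mono) auto
        then have "R * (fk \<alpha> t b + h powr \<beta> * (fk \<alpha> t b * \<bar>b - u\<bar> powr (-\<beta>))) \<le> R * (fk \<alpha> t b + h powr \<beta> * (?W t b + ?W u b))"
          using R by (intro mult_left_mono)
        then show "fk \<alpha> t b * ?B b \<le> R * (fk \<alpha> t b + h powr \<beta> * (?W t b + ?W u b))" by (simp add: algebra_simps)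
      qed
      have "t powr \<alpha> / \<alpha> \<le> T powr \<alpha> / \<alpha>" using t \<alpha>0 by (intro divide_right_mono powr_mono2) auto
      then have "R * (t powr \<alpha> / \<alpha> + h powr \<beta> * (c2 + c2)) \<le> R * (T powr \<alpha> / \<alpha> + h powr \<beta> * (c2 + c2))"
        using R by (intro mult_left_mono) auto
      then show "R * (t powr \<alpha> / \<alpha> + h powr \<beta> * (c2 + c2)) \<le> R * (T powr \<alpha> / \<alpha> + h powr \<beta> * (c2 + c2)) + 1" by linarith
    qed (use R in auto)
  qed auto
  moreover have "0 \<le> R * (T powr \<alpha> / \<alpha> + h powr \<beta> * (c2 + c2))" using R c2 \<alpha>0 by simp
  then have "0 < R * (T powr \<alpha> / \<alpha> + h powr \<beta> * (c2 + c2)) + 1" by linarith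
  ultimately show ?thesis by blast
qed

lemma nn_double_le:
  assumes "\<And>b. ibound lborel (\<lambda>a. F a b) (B b)" "ibound lborel B A"
  shows "(\<integral>\<^sup>+b. (\<integral>\<^sup>+a. ennreal (F a b) \<partial>lborel) \<partial>lborel) \<le> ennreal A"
proof -
  have "(\<integral>\<^sup>+b. (\<integral>\<^sup>+a. ennreal (F a b) \<partial>lborel) \<partial>lborel) \<le> (\<integral>\<^sup>+b. ennreal (B b) \<partial>lborel)"
    using assms(1) by (intro nn_integral_mono) (auto simp: ibound_def)
  also have "\<dots> \<le> ennreal A" using assms(2) by (simp add: ibound_def)
  finally show ?thesis .
qed

text \<open>For \<alpha> up to 2 - 2H one increment is split crudely into two kernels; the resulting
  single rate becomes its square because \<open>h powr (2-2*H)\<close> is within the rate. For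
  larger \<alpha> the kernel exponent 2 - 2H is below \<alpha>, so one increment can be integrated
  directly against the singularity and the mass of the other one gives the second power.\<close>

lemma en_fd_fd_near:
  "\<exists>C>0. \<forall>h r s r' s'. 0 < h \<and> h \<le> T/2 \<and> 0 \<le> r \<and> r \<le> s \<and> s \<le> T \<and> s - r \<le> h \<and>
     0 \<le> r' \<and> r' \<le> s' \<and> s' \<le> T \<and> s' - r' \<le> h \<longrightarrow>
     en (fd \<alpha> r s) (fd \<alpha> r' s') \<le> ennreal (C * (\<rho> h)\<^sup>2 * h powr (-(2-2*H)))"
proof (cases "\<alpha> \<le> 2 - 2*H")
  case True
  obtain C where C: "C > 0" "\<And>h r s u. 0 < h \<Longrightarrow> h \<le> T/2 \<Longrightarrow> 0 \<le> r \<Longrightarrow> r \<le> s \<Longrightarrow> s \<le> T \<Longrightarrow> s - r \<le> h \<Longrightarrow> u \<in> {0..T} \<Longrightarrow>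
     en (fk \<alpha> u) (fd \<alpha> r s) \<le> ennreal (C * \<rho> h)" using en_fk_fd by blast
  obtain D where D: "D > 0" "\<And>h. 0 < h \<Longrightarrow> h \<le> T/2 \<Longrightarrow> h powr (2-2*H) \<le> D * \<rho> h" using rate_ge'[OF True] by blast
  have "en (fd \<alpha> r s) (fd \<alpha> r' s') \<le> ennreal ((2 * C * D) * (\<rho> h)\<^sup>2 * h powr (-(2-2*H)))"
    if h: "0 < h" "h \<le> T/2" and rs: "0 \<le> r" "r \<le> s" "s \<le> T" "s - r \<le> h" "0 \<le> r'" "r' \<le> s'" "s' \<le> T" "s' - r' \<le> h"
    for h r s r' s'
  proof -
    have rp: "0 < \<rho> h" by (rule rate_pos[OF h])
    have "en (fd \<alpha> r s) (fd \<alpha> r' s') \<le> en (\<lambda>a. fk \<alpha> s a + fk \<alpha> r a) (fd \<alpha> r' s')"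
      by (intro en_mono fd_le) auto
    also have "\<dots> = en (fk \<alpha> s) (fd \<alpha> r' s') + en (fk \<alpha> r) (fd \<alpha> r' s')"
      by (intro en_add_left) auto
    also have "\<dots> \<le> ennreal (C * \<rho> h) + ennreal (C * \<rho> h)"
      using h rs by (intro add_mono C) auto
    also have "\<dots> = ennreal (2 * (C * \<rho> h))" using C rp by (simp add: ennreal_plus[symmetric] del: ennreal_plus)
    also have "\<dots> \<le> ennreal ((2 * C * D) * (\<rho> h)\<^sup>2 * h powr (-(2-2*H)))"
    proof (intro ennreal_leI)
      have e: "h powr (2-2*H) * h powr (-(2-2*H)) = 1" using h by (simp add: powr_add[symmetric])
      have "1 \<le> (D * \<rho> h) * h powr (-(2-2*H))"
        using mult_right_mono[OF D(2)[OF h], of "h powr (-(2-2*H))"] unfolding e by simp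
      then have "2 * (C * \<rho> h) * 1 \<le> 2 * (C * \<rho> h) * ((D * \<rho> h) * h powr (-(2-2*H)))"
        using C rp by (intro mult_left_mono) auto
      then show "2 * (C * \<rho> h) \<le> (2 * C * D) * (\<rho> h)\<^sup>2 * h powr (-(2-2*H))" by (simp add: power2_eq_square mult_ac)
    qed
    finally show ?thesis .
  qed
  moreover have "2 * C * D > 0" using C D by auto
  ultimately show ?thesis by blast
next
  case False
  define q where "q = 2 - 2*H"
  have q: "0 \<le> q" "q < \<alpha>" using False H by (auto simp: q_def)
  define c where "c = 2/\<alpha> + 4 * (2 + 2/(\<alpha>-q))"
  have c: "0 < c" using q \<alpha>0 by (auto simp: c_def intro!: add_pos_pos)
  have "en (fd \<alpha> r s) (fd \<alpha> r' s') \<le> ennreal ((c * 2 / \<alpha>) * (\<rho> h)\<^sup>2 * h powr (-(2-2*H)))"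
    if h: "0 < h" "h \<le> T/2" and rs: "0 \<le> r" "r \<le> s" "s \<le> T" "s - r \<le> h" "0 \<le> r'" "r' \<le> s'" "s' \<le> T" "s' - r' \<le> h"
    for h r s r' s'
  proof (rule en_le)
    show "AE b in lborel. fd \<alpha> r' s' b \<noteq> 0 \<longrightarrow> ibound lborel (\<lambda>a. fd \<alpha> r s a * \<bar>a - b\<bar> powr (-(2-2*H))) (c * h powr (\<alpha> - q))"
      unfolding c_def q_def[symmetric] using \<alpha>0 \<alpha> h rs q by (intro AE_I2 impI ibound_fd_powr) auto
    have 1: "ibound lborel (\<lambda>b. (c * h powr (\<alpha> - q)) * fd \<alpha> r' s' b) ((c * h powr (\<alpha> - q)) * (2 * h powr \<alpha> / \<alpha>))"
      using c \<alpha>0 \<alpha> rs by (intro ibound_cmult ibound_fd_h) auto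
    have "\<rho> h = h powr \<alpha>" using False by (simp add: rate_def)
    moreover have "h powr (\<alpha> - q) * h powr \<alpha> = (h powr \<alpha>)\<^sup>2 * h powr (-q)"
      by (simp only: power2_eq_square powr_add[symmetric]) (simp add: algebra_simps)
    ultimately have "(c * h powr (\<alpha> - q)) * (2 * h powr \<alpha> / \<alpha>) = (c * 2 / \<alpha>) * (\<rho> h)\<^sup>2 * h powr (-(2-2*H))"
      by (simp add: q_def field_simps)
    note eq = this
    show "ibound lborel (\<lambda>b. fd \<alpha> r' s' b * (c * h powr (\<alpha> - q))) ((c * 2 / \<alpha>) * (\<rho> h)\<^sup>2 * h powr (-(2-2*H)))"
      unfolding eq[symmetric] using 1 by (simp add: mult_ac)
  qed auto
  moreover have "c * 2 / \<alpha> > 0" using c \<alpha>0 by auto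
  ultimately show ?thesis by blast
qed

text \<open>If a and b are at distance at least d/4, the kernel is of order
  \<open>d powr (-(2-2*H))\<close> and the two masses give \<open>(h powr \<alpha>)\<^sup>2\<close>.
  Otherwise one of the two points is far from the end of its own increment, where \<open>fd\<close>
  has only its small tail. The threshold 6h makes 3/8 of the distance at least 2h, as
  \<open>fd_tail\<close> requires.\<close>

lemma en_fd_fd_far:
  assumes h: "0 < h" and rs: "0 \<le> r" "r \<le> s" "s - r \<le> h" "0 \<le> r'" "r' \<le> s'" "s' - r' \<le> h"
   and d: "6 * h \<le> \<bar>s - s'\<bar>"
  shows "en (fd \<alpha> r s) (fd \<alpha> r' s') \<le> ennreal
    ((4 powr (2-2*H) * 4 / \<alpha>\<^sup>2 + (3/16) powr (\<alpha>-2) * 8 / (\<alpha> * (2*H-1))) * (h powr \<alpha>)\<^sup>2 * \<bar>s - s'\<bar> powr (-(2-2*H)))"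
proof -
  define d where "d = \<bar>s - s'\<bar>"
  define q where "q = 2 - 2*H"
  have q: "0 < q" "q < 1" using H by (auto simp: q_def)
  have d0: "0 < d" "6 * h \<le> d" using h d by (auto simp: d_def)
  \<comment> \<open>Bound of \<open>fd_tail\<close> at distance 3d/8 from the end of the increment;
    3/16 is half of 3/8.\<close>
  define \<tau> where "\<tau> = h * (3/16 * d) powr (\<alpha> - 2)"
  have \<tau>: "0 \<le> \<tau>" using h by (simp add: \<tau>_def)
  define f where "f = fd \<alpha> r s"
  define g where "g = fd \<alpha> r' s'"
  define w where "w x = indicator {-(d/4)..d/4} x * \<bar>x\<bar> powr (-q)" for x
  have [measurable]: "f \<in> borel_measurable borel" "g \<in> borel_measurable borel" "w \<in> borel_measurable borel"
    by (auto simp: f_def g_def w_def[abs_def])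
  have nn: "0 \<le> f a" "0 \<le> g a" "0 \<le> w a" for a by (auto simp: f_def g_def w_def)
  define M where "M = 2 * h powr \<alpha> / \<alpha>"
  have f: "ibound lborel f M" and g: "ibound lborel g M"
    using \<alpha>0 \<alpha> rs by (auto simp: f_def g_def M_def intro!: ibound_fd_h)
  have M: "0 \<le> M" using \<alpha>0 by (simp add: M_def)
  define Q where "Q = 2 * ((d/4) powr (1-q) / (1-q))"
  have w1: "ibound lborel (\<lambda>a. w (a - b)) Q" for b
    unfolding Q_def w_def
    by (rule ibound_mono[OF ibound_powr_ball[of q "d/4" b]]) (use q d0 in \<open>auto simp: indicator_def\<close>)
  have w2: "ibound lborel (\<lambda>b. w (a - b)) Q" for a
  proof -
    have "w (a - b) = w (b - a)" for b by (auto simp: w_def indicator_def abs_minus_commute)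
    then show ?thesis using w1[of a] by simp
  qed
  have tail: "fd \<alpha> r s a \<le> \<tau>" if "r \<le> s" "s - r \<le> h" "3/8 * d \<le> \<bar>a - s\<bar>" for r s a
  proof (cases "s \<le> a")
    case True then show ?thesis using that \<tau> fd_eq_0[of r s a \<alpha>] by simp
  next
    case False
    then have as: "3/8 * d \<le> s - a" using that by simp
    have "fd \<alpha> r s a \<le> h * ((s - a) / 2) powr (\<alpha> - 2)"
      using \<alpha>0 \<alpha> that as d0 h by (intro fd_tail) auto
    also have "\<dots> \<le> \<tau>"
      unfolding \<tau>_def using as d0 h \<alpha> by (intro mult_left_mono powr_mono2') auto
    finally show ?thesis .
  qed
  have pt: "f a * g b * \<bar>a - b\<bar> powr (-q) \<le> (d/4) powr (-q) * (f a * g b) + (\<tau> * (g b * w (a - b)) + \<tau> * (f a * w (a - b)))" for a b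
  proof (cases "d/4 \<le> \<bar>a - b\<bar>")
    case True
    then have "\<bar>a - b\<bar> powr (-q) \<le> (d/4) powr (-q)" using d0 q by (intro powr_mono2') auto
    then have "f a * g b * \<bar>a - b\<bar> powr (-q) \<le> f a * g b * (d/4) powr (-q)" using nn by (intro mult_left_mono) auto
    moreover have "0 \<le> \<tau> * (g b * w (a - b)) + \<tau> * (f a * w (a - b))" using nn \<tau> by auto
    ultimately show ?thesis by (simp add: mult_ac)
  next
    case False
    then have w: "w (a - b) = \<bar>a - b\<bar> powr (-q)"
    proof -
      have "a - b \<in> {-(d/4)..d/4}" using False unfolding atLeastAtMost_iff by linarith
      then show ?thesis by (simp add: w_def)
    qed
    have n2: "0 \<le> (d/4) powr (-q) * (f a * g b)" "0 \<le> \<tau> * (g b * w (a - b))" "0 \<le> \<tau> * (f a * w (a - b))"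
      using nn \<tau> by auto
    \<comment> \<open>With the middle distance below d/4, the two outer ones add up to more than
      3d/4.\<close>
    have "3/8 * d \<le> \<bar>a - s\<bar> \<or> 3/8 * d \<le> \<bar>b - s'\<bar>"
    proof -
      have "d \<le> \<bar>a - s\<bar> + \<bar>a - b\<bar> + \<bar>b - s'\<bar>" unfolding d_def by arith
      then show ?thesis using False by linarith
    qed
    then show ?thesis
    proof
      assume "3/8 * d \<le> \<bar>a - s\<bar>"
      then have "f a * (g b * w (a - b)) \<le> \<tau> * (g b * w (a - b))" unfolding f_def using rs nn by (intro mult_right_mono tail) auto
      then show ?thesis using n2 w by (simp add: mult_ac)
    next
      assume "3/8 * d \<le> \<bar>b - s'\<bar>"
      then have "g b * (f a * w (a - b)) \<le> \<tau> * (f a * w (a - b))" unfolding g_def using rs nn by (intro mult_right_mono tail) auto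
      then show ?thesis using n2 w by (simp add: mult_ac)
    qed
  qed
  have "en f g \<le> (\<integral>\<^sup>+b. (\<integral>\<^sup>+a. ennreal ((d/4) powr (-q) * (f a * g b)) +
      (ennreal (\<tau> * (g b * w (a - b))) + ennreal (\<tau> * (f a * w (a - b)))) \<partial>lborel) \<partial>lborel)"
    unfolding en_def q_def[symmetric] using pt nn \<tau>
    by (intro nn_integral_mono) (simp add: ennreal_plus[symmetric] ennreal_leI del: ennreal_plus)
  also have "\<dots> = (\<integral>\<^sup>+b. (\<integral>\<^sup>+a. ennreal ((d/4) powr (-q) * (f a * g b)) \<partial>lborel) +
      ((\<integral>\<^sup>+a. ennreal (\<tau> * (g b * w (a - b))) \<partial>lborel) + (\<integral>\<^sup>+a. ennreal (\<tau> * (f a * w (a - b))) \<partial>lborel)) \<partial>lborel)"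
    by (simp add: nn_integral_add)
  also have "\<dots> = (\<integral>\<^sup>+b. (\<integral>\<^sup>+a. ennreal ((d/4) powr (-q) * (f a * g b)) \<partial>lborel) \<partial>lborel) +
      ((\<integral>\<^sup>+b. (\<integral>\<^sup>+a. ennreal (\<tau> * (g b * w (a - b))) \<partial>lborel) \<partial>lborel) +
       (\<integral>\<^sup>+b. (\<integral>\<^sup>+a. ennreal (\<tau> * (f a * w (a - b))) \<partial>lborel) \<partial>lborel))"
    by (simp add: nn_integral_add)
  also have "\<dots> \<le> ennreal ((d/4) powr (-q) * (M * M)) + (ennreal (\<tau> * (M * Q)) + ennreal (\<tau> * (M * Q)))"
  proof (intro add_mono)
    show "(\<integral>\<^sup>+b. (\<integral>\<^sup>+a. ennreal ((d/4) powr (-q) * (f a * g b)) \<partial>lborel) \<partial>lborel) \<le> ennreal ((d/4) powr (-q) * (M * M))"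
    proof (rule nn_double_le)
      show "ibound lborel (\<lambda>a. (d/4) powr (-q) * (f a * g b)) ((d/4) powr (-q) * (g b * M))" for b
        using ibound_cmult[OF ibound_cmult[OF f nn(2)[of b]], of "(d/4) powr (-q)"] by (simp add: mult_ac)
      show "ibound lborel (\<lambda>b. (d/4) powr (-q) * (g b * M)) ((d/4) powr (-q) * (M * M))"
        using ibound_cmult[OF ibound_cmult[OF g M], of "(d/4) powr (-q)"] by (simp add: mult_ac)
    qed
    show "(\<integral>\<^sup>+b. (\<integral>\<^sup>+a. ennreal (\<tau> * (g b * w (a - b))) \<partial>lborel) \<partial>lborel) \<le> ennreal (\<tau> * (M * Q))"
    proof (rule nn_double_le)
      show "ibound lborel (\<lambda>a. \<tau> * (g b * w (a - b))) (\<tau> * (g b * Q))" for b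
        by (intro ibound_cmult w1 nn \<tau>)
      have "0 \<le> Q" using w1 by (simp add: ibound_def)
      then show "ibound lborel (\<lambda>b. \<tau> * (g b * Q)) (\<tau> * (M * Q))"
        using ibound_cmult[OF ibound_cmult[OF g, of Q] \<tau>] by (simp add: mult_ac)
    qed
    have "(\<integral>\<^sup>+b. (\<integral>\<^sup>+a. ennreal (\<tau> * (f a * w (a - b))) \<partial>lborel) \<partial>lborel) =
       (\<integral>\<^sup>+a. (\<integral>\<^sup>+b. ennreal (\<tau> * (f a * w (a - b))) \<partial>lborel) \<partial>lborel)"
      by (rule lborel_pair.Fubini') measurable
    also have "\<dots> \<le> ennreal (\<tau> * (M * Q))"
    proof (rule nn_double_le)
      show "ibound lborel (\<lambda>b. \<tau> * (f a * w (a - b))) (\<tau> * (f a * Q))" for a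
        by (intro ibound_cmult w2 nn \<tau>)
      have "0 \<le> Q" using w1 by (simp add: ibound_def)
      then show "ibound lborel (\<lambda>a. \<tau> * (f a * Q)) (\<tau> * (M * Q))"
        using ibound_cmult[OF ibound_cmult[OF f, of Q] \<tau>] by (simp add: mult_ac)
    qed
    finally show "(\<integral>\<^sup>+b. (\<integral>\<^sup>+a. ennreal (\<tau> * (f a * w (a - b))) \<partial>lborel) \<partial>lborel) \<le> ennreal (\<tau> * (M * Q))" .
  qed
  also have "\<dots> = ennreal ((d/4) powr (-q) * (M * M) + 2 * (\<tau> * (M * Q)))"
    using M \<tau> w1[of 0] by (simp add: ibound_def ennreal_plus[symmetric] del: ennreal_plus)
  also have "\<dots> \<le> ennreal ((4 powr q * 4 / \<alpha>\<^sup>2 + (3/16) powr (\<alpha>-2) * 8 / (\<alpha> * (2*H-1))) * (h powr \<alpha>)\<^sup>2 * d powr (-q))"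
  proof (intro ennreal_leI)
    have 1: "(d/4) powr (-q) * (M * M) = (4 powr q * 4 / \<alpha>\<^sup>2) * (h powr \<alpha>)\<^sup>2 * d powr (-q)"
      using d0 by (simp add: M_def powr_divide powr_minus power2_eq_square field_simps)
    have A: "1 / 4 powr (1-q) \<le> 1" using q by (simp add: ge_one_powr_ge_zero)
    \<comment> \<open>One factor \<open>d powr (\<alpha>-1)\<close> is exchanged for
      \<open>h powr (\<alpha>-1)\<close>, which is larger as h lies below d; together with h this
      makes up the second \<open>h powr \<alpha>\<close>.\<close>
    have B: "h * (d powr (\<alpha>-2) * d powr (1-q)) \<le> h powr \<alpha> * d powr (-q)"
    proof -
      have "h * (d powr (\<alpha>-2) * d powr (1-q)) = h * d powr (\<alpha>-1) * d powr (-q)"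
        by (simp only: powr_add[symmetric] mult.assoc) (simp add: algebra_simps)
      also have "\<dots> \<le> h * h powr (\<alpha>-1) * d powr (-q)"
        using d0 h \<alpha> by (intro mult_right_mono mult_left_mono powr_mono2') auto
      also have "h * h powr (\<alpha>-1) = h powr \<alpha>" using h powr_add[of h 1 "\<alpha>-1"] by simp
      finally show ?thesis .
    qed
    have "\<tau> * (M * Q) = (3/16) powr (\<alpha>-2) * (4 / (\<alpha> * (1-q))) * (1 / 4 powr (1-q)) * (h powr \<alpha> * (h * (d powr (\<alpha>-2) * d powr (1-q))))"
      using d0 by (simp add: \<tau>_def M_def Q_def powr_mult powr_divide field_simps)
    also have "\<dots> \<le> (3/16) powr (\<alpha>-2) * (4 / (\<alpha> * (1-q))) * 1 * (h powr \<alpha> * (h powr \<alpha> * d powr (-q)))"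
      using \<alpha>0 q h by (intro mult_mono[OF mult_left_mono[OF A] mult_left_mono[OF B]]) auto
    finally have 2: "\<tau> * (M * Q) \<le> (3/16) powr (\<alpha>-2) * (4 / (\<alpha> * (1-q))) * (h powr \<alpha>)\<^sup>2 * d powr (-q)"
      by (simp add: power2_eq_square mult_ac)
    have q1: "1 - q = 2*H-1" by (simp add: q_def)
    have "(d/4) powr (-q) * (M * M) + 2 * (\<tau> * (M * Q)) \<le> (4 powr q * 4 / \<alpha>\<^sup>2) * (h powr \<alpha>)\<^sup>2 * d powr (-q)
       + 2 * ((3/16) powr (\<alpha>-2) * (4 / (\<alpha> * (1-q))) * (h powr \<alpha>)\<^sup>2 * d powr (-q))"
      using 1 2 by linarith
    also have "\<dots> = (4 powr q * 4 / \<alpha>\<^sup>2 + (3/16) powr (\<alpha>-2) * 8 / (\<alpha> * (2*H-1))) * (h powr \<alpha>)\<^sup>2 * d powr (-q)"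
      unfolding q1 ring_distribs by simp
    finally show "(d/4) powr (-q) * (M * M) + 2 * (\<tau> * (M * Q)) \<le> (4 powr q * 4 / \<alpha>\<^sup>2 + (3/16) powr (\<alpha>-2) * 8 / (\<alpha> * (2*H-1))) * (h powr \<alpha>)\<^sup>2 * d powr (-q)" .
  qed
  finally show ?thesis by (simp add: f_def g_def d_def q_def)
qed

text \<open>Below distance 6h the factor \<open>h powr (-(2-2*H))\<close> of the near estimate is at
  most a constant times the same power of the distance; beyond it the far estimate applies,
  \<open>h powr \<alpha>\<close> being within the rate.\<close>

lemma en_fd_fd:
  "\<exists>C>0. \<forall>h r s r' s'. 0 < h \<and> h \<le> T/2 \<and> 0 \<le> r \<and> r \<le> s \<and> s \<le> T \<and> s - r \<le> h \<and>
     0 \<le> r' \<and> r' \<le> s' \<and> s' \<le> T \<and> s' - r' \<le> h \<and> s \<noteq> s' \<longrightarrow>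
     en (fd \<alpha> r s) (fd \<alpha> r' s') \<le> ennreal (C * (\<rho> h)\<^sup>2 * \<bar>s - s'\<bar> powr (-(2-2*H)))"
proof -
  obtain C where C: "C > 0" "\<And>h r s r' s'. 0 < h \<Longrightarrow> h \<le> T/2 \<Longrightarrow> 0 \<le> r \<Longrightarrow> r \<le> s \<Longrightarrow> s \<le> T \<Longrightarrow> s - r \<le> h \<Longrightarrow>
     0 \<le> r' \<Longrightarrow> r' \<le> s' \<Longrightarrow> s' \<le> T \<Longrightarrow> s' - r' \<le> h \<Longrightarrow>
     en (fd \<alpha> r s) (fd \<alpha> r' s') \<le> ennreal (C * (\<rho> h)\<^sup>2 * h powr (-(2-2*H)))" using en_fd_fd_near by blast
  obtain D where D: "D > 0" "\<And>h. 0 < h \<Longrightarrow> h \<le> T/2 \<Longrightarrow> h powr \<alpha> \<le> D * \<rho> h" using rate_ge by blast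
  define E where "E = 4 powr (2-2*H) * 4 / \<alpha>\<^sup>2 + (3/16) powr (\<alpha>-2) * 8 / (\<alpha> * (2*H-1))"
  have E: "0 < E" using \<alpha>0 H unfolding E_def by (intro add_pos_pos) auto
  define F where "F = C * 6 powr (2-2*H) + E * D\<^sup>2"
  have F: "0 < F" "C * 6 powr (2-2*H) \<le> F" "E * D\<^sup>2 \<le> F" using C D E by (auto simp: F_def intro!: add_pos_pos)
  have "en (fd \<alpha> r s) (fd \<alpha> r' s') \<le> ennreal (F * (\<rho> h)\<^sup>2 * \<bar>s - s'\<bar> powr (-(2-2*H)))"
    if h: "0 < h" "h \<le> T/2" and rs: "0 \<le> r" "r \<le> s" "s \<le> T" "s - r \<le> h" "0 \<le> r'" "r' \<le> s'" "s' \<le> T" "s' - r' \<le> h" and ne: "s \<noteq> s'"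
    for h r s r' s'
  proof (cases "6 * h \<le> \<bar>s - s'\<bar>")
    case True
    have "en (fd \<alpha> r s) (fd \<alpha> r' s') \<le> ennreal (E * (h powr \<alpha>)\<^sup>2 * \<bar>s - s'\<bar> powr (-(2-2*H)))"
      unfolding E_def using h rs True by (intro en_fd_fd_far) auto
    also have "\<dots> \<le> ennreal (F * (\<rho> h)\<^sup>2 * \<bar>s - s'\<bar> powr (-(2-2*H)))"
    proof (intro ennreal_leI mult_right_mono)
      have "E * (h powr \<alpha>)\<^sup>2 \<le> E * (D * \<rho> h)\<^sup>2"
        using D(2)[OF h] E by (intro mult_left_mono power_mono) auto
      also have "\<dots> = (E * D\<^sup>2) * (\<rho> h)\<^sup>2" by (simp add: power_mult_distrib)
      also have "\<dots> \<le> F * (\<rho> h)\<^sup>2" using F by (intro mult_right_mono) auto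
      finally show "E * (h powr \<alpha>)\<^sup>2 \<le> F * (\<rho> h)\<^sup>2" .
    qed auto
    finally show ?thesis .
  next
    case False
    have "en (fd \<alpha> r s) (fd \<alpha> r' s') \<le> ennreal (C * (\<rho> h)\<^sup>2 * h powr (-(2-2*H)))"
      using h rs by (intro C) auto
    also have "\<dots> \<le> ennreal (F * (\<rho> h)\<^sup>2 * \<bar>s - s'\<bar> powr (-(2-2*H)))"
    proof (intro ennreal_leI)
      have "h powr (-(2-2*H)) \<le> (\<bar>s - s'\<bar> / 6) powr (-(2-2*H))"
        using False h ne H by (intro powr_mono2') auto
      also have "\<dots> = 6 powr (2-2*H) * \<bar>s - s'\<bar> powr (-(2-2*H))"
        by (simp add: powr_divide powr_minus_divide powr_diff field_simps)
      finally have "C * (\<rho> h)\<^sup>2 * h powr (-(2-2*H)) \<le> C * (\<rho> h)\<^sup>2 * (6 powr (2-2*H) * \<bar>s - s'\<bar> powr (-(2-2*H)))"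
        using C by (intro mult_left_mono) auto
      also have "\<dots> = (C * 6 powr (2-2*H)) * ((\<rho> h)\<^sup>2 * \<bar>s - s'\<bar> powr (-(2-2*H)))" by simp
      also have "\<dots> \<le> F * ((\<rho> h)\<^sup>2 * \<bar>s - s'\<bar> powr (-(2-2*H)))" using F by (intro mult_right_mono) auto
      finally show "C * (\<rho> h)\<^sup>2 * h powr (-(2-2*H)) \<le> F * (\<rho> h)\<^sup>2 * \<bar>s - s'\<bar> powr (-(2-2*H))" by (simp add: mult_ac)
    qed
    finally show ?thesis .
  qed
  then show ?thesis using F by blast
qed

end

section \<open>Gaussian spaces\<close>

text \<open>Levy's uniqueness theorem for the probability densities \<open>u1 / m\<close> and
  \<open>u2 / m\<close>. The common mass m is read off from the cosine identity at t = 0; mass 0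
  cannot be normalised and is treated apart.\<close>

lemma weighted_law_unique:
  fixes x1 x2 u1 u2 :: "'a \<Rightarrow> real"
  assumes M: "prob_space M"
    and [measurable]: "x1 \<in> borel_measurable M" "x2 \<in> borel_measurable M"
       "u1 \<in> borel_measurable M" "u2 \<in> borel_measurable M"
    and u: "\<And>w. 0 \<le> u1 w" "\<And>w. u1 w \<le> K" "\<And>w. 0 \<le> u2 w" "\<And>w. u2 w \<le> K"
    and c: "\<And>t. (\<integral>w. u1 w * cos (t * x1 w) \<partial>M) = (\<integral>w. u2 w * cos (t * x2 w) \<partial>M)"
    and s: "\<And>t. (\<integral>w. u1 w * sin (t * x1 w) \<partial>M) = (\<integral>w. u2 w * sin (t * x2 w) \<partial>M)"
    and B: "B \<in> sets borel"
  shows "(\<integral>w. u1 w * indicator B (x1 w) \<partial>M) = (\<integral>w. u2 w * indicator B (x2 w) \<partial>M)"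
proof -
  interpret prob_space M by fact
  define m where "m = (\<integral>w. u1 w \<partial>M)"
  have m2: "m = (\<integral>w. u2 w \<partial>M)" using c[of 0] by (simp add: m_def)
  have int: "integrable M u1" "integrable M u2"
    using u by (auto intro!: integrable_const_bound[of _ K])
  have m0: "0 \<le> m" unfolding m_def using u by simp
  show ?thesis
  proof (cases "m = 0")
    case True
    then have "AE w in M. u1 w = 0" "AE w in M. u2 w = 0"
      using integral_nonneg_eq_0_iff_AE[OF int(1)] integral_nonneg_eq_0_iff_AE[OF int(2)] u m2 by (auto simp: m_def)
    then have "AE w in M. u1 w * indicator B (x1 w) = 0" "AE w in M. u2 w * indicator B (x2 w) = 0" by auto
    then have "(\<integral>w. u1 w * indicator B (x1 w) \<partial>M) = 0" "(\<integral>w. u2 w * indicator B (x2 w) \<partial>M) = 0"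
      by (auto intro: integral_eq_zero_AE)
    then show ?thesis by simp
  next
    case False
    with m0 have m: "0 < m" by simp
    have gen: "real_distribution (distr (density M (\<lambda>w. ennreal (u w / m))) borel x) \<and>
        (\<forall>t. char (distr (density M (\<lambda>w. ennreal (u w / m))) borel x) t =
          Complex ((\<integral>w. u w * cos (t * x w) \<partial>M) / m) ((\<integral>w. u w * sin (t * x w) \<partial>M) / m)) \<and>
        (\<forall>B\<in>sets borel. measure (distr (density M (\<lambda>w. ennreal (u w / m))) borel x) B = (\<integral>w. u w * indicator B (x w) \<partial>M) / m)"
      if [measurable]: "x \<in> borel_measurable M" "u \<in> borel_measurable M" and u: "\<And>w. 0 \<le> u w" "\<And>w. u w \<le> K"
        and mm: "(\<integral>w. u w \<partial>M) = m" for x u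
    proof (intro conjI allI ballI)
      let ?N = "density M (\<lambda>w. ennreal (u w / m))"
      have iu: "integrable M u" using u by (auto intro!: integrable_const_bound[of _ K])
      interpret N: prob_space ?N
      proof
        have "emeasure ?N (space ?N) = (\<integral>\<^sup>+w. ennreal (u w / m) \<partial>M)"
          by (simp add: emeasure_density cong: nn_integral_cong)
        also have "\<dots> = ennreal (\<integral>w. u w / m \<partial>M)" using u m iu by (intro nn_integral_eq_integral) auto
        also have "\<dots> = 1" using mm m by simp
        finally show "emeasure ?N (space ?N) = 1" .
      qed
      have xN: "x \<in> borel_measurable ?N" by simp
      show rd: "real_distribution (distr ?N borel x)"
        using xN by (auto simp: real_distribution_def real_distribution_axioms_def intro!: N.prob_space_distr)
      {
        fix t
        have ii: "integrable ?N (\<lambda>w. iexp (t * x w))"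
          by (intro N.integrable_const_bound[of _ 1]) auto
        have c: "char (distr ?N borel x) t = (\<integral>w. iexp (t * x w) \<partial>?N)"
          unfolding char_def by (subst integral_distr) auto
        have "Re (\<integral>w. iexp (t * x w) \<partial>?N) = (\<integral>w. cos (t * x w) \<partial>?N)"
          unfolding integral_Re[OF ii, symmetric] by (intro Bochner_Integration.integral_cong) (simp_all add: Re_exp)
        also have "\<dots> = (\<integral>w. u w * cos (t * x w) \<partial>M) / m"
          using u m by (subst integral_density) auto
        finally have 1: "Re (\<integral>w. iexp (t * x w) \<partial>?N) = (\<integral>w. u w * cos (t * x w) \<partial>M) / m" .
        have "Im (\<integral>w. iexp (t * x w) \<partial>?N) = (\<integral>w. sin (t * x w) \<partial>?N)"
          unfolding integral_Im[OF ii, symmetric] by (intro Bochner_Integration.integral_cong) (simp_all add: Im_exp)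
        also have "\<dots> = (\<integral>w. u w * sin (t * x w) \<partial>M) / m"
          using u m by (subst integral_density) auto
        finally have 2: "Im (\<integral>w. iexp (t * x w) \<partial>?N) = (\<integral>w. u w * sin (t * x w) \<partial>M) / m" .
        show "char (distr ?N borel x) t = Complex ((\<integral>w. u w * cos (t * x w) \<partial>M) / m) ((\<integral>w. u w * sin (t * x w) \<partial>M) / m)"
          unfolding c using 1 2 by (simp add: complex_eq_iff)
      }
      {
        fix B :: "real set" assume B[measurable]: "B \<in> sets borel"
        have "measure (distr ?N borel x) B = (\<integral>y. indicator B y \<partial>distr ?N borel x)" by simp
        also have "\<dots> = (\<integral>w. indicator B (x w) \<partial>?N)" by (subst integral_distr) auto
        also have "\<dots> = (\<integral>w. u w * indicator B (x w) \<partial>M) / m"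
          using u m by (subst integral_density) auto
        finally show "measure (distr ?N borel x) B = (\<integral>w. u w * indicator B (x w) \<partial>M) / m" .
      }
    qed
    have 1: "(\<integral>w. u1 w \<partial>M) = m" "(\<integral>w. u2 w \<partial>M) = m" using m2 by (auto simp: m_def)
    note g1 = gen[OF assms(2,4) u(1,2) 1(1)] and g2 = gen[OF assms(3,5) u(3,4) 1(2)]
    have "distr (density M (\<lambda>w. ennreal (u1 w / m))) borel x1 = distr (density M (\<lambda>w. ennreal (u2 w / m))) borel x2"
    proof (rule Levy_uniqueness)
      show "char (distr (density M (\<lambda>w. ennreal (u1 w / m))) borel x1) = char (distr (density M (\<lambda>w. ennreal (u2 w / m))) borel x2)"
        by (rule ext) (simp only: g1 g2 c s)
    qed (use g1 g2 in \<open>blast+\<close>)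
    then have "(\<integral>w. u1 w * indicator B (x1 w) \<partial>M) / m = (\<integral>w. u2 w * indicator B (x2 w) \<partial>M) / m"
      using g1 g2 B by (metis (no_types))
    then show ?thesis using m by simp
  qed
qed

text \<open>Cramer--Wold by trading, one coordinate at a time, a trigonometric factor for an indicator:
  the weights \<open>1 + cos\<close> and \<open>1 + sin\<close> keep everything a positive measure,
  so that the one-dimensional uniqueness theorem applies.\<close>
lemma cramer_wold_indicator:
  fixes X Y :: "nat \<Rightarrow> 'a \<Rightarrow> real"
  assumes M: "prob_space M" and I: "finite I"
    and Xm: "\<And>i. i \<in> I \<Longrightarrow> X i \<in> borel_measurable M" and Ym: "\<And>i. i \<in> I \<Longrightarrow> Y i \<in> borel_measurable M"
    and c: "\<And>th. (\<integral>w. cos (\<Sum>i\<in>I. th i * X i w) \<partial>M) = (\<integral>w. cos (\<Sum>i\<in>I. th i * Y i w) \<partial>M)"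
    and s: "\<And>th. (\<integral>w. sin (\<Sum>i\<in>I. th i * X i w) \<partial>M) = (\<integral>w. sin (\<Sum>i\<in>I. th i * Y i w) \<partial>M)"
    and J: "J \<subseteq> I" and B: "\<And>i. B i \<in> sets borel"
  shows "(\<integral>w. (\<Prod>j\<in>J. indicator (B j) (X j w)) * cos (\<Sum>i\<in>I-J. th i * X i w) \<partial>M) =
         (\<integral>w. (\<Prod>j\<in>J. indicator (B j) (Y j w)) * cos (\<Sum>i\<in>I-J. th i * Y i w) \<partial>M) \<and>
         (\<integral>w. (\<Prod>j\<in>J. indicator (B j) (X j w)) * sin (\<Sum>i\<in>I-J. th i * X i w) \<partial>M) =
         (\<integral>w. (\<Prod>j\<in>J. indicator (B j) (Y j w)) * sin (\<Sum>i\<in>I-J. th i * Y i w) \<partial>M)"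
proof -
  interpret prob_space M by fact
  have "finite J" using J I by (rule finite_subset)
  then show ?thesis using J
  proof (induction J arbitrary: th rule: finite_induct)
    case empty
    show ?case using c[of th] s[of th] by simp
  next
    case (insert k J)
    define K where "K = I - insert k J"
    have IJ: "I - J = insert k K" "k \<notin> K" "finite K" "k \<in> I" "J \<subseteq> I" "K \<subseteq> I"
      using insert.hyps insert.prems I by (auto simp: K_def)
    note [measurable] = B
    define p where "p Z w = (\<Prod>j\<in>J. indicator (B j) (Z j w) :: real)" for Z :: "nat \<Rightarrow> 'a \<Rightarrow> real" and w
    define S where "S Z th w = (\<Sum>i\<in>K. th i * Z i w)" for Z :: "nat \<Rightarrow> 'a \<Rightarrow> real" and th w
    have p01: "0 \<le> p Z w" "p Z w \<le> 1" for Z w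
      unfolding p_def by (rule prod_nonneg, simp, rule prod_le_1, simp add: indicator_def)
    have pm: "p Z \<in> borel_measurable M" if "\<And>i. i \<in> I \<Longrightarrow> Z i \<in> borel_measurable M" for Z
    proof -
      have "(\<lambda>w. indicator (B j) (Z j w) :: real) \<in> borel_measurable M" if "j \<in> J" for j
      proof -
        have "Z j \<in> borel_measurable M" using that \<open>J \<subseteq> I\<close> \<open>\<And>i. i \<in> I \<Longrightarrow> Z i \<in> borel_measurable M\<close> by blast
        then show ?thesis using B[of j] by (intro measurable_compose[OF _ borel_measurable_indicator])
      qed
      then show ?thesis unfolding p_def[abs_def] by (intro borel_measurable_prod)
    qed
    have Sm: "S Z th \<in> borel_measurable M" if "\<And>i. i \<in> I \<Longrightarrow> Z i \<in> borel_measurable M" for Z th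
      unfolding S_def[abs_def] using that IJ by (intro borel_measurable_sum borel_measurable_times) auto
    note [measurable] = pm[OF Xm] pm[OF Ym] Sm[OF Xm] Sm[OF Ym] Xm[OF IJ(4)] Ym[OF IJ(4)]
    have bnd: "integrable M (\<lambda>w. p X w * f w)" "integrable M (\<lambda>w. p Y w * f w)"
      if "f \<in> borel_measurable M" "\<And>w. \<bar>f w\<bar> \<le> 1" for f
      using that p01 by (auto intro!: integrable_const_bound[of _ 1] simp: abs_mult mult_le_one)
    \<comment> \<open>Scaling the remaining coordinates by r = 0, 1 and -1 provides the three phases
      into which a product such as \<open>(1 + cos S) * cos (t * Z k)\<close> decomposes.\<close>
    have sumeq: "(\<Sum>i\<in>I-J. (if i = k then t else r * th i) * Z i w) = t * Z k w + r * S Z th w" for t r Z w th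
    proof -
      have "(\<Sum>i\<in>K. (if i = k then t else r * th i) * Z i w) = (\<Sum>i\<in>K. r * (th i * Z i w))"
        using IJ by (intro sum.cong) auto
      then show ?thesis using IJ by (simp add: S_def sum_distrib_left)
    qed
    have IHc: "(\<integral>w. p X w * cos (t * X k w + r * S X th w) \<partial>M) = (\<integral>w. p Y w * cos (t * Y k w + r * S Y th w) \<partial>M)"
     and IHs: "(\<integral>w. p X w * sin (t * X k w + r * S X th w) \<partial>M) = (\<integral>w. p Y w * sin (t * Y k w + r * S Y th w) \<partial>M)" for t r th
      using insert.IH[OF IJ(5), of "\<lambda>i. if i = k then t else r * th i"] unfolding sumeq p_def by auto
    have A: "(\<integral>w. (p X w * (1 + cos (S X th w))) * indicator (B k) (X k w) \<partial>M) =
             (\<integral>w. (p Y w * (1 + cos (S Y th w))) * indicator (B k) (Y k w) \<partial>M)" for th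
    proof (rule weighted_law_unique[OF M, where K=2])
      have "(\<integral>w. p Z w * (1 + cos (S Z th w)) * cos (t * Z k w) \<partial>M) = (\<integral>w. p Z w * cos (t * Z k w + 0 * S Z th w) \<partial>M) +
         ((\<integral>w. p Z w * cos (t * Z k w + 1 * S Z th w) \<partial>M) + (\<integral>w. p Z w * cos (t * Z k w + (-1) * S Z th w) \<partial>M)) / 2"
         if "Z \<in> {X, Y}" for Z t
      proof -
        have "(\<integral>w. p Z w * (1 + cos (S Z th w)) * cos (t * Z k w) \<partial>M) =
          (\<integral>w. p Z w * cos (t * Z k w + 0 * S Z th w) +
            (p Z w * cos (t * Z k w + 1 * S Z th w) + p Z w * cos (t * Z k w + (-1) * S Z th w)) / 2 \<partial>M)"
          by (intro Bochner_Integration.integral_cong) (auto simp: cos_add cos_diff field_simps)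
        then show ?thesis using that bnd by auto
      qed
      then show "(\<integral>w. p X w * (1 + cos (S X th w)) * cos (t * X k w) \<partial>M) = (\<integral>w. p Y w * (1 + cos (S Y th w)) * cos (t * Y k w) \<partial>M)" for t
        using IHc[of t 0 th] IHc[of t 1 th] IHc[of t "-1" th] by simp
      have "(\<integral>w. p Z w * (1 + cos (S Z th w)) * sin (t * Z k w) \<partial>M) = (\<integral>w. p Z w * sin (t * Z k w + 0 * S Z th w) \<partial>M) +
         ((\<integral>w. p Z w * sin (t * Z k w + 1 * S Z th w) \<partial>M) + (\<integral>w. p Z w * sin (t * Z k w + (-1) * S Z th w) \<partial>M)) / 2"
         if "Z \<in> {X, Y}" for Z t
      proof -
        have "(\<integral>w. p Z w * (1 + cos (S Z th w)) * sin (t * Z k w) \<partial>M) =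
          (\<integral>w. p Z w * sin (t * Z k w + 0 * S Z th w) +
            (p Z w * sin (t * Z k w + 1 * S Z th w) + p Z w * sin (t * Z k w + (-1) * S Z th w)) / 2 \<partial>M)"
          by (intro Bochner_Integration.integral_cong) (auto simp: sin_add sin_diff field_simps)
        then show ?thesis using that bnd by auto
      qed
      then show "(\<integral>w. p X w * (1 + cos (S X th w)) * sin (t * X k w) \<partial>M) = (\<integral>w. p Y w * (1 + cos (S Y th w)) * sin (t * Y k w) \<partial>M)" for t
        using IHs[of t 0 th] IHs[of t 1 th] IHs[of t "-1" th] by simp
      have "0 \<le> p Z w * (1 + cos x)" "p Z w * (1 + cos x) \<le> 2" for Z w x
      proof -
        have "0 \<le> 1 + cos x" "1 + cos x \<le> 2" using cos_ge_minus_one[of x] cos_le_one[of x] by linarith+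
        then show "0 \<le> p Z w * (1 + cos x)" "p Z w * (1 + cos x) \<le> 2"
          using p01[of Z w] mult_mono[of "p Z w" 1 "1 + cos x" 2] by (simp_all del: cos_le_one)
      qed
      then show "0 \<le> p X w * (1 + cos (S X th w))" "p X w * (1 + cos (S X th w)) \<le> 2"
        "0 \<le> p Y w * (1 + cos (S Y th w))" "p Y w * (1 + cos (S Y th w)) \<le> 2" for w by auto
    qed auto
    have A': "(\<integral>w. (p X w * (1 + sin (S X th w))) * indicator (B k) (X k w) \<partial>M) =
             (\<integral>w. (p Y w * (1 + sin (S Y th w))) * indicator (B k) (Y k w) \<partial>M)" for th
    proof (rule weighted_law_unique[OF M, where K=2])
      have "(\<integral>w. p Z w * (1 + sin (S Z th w)) * cos (t * Z k w) \<partial>M) = (\<integral>w. p Z w * cos (t * Z k w + 0 * S Z th w) \<partial>M) +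
         ((\<integral>w. p Z w * sin (t * Z k w + 1 * S Z th w) \<partial>M) - (\<integral>w. p Z w * sin (t * Z k w + (-1) * S Z th w) \<partial>M)) / 2"
         if "Z \<in> {X, Y}" for Z t
      proof -
        have "(\<integral>w. p Z w * (1 + sin (S Z th w)) * cos (t * Z k w) \<partial>M) =
          (\<integral>w. p Z w * cos (t * Z k w + 0 * S Z th w) +
            (p Z w * sin (t * Z k w + 1 * S Z th w) - p Z w * sin (t * Z k w + (-1) * S Z th w)) / 2 \<partial>M)"
          by (intro Bochner_Integration.integral_cong) (auto simp: sin_add sin_diff field_simps)
        then show ?thesis using that bnd by auto
      qed
      then show "(\<integral>w. p X w * (1 + sin (S X th w)) * cos (t * X k w) \<partial>M) = (\<integral>w. p Y w * (1 + sin (S Y th w)) * cos (t * Y k w) \<partial>M)" for t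
        using IHc[of t 0 th] IHs[of t 1 th] IHs[of t "-1" th] by simp
      have "(\<integral>w. p Z w * (1 + sin (S Z th w)) * sin (t * Z k w) \<partial>M) = (\<integral>w. p Z w * sin (t * Z k w + 0 * S Z th w) \<partial>M) +
         ((\<integral>w. p Z w * cos (t * Z k w + (-1) * S Z th w) \<partial>M) - (\<integral>w. p Z w * cos (t * Z k w + 1 * S Z th w) \<partial>M)) / 2"
         if "Z \<in> {X, Y}" for Z t
      proof -
        have "(\<integral>w. p Z w * (1 + sin (S Z th w)) * sin (t * Z k w) \<partial>M) =
          (\<integral>w. p Z w * sin (t * Z k w + 0 * S Z th w) +
            (p Z w * cos (t * Z k w + (-1) * S Z th w) - p Z w * cos (t * Z k w + 1 * S Z th w)) / 2 \<partial>M)"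
          by (intro Bochner_Integration.integral_cong) (auto simp: cos_add cos_diff field_simps)
        then show ?thesis using that bnd by auto
      qed
      then show "(\<integral>w. p X w * (1 + sin (S X th w)) * sin (t * X k w) \<partial>M) = (\<integral>w. p Y w * (1 + sin (S Y th w)) * sin (t * Y k w) \<partial>M)" for t
        using IHs[of t 0 th] IHc[of t 1 th] IHc[of t "-1" th] by simp
      have "0 \<le> p Z w * (1 + sin x)" "p Z w * (1 + sin x) \<le> 2" for Z w x
      proof -
        have "0 \<le> 1 + sin x" "1 + sin x \<le> 2" using sin_ge_minus_one[of x] sin_le_one[of x] by linarith+
        then show "0 \<le> p Z w * (1 + sin x)" "p Z w * (1 + sin x) \<le> 2"
          using p01[of Z w] mult_mono[of "p Z w" 1 "1 + sin x" 2] by (simp_all del: sin_le_one)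
      qed
      then show "0 \<le> p X w * (1 + sin (S X th w))" "p X w * (1 + sin (S X th w)) \<le> 2"
        "0 \<le> p Y w * (1 + sin (S Y th w))" "p Y w * (1 + sin (S Y th w)) \<le> 2" for w by auto
    qed auto
    have int: "integrable M (\<lambda>w. p Z w * indicator (B k) (Z k w))"
       "integrable M (\<lambda>w. p Z w * indicator (B k) (Z k w) * cos (S Z th w))"
       "integrable M (\<lambda>w. p Z w * indicator (B k) (Z k w) * sin (S Z th w))" if "Z \<in> {X, Y}" for Z th
      using that bnd[of "\<lambda>w. indicator (B k) (Z k w)"]
         bnd[of "\<lambda>w. indicator (B k) (Z k w) * cos (S Z th w)"] bnd[of "\<lambda>w. indicator (B k) (Z k w) * sin (S Z th w)"]
      by (auto simp: mult.assoc indicator_def)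
    have Z1: "(\<integral>w. (p Z w * (1 + cos (S Z th w))) * indicator (B k) (Z k w) \<partial>M) =
        (\<integral>w. p Z w * indicator (B k) (Z k w) \<partial>M) + (\<integral>w. p Z w * indicator (B k) (Z k w) * cos (S Z th w) \<partial>M)" if "Z \<in> {X, Y}" for Z th
      unfolding Bochner_Integration.integral_add[OF int(1)[OF that] int(2)[OF that], symmetric]
      by (intro Bochner_Integration.integral_cong) (simp_all add: algebra_simps)
    have Z2: "(\<integral>w. (p Z w * (1 + sin (S Z th w))) * indicator (B k) (Z k w) \<partial>M) =
        (\<integral>w. p Z w * indicator (B k) (Z k w) \<partial>M) + (\<integral>w. p Z w * indicator (B k) (Z k w) * sin (S Z th w) \<partial>M)" if "Z \<in> {X, Y}" for Z th
      unfolding Bochner_Integration.integral_add[OF int(1)[OF that] int(3)[OF that], symmetric]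
      by (intro Bochner_Integration.integral_cong) (simp_all add: algebra_simps)
    \<comment> \<open>With zero frequencies the weight \<open>1 + sin\<close> is 1, which isolates
      the constant term that the two positive weights have added.\<close>
    have P0: "(\<integral>w. p X w * indicator (B k) (X k w) \<partial>M) = (\<integral>w. p Y w * indicator (B k) (Y k w) \<partial>M)"
      using A'[of "\<lambda>_. 0"] by (simp add: S_def)
    have pk: "(\<Prod>j\<in>insert k J. indicator (B j) (Z j w)) = p Z w * indicator (B k) (Z k w)" for Z w
      using insert.hyps by (simp add: p_def mult.commute)
    show ?case
    proof -
      have 1: "(\<integral>w. p X w * indicator (B k) (X k w) * cos (S X th w) \<partial>M) = (\<integral>w. p Y w * indicator (B k) (Y k w) * cos (S Y th w) \<partial>M)"
        using A[of th] P0 Z1[of X th] Z1[of Y th] by simp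
      have 2: "(\<integral>w. p X w * indicator (B k) (X k w) * sin (S X th w) \<partial>M) = (\<integral>w. p Y w * indicator (B k) (Y k w) * sin (S Y th w) \<partial>M)"
        using A'[of th] P0 Z2[of X th] Z2[of Y th] by simp
      show ?thesis unfolding pk K_def[symmetric] using 1 2 unfolding S_def by blast
    qed
  qed
qed

text \<open>With all coordinates traded for indicators the trigonometric factor is cos 0 = 1, so the
  two laws agree on measurable boxes, which determine a probability on a finite product.\<close>

lemma cramer_wold:
  fixes X Y :: "nat \<Rightarrow> 'a \<Rightarrow> real"
  assumes M: "prob_space M" and I: "finite I"
    and Xm: "\<And>i. i \<in> I \<Longrightarrow> X i \<in> borel_measurable M" and Ym: "\<And>i. i \<in> I \<Longrightarrow> Y i \<in> borel_measurable M"
    and c: "\<And>th. (\<integral>w. cos (\<Sum>i\<in>I. th i * X i w) \<partial>M) = (\<integral>w. cos (\<Sum>i\<in>I. th i * Y i w) \<partial>M)"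
    and s: "\<And>th. (\<integral>w. sin (\<Sum>i\<in>I. th i * X i w) \<partial>M) = (\<integral>w. sin (\<Sum>i\<in>I. th i * Y i w) \<partial>M)"
  shows "distr M (PiM I (\<lambda>_. borel)) (\<lambda>w. \<lambda>i\<in>I. X i w) = distr M (PiM I (\<lambda>_. borel)) (\<lambda>w. \<lambda>i\<in>I. Y i w)"
proof (rule measure_eqI_PiM_finite[OF I])
  interpret prob_space M by fact
  have mX: "(\<lambda>w. \<lambda>i\<in>I. Z i w) \<in> measurable M (PiM I (\<lambda>_. borel))" if "\<And>i. i \<in> I \<Longrightarrow> Z i \<in> borel_measurable M" for Z :: "nat \<Rightarrow> 'a \<Rightarrow> real"
    using that by (intro measurable_restrict) auto
  show "emeasure (distr M (PiM I (\<lambda>_. borel)) (\<lambda>w. \<lambda>i\<in>I. X i w)) (Pi\<^sub>E I A) = emeasure (distr M (PiM I (\<lambda>_. borel)) (\<lambda>w. \<lambda>i\<in>I. Y i w)) (Pi\<^sub>E I A)"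
    if A: "\<And>i. i \<in> I \<Longrightarrow> A i \<in> sets borel" for A
  proof -
    define B where "B i = (if i \<in> I then A i else {})" for i
    have B: "B i \<in> sets borel" for i using A by (auto simp: B_def)
    have PA: "Pi\<^sub>E I A \<in> sets (PiM I (\<lambda>_. borel))" using A I by (intro sets_PiM_I_finite) auto
    have gen: "measure (distr M (PiM I (\<lambda>_. borel)) (\<lambda>w. \<lambda>i\<in>I. Z i w)) (Pi\<^sub>E I A) = (\<integral>w. (\<Prod>j\<in>I. indicator (B j) (Z j w)) \<partial>M)"
      if "\<And>i. i \<in> I \<Longrightarrow> Z i \<in> borel_measurable M" for Z :: "nat \<Rightarrow> 'a \<Rightarrow> real"
    proof -
      have "measure (distr M (PiM I (\<lambda>_. borel)) (\<lambda>w. \<lambda>i\<in>I. Z i w)) (Pi\<^sub>E I A) =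
         (\<integral>y. indicator (Pi\<^sub>E I A) y \<partial>distr M (PiM I (\<lambda>_. borel)) (\<lambda>w. \<lambda>i\<in>I. Z i w))"
        using PA by simp
      also have "\<dots> = (\<integral>w. indicator (Pi\<^sub>E I A) (\<lambda>i\<in>I. Z i w) \<partial>M)"
        using PA mX[OF that] by (subst integral_distr) auto
      also have "\<dots> = (\<integral>w. (\<Prod>j\<in>I. indicator (B j) (Z j w)) \<partial>M)"
      proof (intro Bochner_Integration.integral_cong refl)
        fix w
        show "indicator (Pi\<^sub>E I A) (\<lambda>i\<in>I. Z i w) = (\<Prod>j\<in>I. indicator (B j) (Z j w) :: real)"
        proof (cases "\<forall>i\<in>I. Z i w \<in> A i")
          case True
          then show ?thesis by (simp add: B_def PiE_iff)
        next
          case False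
          then obtain i where "i \<in> I" "Z i w \<notin> A i" by blast
          then have "(\<Prod>j\<in>I. indicator (B j) (Z j w) :: real) = 0"
            using I by (intro prod_zero bexI[of _ i]) (auto simp: B_def)
          then show ?thesis using False by (simp add: PiE_iff)
        qed
      qed
      finally show ?thesis .
    qed
    have "(\<integral>w. (\<Prod>j\<in>I. indicator (B j) (X j w) :: real) \<partial>M) = (\<integral>w. (\<Prod>j\<in>I. indicator (B j) (Y j w)) \<partial>M)"
      using cramer_wold_indicator[OF M I Xm Ym c s subset_refl B] by simp
    then have "measure (distr M (PiM I (\<lambda>_. borel)) (\<lambda>w. \<lambda>i\<in>I. X i w)) (Pi\<^sub>E I A) = measure (distr M (PiM I (\<lambda>_. borel)) (\<lambda>w. \<lambda>i\<in>I. Y i w)) (Pi\<^sub>E I A)"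
      using gen[OF Xm] gen[OF Ym] by simp
    then show ?thesis
      using finite_measure.emeasure_eq_measure[OF prob_space.axioms(1)[OF prob_space_distr[OF mX[OF Xm]]]] finite_measure.emeasure_eq_measure[OF prob_space.axioms(1)[OF prob_space_distr[OF mX[OF Ym]]]] by simp
  qed
  show "range (\<lambda>n::nat. Pi\<^sub>E I (\<lambda>_. UNIV)) \<subseteq> prod_algebra I (\<lambda>_. borel)"
    using I by (auto intro!: prod_algebraI_finite)
  show "(\<Union>n::nat. Pi\<^sub>E I (\<lambda>_. UNIV)) = space (PiM I (\<lambda>_. borel :: real measure))" by (simp add: space_PiM)
  show "emeasure (distr M (PiM I (\<lambda>_. borel)) (\<lambda>w. \<lambda>i\<in>I. X i w)) (Pi\<^sub>E I (\<lambda>_. UNIV)) \<noteq> \<infinity>" for n :: nat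
    using finite_measure.emeasure_eq_measure[OF prob_space.axioms(1)[OF prob_space_distr[OF mX[OF Xm]]]] by simp
qed auto

section \<open>Square integrable products and abstract Gaussian spaces\<close>

lemma integrable_mult_sq:
  fixes f g :: "'a \<Rightarrow> real"
  assumes [measurable]: "f \<in> borel_measurable M" "g \<in> borel_measurable M"
    and "integrable M (\<lambda>w. (f w)\<^sup>2)" "integrable M (\<lambda>w. (g w)\<^sup>2)"
  shows "integrable M (\<lambda>w. f w * g w)"
proof (rule Bochner_Integration.integrable_bound)
  show "integrable M (\<lambda>w. (f w)\<^sup>2 + (g w)\<^sup>2)" using assms by auto
  show "AE w in M. norm (f w * g w) \<le> norm ((f w)\<^sup>2 + (g w)\<^sup>2)"
  proof (intro AE_I2)
    fix w
    have "2 * \<bar>f w\<bar> * \<bar>g w\<bar> \<le> \<bar>f w\<bar>\<^sup>2 + \<bar>g w\<bar>\<^sup>2" by (rule sum_squares_bound)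
    moreover have "0 \<le> \<bar>f w\<bar> * \<bar>g w\<bar>" by simp
    ultimately have "\<bar>f w\<bar> * \<bar>g w\<bar> \<le> (f w)\<^sup>2 + (g w)\<^sup>2" by (simp only: power2_abs)
    then show "norm (f w * g w) \<le> norm ((f w)\<^sup>2 + (g w)\<^sup>2)" by (simp add: abs_mult)
  qed
qed auto

lemma integral_cauchy_schwarz:
  fixes f g :: "'a \<Rightarrow> real"
  assumes [measurable]: "f \<in> borel_measurable M" "g \<in> borel_measurable M"
    and "integrable M (\<lambda>w. (f w)\<^sup>2)" "integrable M (\<lambda>w. (g w)\<^sup>2)"
  shows "(\<integral>w. f w * g w \<partial>M)\<^sup>2 \<le> (\<integral>w. (f w)\<^sup>2 \<partial>M) * (\<integral>w. (g w)\<^sup>2 \<partial>M)"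
proof -
  note fg = integrable_mult_sq[OF assms]
  define A where "A = (\<integral>w. (f w)\<^sup>2 \<partial>M)"
  define B where "B = (\<integral>w. (g w)\<^sup>2 \<partial>M)"
  define C where "C = (\<integral>w. f w * g w \<partial>M)"
  have q: "0 \<le> x\<^sup>2 * A + 2 * (x * y) * C + y\<^sup>2 * B" for x y
  proof -
    have "0 \<le> (\<integral>w. (x * f w + y * g w)\<^sup>2 \<partial>M)" by simp
    also have "\<dots> = (\<integral>w. x\<^sup>2 * (f w)\<^sup>2 + 2 * (x * y) * (f w * g w) + y\<^sup>2 * (g w)\<^sup>2 \<partial>M)"
      by (intro Bochner_Integration.integral_cong) (auto simp: power2_eq_square algebra_simps)
    also have "\<dots> = x\<^sup>2 * A + 2 * (x * y) * C + y\<^sup>2 * B"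
      using assms fg by (simp add: A_def B_def C_def)
    finally show ?thesis .
  qed
  have B0: "0 \<le> B" by (simp add: B_def)
  have "C\<^sup>2 \<le> A * B"
  proof (cases "B = 0")
    case True
    show ?thesis
    proof (cases "C = 0")
      case False
      \<comment> \<open>For B = 0 the quadratic form is affine in y; this choice of y makes its
        value -1 unless C = 0.\<close>
      have "0 \<le> A - 2 * ((A + 1) / (2 * C)) * C" using q[of 1 "- ((A + 1) / (2 * C))"] True by simp
      then show ?thesis using False by (simp add: field_simps)
    qed (use True in simp)
  next
    case False
    have "0 \<le> B\<^sup>2 * A + 2 * (B * -C) * C + C\<^sup>2 * B" using q[of B "-C"] by simp
    then have "B * C\<^sup>2 \<le> B * (A * B)" by (simp add: power2_eq_square algebra_simps)
    then show ?thesis using False B0 by simp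
  qed
  then show ?thesis by (simp add: A_def B_def C_def)
qed

text \<open>Gaussianity is demanded only through cos and sin of single elements. Linearity supplies
  all frequencies and, by Cramer-Wold, the joint laws; in this form the property also passes to L2
  limits.\<close>

locale gauss_space = prob_space +
  fixes V :: "('a \<Rightarrow> real) set"
  assumes V_measurable: "X \<in> V \<Longrightarrow> X \<in> borel_measurable M"
    and V_lin: "X \<in> V \<Longrightarrow> Y \<in> V \<Longrightarrow> (\<lambda>w. a * X w + c * Y w) \<in> V"
    and V_sq: "X \<in> V \<Longrightarrow> integrable M (\<lambda>w. (X w)\<^sup>2)"
    and V_cos: "X \<in> V \<Longrightarrow> (\<integral>w. cos (X w) \<partial>M) = exp (- (\<integral>w. (X w)\<^sup>2 \<partial>M) / 2)"
    and V_sin: "X \<in> V \<Longrightarrow> (\<integral>w. sin (X w) \<partial>M) = 0"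
begin

lemma V_mult: "X \<in> V \<Longrightarrow> (\<lambda>w. a * X w) \<in> V"
  using V_lin[of X X a 0] by simp

lemma V_diff: "X \<in> V \<Longrightarrow> Y \<in> V \<Longrightarrow> (\<lambda>w. X w - Y w) \<in> V"
  using V_lin[of X Y 1 "-1"] by simp

lemma V_add: "X \<in> V \<Longrightarrow> Y \<in> V \<Longrightarrow> (\<lambda>w. X w + Y w) \<in> V"
  using V_lin[of X Y 1 "1"] by simp

lemma V_sum:
  assumes "finite I" "I \<noteq> {}" "\<And>i. i \<in> I \<Longrightarrow> X i \<in> V"
  shows "(\<lambda>w. \<Sum>i\<in>I. c i * X i w) \<in> V"
  using assms by (induction rule: finite_ne_induct) (auto intro!: V_mult V_add)

lemma V_prod_integrable: "X \<in> V \<Longrightarrow> Y \<in> V \<Longrightarrow> integrable M (\<lambda>w. X w * Y w)"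
  by (intro integrable_mult_sq V_measurable V_sq)

text \<open>Second moments of linear combinations are determined by the covariances, and they
  determine cos and sin of these combinations; Cramer-Wold does the rest. This makes every linear
  isometry of the space law preserving.\<close>

lemma V_law_eq:
  fixes X Y :: "nat \<Rightarrow> 'a \<Rightarrow> real"
  assumes I: "finite I" and X: "\<And>i. i \<in> I \<Longrightarrow> X i \<in> V" and Y: "\<And>i. i \<in> I \<Longrightarrow> Y i \<in> V"
    and cov: "\<And>i j. i \<in> I \<Longrightarrow> j \<in> I \<Longrightarrow> expectation (\<lambda>w. X i w * X j w) = expectation (\<lambda>w. Y i w * Y j w)"
    and Phi: "\<Phi> \<in> borel_measurable (PiM I (\<lambda>_. borel))"
  shows "(\<integral>w. (\<Phi> (\<lambda>i\<in>I. X i w) :: real) \<partial>M) = (\<integral>w. \<Phi> (\<lambda>i\<in>I. Y i w) \<partial>M)"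
proof (cases "I = {}")
  case True then show ?thesis by (simp add: restrict_def)
next
  case False
  have sq: "(\<integral>w. (\<Sum>i\<in>I. th i * Z i w)\<^sup>2 \<partial>M) = (\<Sum>i\<in>I. \<Sum>j\<in>I. th i * th j * expectation (\<lambda>w. Z i w * Z j w))"
    if Z: "\<And>i. i \<in> I \<Longrightarrow> Z i \<in> V" for Z th
  proof -
    have "(\<integral>w. (\<Sum>i\<in>I. th i * Z i w)\<^sup>2 \<partial>M) = (\<integral>w. (\<Sum>i\<in>I. \<Sum>j\<in>I. th i * th j * (Z i w * Z j w)) \<partial>M)"
      by (intro Bochner_Integration.integral_cong) (auto simp: power2_eq_square sum_product mult_ac)
    also have "\<dots> = (\<Sum>i\<in>I. \<Sum>j\<in>I. th i * th j * expectation (\<lambda>w. Z i w * Z j w))"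
      using V_prod_integrable[OF Z Z] by (simp add: Bochner_Integration.integral_sum)
    finally show ?thesis .
  qed
  have eq: "(\<integral>w. (\<Sum>i\<in>I. th i * X i w)\<^sup>2 \<partial>M) = (\<integral>w. (\<Sum>i\<in>I. th i * Y i w)\<^sup>2 \<partial>M)" for th
    using sq[OF X] sq[OF Y] cov by simp
  have "distr M (PiM I (\<lambda>_. borel)) (\<lambda>w. \<lambda>i\<in>I. X i w) = distr M (PiM I (\<lambda>_. borel)) (\<lambda>w. \<lambda>i\<in>I. Y i w)"
    using eq V_cos[OF V_sum[OF I False X]] V_cos[OF V_sum[OF I False Y]]
       V_sin[OF V_sum[OF I False X]] V_sin[OF V_sum[OF I False Y]]
    by (intro cramer_wold prob_space_axioms I V_measurable X Y) auto
  moreover have "(\<integral>w. \<Phi> (\<lambda>i\<in>I. Z i w) \<partial>M) = (\<integral>y. \<Phi> y \<partial>distr M (PiM I (\<lambda>_. borel)) (\<lambda>w. \<lambda>i\<in>I. Z i w))"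
    if Z: "\<And>i. i \<in> I \<Longrightarrow> Z i \<in> V" for Z
    using Phi V_measurable[OF Z] by (subst integral_distr) (auto intro!: measurable_restrict)
  ultimately show ?thesis using X Y by simp
qed

text \<open>After division by sqrt v the characteristic function is the standard normal one, whose
  even moments are known. Variance 0 forces the variable to vanish almost everywhere.\<close>

lemma V_moment:
  assumes X: "X \<in> V"
  shows "integrable M (\<lambda>w. (X w) ^ (2*k))"
    "expectation (\<lambda>w. (X w) ^ (2*k)) = fact (2*k) / (2^k * fact k) * (expectation (\<lambda>w. (X w)\<^sup>2)) ^ k"
proof -
  define v where "v = expectation (\<lambda>w. (X w)\<^sup>2)"
  note [measurable] = V_measurable[OF X]
  have "0 \<le> v" by (simp add: v_def)
  have "integrable M (\<lambda>w. (X w) ^ (2*k)) \<and> expectation (\<lambda>w. (X w) ^ (2*k)) = fact (2*k) / (2^k * fact k) * v ^ k"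
  proof (cases "v = 0")
    case True
    then have "AE w in M. (X w)\<^sup>2 = 0"
      using V_sq[OF X] by (subst (asm) v_def, subst (asm) integral_nonneg_eq_0_iff_AE) auto
    then have ae: "AE w in M. (X w) ^ (2*k) = 0 ^ k" by eventually_elim (simp add: power_mult)
    have "integrable M (\<lambda>w. (X w) ^ (2*k))"
      using integrable_cong_AE[OF _ _ ae] by simp
    moreover have "expectation (\<lambda>w. (X w) ^ (2*k)) = expectation (\<lambda>w. 0 ^ k)"
      using ae by (intro integral_cong_AE) auto
    then have "expectation (\<lambda>w. (X w) ^ (2*k)) = 0 ^ k" by (simp add: prob_space)
    ultimately show ?thesis using True by (cases k) auto
  next
    case False
    with \<open>0 \<le> v\<close> have v: "0 < v" by simp
    define Z where "Z w = (1 / sqrt v) * X w" for w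
    have ZV: "(\<lambda>w. t * Z w) \<in> V" for t
      unfolding Z_def mult.assoc[symmetric] by (intro V_mult X)
    have [measurable]: "Z \<in> borel_measurable M" unfolding Z_def[abs_def] by measurable
    have Z2: "expectation (\<lambda>w. (t * Z w)\<^sup>2) = t\<^sup>2" for t
    proof -
      have "expectation (\<lambda>w. (t * Z w)\<^sup>2) = expectation (\<lambda>w. (t\<^sup>2 / v) * (X w)\<^sup>2)"
        using v by (intro Bochner_Integration.integral_cong) (auto simp: Z_def power_mult_distrib power_divide)
      also have "\<dots> = t\<^sup>2 / v * v" by (simp add: v_def)
      finally show ?thesis using v by simp
    qed
    have ii: "integrable M (\<lambda>w. iexp (t * Z w))" for t
      by (intro integrable_const_bound[of _ 1]) auto
    have "char (distr M borel Z) t = char std_normal_distribution t" for t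
    proof -
      have "char (distr M borel Z) t = (\<integral>w. iexp (t * Z w) \<partial>M)"
        unfolding char_def by (subst integral_distr) auto
      also have "\<dots> = complex_of_real (exp (- (t\<^sup>2) / 2))"
      proof (rule complex_eqI)
        have "Re (\<integral>w. iexp (t * Z w) \<partial>M) = (\<integral>w. cos (t * Z w) \<partial>M)"
          unfolding integral_Re[OF ii, symmetric] by (intro Bochner_Integration.integral_cong) (simp_all add: Re_exp)
        then show "Re (\<integral>w. iexp (t * Z w) \<partial>M) = Re (complex_of_real (exp (- (t\<^sup>2) / 2)))"
          using V_cos[OF ZV[of t]] Z2[of t] by simp
        have "Im (\<integral>w. iexp (t * Z w) \<partial>M) = (\<integral>w. sin (t * Z w) \<partial>M)"
          unfolding integral_Im[OF ii, symmetric] by (intro Bochner_Integration.integral_cong) (simp_all add: Im_exp)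
        then show "Im (\<integral>w. iexp (t * Z w) \<partial>M) = Im (complex_of_real (exp (- (t\<^sup>2) / 2)))"
          using V_sin[OF ZV[of t]] by simp
      qed
      finally show ?thesis by (simp add: char_std_normal_distribution)
    qed
    then have d: "distr M borel Z = std_normal_distribution"
      by (intro Levy_uniqueness real_dist_normal_dist) (auto simp: real_distribution_def real_distribution_axioms_def intro!: prob_space_distr)
    have pw: "(X w) ^ (2*k) = v ^ k * (Z w) ^ (2*k)" for w
    proof -
      have "(Z w) ^ (2*k) = ((Z w)\<^sup>2) ^ k" by (simp add: power_mult)
      also have "(Z w)\<^sup>2 = (X w)\<^sup>2 / v" using v by (simp add: Z_def power_mult_distrib power_divide)
      finally show ?thesis using v by (simp add: power_divide power_mult)
    qed
    have "integrable (distr M borel Z) (\<lambda>x. x ^ (2*k))" unfolding d by (rule integrable_std_normal_distribution_moment)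
    then have i: "integrable M (\<lambda>w. (Z w) ^ (2*k))" by (subst (asm) integrable_distr_eq) auto
    have "(\<integral>x. x ^ (2*k) \<partial>distr M borel Z) = fact (2*k) / (2^k * fact k)"
      unfolding d by (rule std_normal_distribution_even_moments)
    then have "expectation (\<lambda>w. (Z w) ^ (2*k)) = fact (2*k) / (2^k * fact k)" by (subst (asm) integral_distr) auto
    then show ?thesis unfolding pw using i by simp
  qed
  then show "integrable M (\<lambda>w. (X w) ^ (2*k))"
    "expectation (\<lambda>w. (X w) ^ (2*k)) = fact (2*k) / (2^k * fact k) * (expectation (\<lambda>w. (X w)\<^sup>2)) ^ k"
    by (auto simp: v_def)
qed

text \<open>Orthogonal reflection of L2 in the hyperplane perpendicular to d. It is an isometry,
  hence leaves joint laws invariant; it sends d to -d and fixes everything orthogonal to d.\<close>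

definition refl :: "('a \<Rightarrow> real) \<Rightarrow> ('a \<Rightarrow> real) \<Rightarrow> 'a \<Rightarrow> real" where
  "refl d Y = (\<lambda>w. Y w - (2 * expectation (\<lambda>w. Y w * d w) / expectation (\<lambda>w. (d w)\<^sup>2)) * d w)"

lemma refl_V: "d \<in> V \<Longrightarrow> Y \<in> V \<Longrightarrow> refl d Y \<in> V"
  unfolding refl_def by (intro V_diff V_mult)

lemma expectation_refl:
  assumes d: "d \<in> V" and Y: "Y \<in> V" and Z: "Z \<in> V" and v: "expectation (\<lambda>w. (d w)\<^sup>2) \<noteq> 0"
  shows "expectation (\<lambda>w. refl d Y w * refl d Z w) = expectation (\<lambda>w. Y w * Z w)"
proof -
  define v where "v = expectation (\<lambda>w. (d w)\<^sup>2)"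
  define a where "a = 2 * expectation (\<lambda>w. Y w * d w) / v"
  define c where "c = 2 * expectation (\<lambda>w. Z w * d w) / v"
  have "expectation (\<lambda>w. refl d Y w * refl d Z w) =
     expectation (\<lambda>w. Y w * Z w - c * (Y w * d w) - a * (Z w * d w) + a * c * (d w)\<^sup>2)"
    unfolding refl_def a_def c_def v_def
    by (intro Bochner_Integration.integral_cong) (auto simp: algebra_simps power2_eq_square)
  also have "\<dots> = expectation (\<lambda>w. Y w * Z w) - c * expectation (\<lambda>w. Y w * d w) - a * expectation (\<lambda>w. Z w * d w) + a * c * v"
    using V_prod_integrable[OF Y Z] V_prod_integrable[OF Y d] V_prod_integrable[OF Z d] V_sq[OF d]
    by (simp add: v_def)
  also have "\<dots> = expectation (\<lambda>w. Y w * Z w)"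
  proof -
    have "v \<noteq> 0" using assms(4) by (simp add: v_def)
    then have "- (2 * z / v) * y - (2 * y / v) * z + (2 * y / v) * (2 * z / v) * v = 0" for y z :: real
      by (simp add: field_simps)
    from this[of "expectation (\<lambda>w. Z w * d w)" "expectation (\<lambda>w. Y w * d w)"] show ?thesis
      unfolding a_def c_def by linarith
  qed
  finally show ?thesis .
qed

lemma refl_self: "expectation (\<lambda>w. (d w)\<^sup>2) \<noteq> 0 \<Longrightarrow> refl d d = (\<lambda>w. - d w)"
  by (simp add: refl_def power2_eq_square)

lemma refl_orthogonal: "expectation (\<lambda>w. Y w * d w) = 0 \<Longrightarrow> refl d Y = Y"
  by (simp add: refl_def)

text \<open>A substitute for Gaussian integration by parts: reflecting the Gaussian space along \<open>d\<close>
  and along \<open>e\<close> turns the expectation of \<open>\<Psi> d e\<close> into that of a mixed second difference of \<open>\<Psi>\<close>.\<close>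
lemma mixed_difference:
  fixes g :: "nat \<Rightarrow> 'a \<Rightarrow> real"
  assumes g: "\<And>i. i < n \<Longrightarrow> g i \<in> V" and d: "d \<in> V" and e: "e \<in> V"
    and orth: "expectation (\<lambda>w. e w * d w) = 0"
    and d0: "expectation (\<lambda>w. (d w)\<^sup>2) \<noteq> 0" and e0: "expectation (\<lambda>w. (e w)\<^sup>2) \<noteq> 0"
    and Psi: "\<Psi> \<in> borel_measurable (PiM {..<n} (\<lambda>_. borel))" and K: "\<And>y. \<bar>\<Psi> y\<bar> \<le> K"
  defines "F \<equiv> \<lambda>h w. \<Psi> (\<lambda>i\<in>{..<n}. h i w) :: real"
  shows "expectation (\<lambda>w. F g w * d w * e w) =
     expectation (\<lambda>w. (F g w - F (\<lambda>i. refl d (g i)) w - F (\<lambda>i. refl e (g i)) w + F (\<lambda>i. refl e (refl d (g i))) w) * d w * e w) / 4"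
proof -
  have orth': "expectation (\<lambda>w. d w * e w) = 0" using orth by (simp add: mult.commute)
  \<comment> \<open>The directions d and e are carried along as coordinates n and n+1, so that one
    invariance of the joint law moves the functional and both factors together.\<close>
  define \<Phi> where "\<Phi> y = \<Psi> (restrict y {..<n}) * y n * y (Suc n)" for y
  have Phi: "\<Phi> \<in> borel_measurable (PiM {..<Suc (Suc n)} (\<lambda>_. borel))"
    unfolding \<Phi>_def
    by (intro borel_measurable_times measurable_compose[OF measurable_restrict_subset Psi] measurable_component_singleton) auto
  define ext where "ext h a b i = (if i < n then h i else if i = n then a else b)" for h :: "nat \<Rightarrow> 'a \<Rightarrow> real" and a b i
  have ext: "\<Phi> (\<lambda>i\<in>{..<Suc (Suc n)}. ext h a b i w) = F h w * a w * b w" for h a b w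
  proof -
    have "restrict (\<lambda>i\<in>{..<Suc (Suc n)}. ext h a b i w) {..<n} = (\<lambda>i\<in>{..<n}. h i w)"
      by (auto simp: restrict_def ext_def fun_eq_iff)
    then show ?thesis by (simp add: \<Phi>_def F_def ext_def)
  qed
  have step: "expectation (\<lambda>w. F h w * a w * b w) = expectation (\<lambda>w. F (\<lambda>i. refl z (h i)) w * refl z a w * refl z b w)"
    if h: "\<And>i. i < n \<Longrightarrow> h i \<in> V" and ab: "a \<in> V" "b \<in> V" and z: "z \<in> V" "expectation (\<lambda>w. (z w)\<^sup>2) \<noteq> 0" for h a b z
  proof -
    have "expectation (\<lambda>w. \<Phi> (\<lambda>i\<in>{..<Suc (Suc n)}. ext h a b i w)) =
        expectation (\<lambda>w. \<Phi> (\<lambda>i\<in>{..<Suc (Suc n)}. refl z (ext h a b i) w))"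
    proof (rule V_law_eq[OF _ _ _ _ Phi])
      show eV: "ext h a b i \<in> V" if "i \<in> {..<Suc (Suc n)}" for i
        using h ab by (simp add: ext_def)
      show "refl z (ext h a b i) \<in> V" if "i \<in> {..<Suc (Suc n)}" for i
        using eV[OF that] z by (intro refl_V)
      show "expectation (\<lambda>w. ext h a b i w * ext h a b j w) = expectation (\<lambda>w. refl z (ext h a b i) w * refl z (ext h a b j) w)"
        if "i \<in> {..<Suc (Suc n)}" "j \<in> {..<Suc (Suc n)}" for i j
        using expectation_refl[OF z(1) eV[OF that(1)] eV[OF that(2)] z(2)] by simp
    qed simp
    moreover have "refl z (ext h a b i) = ext (\<lambda>i. refl z (h i)) (refl z a) (refl z b) i" for i
      by (simp add: ext_def)
    ultimately show ?thesis by (simp only: ext)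
  qed
  have Fm: "F h \<in> borel_measurable M" if "\<And>i. i < n \<Longrightarrow> h i \<in> V" for h
    unfolding F_def using that by (intro measurable_compose[OF _ Psi] measurable_restrict V_measurable) auto
  have int: "integrable M (\<lambda>w. F h w * d w * e w)" if "\<And>i. i < n \<Longrightarrow> h i \<in> V" for h
  proof (rule Bochner_Integration.integrable_bound)
    show "integrable M (\<lambda>w. K * (d w * e w))" using V_prod_integrable[OF d e] by simp
    show "(\<lambda>w. F h w * d w * e w) \<in> borel_measurable M" using Fm[OF that] V_measurable[OF d] V_measurable[OF e] by measurable
    have "\<bar>F h w\<bar> * \<bar>d w * e w\<bar> \<le> \<bar>K\<bar> * \<bar>d w * e w\<bar>" for w
      using K[of "\<lambda>i\<in>{..<n}. h i w"] unfolding F_def by (intro mult_right_mono) auto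
    then show "AE w in M. norm (F h w * d w * e w) \<le> norm (K * (d w * e w))"
      by (intro AE_I2) (simp add: abs_mult mult.assoc)
  qed
  have gd: "refl d (g i) \<in> V" and ge: "refl e (g i) \<in> V" and gde: "refl e (refl d (g i)) \<in> V" if "i < n" for i
    using g d e that by (auto intro!: refl_V)
  \<comment> \<open>By orthogonality each reflection changes the sign of exactly one of the factors
    d, e and fixes the other. With the signs of the mixed difference the four expectations are
    therefore equal, whence the division by 4.\<close>
  have 1: "expectation (\<lambda>w. F g w * d w * e w) = - expectation (\<lambda>w. F (\<lambda>i. refl d (g i)) w * d w * e w)"
    using step[OF g d e d d0] by (simp add: refl_self[OF d0] refl_orthogonal[OF orth])
  have 2: "expectation (\<lambda>w. F g w * d w * e w) = - expectation (\<lambda>w. F (\<lambda>i. refl e (g i)) w * d w * e w)"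
    using step[OF g d e e e0] by (simp add: refl_self[OF e0] refl_orthogonal[OF orth'])
  have 3: "expectation (\<lambda>w. F (\<lambda>i. refl d (g i)) w * d w * e w) = - expectation (\<lambda>w. F (\<lambda>i. refl e (refl d (g i))) w * d w * e w)"
    using step[OF gd d e e e0] by (simp add: refl_self[OF e0] refl_orthogonal[OF orth'])
  have "expectation (\<lambda>w. (F g w - F (\<lambda>i. refl d (g i)) w - F (\<lambda>i. refl e (g i)) w + F (\<lambda>i. refl e (refl d (g i))) w) * d w * e w)
    = expectation (\<lambda>w. F g w * d w * e w - F (\<lambda>i. refl d (g i)) w * d w * e w - F (\<lambda>i. refl e (g i)) w * d w * e w + F (\<lambda>i. refl e (refl d (g i))) w * d w * e w)"
    by (intro Bochner_Integration.integral_cong) (auto simp: algebra_simps)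
  also have "\<dots> = expectation (\<lambda>w. F g w * d w * e w) - expectation (\<lambda>w. F (\<lambda>i. refl d (g i)) w * d w * e w)
     - expectation (\<lambda>w. F (\<lambda>i. refl e (g i)) w * d w * e w) + expectation (\<lambda>w. F (\<lambda>i. refl e (refl d (g i))) w * d w * e w)"
    using int[OF g] int[OF gd] int[OF ge] int[OF gde] by simp
  finally show ?thesis using 1 2 3 by simp
qed

end

section \<open>The Gaussian space of fractional Brownian motion\<close>

text \<open>The distance is taken in ennreal, as in \<open>is_wiener_integral\<close>, so that X
  need not be known to be square integrable beforehand.\<close>

definition L2_lim :: "'a measure \<Rightarrow> (nat \<Rightarrow> 'a \<Rightarrow> real) \<Rightarrow> ('a \<Rightarrow> real) \<Rightarrow> bool" where
  "L2_lim M Y X \<longleftrightarrow> X \<in> borel_measurable M \<and> (\<forall>n. Y n \<in> borel_measurable M \<and> integrable M (\<lambda>w. (Y n w)\<^sup>2)) \<and>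
     (\<lambda>n. \<integral>\<^sup>+w. ennreal ((Y n w - X w)\<^sup>2) \<partial>M) \<longlonglongrightarrow> 0"

lemma integrable_sq_lin:
  fixes f g :: "'a \<Rightarrow> real"
  assumes "f \<in> borel_measurable M" "g \<in> borel_measurable M"
    and "integrable M (\<lambda>w. (f w)\<^sup>2)" "integrable M (\<lambda>w. (g w)\<^sup>2)"
  shows "integrable M (\<lambda>w. (a * f w + c * g w)\<^sup>2)"
proof -
  have "(\<lambda>w. (a * f w + c * g w)\<^sup>2) = (\<lambda>w. a\<^sup>2 * (f w)\<^sup>2 + (2 * a * c) * (f w * g w) + c\<^sup>2 * (g w)\<^sup>2)"
    by (auto simp: fun_eq_iff power2_eq_square algebra_simps)
  then show ?thesis using assms integrable_mult_sq[OF assms] by simp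
qed

text \<open>Some \<open>Y m\<close> is at distance less than 1 from X, and this already makes X
  square integrable; afterwards everything can be said with real integrals.\<close>

lemma L2_lim_E:
  assumes "L2_lim M Y X"
  shows "X \<in> borel_measurable M" "Y n \<in> borel_measurable M" "integrable M (\<lambda>w. (Y n w)\<^sup>2)"
    "integrable M (\<lambda>w. (X w)\<^sup>2)"
    "integrable M (\<lambda>w. (Y n w - X w)\<^sup>2)"
    "(\<lambda>n. \<integral>w. (Y n w - X w)\<^sup>2 \<partial>M) \<longlonglongrightarrow> 0"
proof -
  show [measurable]: "X \<in> borel_measurable M" "Y n \<in> borel_measurable M" and iY: "integrable M (\<lambda>w. (Y n w)\<^sup>2)" for n
    using assms by (auto simp: L2_lim_def)
  have lim: "(\<lambda>n. \<integral>\<^sup>+w. ennreal ((Y n w - X w)\<^sup>2) \<partial>M) \<longlonglongrightarrow> 0" using assms by (auto simp: L2_lim_def)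
  then have "\<forall>\<^sub>F n in sequentially. (\<integral>\<^sup>+w. ennreal ((Y n w - X w)\<^sup>2) \<partial>M) < 1"
    by (intro order_tendstoD) auto
  then obtain m where m: "(\<integral>\<^sup>+w. ennreal ((Y m w - X w)\<^sup>2) \<partial>M) < 1" by (auto simp: eventually_sequentially)
  then have im: "integrable M (\<lambda>w. (Y m w - X w)\<^sup>2)"
    by (intro integrableI_nonneg) (auto intro: less_trans)
  show iX: "integrable M (\<lambda>w. (X w)\<^sup>2)"
    using integrable_sq_lin[OF _ _ iY[of m] im, of 1 "-1"] by simp
  show iD: "integrable M (\<lambda>w. (Y n w - X w)\<^sup>2)" for n
    using integrable_sq_lin[OF _ _ iY[of n] iX, of 1 "-1"] by simp
  have "(\<lambda>n. ennreal (\<integral>w. (Y n w - X w)\<^sup>2 \<partial>M)) \<longlonglongrightarrow> ennreal 0"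
    using lim nn_integral_eq_integral[OF iD] by simp
  then show "(\<lambda>n. \<integral>w. (Y n w - X w)\<^sup>2 \<partial>M) \<longlonglongrightarrow> 0"
    by (subst (asm) tendsto_ennreal_iff) auto
qed

lemma integral_mult_tendsto_0:
  assumes "\<And>n. f n \<in> borel_measurable M" "\<And>n. g n \<in> borel_measurable M"
    "\<And>n. integrable M (\<lambda>w. (f n w :: real)\<^sup>2)" "\<And>n. integrable M (\<lambda>w. (g n w :: real)\<^sup>2)"
    "(\<lambda>n. (\<integral>w. (f n w)\<^sup>2 \<partial>M) * (\<integral>w. (g n w)\<^sup>2 \<partial>M)) \<longlonglongrightarrow> 0"
  shows "(\<lambda>n. \<integral>w. f n w * g n w \<partial>M) \<longlonglongrightarrow> 0"
proof -
  have "(\<lambda>n. (\<integral>w. f n w * g n w \<partial>M)\<^sup>2) \<longlonglongrightarrow> 0"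
    using integral_cauchy_schwarz[OF assms(1-4)]
    by (intro tendsto_sandwich[OF _ _ tendsto_const assms(5)]) auto
  then have "(\<lambda>n. sqrt ((\<integral>w. f n w * g n w \<partial>M)\<^sup>2)) \<longlonglongrightarrow> sqrt 0" by (rule tendsto_real_sqrt)
  then show ?thesis by (simp add: tendsto_rabs_zero_iff)
qed

lemma L2_lim_mult:
  assumes X: "L2_lim M Y X" and X': "L2_lim M Y' X'"
  shows "(\<lambda>n. \<integral>w. Y n w * Y' n w \<partial>M) \<longlonglongrightarrow> (\<integral>w. X w * X' w \<partial>M)"
proof -
  note a = L2_lim_E[OF X] and b = L2_lim_E[OF X']
  note [measurable] = a(1) a(2) b(1) b(2)
  have 1: "(\<lambda>n. \<integral>w. (Y n w - X w) * (Y' n w - X' w) \<partial>M) \<longlonglongrightarrow> 0"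
    by (rule integral_mult_tendsto_0[OF _ _ a(5) b(5) tendsto_mult_zero[OF a(6) b(6)]]) measurable
  have 2: "(\<lambda>n. \<integral>w. X w * (Y' n w - X' w) \<partial>M) \<longlonglongrightarrow> 0"
    by (rule integral_mult_tendsto_0[OF _ _ a(4) b(5) tendsto_mult_right_zero[OF b(6)]]) measurable
  have 3: "(\<lambda>n. \<integral>w. (Y n w - X w) * X' w \<partial>M) \<longlonglongrightarrow> 0"
    by (rule integral_mult_tendsto_0[OF _ _ a(5) b(4) tendsto_mult_left_zero[OF a(6)]]) measurable
  have eq: "(\<integral>w. Y n w * Y' n w \<partial>M) = (\<integral>w. (Y n w - X w) * (Y' n w - X' w) \<partial>M) + (\<integral>w. X w * (Y' n w - X' w) \<partial>M)
      + (\<integral>w. (Y n w - X w) * X' w \<partial>M) + (\<integral>w. X w * X' w \<partial>M)" for n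
  proof -
    have i: "integrable M (\<lambda>w. (Y n w - X w) * (Y' n w - X' w))" "integrable M (\<lambda>w. X w * (Y' n w - X' w))"
      "integrable M (\<lambda>w. (Y n w - X w) * X' w)" "integrable M (\<lambda>w. X w * X' w)"
      by (rule integrable_mult_sq[OF _ _ a(5) b(5)], measurable)
         (rule integrable_mult_sq[OF _ _ a(4) b(5)], measurable,
          rule integrable_mult_sq[OF _ _ a(5) b(4)], measurable, rule integrable_mult_sq[OF _ _ a(4) b(4)], measurable)
    have "(\<integral>w. Y n w * Y' n w \<partial>M) = (\<integral>w. (Y n w - X w) * (Y' n w - X' w) + X w * (Y' n w - X' w) + (Y n w - X w) * X' w + X w * X' w \<partial>M)"
      by (intro Bochner_Integration.integral_cong) (auto simp: algebra_simps)
    then show ?thesis using i by simp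
  qed
  show ?thesis unfolding eq using tendsto_add[OF tendsto_add[OF tendsto_add[OF 1 2] 3] tendsto_const] by simp
qed

lemma L2_lim_lin:
  assumes X: "L2_lim M Y X" and X': "L2_lim M Y' X'"
  shows "L2_lim M (\<lambda>n w. a * Y n w + c * Y' n w) (\<lambda>w. a * X w + c * X' w)"
proof -
  note A = L2_lim_E[OF X] and B = L2_lim_E[OF X']
  note [measurable] = A(1) A(2) B(1) B(2)
  have 1: "(\<lambda>n. \<integral>w. (Y n w - X w) * (Y' n w - X' w) \<partial>M) \<longlonglongrightarrow> 0"
    by (rule integral_mult_tendsto_0[OF _ _ A(5) B(5) tendsto_mult_zero[OF A(6) B(6)]]) measurable
  have eq: "(\<integral>w. (a * Y n w + c * Y' n w - (a * X w + c * X' w))\<^sup>2 \<partial>M) =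
     a\<^sup>2 * (\<integral>w. (Y n w - X w)\<^sup>2 \<partial>M) + (2 * a * c) * (\<integral>w. (Y n w - X w) * (Y' n w - X' w) \<partial>M) + c\<^sup>2 * (\<integral>w. (Y' n w - X' w)\<^sup>2 \<partial>M)" for n
  proof -
    have "(\<integral>w. (a * Y n w + c * Y' n w - (a * X w + c * X' w))\<^sup>2 \<partial>M) =
      (\<integral>w. a\<^sup>2 * (Y n w - X w)\<^sup>2 + (2 * a * c) * ((Y n w - X w) * (Y' n w - X' w)) + c\<^sup>2 * (Y' n w - X' w)\<^sup>2 \<partial>M)"
      by (intro Bochner_Integration.integral_cong) (auto simp: algebra_simps power2_eq_square)
    moreover have "integrable M (\<lambda>w. (Y n w - X w) * (Y' n w - X' w))"
      by (rule integrable_mult_sq[OF _ _ A(5) B(5)]) measurable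
    ultimately show ?thesis using A(5)[of n] B(5)[of n] by simp
  qed
  have i: "integrable M (\<lambda>w. (a * Y n w + c * Y' n w - (a * X w + c * X' w))\<^sup>2)" for n
  proof -
    have "(\<lambda>w. (a * Y n w + c * Y' n w - (a * X w + c * X' w))\<^sup>2) = (\<lambda>w. (a * (Y n w - X w) + c * (Y' n w - X' w))\<^sup>2)"
      by (simp add: algebra_simps)
    moreover have "integrable M (\<lambda>w. (a * (Y n w - X w) + c * (Y' n w - X' w))\<^sup>2)"
      by (rule integrable_sq_lin[OF _ _ A(5) B(5)]) measurable
    ultimately show ?thesis by (simp only:)
  qed
  have "(\<lambda>n. \<integral>w. (a * Y n w + c * Y' n w - (a * X w + c * X' w))\<^sup>2 \<partial>M) \<longlonglongrightarrow> 0"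
    unfolding eq
    using tendsto_add[OF tendsto_add[OF tendsto_mult_left[OF A(6), of "a\<^sup>2"] tendsto_mult_left[OF 1, of "2*a*c"]]
        tendsto_mult_left[OF B(6), of "c\<^sup>2"]] by simp
  then have "(\<lambda>n. ennreal (\<integral>w. (a * Y n w + c * Y' n w - (a * X w + c * X' w))\<^sup>2 \<partial>M)) \<longlonglongrightarrow> 0"
    using tendsto_ennrealI by fastforce
  then have "(\<lambda>n. \<integral>\<^sup>+w. ennreal ((a * Y n w + c * Y' n w - (a * X w + c * X' w))\<^sup>2) \<partial>M) \<longlonglongrightarrow> 0"
    using nn_integral_eq_integral[OF i] by simp
  then show ?thesis unfolding L2_lim_def using integrable_sq_lin[OF A(2) B(2) A(3) B(3)]
    by (intro conjI allI) measurable
qed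

text \<open>cos and sin are bounded and 1-Lipschitz, and on a probability space L2 convergence
  implies L1 convergence.\<close>

lemma (in prob_space) L2_lim_char:
  assumes X: "L2_lim M Y X"
  shows "(\<lambda>n. \<integral>w. cos (Y n w) \<partial>M) \<longlonglongrightarrow> (\<integral>w. cos (X w) \<partial>M)"
    "(\<lambda>n. \<integral>w. sin (Y n w) \<partial>M) \<longlonglongrightarrow> (\<integral>w. sin (X w) \<partial>M)"
proof -
  note A = L2_lim_E[OF X]
  note [measurable] = A(1) A(2)
  have i1: "integrable M (\<lambda>w. \<bar>Y n w - X w\<bar>)" for n
    using integrable_mult_sq[of "\<lambda>w. \<bar>Y n w - X w\<bar>" M "\<lambda>_. 1"] A(5)[of n] by simp
  have L1: "(\<lambda>n. \<integral>w. \<bar>Y n w - X w\<bar> \<partial>M) \<longlonglongrightarrow> 0"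
    using integral_mult_tendsto_0[of "\<lambda>n w. \<bar>Y n w - X w\<bar>" M "\<lambda>_ _. 1"] A(5,6) by (simp add: prob_space)
  have gen: "(\<lambda>n. \<integral>w. f (Y n w) \<partial>M) \<longlonglongrightarrow> (\<integral>w. f (X w) \<partial>M)"
    if [measurable]: "f \<in> borel_measurable borel" and b: "\<And>x. \<bar>f x\<bar> \<le> 1" and l: "\<And>x y. \<bar>f x - f y\<bar> \<le> \<bar>x - y\<bar>" for f :: "real \<Rightarrow> real"
  proof (rule LIM_zero_cancel, rule Lim_null_comparison[OF _ L1], intro always_eventually allI)
    fix n
    have i: "integrable M (\<lambda>w. f (Y n w))" "integrable M (\<lambda>w. f (X w))"
      using b by (auto intro!: integrable_const_bound[of _ 1])
    have "\<bar>\<integral>w. f (Y n w) - f (X w) \<partial>M\<bar> \<le> (\<integral>w. \<bar>f (Y n w) - f (X w)\<bar> \<partial>M)" by (rule integral_abs_bound)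
    also have "\<dots> \<le> (\<integral>w. \<bar>Y n w - X w\<bar> \<partial>M)" using i i1 l by (intro integral_mono) auto
    finally show "norm ((\<integral>w. f (Y n w) \<partial>M) - (\<integral>w. f (X w) \<partial>M)) \<le> (\<integral>w. \<bar>Y n w - X w\<bar> \<partial>M)" using i by simp
  qed
  have lc: "\<bar>cos x - cos y\<bar> \<le> \<bar>x - y\<bar>" for x y :: real
  proof -
    have "\<bar>cos x - cos y\<bar> = 2 * \<bar>sin ((x + y) / 2)\<bar> * \<bar>sin ((y - x) / 2)\<bar>" by (simp add: cos_diff_cos abs_mult)
    also have "\<dots> \<le> 2 * 1 * \<bar>(y - x) / 2\<bar>" by (intro mult_mono abs_sin_le_one abs_sin_x_le_abs_x) auto
    finally show ?thesis by simp
  qed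
  have ls: "\<bar>sin x - sin y\<bar> \<le> \<bar>x - y\<bar>" for x y :: real
    using lc[of "pi/2 - x" "pi/2 - y"] by (simp add: cos_diff abs_minus_commute)
  show "(\<lambda>n. \<integral>w. cos (Y n w) \<partial>M) \<longlonglongrightarrow> (\<integral>w. cos (X w) \<partial>M)"
    by (rule gen) (auto intro: lc)
  show "(\<lambda>n. \<integral>w. sin (Y n w) \<partial>M) \<longlonglongrightarrow> (\<integral>w. sin (X w) \<partial>M)"
    by (rule gen) (auto intro: ls)
qed

lemma (in prob_space) centered_gaussian_char:
  assumes "centered_gaussian M X v"
  shows "X \<in> borel_measurable M" "integrable M (\<lambda>w. (X w)\<^sup>2)" "(\<integral>w. (X w)\<^sup>2 \<partial>M) = v"
    "(\<integral>w. cos (X w) \<partial>M) = exp (- v / 2)" "(\<integral>w. sin (X w) \<partial>M) = 0"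
proof -
  have "X \<in> borel_measurable M \<and> integrable M (\<lambda>w. (X w)\<^sup>2) \<and> (\<integral>w. (X w)\<^sup>2 \<partial>M) = v \<and>
    (\<integral>w. cos (X w) \<partial>M) = exp (- v / 2) \<and> (\<integral>w. sin (X w) \<partial>M) = 0"
  proof (cases "v = 0")
    case True
    then have [measurable]: "X \<in> borel_measurable M" and ae: "AE w in M. X w = 0"
      using assms by (auto simp: centered_gaussian_def)
    have "(\<integral>w. f (X w) \<partial>M) = f 0" if [measurable]: "f \<in> borel_measurable borel" for f :: "real \<Rightarrow> real"
    proof -
      have "(\<integral>w. f (X w) \<partial>M) = (\<integral>w. f 0 \<partial>M)" using ae by (intro integral_cong_AE) auto
      then show ?thesis by (simp add: prob_space)
    qed
    from this[of "\<lambda>x. x\<^sup>2"] this[of cos] this[of sin]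
    have "(\<integral>w. (X w)\<^sup>2 \<partial>M) = 0" "(\<integral>w. cos (X w) \<partial>M) = 1" "(\<integral>w. sin (X w) \<partial>M) = 0" by auto
    moreover have "integrable M (\<lambda>w. (X w)\<^sup>2)"
      using ae by (subst integrable_cong_AE[where g="\<lambda>_. 0"]) auto
    ultimately show ?thesis using True by simp
  next
    case False
    then have v: "0 < v" and d: "distributed M lborel X (normal_density 0 (sqrt v))"
      using assms by (auto simp: centered_gaussian_def)
    have [measurable]: "X \<in> borel_measurable M" using distributed_measurable[OF d] by simp
    define Z where "Z w = X w / sqrt v" for w
    have [measurable]: "Z \<in> borel_measurable M" unfolding Z_def[abs_def] by measurable
    have "distributed M lborel Z std_normal_density"
      using d v normal_standard_normal_convert[of "sqrt v" X 0] by (simp add: Z_def[abs_def])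
    then have dist: "distr M lborel Z = std_normal_distribution" by (simp add: distributed_distr_eq_density)
    have dist: "distr M borel Z = std_normal_distribution"
      unfolding dist[symmetric] by (intro distr_cong) auto
    have XZ: "X w = sqrt v * Z w" for w using v by (simp add: Z_def)
    have ii: "integrable M (\<lambda>w. iexp (X w))"
      by (intro integrable_const_bound[of _ 1]) auto
    have c: "(\<integral>w. iexp (X w) \<partial>M) = complex_of_real (exp (- v / 2))"
    proof -
      have "(\<integral>w. iexp (X w) \<partial>M) = char (distr M borel Z) (sqrt v)"
        unfolding char_def XZ by (subst integral_distr) auto
      also have "\<dots> = complex_of_real (exp (- v / 2))" unfolding dist using v by (simp add: char_std_normal_distribution)
      finally show ?thesis .
    qed
    have "Re (\<integral>w. iexp (X w) \<partial>M) = (\<integral>w. cos (X w) \<partial>M)"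
      unfolding integral_Re[OF ii, symmetric] by (intro Bochner_Integration.integral_cong) (simp_all add: Re_exp)
    then have 1: "(\<integral>w. cos (X w) \<partial>M) = exp (- v / 2)" unfolding c by simp
    have "Im (\<integral>w. iexp (X w) \<partial>M) = (\<integral>w. sin (X w) \<partial>M)"
      unfolding integral_Im[OF ii, symmetric] by (intro Bochner_Integration.integral_cong) (simp_all add: Im_exp)
    then have 2: "(\<integral>w. sin (X w) \<partial>M) = 0" unfolding c by simp
    have "integrable (distr M borel Z) (\<lambda>x. x ^ 2)" unfolding dist by (rule integrable_std_normal_distribution_moment)
    then have i: "integrable M (\<lambda>w. (Z w)\<^sup>2)" by (subst (asm) integrable_distr_eq) auto
    have "(\<integral>x. x ^ (2*1) \<partial>distr M borel Z) = 1"
      unfolding dist std_normal_distribution_even_moments by simp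
    then have m: "(\<integral>w. (Z w)\<^sup>2 \<partial>M) = 1" by (subst (asm) integral_distr) auto
    have X2: "(X w)\<^sup>2 = v * (Z w)\<^sup>2" for w using v by (simp add: XZ power_mult_distrib)
    show ?thesis using 1 2 i m by (simp add: X2)
  qed
  then show "X \<in> borel_measurable M" "integrable M (\<lambda>w. (X w)\<^sup>2)" "(\<integral>w. (X w)\<^sup>2 \<partial>M) = v"
    "(\<integral>w. cos (X w) \<partial>M) = exp (- v / 2)" "(\<integral>w. sin (X w) \<partial>M) = 0" by auto
qed

text \<open>Lists of coefficient-time pairs match the finite linear combinations of
  \<open>is_fbm\<close> and make closure under linear combinations a concatenation.\<close>

definition fbm_span :: "(real \<Rightarrow> 'a \<Rightarrow> real) \<Rightarrow> ('a \<Rightarrow> real) set" where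
  "fbm_span W = {\<lambda>w. \<Sum>p\<leftarrow>ps. fst p * W (snd p) w | ps. \<forall>p\<in>set ps. 0 \<le> snd p}"

lemma fbm_span_0: "(\<lambda>w. 0) \<in> fbm_span W"
  unfolding fbm_span_def by (auto intro!: exI[of _ "[]"])

lemma fbm_span_W: "0 \<le> t \<Longrightarrow> W t \<in> fbm_span W"
  unfolding fbm_span_def by (auto intro!: exI[of _ "[(1, t)]"])

lemma fbm_span_lin:
  assumes "X \<in> fbm_span W" "Y \<in> fbm_span W"
  shows "(\<lambda>w. a * X w + c * Y w) \<in> fbm_span W"
proof -
  obtain ps where ps: "X = (\<lambda>w. \<Sum>p\<leftarrow>ps. fst p * W (snd p) w)" "\<forall>p\<in>set ps. 0 \<le> snd p"
    using assms(1) by (auto simp: fbm_span_def)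
  obtain qs where qs: "Y = (\<lambda>w. \<Sum>p\<leftarrow>qs. fst p * W (snd p) w)" "\<forall>p\<in>set qs. 0 \<le> snd p"
    using assms(2) by (auto simp: fbm_span_def)
  have "(\<lambda>w. a * X w + c * Y w) = (\<lambda>w. \<Sum>p\<leftarrow>map (\<lambda>p. (a * fst p, snd p)) ps @ map (\<lambda>p. (c * fst p, snd p)) qs. fst p * W (snd p) w)"
    unfolding ps(1) qs(1) by (simp add: sum_list_const_mult[symmetric] o_def mult.assoc)
  moreover have "\<forall>p\<in>set (map (\<lambda>p. (a * fst p, snd p)) ps @ map (\<lambda>p. (c * fst p, snd p)) qs). 0 \<le> snd p"
    using ps qs by auto
  ultimately show ?thesis unfolding fbm_span_def by blast
qed

lemma fbm_span_sum:
  fixes n :: nat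
  shows "(\<And>k. k < n \<Longrightarrow> X k \<in> fbm_span W) \<Longrightarrow> (\<lambda>w. \<Sum>k<n. c k * X k w) \<in> fbm_span W"
proof (induction n)
  case 0
  then show ?case using fbm_span_0 by simp
next
  case (Suc n)
  then have "(\<lambda>w. 1 * (\<Sum>k<n. c k * X k w) + c n * X n w) \<in> fbm_span W" by (intro fbm_span_lin) auto
  then show ?case by simp
qed

lemma fbm_span_gaussian:
  assumes W: "is_fbm M H W" and X: "X \<in> fbm_span W"
  shows "\<exists>v. centered_gaussian M X v"
proof -
  obtain ps where ps: "X = (\<lambda>w. \<Sum>p\<leftarrow>ps. fst p * W (snd p) w)" "\<forall>p\<in>set ps. 0 \<le> snd p"
    using X by (auto simp: fbm_span_def)
  have "X = (\<lambda>w. \<Sum>i<length (map snd ps). map fst ps ! i * W (map snd ps ! i) w)"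
    unfolding ps by (simp add: sum_list_sum_nth atLeast0LessThan)
  moreover have "\<forall>t\<in>set (map snd ps). 0 \<le> t" using ps by auto
  moreover have "length (map snd ps) = length (map fst ps)" by simp
  moreover have "\<And>ts cs. length ts = length cs \<Longrightarrow> \<forall>t\<in>set ts. 0 \<le> t \<Longrightarrow>
     \<exists>v. centered_gaussian M (\<lambda>\<omega>. \<Sum>i<length ts. cs!i * W (ts!i) \<omega>) v"
    using W unfolding is_fbm_def by blast
  ultimately show ?thesis by (simp only:)
qed

text \<open>Polarisation: \<open>is_fbm\<close> speaks of variances of linear combinations, and
  those of \<open>W s\<close>, \<open>W t\<close> and their sum determine the mixed moment.\<close>

lemma fbm_expectation:
  assumes W: "is_fbm M H W" and s: "0 \<le> s" and t: "0 \<le> t"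
  shows "(\<integral>w. W s w * W t w \<partial>M) = fbm_cov H s t"
proof -
  interpret prob_space M using W by (simp add: is_fbm_def)
  have g: "centered_gaussian M (\<lambda>\<omega>. \<Sum>i<length ts. cs!i * W (ts!i) \<omega>)
          (\<Sum>i<length ts. \<Sum>j<length ts. cs!i * cs!j * fbm_cov H (ts!i) (ts!j))"
    if "length ts = length cs" "\<forall>t\<in>set ts. 0 \<le> t" for ts cs
    using W that by (auto simp: is_fbm_def)
  have 1: "centered_gaussian M (W t) (fbm_cov H t t)" if "0 \<le> t" for t
    using g[of "[t]" "[1]"] that by simp
  have 2: "centered_gaussian M (\<lambda>w. W s w + W t w) (fbm_cov H s s + fbm_cov H s t + (fbm_cov H t s + fbm_cov H t t))"
    using g[of "[s, t]" "[1, 1]"] s t by (simp add: lessThan_Suc add_ac)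
  have c: "fbm_cov H t s = fbm_cov H s t" by (simp add: fbm_cov_def abs_minus_commute)
  note a = centered_gaussian_char[OF 1[OF s]] and b = centered_gaussian_char[OF 1[OF t]] and ab = centered_gaussian_char[OF 2]
  have i: "integrable M (\<lambda>w. W s w * W t w)" by (rule integrable_mult_sq[OF a(1) b(1) a(2) b(2)])
  have "(\<integral>w. (W s w + W t w)\<^sup>2 \<partial>M) = (\<integral>w. (W s w)\<^sup>2 + 2 * (W s w * W t w) + (W t w)\<^sup>2 \<partial>M)"
    by (intro Bochner_Integration.integral_cong) (auto simp: power2_eq_square algebra_simps)
  also have "\<dots> = fbm_cov H s s + 2 * (\<integral>w. W s w * W t w \<partial>M) + fbm_cov H t t"
    using a(2,3) b(2,3) i by simp
  finally show ?thesis using ab(3) c by linarith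
qed

text \<open>L2 closure of the span, that is, the first Wiener chaos; the closure is what makes room
  for Wiener integrals.\<close>

definition fbm_space :: "'a measure \<Rightarrow> (real \<Rightarrow> 'a \<Rightarrow> real) \<Rightarrow> ('a \<Rightarrow> real) set" where
  "fbm_space M W = {X. \<exists>Y. (\<forall>n. Y n \<in> fbm_span W) \<and> L2_lim M Y X}"

lemma gauss_space_fbm:
  assumes W: "is_fbm M H W"
  shows "gauss_space M (fbm_space M W)"
proof -
  interpret prob_space M using W by (simp add: is_fbm_def)
  show ?thesis
  proof
    fix X assume "X \<in> fbm_space M W"
    then obtain Y where Y: "\<And>n. Y n \<in> fbm_span W" "L2_lim M Y X" by (auto simp: fbm_space_def)
    note L = L2_lim_E[OF Y(2)]
    show "X \<in> borel_measurable M" "integrable M (\<lambda>w. (X w)\<^sup>2)" by fact+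
    have v: "(\<integral>w. cos (Y n w) \<partial>M) = exp (- (\<integral>w. Y n w * Y n w \<partial>M) / 2)" "(\<integral>w. sin (Y n w) \<partial>M) = 0" for n
    proof -
      obtain v where "centered_gaussian M (Y n) v" using fbm_span_gaussian[OF W Y(1)[of n]] ..
      note g = centered_gaussian_char[OF this]
      show "(\<integral>w. cos (Y n w) \<partial>M) = exp (- (\<integral>w. Y n w * Y n w \<partial>M) / 2)" "(\<integral>w. sin (Y n w) \<partial>M) = 0"
        using g(3,4,5) by (simp_all add: power2_eq_square)
    qed
    have "(\<lambda>n. \<integral>w. cos (Y n w) \<partial>M) \<longlonglongrightarrow> exp (- (\<integral>w. X w * X w \<partial>M) / 2)"
      unfolding v(1) by (intro tendsto_intros L2_lim_mult Y(2)) simp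
    then show "(\<integral>w. cos (X w) \<partial>M) = exp (- (\<integral>w. (X w)\<^sup>2 \<partial>M) / 2)"
      unfolding power2_eq_square by (rule LIMSEQ_unique[OF L2_lim_char(1)[OF Y(2)]])
    have "(\<lambda>n. \<integral>w. sin (Y n w) \<partial>M) \<longlonglongrightarrow> 0"
      unfolding v(2) by (rule tendsto_const)
    then show "(\<integral>w. sin (X w) \<partial>M) = 0"
      by (rule LIMSEQ_unique[OF L2_lim_char(2)[OF Y(2)]])
  next
    fix X X' a c assume "X \<in> fbm_space M W" "X' \<in> fbm_space M W"
    then obtain Y Y' where Y: "\<And>n. Y n \<in> fbm_span W" "L2_lim M Y X" "\<And>n. Y' n \<in> fbm_span W" "L2_lim M Y' X'" by (auto simp: fbm_space_def)
    have "\<forall>n. (\<lambda>w. a * Y n w + c * Y' n w) \<in> fbm_span W"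
      using fbm_span_lin[OF Y(1) Y(3)] by simp
    then show "(\<lambda>w. a * X w + c * X' w) \<in> fbm_space M W"
      unfolding fbm_space_def mem_Collect_eq using L2_lim_lin[OF Y(2) Y(4)]
      by (intro exI[of _ "\<lambda>n w. a * Y n w + c * Y' n w"]) simp
  qed
qed

section \<open>Covariance of the Volterra noise\<close>

lemma has_real_derivative_pos_part_powr:
  fixes r z :: real
  assumes "z \<noteq> 0" "0 < r"
  shows "((\<lambda>z. (max z 0) powr r) has_real_derivative r * (max z 0) powr (r - 1)) (at z)"
    and "((\<lambda>z. (max (-z) 0) powr r) has_real_derivative - (r * (max (-z) 0) powr (r - 1))) (at z)"
proof -
  have "((\<lambda>z. (max z 0) powr r) has_real_derivative r * (max z 0) powr (r - 1)) (at z) \<and>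
    ((\<lambda>z. (max (-z) 0) powr r) has_real_derivative - (r * (max (-z) 0) powr (r - 1))) (at z)"
  proof (cases "0 < z")
    case True
    have 1: "((\<lambda>z. z powr r) has_real_derivative r * z powr (r - 1)) (at z)"
      using True by (auto intro!: derivative_eq_intros)
    have 2: "((\<lambda>z. 0 :: real) has_real_derivative 0) (at z)" by simp
    show ?thesis
      using True assms
      by (intro conjI DERIV_cong[OF has_field_derivative_transform_within_open[OF 1, of "{0<..}"]]
          DERIV_cong[OF has_field_derivative_transform_within_open[OF 2, of "{0<..}"]]) (auto simp: max_def)
  next
    case False
    then have z: "z < 0" using assms by simp
    have 1: "((\<lambda>z. (-z) powr r) has_real_derivative - (r * (-z) powr (r - 1))) (at z)"
      using z by (auto intro!: derivative_eq_intros)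
    have 2: "((\<lambda>z. 0 :: real) has_real_derivative 0) (at z)" by simp
    show ?thesis
      using z assms
      by (intro conjI DERIV_cong[OF has_field_derivative_transform_within_open[OF 1, of "{..<0}"]]
          DERIV_cong[OF has_field_derivative_transform_within_open[OF 2, of "{..<0}"]]) (auto simp: max_def)
  qed
  then show "((\<lambda>z. (max z 0) powr r) has_real_derivative r * (max z 0) powr (r - 1)) (at z)"
    and "((\<lambda>z. (max (-z) 0) powr r) has_real_derivative - (r * (max (-z) 0) powr (r - 1))) (at z)" by auto
qed

lemma ennreal_sum_sum:
  assumes "\<And>k l. k \<in> A \<Longrightarrow> l \<in> B \<Longrightarrow> 0 \<le> F k l"
  shows "ennreal (\<Sum>k\<in>A. \<Sum>l\<in>B. F k l) = (\<Sum>k\<in>A. \<Sum>l\<in>B. ennreal (F k l))"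
proof -
  have "(\<Sum>k\<in>A. \<Sum>l\<in>B. ennreal (F k l)) = (\<Sum>k\<in>A. ennreal (\<Sum>l\<in>B. F k l))"
    using assms by (intro sum.cong refl sum_ennreal) auto
  also have "\<dots> = ennreal (\<Sum>k\<in>A. \<Sum>l\<in>B. F k l)"
    using assms by (intro sum_ennreal sum_nonneg) auto
  finally show ?thesis by simp
qed

context fpar
begin

text \<open>An odd antiderivative of \<open>\<bar>z\<bar> powr (2*H-2)\<close>, and
  \<open>kG\<close> an even antiderivative of it. Both are continuous across 0 because 2H - 1 is
  positive, so the fundamental theorem of calculus may pass over the singularity.\<close>

definition kg :: "real \<Rightarrow> real" where
  "kg z = ((max z 0) powr (2*H-1) - (max (-z) 0) powr (2*H-1)) / (2*H-1)"

definition kG :: "real \<Rightarrow> real" where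
  "kG z = ((max z 0) powr (2*H) + (max (-z) 0) powr (2*H)) / (2*H*(2*H-1))"

lemma kG_eq: "kG z = \<bar>z\<bar> powr (2*H) / (2*H*(2*H-1))"
  using H by (cases "0 \<le> z") (auto simp: kG_def max_def abs_if)

lemma kg_deriv: "z \<noteq> 0 \<Longrightarrow> (kg has_real_derivative \<bar>z\<bar> powr (-(2-2*H))) (at z)"
proof -
  assume z: "z \<noteq> 0"
  have r: "0 < 2*H-1" using H by simp
  have "(kg has_real_derivative ((2*H-1) * (max z 0) powr (2*H-1-1) - - ((2*H-1) * (max (-z) 0) powr (2*H-1-1))) / (2*H-1)) (at z)"
    unfolding kg_def[abs_def]
    by (intro DERIV_cdivide DERIV_diff has_real_derivative_pos_part_powr[OF z r])
  moreover have "((2*H-1) * (max z 0) powr (2*H-1-1) - - ((2*H-1) * (max (-z) 0) powr (2*H-1-1))) / (2*H-1) = \<bar>z\<bar> powr (-(2-2*H))"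
    using r z by (cases "0 < z") (auto simp: max_def abs_if add_divide_distrib)
  ultimately show ?thesis by simp
qed

lemma kG_deriv: "z \<noteq> 0 \<Longrightarrow> (kG has_real_derivative kg z) (at z)"
proof -
  assume z: "z \<noteq> 0"
  have r: "0 < 2*H" "0 < 2*H-1" using H by auto
  have "(kG has_real_derivative ((2*H) * (max z 0) powr (2*H-1) + - ((2*H) * (max (-z) 0) powr (2*H-1))) / (2*H*(2*H-1))) (at z)"
    unfolding kG_def[abs_def]
    by (intro DERIV_cdivide DERIV_add has_real_derivative_pos_part_powr[OF z r(1)])
  moreover have "((2*H) * (max z 0) powr (2*H-1) + - ((2*H) * (max (-z) 0) powr (2*H-1))) / (2*H*(2*H-1)) = kg z"
    using r by (simp add: kg_def right_diff_distrib[symmetric])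
  ultimately show ?thesis by simp
qed

lemma kg_cont: "continuous_on S kg"
  unfolding kg_def[abs_def] using H by (intro continuous_intros continuous_on_powr') auto

lemma kG_cont: "continuous_on S kG"
  unfolding kG_def[abs_def] using H by (intro continuous_intros continuous_on_powr') auto

lemma kg_measurable [measurable]: "kg \<in> borel_measurable borel"
  by (intro borel_measurable_continuous_onI kg_cont)

lemma kernel_inner_integral:
  assumes "u1 \<le> u2"
  shows "(\<integral>\<^sup>+a. ennreal (indicator {u1..u2} a * \<bar>a - b\<bar> powr (-(2-2*H))) \<partial>lborel) = ennreal (kg (u2 - b) - kg (u1 - b))"
proof (rule nn_integral_has_integral_lborel)
  have "((\<lambda>a. \<bar>a - b\<bar> powr (-(2-2*H))) has_integral (kg (u2 - b) - kg (u1 - b))) {u1..u2}"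
  proof (rule fundamental_theorem_of_calculus_interior_strong[where S="{b}"])
    show "continuous_on {u1..u2} (\<lambda>a. kg (a - b))"
      by (rule continuous_on_compose2[OF kg_cont[of UNIV]]) (auto intro!: continuous_intros)
    fix a assume "a \<in> {u1<..<u2} - {b}"
    then have "((\<lambda>a. kg (a - b)) has_real_derivative \<bar>a - b\<bar> powr (-(2-2*H)) * 1) (at a)"
      by (intro DERIV_chain2[of kg] kg_deriv) (auto intro!: derivative_eq_intros)
    then show "((\<lambda>a. kg (a - b)) has_vector_derivative \<bar>a - b\<bar> powr (-(2-2*H))) (at a)"
      by (simp add: has_real_derivative_iff_has_vector_derivative)
  qed (use assms in auto)
  then show "((\<lambda>a. indicator {u1..u2} a * \<bar>a - b\<bar> powr (-(2-2*H))) has_integral (kg (u2 - b) - kg (u1 - b))) UNIV"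
    by (rule has_integral_indicator)
qed auto

text \<open>Two applications of the fundamental theorem with the singular points as exceptions. The
  sign is recorded separately because \<open>ennreal\<close> would hide a negative value.\<close>

lemma kernel_rect_integral:
  assumes u: "u1 \<le> u2" and v: "v1 \<le> v2"
  shows "(\<integral>\<^sup>+b. (\<integral>\<^sup>+a. ennreal (indicator {u1..u2} a * indicator {v1..v2} b * \<bar>a - b\<bar> powr (-(2-2*H))) \<partial>lborel) \<partial>lborel) =
    ennreal (kG (u2 - v1) - kG (u2 - v2) - kG (u1 - v1) + kG (u1 - v2))" (is ?nn)
    and "0 \<le> kG (u2 - v1) - kG (u2 - v2) - kG (u1 - v1) + kG (u1 - v2)" (is ?pos)
proof -
  have nn: "0 \<le> kg (u2 - b) - kg (u1 - b)" for b
  proof -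
    have "kg (u1 - b) \<le> kg (u2 - b)"
      unfolding kg_def using u H by (intro divide_right_mono diff_mono powr_mono2) auto
    then show ?thesis by simp
  qed
  have "(\<integral>\<^sup>+b. (\<integral>\<^sup>+a. ennreal (indicator {u1..u2} a * indicator {v1..v2} b * \<bar>a - b\<bar> powr (-(2-2*H))) \<partial>lborel) \<partial>lborel) =
    (\<integral>\<^sup>+b. ennreal (indicator {v1..v2} b * (kg (u2 - b) - kg (u1 - b))) \<partial>lborel)"
  proof (intro nn_integral_cong)
    fix b
    show "(\<integral>\<^sup>+a. ennreal (indicator {u1..u2} a * indicator {v1..v2} b * \<bar>a - b\<bar> powr (-(2-2*H))) \<partial>lborel) =
       ennreal (indicator {v1..v2} b * (kg (u2 - b) - kg (u1 - b)))"
      using kernel_inner_integral[OF u, of b] by (cases "b \<in> {v1..v2}") auto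
  qed
  moreover have hi: "((\<lambda>b. indicator {v1..v2} b * (kg (u2 - b) - kg (u1 - b))) has_integral (kG (u2 - v1) - kG (u2 - v2) - kG (u1 - v1) + kG (u1 - v2))) UNIV"
  proof -
    have "((\<lambda>b. kg (u2 - b) - kg (u1 - b)) has_integral ((- kG (u2 - v2) + kG (u1 - v2)) - (- kG (u2 - v1) + kG (u1 - v1)))) {v1..v2}"
    proof (rule fundamental_theorem_of_calculus_interior_strong[where S="{u1,u2}"])
      show "continuous_on {v1..v2} (\<lambda>b. - kG (u2 - b) + kG (u1 - b))"
        by (intro continuous_intros continuous_on_compose2[OF kG_cont[of UNIV]]) auto
      fix b assume b: "b \<in> {v1<..<v2} - {u1,u2}"
      have "((\<lambda>b. kG (u - b)) has_real_derivative kg (u - b) * (-1)) (at b)" if "u \<noteq> b" for u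
        using that by (intro DERIV_chain2[of kG] kG_deriv) (auto intro!: derivative_eq_intros)
      from DERIV_add[OF DERIV_minus[OF this[of u2]] this[of u1]] b
      have "((\<lambda>b. - kG (u2 - b) + kG (u1 - b)) has_real_derivative kg (u2 - b) - kg (u1 - b)) (at b)" by auto
      then show "((\<lambda>b. - kG (u2 - b) + kG (u1 - b)) has_vector_derivative kg (u2 - b) - kg (u1 - b)) (at b)"
        by (simp add: has_real_derivative_iff_has_vector_derivative)
    qed (use v in auto)
    then show ?thesis
      by (intro has_integral_indicator) (simp add: algebra_simps)
  qed
  moreover have nn': "0 \<le> indicator {v1..v2} b * (kg (u2 - b) - kg (u1 - b))" for b using nn by simp
  moreover have "(\<integral>\<^sup>+b. ennreal (indicator {v1..v2} b * (kg (u2 - b) - kg (u1 - b))) \<partial>lborel) =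
    ennreal (kG (u2 - v1) - kG (u2 - v2) - kG (u1 - v1) + kG (u1 - v2))"
    by (rule nn_integral_has_integral_lborel[OF _ nn' hi]) measurable
  ultimately show ?nn by simp
  show ?pos by (rule has_integral_nonneg[OF hi]) (rule nn')
qed

text \<open>The rectangular difference removes the terms depending on one time only and leaves those
  in the time differences, which are multiples of \<open>kG\<close>. This is where the factor
  H(2H-1) of the covariance formula arises.\<close>

lemma fbm_cov_rect:
  "fbm_cov H u2 v2 - fbm_cov H u2 v1 - fbm_cov H u1 v2 + fbm_cov H u1 v1 =
     H * (2*H-1) * (kG (u2 - v1) - kG (u2 - v2) - kG (u1 - v1) + kG (u1 - v2))"
proof -
  define C where "C = 2*H*(2*H-1)"
  have C: "C \<noteq> 0" "H * (2*H-1) = C / 2" using H by (auto simp: C_def)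
  have "C / 2 * (kG (u2 - v1) - kG (u2 - v2) - kG (u1 - v1) + kG (u1 - v2)) =
    (\<bar>u2 - v1\<bar> powr (2*H) - \<bar>u2 - v2\<bar> powr (2*H) - \<bar>u1 - v1\<bar> powr (2*H) + \<bar>u1 - v2\<bar> powr (2*H)) / 2"
    unfolding kG_eq C_def[symmetric] using C(1) by (simp add: field_simps)
  then show ?thesis unfolding C(2) by (simp add: fbm_cov_def abs_minus_commute field_simps)
qed

text \<open>The kernel frozen at the left endpoints of the uniform partition of [0,t]: the integrand
  whose Wiener integral is the Riemann sum \<open>rs_sum\<close>. For positive t left endpoints
  never reach the singularity at t.\<close>

definition stepf :: "real \<Rightarrow> nat \<Rightarrow> real \<Rightarrow> real" where
  "stepf t n a = (\<Sum>k<n. (t - real k * t / real n) powr (\<alpha> - 1) * indicator {real k * t / real n ..< real (Suc k) * t / real n} a)"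

lemma stepf_measurable [measurable]: "stepf t n \<in> borel_measurable borel"
  unfolding stepf_def[abs_def] by measurable

lemma stepf_nonneg: "0 \<le> stepf t n a"
  unfolding stepf_def by (intro sum_nonneg) auto

lemma stepf_eq_0:
  assumes "0 \<le> t" "a < 0 \<or> t \<le> a"
  shows "stepf t n a = 0"
  unfolding stepf_def
proof (intro sum.neutral ballI)
  fix k assume k: "k \<in> {..<n}"
  have "real (Suc k) * t / real n \<le> t"
  proof -
    have "real (Suc k) * t \<le> real n * t" using k assms by (intro mult_right_mono) auto
    then show ?thesis using k by (simp add: field_simps)
  qed
  moreover have "0 \<le> real k * t / real n" using assms by simp
  ultimately have "a \<notin> {real k * t / real n ..< real (Suc k) * t / real n}"
    using assms(2) unfolding atLeastLessThan_iff by linarith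
  then show "(t - real k * t / real n) powr (\<alpha> - 1) * indicator {real k * t / real n ..< real (Suc k) * t / real n} a = 0" by simp
qed

lemma stepf_eq:
  assumes a: "0 \<le> a" "a < t" and n: "0 < n"
  shows "\<exists>x. x \<le> a \<and> a < x + t / real n \<and> stepf t n a = (t - x) powr (\<alpha> - 1)"
proof -
  define k where "k = nat \<lfloor>a * real n / t\<rfloor>"
  have t: "0 < t" using a by simp
  have y0: "0 \<le> a * real n / t" using a t by simp
  have k1: "real k \<le> a * real n / t" "a * real n / t < real k + 1"
    using y0 by (auto simp: k_def)
  have x1: "real k * t / real n \<le> a" using k1(1) t n by (simp add: field_simps)
  have x2: "a < real (Suc k) * t / real n" using k1(2) t n by (simp add: field_simps)
  have "real k < real n"
  proof -
    have "a * real n / t < real n" using a t n by (simp add: field_simps)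
    then show ?thesis using k1(1) by linarith
  qed
  then have kn: "k < n" by simp
  have other: "indicator {real j * t / real n ..< real (Suc j) * t / real n} a = (0::real)" if "j \<noteq> k" for j
  proof -
    have "a \<notin> {real j * t / real n ..< real (Suc j) * t / real n}"
    proof
      assume j: "a \<in> {real j * t / real n ..< real (Suc j) * t / real n}"
      then have "real j * t / real n < real (Suc k) * t / real n" "real k * t / real n < real (Suc j) * t / real n"
        using x1 x2 by auto
      then have "real j < real (Suc k)" "real k < real (Suc j)" using t n by (simp_all add: divide_less_cancel del: of_nat_Suc)
      then show False using that by auto
    qed
    then show ?thesis by simp
  qed
  have "stepf t n a = (t - real k * t / real n) powr (\<alpha> - 1) * indicator {real k * t / real n ..< real (Suc k) * t / real n} a
      + (\<Sum>j\<in>{..<n}-{k}. (t - real j * t / real n) powr (\<alpha> - 1) * indicator {real j * t / real n ..< real (Suc j) * t / real n} a)"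
    unfolding stepf_def using kn by (subst sum.remove[of _ k]) auto
  also have "(\<Sum>j\<in>{..<n}-{k}. (t - real j * t / real n) powr (\<alpha> - 1) * indicator {real j * t / real n ..< real (Suc j) * t / real n} a) = 0"
    using other by (intro sum.neutral) auto
  finally have "stepf t n a = (t - real k * t / real n) powr (\<alpha> - 1)" using x1 x2 by simp
  then show ?thesis using x1 x2 by (intro exI[of _ "real k * t / real n"]) (auto simp: add_divide_distrib algebra_simps)
qed

text \<open>The kernel increases in its integration variable, so freezing at left endpoints stays
  below it. This is the majorant for dominated convergence of the energies.\<close>

lemma stepf_le:
  assumes "0 \<le> t"
  shows "stepf t n a \<le> fk \<alpha> t a"
proof (cases "0 \<le> a \<and> a < t \<and> 0 < n")
  case True
  then obtain x where "x \<le> a" "stepf t n a = (t - x) powr (\<alpha> - 1)" using stepf_eq by blast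
  then show ?thesis using True \<alpha> by (simp add: fk_def) (intro powr_mono2', auto)
next
  case False
  then consider "a < 0 \<or> t \<le> a" | "n = 0" by auto
  then show ?thesis
  proof cases
    case 1 then show ?thesis using stepf_eq_0[OF assms] by simp
  next
    case 2 then show ?thesis by (simp add: stepf_def)
  qed
qed

lemma stepf_tendsto:
  assumes "0 \<le> t"
  shows "(\<lambda>n. stepf t n a) \<longlonglongrightarrow> fk \<alpha> t a"
proof (cases "0 \<le> a \<and> a < t")
  case False
  then have "stepf t n a = 0" for n using stepf_eq_0[OF assms, of a n] by force
  then show ?thesis using False by (auto simp: fk_def)
next
  case True
  define x where "x n = (SOME x. x \<le> a \<and> a < x + t / real n \<and> stepf t n a = (t - x) powr (\<alpha> - 1))" for n
  have x: "x n \<le> a \<and> a < x n + t / real n \<and> stepf t n a = (t - x n) powr (\<alpha> - 1)" if "0 < n" for n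
    unfolding x_def using True by (intro someI_ex[OF stepf_eq[OF _ _ that]]) auto
  have "x \<longlonglongrightarrow> a"
  proof (rule tendsto_sandwich)
    have "(\<lambda>n. a - t / real n) \<longlonglongrightarrow> a - 0" by (intro tendsto_intros lim_const_over_n)
    then show "(\<lambda>n. a - t / real n) \<longlonglongrightarrow> a" by simp
    show "\<forall>\<^sub>F n in sequentially. a - t / real n \<le> x n"
      using eventually_gt_at_top[of 0]
    proof eventually_elim
      case (elim n)
      show ?case using x[OF elim] by linarith
    qed
    show "\<forall>\<^sub>F n in sequentially. x n \<le> a"
      using eventually_gt_at_top[of 0]
    proof eventually_elim
      case (elim n)
      show ?case using x[OF elim] by linarith
    qed
  qed simp
  then have "(\<lambda>n. (t - x n) powr (\<alpha> - 1)) \<longlonglongrightarrow> (t - a) powr (\<alpha> - 1)"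
    using True by (intro tendsto_intros) auto
  moreover have "\<forall>\<^sub>F n in sequentially. (t - x n) powr (\<alpha> - 1) = stepf t n a"
    using eventually_gt_at_top[of 0]
  proof eventually_elim
    case (elim n)
    show ?case using x[OF elim] by simp
  qed
  ultimately have "(\<lambda>n. stepf t n a) \<longlonglongrightarrow> (t - a) powr (\<alpha> - 1)" by (rule Lim_transform_eventually)
  then show ?thesis using True by (simp add: fk_def)
qed

lemma en_pair:
  assumes [measurable]: "f \<in> borel_measurable borel" "g \<in> borel_measurable borel"
  shows "en f g = (\<integral>\<^sup>+p. ennreal (f (fst p) * g (snd p) * \<bar>fst p - snd p\<bar> powr (-(2-2*H))) \<partial>(lborel \<Otimes>\<^sub>M lborel))"
  unfolding en_def
  by (subst lborel_pair.nn_integral_snd[symmetric]) (simp_all add: case_prod_beta')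

lemma en_stepf_tendsto:
  assumes t: "t \<in> {0..T}" "t' \<in> {0..T}"
  shows "(\<lambda>n. en (stepf t n) (stepf t' n)) \<longlonglongrightarrow> en (fk \<alpha> t) (fk \<alpha> t')"
proof -
  obtain C where "en (fk \<alpha> t) (fk \<alpha> t') \<le> ennreal C" using en_fk_fk t by blast
  then have fin: "en (fk \<alpha> t) (fk \<alpha> t') < \<infinity>" by (auto intro: le_less_trans)
  have [simp]: "0 \<le> t" "0 \<le> t'" using t by auto
  show ?thesis
    unfolding en_pair[OF stepf_measurable stepf_measurable] en_pair[OF fk_measurable fk_measurable]
  proof (rule nn_integral_dominated_convergence)
    show "(\<integral>\<^sup>+p. ennreal (fk \<alpha> t (fst p) * fk \<alpha> t' (snd p) * \<bar>fst p - snd p\<bar> powr (-(2-2*H))) \<partial>(lborel \<Otimes>\<^sub>M lborel)) < \<infinity>"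
      using fin by (simp add: en_pair)
    show "AE p in lborel \<Otimes>\<^sub>M lborel. ennreal (stepf t n (fst p) * stepf t' n (snd p) * \<bar>fst p - snd p\<bar> powr (-(2-2*H)))
       \<le> ennreal (fk \<alpha> t (fst p) * fk \<alpha> t' (snd p) * \<bar>fst p - snd p\<bar> powr (-(2-2*H)))" for n
      by (intro AE_I2 ennreal_leI mult_right_mono mult_mono stepf_le stepf_nonneg) auto
    show "AE p in lborel \<Otimes>\<^sub>M lborel. (\<lambda>n. ennreal (stepf t n (fst p) * stepf t' n (snd p) * \<bar>fst p - snd p\<bar> powr (-(2-2*H))))
       \<longlonglongrightarrow> ennreal (fk \<alpha> t (fst p) * fk \<alpha> t' (snd p) * \<bar>fst p - snd p\<bar> powr (-(2-2*H)))"
      by (intro AE_I2 tendsto_ennrealI tendsto_mult tendsto_const stepf_tendsto) auto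
  qed measurable
qed

text \<open>Bilinearity plus the rectangle formula, half-open and closed cells differing by null
  sets. The result is the same finite sum that the covariance of two Riemann sums produces.\<close>

lemma en_sum_indicator:
  assumes c: "\<And>k. 0 \<le> c k" and d: "\<And>l. 0 \<le> d l"
    and u: "\<And>k. k < n \<Longrightarrow> u k \<le> u (Suc k)" and v: "\<And>l. l < m \<Longrightarrow> v l \<le> v (Suc l)"
  shows "en (\<lambda>a. \<Sum>k<n. c k * indicator {u k..<u (Suc k)} a) (\<lambda>b. \<Sum>l<m. d l * indicator {v l..<v (Suc l)} b) =
    ennreal (\<Sum>k<n. \<Sum>l<m. c k * d l * (kG (u (Suc k) - v l) - kG (u (Suc k) - v (Suc l)) - kG (u k - v l) + kG (u k - v (Suc l))))"
proof -
  let ?E = "\<lambda>k l. \<integral>\<^sup>+p. ennreal (indicator {u k..<u (Suc k)} (fst p) * indicator {v l..<v (Suc l)} (snd p) * \<bar>fst p - snd p\<bar> powr (-(2-2*H))) \<partial>(lborel \<Otimes>\<^sub>M lborel)"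
  let ?K = "\<lambda>k l. kG (u (Suc k) - v l) - kG (u (Suc k) - v (Suc l)) - kG (u k - v l) + kG (u k - v (Suc l))"
  have E: "?E k l = ennreal (?K k l)" if "k < n" "l < m" for k l
  proof -
    have "?E k l = en (indicator {u k..<u (Suc k)}) (indicator {v l..<v (Suc l)})"
      by (subst en_pair) auto
    also have "\<dots> = (\<integral>\<^sup>+b. (\<integral>\<^sup>+a. ennreal (indicator {u k..u (Suc k)} a * indicator {v l..v (Suc l)} b * \<bar>a - b\<bar> powr (-(2-2*H))) \<partial>lborel) \<partial>lborel)"
      unfolding en_def
    proof (intro nn_integral_cong_AE)
      show "AE b in lborel. (\<integral>\<^sup>+a. ennreal (indicator {u k..<u (Suc k)} a * indicator {v l..<v (Suc l)} b * \<bar>a - b\<bar> powr (-(2-2*H))) \<partial>lborel) =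
        (\<integral>\<^sup>+a. ennreal (indicator {u k..u (Suc k)} a * indicator {v l..v (Suc l)} b * \<bar>a - b\<bar> powr (-(2-2*H))) \<partial>lborel)"
        using AE_lborel_singleton[of "v (Suc l)"]
      proof eventually_elim
        case (elim b)
        show ?case
        proof (intro nn_integral_cong_AE)
          show "AE a in lborel. ennreal (indicator {u k..<u (Suc k)} a * indicator {v l..<v (Suc l)} b * \<bar>a - b\<bar> powr (-(2-2*H))) =
             ennreal (indicator {u k..u (Suc k)} a * indicator {v l..v (Suc l)} b * \<bar>a - b\<bar> powr (-(2-2*H)))"
            using AE_lborel_singleton[of "u (Suc k)"]
          proof eventually_elim
            case (elim a)
            have "a \<in> {u k..<u (Suc k)} \<longleftrightarrow> a \<in> {u k..u (Suc k)}" using elim by auto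
            moreover have "b \<in> {v l..<v (Suc l)} \<longleftrightarrow> b \<in> {v l..v (Suc l)}" using \<open>b \<noteq> v (Suc l)\<close> by auto
            ultimately show ?case by (simp only: indicator_def)
          qed
        qed
      qed
    qed
    also have "\<dots> = ennreal (?K k l)" using that by (intro kernel_rect_integral u v)
    finally show ?thesis .
  qed
  have Knn: "0 \<le> ?K k l" if "k < n" "l < m" for k l
    using that by (intro kernel_rect_integral u v)
  let ?e = "\<lambda>k l p. ennreal (indicator {u k..<u (Suc k)} (fst p) * indicator {v l..<v (Suc l)} (snd p) * \<bar>fst p - snd p\<bar> powr (-(2-2*H)))"
  have "en (\<lambda>a. \<Sum>k<n. c k * indicator {u k..<u (Suc k)} a) (\<lambda>b. \<Sum>l<m. d l * indicator {v l..<v (Suc l)} b) =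
     (\<integral>\<^sup>+p. (\<Sum>k<n. \<Sum>l<m. ennreal (c k * d l) * ?e k l p) \<partial>(lborel \<Otimes>\<^sub>M lborel))"
  proof -
    have m1: "(\<lambda>a. \<Sum>k<n. c k * indicator {u k..<u (Suc k)} a) \<in> borel_measurable borel"
      and m2: "(\<lambda>b. \<Sum>l<m. d l * indicator {v l..<v (Suc l)} b) \<in> borel_measurable borel"
      by (intro borel_measurable_sum borel_measurable_times borel_measurable_const borel_measurable_indicator; simp)+
    show ?thesis unfolding en_pair[OF m1 m2]
    proof (intro nn_integral_cong)
      fix p :: "real \<times> real"
      let ?x = "\<lambda>k. indicator {u k..<u (Suc k)} (fst p) :: real" and ?y = "\<lambda>l. indicator {v l..<v (Suc l)} (snd p) :: real"
      let ?z = "\<bar>fst p - snd p\<bar> powr (-(2-2*H))"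
      have s: "(\<Sum>k<n. c k * ?x k) * (\<Sum>l<m. d l * ?y l) * ?z = (\<Sum>k<n. \<Sum>l<m. (c k * d l) * (?x k * ?y l * ?z))"
        unfolding sum_product unfolding sum_distrib_right by (intro sum.cong refl) (simp only: mult_ac)
      have "ennreal (\<Sum>k<n. \<Sum>l<m. (c k * d l) * (?x k * ?y l * ?z)) = (\<Sum>k<n. \<Sum>l<m. ennreal ((c k * d l) * (?x k * ?y l * ?z)))"
        using c d by (intro ennreal_sum_sum mult_nonneg_nonneg) auto
      also have "\<dots> = (\<Sum>k<n. \<Sum>l<m. ennreal (c k * d l) * ?e k l p)"
        using c d by (intro sum.cong refl ennreal_mult) auto
      finally show "ennreal ((\<Sum>k<n. c k * ?x k) * (\<Sum>l<m. d l * ?y l) * ?z) = (\<Sum>k<n. \<Sum>l<m. ennreal (c k * d l) * ?e k l p)"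
        unfolding s .
    qed
  qed
  also have "\<dots> = (\<Sum>k<n. \<Sum>l<m. ennreal (c k * d l) * ?E k l)"
  proof -
    have em: "(\<lambda>p. ?e k l p) \<in> borel_measurable (lborel \<Otimes>\<^sub>M lborel)" for k l by measurable
    have "(\<integral>\<^sup>+p. (\<Sum>k<n. \<Sum>l<m. ennreal (c k * d l) * ?e k l p) \<partial>(lborel \<Otimes>\<^sub>M lborel)) =
       (\<Sum>k<n. \<integral>\<^sup>+p. (\<Sum>l<m. ennreal (c k * d l) * ?e k l p) \<partial>(lborel \<Otimes>\<^sub>M lborel))"
      by (intro nn_integral_sum borel_measurable_sum borel_measurable_times em) simp_all
    also have "\<dots> = (\<Sum>k<n. \<Sum>l<m. \<integral>\<^sup>+p. ennreal (c k * d l) * ?e k l p \<partial>(lborel \<Otimes>\<^sub>M lborel))"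
      by (intro sum.cong refl nn_integral_sum borel_measurable_times em) simp_all
    also have "\<dots> = (\<Sum>k<n. \<Sum>l<m. ennreal (c k * d l) * ?E k l)"
      by (intro sum.cong refl nn_integral_cmult em)
    finally show ?thesis .
  qed
  also have "\<dots> = (\<Sum>k<n. \<Sum>l<m. ennreal (c k * d l * ?K k l))"
    using E c d Knn by (intro sum.cong refl) (simp add: ennreal_mult)
  also have "\<dots> = ennreal (\<Sum>k<n. \<Sum>l<m. c k * d l * ?K k l)"
    using c d Knn by (intro ennreal_sum_sum[symmetric] mult_nonneg_nonneg) auto
  finally show ?thesis .
qed

end

section \<open>The Volterra noise: its covariances as energies\<close>

locale fbm_setting = fpar +
  fixes M :: "'a measure" and W :: "real \<Rightarrow> 'a \<Rightarrow> real" and \<sigma> :: real and G :: "real \<Rightarrow> 'a \<Rightarrow> real"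
  assumes W: "is_fbm M H W" and \<sigma>: "0 < \<sigma>"
    and G: "\<And>t. t \<in> {0..T} \<Longrightarrow> is_wiener_integral M W (\<lambda>s. \<sigma> / Gamma \<alpha> * (t - s) powr (\<alpha> - 1)) 0 t (G t)"
begin

sublocale gauss_space M "fbm_space M W"
  by (rule gauss_space_fbm[OF W])

abbreviation "VV \<equiv> fbm_space M W"

definition "a0 = \<sigma> / Gamma \<alpha>"

lemma a0: "0 < a0"
  unfolding a0_def using \<sigma> \<alpha>0 by (intro divide_pos_pos Gamma_real_pos)

definition Y :: "real \<Rightarrow> nat \<Rightarrow> 'a \<Rightarrow> real" where
  "Y t n = rs_sum W (\<lambda>s. a0 * (t - s) powr (\<alpha> - 1)) 0 t n"

definition dW :: "real \<Rightarrow> nat \<Rightarrow> nat \<Rightarrow> 'a \<Rightarrow> real" where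
  "dW t n k w = W (real (Suc k) * t / real n) w - W (real k * t / real n) w"

lemma Y_eq: "Y t n w = (\<Sum>k<n. (a0 * (t - real k * t / real n) powr (\<alpha> - 1)) * dW t n k w)"
  by (simp add: Y_def rs_sum_def dW_def)

lemma dW_span: "0 \<le> t \<Longrightarrow> dW t n k \<in> fbm_span W"
proof -
  assume t: "0 \<le> t"
  have "(\<lambda>w. 1 * W (real (Suc k) * t / real n) w + (-1) * W (real k * t / real n) w) \<in> fbm_span W"
    using t by (intro fbm_span_lin fbm_span_W) auto
  moreover have "dW t n k = (\<lambda>w. 1 * W (real (Suc k) * t / real n) w + (-1) * W (real k * t / real n) w)"
    by (simp add: dW_def fun_eq_iff)
  ultimately show ?thesis by simp
qed

lemma Y_span: "0 \<le> t \<Longrightarrow> Y t n \<in> fbm_span W"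
  using fbm_span_sum[of n "dW t n" W "\<lambda>k. a0 * (t - real k * t / real n) powr (\<alpha> - 1)"] dW_span
  by (simp add: Y_eq[abs_def])

lemma span_sq: "X \<in> fbm_span W \<Longrightarrow> X \<in> borel_measurable M \<and> integrable M (\<lambda>w. (X w)\<^sup>2)"
  using fbm_span_gaussian[OF W] centered_gaussian_char by blast

lemma L2_lim_G: "t \<in> {0..T} \<Longrightarrow> L2_lim M (Y t) (G t)"
  using G[of t] Y_span[of t] span_sq
  unfolding L2_lim_def is_wiener_integral_def Y_def a0_def by auto

lemma G_VV: "t \<in> {0..T} \<Longrightarrow> G t \<in> VV"
  unfolding fbm_space_def mem_Collect_eq
  by (intro exI[of _ "Y t"] conjI allI Y_span L2_lim_G) auto

definition "cH = a0\<^sup>2 * (H * (2*H-1))"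

lemma cH: "0 < cH"
  unfolding cH_def using a0 H by (intro mult_pos_pos) auto

lemma expectation_dW:
  fixes n m :: nat
  assumes t: "0 \<le> t" "0 \<le> t'"
  defines "u \<equiv> \<lambda>k. real k * t / real n" and "v \<equiv> \<lambda>l. real l * t' / real m"
  shows "expectation (\<lambda>w. dW t n k w * dW t' m l w) =
     H * (2*H-1) * (kG (u (Suc k) - v l) - kG (u (Suc k) - v (Suc l)) - kG (u k - v l) + kG (u k - v (Suc l)))"
proof -
  have u: "0 \<le> u k" for k using t by (simp add: u_def)
  have v: "0 \<le> v k" for k using t by (simp add: v_def)
  have i: "integrable M (\<lambda>w. W x w * W y w)" if "0 \<le> x" "0 \<le> y" for x y
    using span_sq[OF fbm_span_W[OF that(1)]] span_sq[OF fbm_span_W[OF that(2)]] by (intro integrable_mult_sq) auto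
  have "expectation (\<lambda>w. dW t n k w * dW t' m l w) = expectation (\<lambda>w. W (u (Suc k)) w * W (v (Suc l)) w
     - W (u (Suc k)) w * W (v l) w - W (u k) w * W (v (Suc l)) w + W (u k) w * W (v l) w)"
    unfolding dW_def u_def v_def by (intro Bochner_Integration.integral_cong) (auto simp: algebra_simps)
  also have "\<dots> = fbm_cov H (u (Suc k)) (v (Suc l)) - fbm_cov H (u (Suc k)) (v l) - fbm_cov H (u k) (v (Suc l)) + fbm_cov H (u k) (v l)"
    using i u v fbm_expectation[OF W u v] by simp
  also have "\<dots> = H * (2*H-1) * (kG (u (Suc k) - v l) - kG (u (Suc k) - v (Suc l)) - kG (u k - v l) + kG (u k - v (Suc l)))"
    by (rule fbm_cov_rect)
  finally show ?thesis .
qed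

text \<open>Riemann sums are finite combinations of increments of \<open>W\<close>, whose
  covariances are second differences of \<open>kG\<close>; so are the energies of the step kernels.
  Nonnegativity is needed to return from ennreal to real numbers.\<close>

lemma expectation_Y:
  assumes t: "0 \<le> t" "0 \<le> t'"
  shows "ennreal (expectation (\<lambda>w. Y t n w * Y t' n w)) = ennreal cH * en (stepf t n) (stepf t' n)"
    and "0 \<le> expectation (\<lambda>w. Y t n w * Y t' n w)"
proof -
  let ?c = "\<lambda>k. (t - real k * t / real n) powr (\<alpha> - 1)" and ?d = "\<lambda>k. (t' - real k * t' / real n) powr (\<alpha> - 1)"
  define u where "u k = real k * t / real n" for k
  define v where "v k = real k * t' / real n" for k
  let ?K = "\<lambda>k l. kG (u (Suc k) - v l) - kG (u (Suc k) - v (Suc l)) - kG (u k - v l) + kG (u k - v (Suc l))"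
  have u: "u k \<le> u (Suc k)" for k using t by (auto simp: u_def intro!: divide_right_mono mult_right_mono)
  have v: "v k \<le> v (Suc k)" for k using t by (auto simp: v_def intro!: divide_right_mono mult_right_mono)
  have i: "integrable M (\<lambda>w. dW t n k w * dW t' n l w)" for k l
    using span_sq[OF dW_span[OF t(1)]] span_sq[OF dW_span[OF t(2)]] by (intro integrable_mult_sq) auto
  have "expectation (\<lambda>w. Y t n w * Y t' n w) = expectation (\<lambda>w. \<Sum>k<n. \<Sum>l<n. (a0\<^sup>2 * (?c k * ?d l)) * (dW t n k w * dW t' n l w))"
    unfolding Y_eq by (intro Bochner_Integration.integral_cong) (simp_all add: sum_product power2_eq_square mult_ac)
  also have "\<dots> = (\<Sum>k<n. \<Sum>l<n. (a0\<^sup>2 * (?c k * ?d l)) * expectation (\<lambda>w. dW t n k w * dW t' n l w))"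
    using i by (simp add: Bochner_Integration.integral_sum)
  also have "\<dots> = (\<Sum>k<n. \<Sum>l<n. (a0\<^sup>2 * (?c k * ?d l)) * (H * (2*H-1) * ?K k l))"
    unfolding expectation_dW[OF t] u_def v_def ..
  also have "\<dots> = cH * (\<Sum>k<n. \<Sum>l<n. ?c k * ?d l * ?K k l)"
    by (simp add: cH_def sum_distrib_left mult_ac)
  finally have eq: "expectation (\<lambda>w. Y t n w * Y t' n w) = cH * (\<Sum>k<n. \<Sum>l<n. ?c k * ?d l * ?K k l)" .
  have nn: "0 \<le> (\<Sum>k<n. \<Sum>l<n. ?c k * ?d l * ?K k l)"
    by (intro sum_nonneg mult_nonneg_nonneg kernel_rect_integral u v) auto
  have "en (stepf t n) (stepf t' n) = ennreal (\<Sum>k<n. \<Sum>l<n. ?c k * ?d l * ?K k l)"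
    unfolding stepf_def[abs_def] u_def[symmetric] v_def[symmetric]
    by (rule en_sum_indicator) (use u v in auto)
  then show "ennreal (expectation (\<lambda>w. Y t n w * Y t' n w)) = ennreal cH * en (stepf t n) (stepf t' n)"
    unfolding eq using cH nn by (simp add: ennreal_mult)
  show "0 \<le> expectation (\<lambda>w. Y t n w * Y t' n w)" unfolding eq using cH nn by simp
qed

text \<open>Limit of the identity for Riemann sums: the left side converges since \<open>G\<close>
  is an L2 limit, the right side by dominated convergence.\<close>

lemma expectation_G_en:
  assumes t: "t \<in> {0..T}" "t' \<in> {0..T}"
  shows "ennreal (expectation (\<lambda>w. G t w * G t' w)) = ennreal cH * en (fk \<alpha> t) (fk \<alpha> t')"
    and "0 \<le> expectation (\<lambda>w. G t w * G t' w)"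
proof -
  have t0: "0 \<le> t" "0 \<le> t'" using t by auto
  have lim: "(\<lambda>n. expectation (\<lambda>w. Y t n w * Y t' n w)) \<longlonglongrightarrow> expectation (\<lambda>w. G t w * G t' w)"
    by (intro L2_lim_mult L2_lim_G t)
  then have 1: "(\<lambda>n. ennreal cH * en (stepf t n) (stepf t' n)) \<longlonglongrightarrow> ennreal (expectation (\<lambda>w. G t w * G t' w))"
    unfolding expectation_Y(1)[OF t0, symmetric] by (rule tendsto_ennrealI)
  have 2: "(\<lambda>n. ennreal cH * en (stepf t n) (stepf t' n)) \<longlonglongrightarrow> ennreal cH * en (fk \<alpha> t) (fk \<alpha> t')"
    by (intro ennreal_tendsto_cmult en_stepf_tendsto t) simp
  show "ennreal (expectation (\<lambda>w. G t w * G t' w)) = ennreal cH * en (fk \<alpha> t) (fk \<alpha> t')"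
    by (rule LIMSEQ_unique[OF 1 2])
  show "0 \<le> expectation (\<lambda>w. G t w * G t' w)"
    by (rule LIMSEQ_le_const[OF lim]) (use expectation_Y(2)[OF t0] in auto)
qed

text \<open>Real-valued integrand of the energy. Covariances of increments are differences of
  energies, and these cannot be formed in ennreal.\<close>

definition eR :: "(real \<Rightarrow> real) \<Rightarrow> (real \<Rightarrow> real) \<Rightarrow> real \<times> real \<Rightarrow> real" where
  "eR f g p = f (fst p) * g (snd p) * \<bar>fst p - snd p\<bar> powr (-(2-2*H))"

lemma eR_ibound:
  assumes [measurable]: "f \<in> borel_measurable borel" "g \<in> borel_measurable borel"
    and nn: "\<And>a. 0 \<le> f a" "\<And>a. 0 \<le> g a" and e: "en f g \<le> ennreal A" "0 \<le> A"
  shows "ibound (lborel \<Otimes>\<^sub>M lborel) (eR f g) A"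
  unfolding ibound_def
proof (intro conjI allI)
  show "eR f g \<in> borel_measurable (lborel \<Otimes>\<^sub>M lborel)" unfolding eR_def[abs_def] by measurable
  show "0 \<le> eR f g p" for p unfolding eR_def using nn by simp
  show "(\<integral>\<^sup>+p. ennreal (eR f g p) \<partial>(lborel \<Otimes>\<^sub>M lborel)) \<le> ennreal A"
    unfolding eR_def using e(1) en_pair[of f g] by simp
qed (fact e)

lemma expectation_G:
  assumes t: "t \<in> {0..T}" "t' \<in> {0..T}"
  shows "integrable (lborel \<Otimes>\<^sub>M lborel) (eR (fk \<alpha> t) (fk \<alpha> t'))"
    "expectation (\<lambda>w. G t w * G t' w) = cH * (\<integral>p. eR (fk \<alpha> t) (fk \<alpha> t') p \<partial>(lborel \<Otimes>\<^sub>M lborel))"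
proof -
  obtain C where C: "0 < C" "en (fk \<alpha> t) (fk \<alpha> t') \<le> ennreal C" using en_fk_fk t by blast
  have ib: "ibound (lborel \<Otimes>\<^sub>M lborel) (eR (fk \<alpha> t) (fk \<alpha> t')) C"
    using C by (intro eR_ibound) auto
  show i: "integrable (lborel \<Otimes>\<^sub>M lborel) (eR (fk \<alpha> t) (fk \<alpha> t'))" by (rule ibound_integrable[OF ib])
  have "en (fk \<alpha> t) (fk \<alpha> t') = ennreal (\<integral>p. eR (fk \<alpha> t) (fk \<alpha> t') p \<partial>(lborel \<Otimes>\<^sub>M lborel))"
  proof -
    have "en (fk \<alpha> t) (fk \<alpha> t') = (\<integral>\<^sup>+p. ennreal (eR (fk \<alpha> t) (fk \<alpha> t') p) \<partial>(lborel \<Otimes>\<^sub>M lborel))"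
      unfolding eR_def by (rule en_pair) measurable
    also have "\<dots> = ennreal (\<integral>p. eR (fk \<alpha> t) (fk \<alpha> t') p \<partial>(lborel \<Otimes>\<^sub>M lborel))"
      using ib unfolding ibound_def by (intro nn_integral_eq_integral i) auto
    finally show ?thesis .
  qed
  then have "ennreal (expectation (\<lambda>w. G t w * G t' w)) = ennreal (cH * (\<integral>p. eR (fk \<alpha> t) (fk \<alpha> t') p \<partial>(lborel \<Otimes>\<^sub>M lborel)))"
    using expectation_G_en(1)[OF t] cH ibound_integrable(3)[OF ib] by (simp add: ennreal_mult)
  then show "expectation (\<lambda>w. G t w * G t' w) = cH * (\<integral>p. eR (fk \<alpha> t) (fk \<alpha> t') p \<partial>(lborel \<Otimes>\<^sub>M lborel))"
    using expectation_G_en(2)[OF t] cH ibound_integrable(3)[OF ib] by simp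
qed

lemma G_prod_integrable: "t \<in> {0..T} \<Longrightarrow> t' \<in> {0..T} \<Longrightarrow> integrable M (\<lambda>w. G t w * G t' w)"
  by (intro V_prod_integrable G_VV)

lemma expectation_G_incr_bound:
  assumes t: "u \<in> {0..T}" "s \<in> {0..T}" "r \<in> {0..T}" and e: "en (fk \<alpha> u) (fd \<alpha> r s) \<le> ennreal A" "0 \<le> A"
  shows "\<bar>expectation (\<lambda>w. G u w * (G s w - G r w))\<bar> \<le> cH * A"
proof -
  have ib: "ibound (lborel \<Otimes>\<^sub>M lborel) (eR (fk \<alpha> u) (fd \<alpha> r s)) A"
    using e by (intro eR_ibound) auto
  have "expectation (\<lambda>w. G u w * (G s w - G r w)) = expectation (\<lambda>w. G u w * G s w) - expectation (\<lambda>w. G u w * G r w)"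
    using G_prod_integrable t by (simp add: right_diff_distrib)
  also have "\<dots> = cH * (\<integral>p. eR (fk \<alpha> u) (fk \<alpha> s) p - eR (fk \<alpha> u) (fk \<alpha> r) p \<partial>(lborel \<Otimes>\<^sub>M lborel))"
    using expectation_G t by (simp add: right_diff_distrib)
  finally have eq: "expectation (\<lambda>w. G u w * (G s w - G r w)) = cH * (\<integral>p. eR (fk \<alpha> u) (fk \<alpha> s) p - eR (fk \<alpha> u) (fk \<alpha> r) p \<partial>(lborel \<Otimes>\<^sub>M lborel))" .
  have "\<bar>\<integral>p. eR (fk \<alpha> u) (fk \<alpha> s) p - eR (fk \<alpha> u) (fk \<alpha> r) p \<partial>(lborel \<Otimes>\<^sub>M lborel)\<bar> \<le>
     (\<integral>p. \<bar>eR (fk \<alpha> u) (fk \<alpha> s) p - eR (fk \<alpha> u) (fk \<alpha> r) p\<bar> \<partial>(lborel \<Otimes>\<^sub>M lborel))"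
    by (rule integral_abs_bound)
  also have "\<dots> = (\<integral>p. eR (fk \<alpha> u) (fd \<alpha> r s) p \<partial>(lborel \<Otimes>\<^sub>M lborel))"
  proof (intro Bochner_Integration.integral_cong refl)
    fix p
    have "eR (fk \<alpha> u) (fk \<alpha> s) p - eR (fk \<alpha> u) (fk \<alpha> r) p = fk \<alpha> u (fst p) * (fk \<alpha> s (snd p) - fk \<alpha> r (snd p)) * \<bar>fst p - snd p\<bar> powr (-(2-2*H))"
      by (simp add: eR_def algebra_simps)
    then show "\<bar>eR (fk \<alpha> u) (fk \<alpha> s) p - eR (fk \<alpha> u) (fk \<alpha> r) p\<bar> = eR (fk \<alpha> u) (fd \<alpha> r s) p"
      by (simp add: eR_def fd_def abs_mult)
  qed
  also have "\<dots> \<le> A" by (rule ibound_integrable[OF ib])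
  finally show ?thesis unfolding eq using cH by (simp add: abs_mult)
qed

lemma expectation_G_incr_incr_bound:
  assumes t: "s \<in> {0..T}" "r \<in> {0..T}" "s' \<in> {0..T}" "r' \<in> {0..T}" and e: "en (fd \<alpha> r s) (fd \<alpha> r' s') \<le> ennreal A" "0 \<le> A"
  shows "\<bar>expectation (\<lambda>w. (G s w - G r w) * (G s' w - G r' w))\<bar> \<le> cH * A"
proof -
  have ib: "ibound (lborel \<Otimes>\<^sub>M lborel) (eR (fd \<alpha> r s) (fd \<alpha> r' s')) A"
    using e by (intro eR_ibound) auto
  let ?D = "\<lambda>p. eR (fk \<alpha> s) (fk \<alpha> s') p - eR (fk \<alpha> s) (fk \<alpha> r') p - eR (fk \<alpha> r) (fk \<alpha> s') p + eR (fk \<alpha> r) (fk \<alpha> r') p"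
  have "expectation (\<lambda>w. (G s w - G r w) * (G s' w - G r' w)) =
    expectation (\<lambda>w. G s w * G s' w - G s w * G r' w - G r w * G s' w + G r w * G r' w)"
    by (intro Bochner_Integration.integral_cong) (auto simp: algebra_simps)
  also have "\<dots> = expectation (\<lambda>w. G s w * G s' w) - expectation (\<lambda>w. G s w * G r' w) - expectation (\<lambda>w. G r w * G s' w) + expectation (\<lambda>w. G r w * G r' w)"
    using G_prod_integrable t by simp
  also have "\<dots> = cH * (\<integral>p. ?D p \<partial>(lborel \<Otimes>\<^sub>M lborel))"
    using expectation_G t by (simp add: right_diff_distrib distrib_left)
  finally have eq: "expectation (\<lambda>w. (G s w - G r w) * (G s' w - G r' w)) = cH * (\<integral>p. ?D p \<partial>(lborel \<Otimes>\<^sub>M lborel))" .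
  have "\<bar>\<integral>p. ?D p \<partial>(lborel \<Otimes>\<^sub>M lborel)\<bar> \<le> (\<integral>p. \<bar>?D p\<bar> \<partial>(lborel \<Otimes>\<^sub>M lborel))"
    by (rule integral_abs_bound)
  also have "\<dots> = (\<integral>p. eR (fd \<alpha> r s) (fd \<alpha> r' s') p \<partial>(lborel \<Otimes>\<^sub>M lborel))"
  proof (intro Bochner_Integration.integral_cong refl)
    fix p
    have "?D p = (fk \<alpha> s (fst p) - fk \<alpha> r (fst p)) * (fk \<alpha> s' (snd p) - fk \<alpha> r' (snd p)) * \<bar>fst p - snd p\<bar> powr (-(2-2*H))"
      by (simp add: eR_def algebra_simps)
    then show "\<bar>?D p\<bar> = eR (fd \<alpha> r s) (fd \<alpha> r' s') p"
      by (simp add: eR_def fd_def abs_mult)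
  qed
  also have "\<dots> \<le> A" by (rule ibound_integrable[OF ib])
  finally show ?thesis unfolding eq using cH by (simp add: abs_mult)
qed

lemma G_variance_bound: "\<exists>C>0. \<forall>t\<in>{0..T}. expectation (\<lambda>w. (G t w)\<^sup>2) \<le> C"
proof -
  obtain C where C: "0 < C" "\<And>t t'. t \<in> {0..T} \<Longrightarrow> t' \<in> {0..T} \<Longrightarrow> en (fk \<alpha> t) (fk \<alpha> t') \<le> ennreal C" using en_fk_fk by blast
  have "expectation (\<lambda>w. (G t w)\<^sup>2) \<le> cH * C" if t: "t \<in> {0..T}" for t
  proof -
    have "ennreal (expectation (\<lambda>w. G t w * G t w)) \<le> ennreal cH * ennreal C"
      unfolding expectation_G_en(1)[OF t t] by (intro mult_left_mono C t) simp
    also have "\<dots> = ennreal (cH * C)" using cH C by (simp add: ennreal_mult)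
    finally show ?thesis using cH C by (simp add: power2_eq_square)
  qed
  then show ?thesis using cH C by (intro exI[of _ "cH * C"]) auto
qed

lemma G_incr_cov:
  "\<exists>C>0. \<forall>h r s u. 0 < h \<and> h \<le> T/2 \<and> 0 \<le> r \<and> r \<le> s \<and> s \<le> T \<and> s - r \<le> h \<and> u \<in> {0..T} \<longrightarrow>
     \<bar>expectation (\<lambda>w. G u w * (G s w - G r w))\<bar> \<le> C * \<rho> h"
proof -
  obtain C where C: "0 < C" "\<And>h r s u. 0 < h \<Longrightarrow> h \<le> T/2 \<Longrightarrow> 0 \<le> r \<Longrightarrow> r \<le> s \<Longrightarrow> s \<le> T \<Longrightarrow> s - r \<le> h \<Longrightarrow> u \<in> {0..T} \<Longrightarrow>
     en (fk \<alpha> u) (fd \<alpha> r s) \<le> ennreal (C * \<rho> h)" using en_fk_fd by blast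
  have "\<bar>expectation (\<lambda>w. G u w * (G s w - G r w))\<bar> \<le> (cH * C) * \<rho> h"
    if "0 < h" "h \<le> T/2" "0 \<le> r" "r \<le> s" "s \<le> T" "s - r \<le> h" "u \<in> {0..T}" for h r s u
    using expectation_G_incr_bound[OF that(7) _ _ C(2)[OF that]] that rate_pos[of h] C(1) by simp
  moreover have "0 < cH * C" using cH C by simp
  ultimately show ?thesis by blast
qed

lemma G_incr_incr_cov:
  "\<exists>C>0. \<forall>h r s r' s'. 0 < h \<and> h \<le> T/2 \<and> 0 \<le> r \<and> r \<le> s \<and> s \<le> T \<and> s - r \<le> h \<and>
     0 \<le> r' \<and> r' \<le> s' \<and> s' \<le> T \<and> s' - r' \<le> h \<and> s \<noteq> s' \<longrightarrow>
     \<bar>expectation (\<lambda>w. (G s w - G r w) * (G s' w - G r' w))\<bar> \<le> C * (\<rho> h)\<^sup>2 * \<bar>s - s'\<bar> powr (-(2-2*H))"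
proof -
  obtain C where C: "0 < C" "\<And>h r s r' s'. 0 < h \<Longrightarrow> h \<le> T/2 \<Longrightarrow> 0 \<le> r \<Longrightarrow> r \<le> s \<Longrightarrow> s \<le> T \<Longrightarrow> s - r \<le> h \<Longrightarrow>
     0 \<le> r' \<Longrightarrow> r' \<le> s' \<Longrightarrow> s' \<le> T \<Longrightarrow> s' - r' \<le> h \<Longrightarrow> s \<noteq> s' \<Longrightarrow>
     en (fd \<alpha> r s) (fd \<alpha> r' s') \<le> ennreal (C * (\<rho> h)\<^sup>2 * \<bar>s - s'\<bar> powr (-(2-2*H)))" using en_fd_fd by blast
  have "\<bar>expectation (\<lambda>w. (G s w - G r w) * (G s' w - G r' w))\<bar> \<le> (cH * C) * (\<rho> h)\<^sup>2 * \<bar>s - s'\<bar> powr (-(2-2*H))"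
    if "0 < h" "h \<le> T/2" "0 \<le> r" "r \<le> s" "s \<le> T" "s - r \<le> h" "0 \<le> r'" "r' \<le> s'" "s' \<le> T" "s' - r' \<le> h" "s \<noteq> s'" for h r s r' s'
    using expectation_G_incr_incr_bound[OF _ _ _ _ C(2)[OF that]] that C(1) by (simp add: mult.assoc)
  moreover have "0 < cH * C" using cH C by simp
  ultimately show ?thesis by blast
qed

end

section \<open>Uniform moment bounds and Gronwall inequalities\<close>

text \<open>All moments of \<open>Y i\<close> are of order \<open>r i\<close>, uniformly in \<open>i\<close>; exponents that are powers of two suffice.\<close>
definition moms :: "'a measure \<Rightarrow> 'i set \<Rightarrow> ('i \<Rightarrow> 'a \<Rightarrow> real) \<Rightarrow> ('i \<Rightarrow> real) \<Rightarrow> bool" where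
  "moms M I Y r \<longleftrightarrow> (\<forall>i\<in>I. Y i \<in> borel_measurable M \<and> 0 < r i) \<and>
     (\<forall>q::nat. \<exists>C\<ge>0. \<forall>i\<in>I. ibound M (\<lambda>w. \<bar>Y i w\<bar> ^ (2^q)) (C * r i ^ (2^q)))"

lemma momsD:
  assumes "moms M I Y r"
  shows "i \<in> I \<Longrightarrow> Y i \<in> borel_measurable M" "i \<in> I \<Longrightarrow> 0 < r i"
    "\<exists>C\<ge>0. \<forall>i\<in>I. ibound M (\<lambda>w. \<bar>Y i w\<bar> ^ (2^q)) (C * r i ^ (2^q))"
  using assms unfolding moms_def by blast+

lemma momsI:
  assumes "\<And>i. i \<in> I \<Longrightarrow> Y i \<in> borel_measurable M" "\<And>i. i \<in> I \<Longrightarrow> 0 < r i"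
    "\<And>q. \<exists>C\<ge>0. \<forall>i\<in>I. ibound M (\<lambda>w. \<bar>Y i w\<bar> ^ (2^q)) (C * r i ^ (2^q))"
  shows "moms M I Y r"
  using assms unfolding moms_def by blast

lemma moms_mono:
  assumes Y: "moms M I Y r" and Z: "\<And>i. i \<in> I \<Longrightarrow> Z i \<in> borel_measurable M"
    and le: "\<And>i. i \<in> I \<Longrightarrow> AE w in M. \<bar>Z i w\<bar> \<le> \<bar>Y i w\<bar>"
    and r: "\<And>i. i \<in> I \<Longrightarrow> r i \<le> K * r' i" "\<And>i. i \<in> I \<Longrightarrow> 0 < r' i"
  shows "moms M I Z r'"
proof (rule momsI)
  fix q :: nat
  obtain C where C: "0 \<le> C" "\<And>i. i \<in> I \<Longrightarrow> ibound M (\<lambda>w. \<bar>Y i w\<bar> ^ (2^q)) (C * r i ^ (2^q))"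
    using momsD(3)[OF Y] by blast
  show "\<exists>C\<ge>0. \<forall>i\<in>I. ibound M (\<lambda>w. \<bar>Z i w\<bar> ^ (2^q)) (C * r' i ^ (2^q))"
  proof (intro exI[of _ "C * \<bar>K\<bar> ^ (2^q)"] conjI ballI)
    fix i assume i: "i \<in> I"
    note [measurable] = Z[OF i]
    show "ibound M (\<lambda>w. \<bar>Z i w\<bar> ^ (2^q)) (C * \<bar>K\<bar> ^ (2^q) * r' i ^ (2^q))"
    proof (rule ibound_mono[OF C(2)[OF i]])
      show "AE w in M. \<bar>Z i w\<bar> ^ (2^q) \<le> \<bar>Y i w\<bar> ^ (2^q)"
        using le[OF i] by eventually_elim (intro power_mono, auto)
      have "r i ^ (2^q) \<le> (\<bar>K\<bar> * r' i) ^ (2^q)"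
      proof (rule power_mono)
        have "K * r' i \<le> \<bar>K\<bar> * r' i" using r(2)[OF i] by (intro mult_right_mono) auto
        then show "r i \<le> \<bar>K\<bar> * r' i" using r(1)[OF i] by linarith
      qed (use momsD(2)[OF Y i] in simp)
      then show "C * r i ^ (2^q) \<le> C * \<bar>K\<bar> ^ (2^q) * r' i ^ (2^q)"
        using C(1) by (simp add: power_mult_distrib mult.assoc mult_left_mono)
    qed auto
  qed (use C in auto)
qed (use Z r(2) in \<open>blast+\<close>)

lemma moms_reindex:
  assumes "moms M I Y r" "\<And>j. j \<in> J \<Longrightarrow> f j \<in> I"
  shows "moms M J (\<lambda>j. Y (f j)) (\<lambda>j. r (f j))"
proof (rule momsI)
  fix q :: nat
  obtain C where "0 \<le> C" "\<forall>i\<in>I. ibound M (\<lambda>w. \<bar>Y i w\<bar> ^ (2^q)) (C * r i ^ (2^q))"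
    using momsD(3)[OF assms(1)] by blast
  then show "\<exists>C\<ge>0. \<forall>j\<in>J. ibound M (\<lambda>w. \<bar>Y (f j) w\<bar> ^ (2^q)) (C * r (f j) ^ (2^q))"
    using assms(2) by blast
qed (use assms(2) momsD(1,2)[OF assms(1)] in simp_all)

lemma abs_add_power_le:
  fixes a b :: real
  shows "\<bar>a + b\<bar> ^ n \<le> 2 ^ n * (\<bar>a\<bar> ^ n + \<bar>b\<bar> ^ n)"
proof -
  have "\<bar>a + b\<bar> ^ n \<le> (2 * max \<bar>a\<bar> \<bar>b\<bar>) ^ n" by (intro power_mono) auto
  also have "\<dots> = 2 ^ n * max \<bar>a\<bar> \<bar>b\<bar> ^ n" by (simp add: power_mult_distrib)
  also have "\<dots> \<le> 2 ^ n * (\<bar>a\<bar> ^ n + \<bar>b\<bar> ^ n)"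
    by (intro mult_left_mono) (auto simp: max_def)
  finally show ?thesis .
qed

lemma moms_add:
  assumes Y: "moms M I Y r" and Z: "moms M I Z r"
  shows "moms M I (\<lambda>i w. Y i w + Z i w) r"
proof (rule momsI)
  fix q :: nat
  obtain C where C: "0 \<le> C" "\<And>i. i \<in> I \<Longrightarrow> ibound M (\<lambda>w. \<bar>Y i w\<bar> ^ (2^q)) (C * r i ^ (2^q))"
    using momsD(3)[OF Y] by blast
  obtain D where D: "0 \<le> D" "\<And>i. i \<in> I \<Longrightarrow> ibound M (\<lambda>w. \<bar>Z i w\<bar> ^ (2^q)) (D * r i ^ (2^q))"
    using momsD(3)[OF Z] by blast
  show "\<exists>C\<ge>0. \<forall>i\<in>I. ibound M (\<lambda>w. \<bar>Y i w + Z i w\<bar> ^ (2^q)) (C * r i ^ (2^q))"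
  proof (intro exI[of _ "2^(2^q) * (C + D)"] conjI ballI)
    fix i assume i: "i \<in> I"
    note [measurable] = momsD(1)[OF Y i] momsD(1)[OF Z i]
    show "ibound M (\<lambda>w. \<bar>Y i w + Z i w\<bar> ^ (2^q)) (2^(2^q) * (C + D) * r i ^ (2^q))"
    proof (rule ibound_mono)
      show "ibound M (\<lambda>w. 2^(2^q) * (\<bar>Y i w\<bar> ^ (2^q) + \<bar>Z i w\<bar> ^ (2^q))) (2^(2^q) * (C * r i ^ (2^q) + D * r i ^ (2^q)))"
        using C(2)[OF i] D(2)[OF i] by (intro ibound_cmult ibound_add) auto
      show "AE w in M. \<bar>Y i w + Z i w\<bar> ^ (2^q) \<le> 2^(2^q) * (\<bar>Y i w\<bar> ^ (2^q) + \<bar>Z i w\<bar> ^ (2^q))"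
        by (intro AE_I2 abs_add_power_le)
      show "2^(2^q) * (C * r i ^ (2^q) + D * r i ^ (2^q)) \<le> 2^(2^q) * (C + D) * r i ^ (2^q)"
        by (simp only: distrib_right distrib_left mult.assoc order_refl)
    qed auto
  qed (use C D in auto)
next
  fix i assume "i \<in> I"
  then show "(\<lambda>w. Y i w + Z i w) \<in> borel_measurable M" "0 < r i"
    using momsD(1)[OF Y] momsD(1)[OF Z] momsD(2)[OF Y] by auto
qed

text \<open>Young's inequality reduces the exponent \<open>2^q\<close> of a product to
  \<open>2^Suc q\<close> of the factors; this is why the class asks for all powers of two at
  once.\<close>

lemma moms_mult:
  assumes Y: "moms M I Y r" and Z: "moms M I Z s"
  shows "moms M I (\<lambda>i w. Y i w * Z i w) (\<lambda>i. r i * s i)"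
proof (rule momsI)
  fix q :: nat
  let ?p = "2^q :: nat"
  obtain C where C: "0 \<le> C" "\<And>i. i \<in> I \<Longrightarrow> ibound M (\<lambda>w. \<bar>Y i w\<bar> ^ (2^Suc q)) (C * r i ^ (2^Suc q))"
    using momsD(3)[OF Y] by blast
  obtain D where D: "0 \<le> D" "\<And>i. i \<in> I \<Longrightarrow> ibound M (\<lambda>w. \<bar>Z i w\<bar> ^ (2^Suc q)) (D * s i ^ (2^Suc q))"
    using momsD(3)[OF Z] by blast
  show "\<exists>C\<ge>0. \<forall>i\<in>I. ibound M (\<lambda>w. \<bar>Y i w * Z i w\<bar> ^ (2^q)) (C * (r i * s i) ^ (2^q))"
  proof (intro exI[of _ "C + D"] conjI ballI)
    fix i assume i: "i \<in> I"
    note [measurable] = momsD(1)[OF Y i] momsD(1)[OF Z i]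
    have rs: "0 < r i" "0 < s i" using momsD(2)[OF Y i] momsD(2)[OF Z i] by auto
    \<comment> \<open>The weight in Young's inequality balances the two scales, so that both terms
      become multiples of \<open>(r i * s i) ^ (2^q)\<close>.\<close>
    define a where "a = (s i / r i) ^ ?p"
    have a: "0 < a" using rs by (simp add: a_def)
    show "ibound M (\<lambda>w. \<bar>Y i w * Z i w\<bar> ^ (2^q)) ((C + D) * (r i * s i) ^ (2^q))"
    proof (rule ibound_mono)
      show "ibound M (\<lambda>w. a * \<bar>Y i w\<bar> ^ (2^Suc q) + (1/a) * \<bar>Z i w\<bar> ^ (2^Suc q)) (a * (C * r i ^ (2^Suc q)) + (1/a) * (D * s i ^ (2^Suc q)))"
        using a C(2)[OF i] D(2)[OF i] by (intro ibound_cmult ibound_add) auto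
      show "AE w in M. \<bar>Y i w * Z i w\<bar> ^ (2^q) \<le> a * \<bar>Y i w\<bar> ^ (2^Suc q) + (1/a) * \<bar>Z i w\<bar> ^ (2^Suc q)"
      proof (intro AE_I2)
        fix w
        define y where "y = \<bar>Y i w\<bar> ^ ?p"
        define z where "z = \<bar>Z i w\<bar> ^ ?p"
        have yz: "0 \<le> y" "0 \<le> z" by (auto simp: y_def z_def)
        have "2 * (sqrt a * y) * (z / sqrt a) \<le> (sqrt a * y)\<^sup>2 + (z / sqrt a)\<^sup>2" by (rule sum_squares_bound)
        then have "2 * (y * z) \<le> a * y\<^sup>2 + (1/a) * z\<^sup>2" using a by (simp add: power_mult_distrib power_divide)
        moreover have "0 \<le> y * z" using yz by simp
        ultimately have "y * z \<le> a * y\<^sup>2 + (1/a) * z\<^sup>2" by linarith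
        moreover have "y\<^sup>2 = \<bar>Y i w\<bar> ^ (2^Suc q)" "z\<^sup>2 = \<bar>Z i w\<bar> ^ (2^Suc q)"
          by (simp_all add: y_def z_def power_mult[symmetric] mult.commute del: power_abs)
        moreover have "\<bar>Y i w * Z i w\<bar> ^ (2^q) = y * z" by (simp add: y_def z_def abs_mult power_mult_distrib del: power_abs)
        ultimately show "\<bar>Y i w * Z i w\<bar> ^ (2^q) \<le> a * \<bar>Y i w\<bar> ^ (2^Suc q) + (1/a) * \<bar>Z i w\<bar> ^ (2^Suc q)" by simp
      qed
      have e: "r i ^ (2^Suc q) = r i ^ ?p * r i ^ ?p" "s i ^ (2^Suc q) = s i ^ ?p * s i ^ ?p"
        by (simp_all add: power_add[symmetric] mult_2)
      have "a * (r i ^ ?p * r i ^ ?p) = (r i * s i) ^ ?p" "(1/a) * (s i ^ ?p * s i ^ ?p) = (r i * s i) ^ ?p"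
        using rs by (simp_all add: a_def power_divide power_mult_distrib)
      then have ee: "a * (C * r i ^ (2^Suc q)) = C * (r i * s i) ^ ?p" "(1/a) * (D * s i ^ (2^Suc q)) = D * (r i * s i) ^ ?p"
        unfolding e by (metis mult.left_commute)+
      then show "a * (C * r i ^ (2^Suc q)) + (1/a) * (D * s i ^ (2^Suc q)) \<le> (C + D) * (r i * s i) ^ (2^q)"
        unfolding ee by (simp only: distrib_right order_refl)
    qed auto
  qed (use C D in auto)
next
  fix i assume "i \<in> I"
  then show "(\<lambda>w. Y i w * Z i w) \<in> borel_measurable M" "0 < r i * s i"
    using momsD(1)[OF Y] momsD(1)[OF Z] momsD(2)[OF Y] momsD(2)[OF Z] by auto
qed

lemma (in prob_space) moms_const: "moms M I (\<lambda>i w. c) (\<lambda>i. 1)"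
proof (rule momsI)
  fix q :: nat
  have "ibound M (\<lambda>w. \<bar>c\<bar> ^ (2^q)) (\<bar>c\<bar> ^ (2^q))"
    by (intro integral_ibound) (auto simp: prob_space)
  then show "\<exists>C\<ge>0. \<forall>i\<in>I. ibound M (\<lambda>w. \<bar>c\<bar> ^ (2^q)) (C * 1 ^ (2^q))"
    by (intro exI[of _ "\<bar>c\<bar> ^ (2^q)"]) auto
qed auto

lemma moms_cmult:
  assumes Y: "moms M I Y r"
  shows "moms M I (\<lambda>i w. c * Y i w) r"
proof (rule momsI)
  fix q :: nat
  obtain C where C: "0 \<le> C" "\<And>i. i \<in> I \<Longrightarrow> ibound M (\<lambda>w. \<bar>Y i w\<bar> ^ (2^q)) (C * r i ^ (2^q))"
    using momsD(3)[OF Y] by blast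
  show "\<exists>C\<ge>0. \<forall>i\<in>I. ibound M (\<lambda>w. \<bar>c * Y i w\<bar> ^ (2^q)) (C * r i ^ (2^q))"
  proof (intro exI[of _ "\<bar>c\<bar> ^ (2^q) * C"] conjI ballI)
    fix i assume i: "i \<in> I"
    have "ibound M (\<lambda>w. \<bar>c\<bar> ^ (2^q) * \<bar>Y i w\<bar> ^ (2^q)) (\<bar>c\<bar> ^ (2^q) * (C * r i ^ (2^q)))"
      using C(2)[OF i] by (intro ibound_cmult) auto
    then show "ibound M (\<lambda>w. \<bar>c * Y i w\<bar> ^ (2^q)) (\<bar>c\<bar> ^ (2^q) * C * r i ^ (2^q))"
      by (simp add: abs_mult power_mult_distrib mult.assoc del: power_abs)
  qed (use C in auto)
next
  fix i assume "i \<in> I"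
  then show "(\<lambda>w. c * Y i w) \<in> borel_measurable M" "0 < r i"
    using momsD(1)[OF Y] momsD(2)[OF Y] by auto
qed

lemma (in prob_space) moms_power:
  assumes Y: "moms M I Y r"
  shows "moms M I (\<lambda>i w. Y i w ^ m) (\<lambda>i. r i ^ m)"
proof (induction m)
  case 0
  then show ?case using moms_const[of I 1] by simp
next
  case (Suc m)
  then show ?case using moms_mult[OF Y Suc] by simp
qed

lemma moms_expectation:
  assumes Y: "moms M I Y r"
  shows "\<exists>C\<ge>0. \<forall>i\<in>I. integrable M (Y i) \<and> integral\<^sup>L M (\<lambda>w. \<bar>Y i w\<bar>) \<le> C * r i"
proof -
  obtain C where C: "0 \<le> C" "\<And>i. i \<in> I \<Longrightarrow> ibound M (\<lambda>w. \<bar>Y i w\<bar> ^ (2^0)) (C * r i ^ (2^0))"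
    using momsD(3)[OF Y] by blast
  have "integrable M (Y i) \<and> integral\<^sup>L M (\<lambda>w. \<bar>Y i w\<bar>) \<le> C * r i" if "i \<in> I" for i
  proof -
    have ib: "ibound M (\<lambda>w. \<bar>Y i w\<bar>) (C * r i)" using C(2)[OF that] by simp
    show ?thesis using ibound_integrable[OF ib] momsD(1)[OF Y that] by (simp add: integrable_abs_iff)
  qed
  then show ?thesis using C by blast
qed

lemma moms_sq:
  assumes Y: "moms M I Y r"
  shows "\<exists>C\<ge>0. \<forall>i\<in>I. ibound M (\<lambda>w. (Y i w)\<^sup>2) (C * (r i)\<^sup>2)"
proof -
  obtain C where "0 \<le> C" "\<forall>i\<in>I. ibound M (\<lambda>w. \<bar>Y i w\<bar> ^ (2^1)) (C * r i ^ (2^1))"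
    using momsD(3)[OF Y] by blast
  then show ?thesis by auto
qed

text \<open>An even moment of a centered Gaussian variable is a constant times a power of its
  variance, so a variance bound controls all of them. The exponent 1, where q = 0, is reduced to the
  second moment by the inequality between the means.\<close>

lemma (in gauss_space) moms_gauss:
  assumes X: "\<And>i. i \<in> I \<Longrightarrow> X i \<in> V" and r: "\<And>i. i \<in> I \<Longrightarrow> 0 < r i"
    and v: "\<And>i. i \<in> I \<Longrightarrow> expectation (\<lambda>w. (X i w)\<^sup>2) \<le> K * (r i)\<^sup>2" and K: "0 \<le> K"
  shows "moms M I X r"
proof (rule momsI)
  fix q :: nat
  show "\<exists>C\<ge>0. \<forall>i\<in>I. ibound M (\<lambda>w. \<bar>X i w\<bar> ^ (2^q)) (C * r i ^ (2^q))"
  proof (cases q)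
    case 0
    show ?thesis
    proof (intro exI[of _ "1 + K"] conjI ballI)
      fix i assume i: "i \<in> I"
      note [measurable] = V_measurable[OF X[OF i]]
      have "ibound M (\<lambda>w. (X i w)\<^sup>2) (K * (r i)\<^sup>2)"
        using v[OF i] by (intro integral_ibound V_sq X i) auto
      then have 1: "ibound M (\<lambda>w. (1 / r i) * (X i w)\<^sup>2) ((1 / r i) * (K * (r i)\<^sup>2))"
        using r[OF i] by (intro ibound_cmult) auto
      have 2: "ibound M (\<lambda>w. r i) (r i)" using r[OF i] by (intro integral_ibound) (auto simp: prob_space)
      show "ibound M (\<lambda>w. \<bar>X i w\<bar> ^ (2^q)) ((1 + K) * r i ^ (2^q))"
      proof (rule ibound_mono[OF ibound_add[OF 2 1]])
        show "AE w in M. \<bar>X i w\<bar> ^ (2^q) \<le> r i + (1 / r i) * (X i w)\<^sup>2"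
        proof (intro AE_I2)
          fix w
          have "2 * r i * \<bar>X i w\<bar> \<le> (r i)\<^sup>2 + \<bar>X i w\<bar>\<^sup>2" by (rule sum_squares_bound)
          moreover have "0 \<le> r i * \<bar>X i w\<bar>" using r[OF i] by simp
          ultimately have "r i * \<bar>X i w\<bar> \<le> (r i)\<^sup>2 + (X i w)\<^sup>2" by simp
          then show "\<bar>X i w\<bar> ^ (2^q) \<le> r i + (1 / r i) * (X i w)\<^sup>2"
            using r[OF i] 0 by (simp add: field_simps power2_eq_square)
        qed
        show "r i + (1 / r i) * (K * (r i)\<^sup>2) \<le> (1 + K) * r i ^ (2^q)"
          using r[OF i] 0 by (simp add: power2_eq_square field_simps)
      qed auto
    qed (use K in auto)
  next
    case (Suc q')
    define k where "k = (2::nat) ^ q'"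
    have q: "2^q = 2 * k" by (simp add: Suc k_def)
    define c where "c = (fact (2*k) / (2^k * fact k) :: real)"
    have c: "0 \<le> c" by (simp add: c_def)
    show ?thesis unfolding q
    proof (intro exI[of _ "c * K ^ k"] conjI ballI)
      fix i assume i: "i \<in> I"
      have "expectation (\<lambda>w. (X i w) ^ (2*k)) \<le> c * (K * (r i)\<^sup>2) ^ k"
        unfolding V_moment(2)[OF X[OF i]] c_def[symmetric] using c v[OF i] by (intro mult_left_mono power_mono) auto
      then have "expectation (\<lambda>w. (X i w) ^ (2*k)) \<le> c * K ^ k * r i ^ (2*k)"
        by (simp add: power_mult_distrib power_mult mult.assoc)
      moreover have "\<bar>X i w\<bar> ^ (2*k) = (X i w) ^ (2*k)" for w by (simp add: power_mult)
      ultimately show "ibound M (\<lambda>w. \<bar>X i w\<bar> ^ (2*k)) (c * K ^ k * r i ^ (2*k))"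
        by (simp only:) (intro integral_ibound V_moment(1) X i, auto simp: power_mult)
    qed (use c K in auto)
  qed
qed (use assms V_measurable in auto)

text \<open>Jensen's inequality for the measure with density k. For powers of two it is
  Cauchy-Schwarz iterated: each squaring costs one more factor \<kappa>.\<close>

lemma nn_integral_power_le:
  fixes k :: "'s \<Rightarrow> real" and y :: "'s \<Rightarrow> ennreal"
  assumes [measurable]: "y \<in> borel_measurable N" and k: "ibound N k \<kappa>"
  shows "(\<integral>\<^sup>+s. ennreal (k s) * y s \<partial>N) ^ (2^q) \<le> ennreal (\<kappa> ^ (2^q - 1)) * (\<integral>\<^sup>+s. ennreal (k s) * y s ^ (2^q) \<partial>N)"
proof (induction q)
  case 0
  then show ?case by simp
next
  case (Suc q)
  have [measurable]: "k \<in> borel_measurable N" and k0: "\<And>s. 0 \<le> k s" and \<kappa>: "0 \<le> \<kappa>" and ki: "(\<integral>\<^sup>+s. ennreal (k s) \<partial>N) \<le> ennreal \<kappa>"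
    using k by (auto simp: ibound_def)
  have sq: "ennreal (sqrt (k s)) * ennreal (sqrt (k s)) = ennreal (k s)" for s
    using k0 by (simp add: ennreal_mult[symmetric])
  have CS: "(\<integral>\<^sup>+s. ennreal (k s) * z s \<partial>N)\<^sup>2 \<le> ennreal \<kappa> * (\<integral>\<^sup>+s. ennreal (k s) * (z s)\<^sup>2 \<partial>N)"
    if [measurable]: "z \<in> borel_measurable N" for z
  proof -
    have "(\<integral>\<^sup>+s. ennreal (k s) * z s \<partial>N) = (\<integral>\<^sup>+s. ennreal (sqrt (k s)) * (ennreal (sqrt (k s)) * z s) \<partial>N)"
      by (intro nn_integral_cong) (simp add: mult.assoc[symmetric] sq)
    then have "(\<integral>\<^sup>+s. ennreal (k s) * z s \<partial>N)\<^sup>2 \<le> (\<integral>\<^sup>+s. (ennreal (sqrt (k s)))\<^sup>2 \<partial>N) * (\<integral>\<^sup>+s. (ennreal (sqrt (k s)) * z s)\<^sup>2 \<partial>N)"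
      using Cauchy_Schwarz_nn_integral[of "\<lambda>s. ennreal (sqrt (k s))" N "\<lambda>s. ennreal (sqrt (k s)) * z s"] by simp
    moreover have "(\<integral>\<^sup>+s. (ennreal (sqrt (k s)))\<^sup>2 \<partial>N) = (\<integral>\<^sup>+s. ennreal (k s) \<partial>N)"
      by (intro nn_integral_cong) (simp add: power2_eq_square sq)
    moreover have "(\<integral>\<^sup>+s. (ennreal (sqrt (k s)) * z s)\<^sup>2 \<partial>N) = (\<integral>\<^sup>+s. ennreal (k s) * (z s)\<^sup>2 \<partial>N)"
      by (intro nn_integral_cong) (simp only: power_mult_distrib power2_eq_square[of "ennreal _"] sq)
    ultimately have "(\<integral>\<^sup>+s. ennreal (k s) * z s \<partial>N)\<^sup>2 \<le> (\<integral>\<^sup>+s. ennreal (k s) \<partial>N) * (\<integral>\<^sup>+s. ennreal (k s) * (z s)\<^sup>2 \<partial>N)"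
      by (simp only:)
    then show ?thesis by (rule order_trans[OF _ mult_right_mono[OF ki]]) simp
  qed
  have "(\<integral>\<^sup>+s. ennreal (k s) * y s \<partial>N) ^ (2^Suc q) = ((\<integral>\<^sup>+s. ennreal (k s) * y s \<partial>N) ^ (2^q))\<^sup>2"
    by (simp add: power_mult[symmetric] mult.commute)
  also have "\<dots> \<le> (ennreal (\<kappa> ^ (2^q - 1)) * (\<integral>\<^sup>+s. ennreal (k s) * y s ^ (2^q) \<partial>N))\<^sup>2"
    by (intro power_mono Suc) simp
  also have "\<dots> = (ennreal (\<kappa> ^ (2^q - 1)))\<^sup>2 * (\<integral>\<^sup>+s. ennreal (k s) * y s ^ (2^q) \<partial>N)\<^sup>2"
    by (simp add: power_mult_distrib)
  also have "\<dots> \<le> (ennreal (\<kappa> ^ (2^q - 1)))\<^sup>2 * (ennreal \<kappa> * (\<integral>\<^sup>+s. ennreal (k s) * (y s ^ (2^q))\<^sup>2 \<partial>N))"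
    by (intro mult_left_mono CS) simp_all
  also have "\<dots> = ((ennreal (\<kappa> ^ (2^q - 1)))\<^sup>2 * ennreal \<kappa>) * (\<integral>\<^sup>+s. ennreal (k s) * y s ^ (2^Suc q) \<partial>N)"
    by (simp add: power_mult[symmetric] mult.commute mult.assoc mult.left_commute)
  also have "(ennreal (\<kappa> ^ (2^q - 1)))\<^sup>2 * ennreal \<kappa> = ennreal (\<kappa> ^ (2^Suc q - 1))"
  proof -
    have "(ennreal (\<kappa> ^ (2^q - 1)))\<^sup>2 * ennreal \<kappa> = ennreal ((\<kappa> ^ (2^q - 1))\<^sup>2 * \<kappa>)"
      using \<kappa> by (simp add: ennreal_power[symmetric] ennreal_mult)
    moreover have "(\<kappa> ^ (2^q - 1))\<^sup>2 * \<kappa> = \<kappa> ^ (2^Suc q - 1)"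
    proof -
      have "(1::nat) \<le> 2^q" by simp
      then have "2^Suc q - 1 = (2^q - 1) * 2 + (1::nat)" unfolding power_Suc by arith
      then show ?thesis by (simp only: power_add power_mult power_one_right)
    qed
    ultimately show ?thesis by simp
  qed
  finally show ?case .
qed

text \<open>Holds without integrability too, since the Bochner integral is then 0; so pathwise
  integrability need not be settled first.\<close>

lemma ennreal_integral_le:
  assumes "f \<in> borel_measurable N" "\<And>x. 0 \<le> f x"
  shows "ennreal (integral\<^sup>L N f) \<le> (\<integral>\<^sup>+x. ennreal (f x) \<partial>N)"
  using assms nn_integral_eq_integral[of N f] by (cases "integrable N f") (auto simp: not_integrable_integral_eq)

text \<open>Jensen (through Cauchy--Schwarz) and Tonelli.\<close>
lemma (in prob_space) volterra_moment_le:
  fixes k :: "real \<Rightarrow> real" and Y :: "real \<Rightarrow> 'a \<Rightarrow> real"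
  assumes k: "ibound lborel k \<kappa>" and Y: "jointly_measurable M Y"
    and A: "A \<in> sets M"
  shows "(\<integral>\<^sup>+w. ennreal (indicator A w * (LBINT s. k s * \<bar>Y s w\<bar>) ^ (2^q)) \<partial>M) \<le>
     ennreal (\<kappa> ^ (2^q - 1)) * (\<integral>\<^sup>+s. ennreal (k s) * (\<integral>\<^sup>+w. ennreal (indicator A w * \<bar>Y s w\<bar> ^ (2^q)) \<partial>M) \<partial>lborel)"
proof -
  have [measurable]: "k \<in> borel_measurable borel" and k0: "\<And>s. 0 \<le> k s"
    using k by (auto simp: ibound_def)
  note [measurable] = Y A
  have Yw[measurable]: "(\<lambda>s. Y s w) \<in> borel_measurable lborel" if "w \<in> space M" for w
    using measurable_compose[OF measurable_Pair2'[OF that, of lborel] Y] by simp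
  have sw: "(\<lambda>p. (snd p, fst p)) \<in> measurable (M \<Otimes>\<^sub>M borel) (lborel \<Otimes>\<^sub>M M)" by measurable
  have [measurable]: "(\<lambda>p. Y (snd p) (fst p)) \<in> borel_measurable (M \<Otimes>\<^sub>M borel)"
    using measurable_compose[OF sw Y] by simp
  interpret P: pair_sigma_finite lborel M ..
  have "(\<integral>\<^sup>+w. ennreal (indicator A w * (LBINT s. k s * \<bar>Y s w\<bar>) ^ (2^q)) \<partial>M) \<le>
     (\<integral>\<^sup>+w. ennreal (\<kappa> ^ (2^q - 1)) * (\<integral>\<^sup>+s. ennreal (k s * (indicator A w * \<bar>Y s w\<bar> ^ (2^q))) \<partial>lborel) \<partial>M)"
  proof (intro nn_integral_mono)
    fix w assume w: "w \<in> space M"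
    note [measurable] = Yw[OF w]
    show "ennreal (indicator A w * (LBINT s. k s * \<bar>Y s w\<bar>) ^ (2^q)) \<le>
       ennreal (\<kappa> ^ (2^q - 1)) * (\<integral>\<^sup>+s. ennreal (k s * (indicator A w * \<bar>Y s w\<bar> ^ (2^q))) \<partial>lborel)"
    proof (cases "w \<in> A")
      case True
      have "ennreal ((LBINT s. k s * \<bar>Y s w\<bar>) ^ (2^q)) = ennreal (LBINT s. k s * \<bar>Y s w\<bar>) ^ (2^q)"
        using k0 by (intro ennreal_power[symmetric] Bochner_Integration.integral_nonneg) auto
      also have "\<dots> \<le> (\<integral>\<^sup>+s. ennreal (k s * \<bar>Y s w\<bar>) \<partial>lborel) ^ (2^q)"
        using k0 by (intro power_mono ennreal_integral_le) auto
      also have "\<dots> = (\<integral>\<^sup>+s. ennreal (k s) * ennreal \<bar>Y s w\<bar> \<partial>lborel) ^ (2^q)"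
        using k0 by (simp add: ennreal_mult)
      also have "\<dots> \<le> ennreal (\<kappa> ^ (2^q - 1)) * (\<integral>\<^sup>+s. ennreal (k s) * ennreal \<bar>Y s w\<bar> ^ (2^q) \<partial>lborel)"
        by (intro nn_integral_power_le k) measurable
      also have "(\<integral>\<^sup>+s. ennreal (k s) * ennreal \<bar>Y s w\<bar> ^ (2^q) \<partial>lborel) = (\<integral>\<^sup>+s. ennreal (k s * (indicator A w * \<bar>Y s w\<bar> ^ (2^q))) \<partial>lborel)"
        using k0 True by (intro nn_integral_cong) (simp add: ennreal_mult ennreal_power)
      finally show ?thesis using True by simp
    qed simp
  qed
  also have "\<dots> = ennreal (\<kappa> ^ (2^q - 1)) * (\<integral>\<^sup>+w. (\<integral>\<^sup>+s. ennreal (k s * (indicator A w * \<bar>Y s w\<bar> ^ (2^q))) \<partial>lborel) \<partial>M)"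
    by (intro nn_integral_cmult) measurable
  also have "(\<integral>\<^sup>+w. (\<integral>\<^sup>+s. ennreal (k s * (indicator A w * \<bar>Y s w\<bar> ^ (2^q))) \<partial>lborel) \<partial>M) =
      (\<integral>\<^sup>+s. (\<integral>\<^sup>+w. ennreal (k s * (indicator A w * \<bar>Y s w\<bar> ^ (2^q))) \<partial>M) \<partial>lborel)"
    by (rule P.Fubini') measurable
  also have "\<dots> = (\<integral>\<^sup>+s. ennreal (k s) * (\<integral>\<^sup>+w. ennreal (indicator A w * \<bar>Y s w\<bar> ^ (2^q)) \<partial>M) \<partial>lborel)"
  proof (intro nn_integral_cong)
    fix s
    have [measurable]: "Y s \<in> borel_measurable M"
      using measurable_compose[OF measurable_Pair1'[of s lborel M] Y] by simp
    show "(\<integral>\<^sup>+w. ennreal (k s * (indicator A w * \<bar>Y s w\<bar> ^ (2^q))) \<partial>M) = ennreal (k s) * (\<integral>\<^sup>+w. ennreal (indicator A w * \<bar>Y s w\<bar> ^ (2^q)) \<partial>M)"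
      using k0 by (subst nn_integral_cmult[symmetric]) (auto simp: ennreal_mult)
  qed
  finally show ?thesis .
qed

lemma (in prob_space) measurable_volterra:
  assumes Y: "jointly_measurable M Y" and [measurable]: "k \<in> borel_measurable borel"
  shows "(\<lambda>w. \<integral>s. k s * Y s w \<partial>lborel :: real) \<in> borel_measurable M"
proof -
  have sw: "(\<lambda>p. (snd p, fst p)) \<in> measurable (M \<Otimes>\<^sub>M lborel) (lborel \<Otimes>\<^sub>M M)" by measurable
  have "(\<lambda>p. Y (snd p) (fst p)) \<in> borel_measurable (M \<Otimes>\<^sub>M lborel)"
    using measurable_compose[OF sw Y] by simp
  then have [measurable]: "(\<lambda>(w, s). Y s w) \<in> borel_measurable (M \<Otimes>\<^sub>M lborel)" by (simp add: case_prod_beta')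
  show ?thesis by (intro lborel.borel_measurable_lebesgue_integral) measurable
qed

text \<open>Integration against a kernel of mass \<kappa> multiplies the scale by \<kappa>: Jensen
  yields \<kappa> to the power \<open>2^q - 1\<close> and the remaining integral of the kernel one
  more factor.\<close>

lemma (in prob_space) moms_volterra:
  fixes Y :: "'i \<Rightarrow> real \<Rightarrow> 'a \<Rightarrow> real" and k :: "'i \<Rightarrow> real \<Rightarrow> real"
  assumes Y: "moms M (I \<times> S) (\<lambda>(i, s). Y i s) (\<lambda>(i, s). r i)"
    and Ym: "\<And>i. i \<in> I \<Longrightarrow> jointly_measurable M (Y i)"
    and k: "\<And>i. i \<in> I \<Longrightarrow> ibound lborel (k i) (\<kappa> i)" "\<And>i s. i \<in> I \<Longrightarrow> s \<notin> S \<Longrightarrow> k i s = 0"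
    and \<kappa>: "\<And>i. i \<in> I \<Longrightarrow> 0 < \<kappa> i" and S: "S \<noteq> {}"
  shows "moms M I (\<lambda>i w. LBINT s. k i s * \<bar>Y i s w\<bar>) (\<lambda>i. \<kappa> i * r i)"
proof (rule momsI)
  fix i assume i: "i \<in> I"
  have "(\<lambda>p. \<bar>Y i (fst p) (snd p)\<bar>) \<in> borel_measurable (lborel \<Otimes>\<^sub>M M)" using Ym[OF i] by measurable
  then show "(\<lambda>w. LBINT s. k i s * \<bar>Y i s w\<bar>) \<in> borel_measurable M"
    using k(1)[OF i] by (intro measurable_volterra) (auto simp: ibound_def)
  obtain s where "s \<in> S" using S by blast
  then have "0 < r i" using momsD(2)[OF Y, of "(i, s)"] i by simp
  then show "0 < \<kappa> i * r i" using \<kappa>[OF i] by simp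
next
  fix q :: nat
  obtain C where C: "0 \<le> C" "\<And>i s. i \<in> I \<Longrightarrow> s \<in> S \<Longrightarrow> ibound M (\<lambda>w. \<bar>Y i s w\<bar> ^ (2^q)) (C * r i ^ (2^q))"
    using momsD(3)[OF Y, of q] by auto
  show "\<exists>C\<ge>0. \<forall>i\<in>I. ibound M (\<lambda>w. \<bar>LBINT s. k i s * \<bar>Y i s w\<bar>\<bar> ^ (2^q)) (C * (\<kappa> i * r i) ^ (2^q))"
  proof (intro exI[of _ C] conjI ballI C)
    fix i assume i: "i \<in> I"
    let ?X = "\<lambda>w. LBINT s. k i s * \<bar>Y i s w\<bar>"
    have k0: "0 \<le> k i s" for s using k(1)[OF i] by (simp add: ibound_def)
    have X0: "0 \<le> ?X w" for w using k0 by (intro Bochner_Integration.integral_nonneg) auto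
    have r0: "0 \<le> r i"
    proof -
      obtain s where "s \<in> S" using S by blast
      then show ?thesis using momsD(2)[OF Y, of "(i, s)"] i by simp
    qed
    have [measurable]: "k i \<in> borel_measurable borel" using k(1)[OF i] by (simp add: ibound_def)
    have "(\<lambda>p. \<bar>Y i (fst p) (snd p)\<bar>) \<in> borel_measurable (lborel \<Otimes>\<^sub>M M)" using Ym[OF i] by measurable
    then have [measurable]: "?X \<in> borel_measurable M"
      by (intro measurable_volterra) auto
    have "(\<integral>\<^sup>+w. ennreal (\<bar>?X w\<bar> ^ (2^q)) \<partial>M) = (\<integral>\<^sup>+w. ennreal (indicator (space M) w * ?X w ^ (2^q)) \<partial>M)"
      using X0 by (intro nn_integral_cong) simp
    also have "\<dots> \<le> ennreal (\<kappa> i ^ (2^q - 1)) * (\<integral>\<^sup>+s. ennreal (k i s) * (\<integral>\<^sup>+w. ennreal (indicator (space M) w * \<bar>Y i s w\<bar> ^ (2^q)) \<partial>M) \<partial>lborel)"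
      by (intro volterra_moment_le k Ym i) auto
    also have "\<dots> \<le> ennreal (\<kappa> i ^ (2^q - 1)) * (\<integral>\<^sup>+s. ennreal (k i s) * ennreal (C * r i ^ (2^q)) \<partial>lborel)"
    proof (rule mult_left_mono[OF nn_integral_mono])
      fix s
      show "ennreal (k i s) * (\<integral>\<^sup>+w. ennreal (indicator (space M) w * \<bar>Y i s w\<bar> ^ (2^q)) \<partial>M) \<le> ennreal (k i s) * ennreal (C * r i ^ (2^q))"
      proof (cases "s \<in> S")
        case True
        have "(\<integral>\<^sup>+w. ennreal (indicator (space M) w * \<bar>Y i s w\<bar> ^ (2^q)) \<partial>M) = (\<integral>\<^sup>+w. ennreal (\<bar>Y i s w\<bar> ^ (2^q)) \<partial>M)"
          by (intro nn_integral_cong) simp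
        also have "\<dots> \<le> ennreal (C * r i ^ (2^q))" using C(2)[OF i True] by (simp add: ibound_def)
        finally show ?thesis by (intro mult_left_mono) simp_all
      qed (simp add: k(2)[OF i])
    qed simp
    also have "\<dots> = ennreal (\<kappa> i ^ (2^q - 1)) * ((\<integral>\<^sup>+s. ennreal (k i s) \<partial>lborel) * ennreal (C * r i ^ (2^q)))"
      by (subst nn_integral_multc) auto
    also have "\<dots> \<le> ennreal (\<kappa> i ^ (2^q - 1)) * (ennreal (\<kappa> i) * ennreal (C * r i ^ (2^q)))"
      using k(1)[OF i] by (intro mult_left_mono mult_right_mono) (auto simp: ibound_def)
    also have "\<dots> = ennreal (\<kappa> i ^ (2^q - 1) * (\<kappa> i * (C * r i ^ (2^q))))"
      using \<kappa>[OF i] C(1) r0 by (simp add: ennreal_mult)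
    finally have nn: "(\<integral>\<^sup>+w. ennreal (\<bar>?X w\<bar> ^ (2^q)) \<partial>M) \<le> ennreal (\<kappa> i ^ (2^q - 1) * (\<kappa> i * (C * r i ^ (2^q))))" .
    have "\<kappa> i ^ (2^q - 1) * \<kappa> i = \<kappa> i ^ (2^q)"
      by (metis power_minus_mult zero_less_numeral zero_less_power)
    then have eq: "\<kappa> i ^ (2^q - 1) * (\<kappa> i * (C * r i ^ (2^q))) = C * (\<kappa> i * r i) ^ (2^q)"
      by (simp add: power_mult_distrib mult.assoc[symmetric])
    show "ibound M (\<lambda>w. \<bar>?X w\<bar> ^ (2^q)) (C * (\<kappa> i * r i) ^ (2^q))"
      unfolding ibound_def using nn C(1) \<kappa>[OF i] r0 unfolding eq by (intro conjI allI) auto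
  qed
qed

text \<open>The cutoffs \<open>B \<le> k\<close> make the moments finite a priori, so that the contraction can be iterated.\<close>
lemma (in prob_space) moment_gronwall:
  fixes Y Z :: "'i \<Rightarrow> real \<Rightarrow> 'a \<Rightarrow> real" and \<tau> :: "'i \<Rightarrow> real \<Rightarrow> real" and B :: "'i \<Rightarrow> 'a \<Rightarrow> real"
  assumes \<alpha>: "0 < \<alpha>" "\<alpha> < 1" and T: "0 < T" and A: "0 \<le> A"
    and Ym: "\<And>i. i \<in> I \<Longrightarrow> jointly_measurable M (Y i)"
    and Bm: "\<And>i. i \<in> I \<Longrightarrow> B i \<in> borel_measurable M"
    and B: "\<And>i t w. i \<in> I \<Longrightarrow> t \<in> {0..T} \<Longrightarrow> w \<in> space M \<Longrightarrow> \<bar>Y i t w\<bar> \<le> B i w"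
    and \<tau>: "\<And>i t. i \<in> I \<Longrightarrow> t \<in> {0..T} \<Longrightarrow> 0 \<le> \<tau> i t \<and> \<tau> i t \<le> t"
    and le: "\<And>i t. i \<in> I \<Longrightarrow> t \<in> {0..T} \<Longrightarrow>
       AE w in M. \<bar>Y i t w\<bar> \<le> A * (LBINT s. fk \<alpha> (\<tau> i t) s * \<bar>Y i s w\<bar>) + \<bar>Z i t w\<bar>"
    and rp: "\<And>i. i \<in> I \<Longrightarrow> 0 < r i" and Zm: "\<And>i t. i \<in> I \<Longrightarrow> t \<in> {0..T} \<Longrightarrow> Z i t \<in> borel_measurable M"
    and C: "0 \<le> C" "\<And>i t. i \<in> I \<Longrightarrow> t \<in> {0..T} \<Longrightarrow> ibound M (\<lambda>w. \<bar>Z i t w\<bar> ^ (2^q)) (C * r i ^ (2^q))"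
  shows "\<exists>C\<ge>0. \<forall>j\<in>I \<times> {0..T}. ibound M (\<lambda>w. \<bar>(case j of (i, t) \<Rightarrow> Y i t) w\<bar> ^ (2^q)) (C * (case j of (i, t) \<Rightarrow> r i) ^ (2^q))"
proof -
  have Yt: "Y i t \<in> borel_measurable M" if "i \<in> I" for i t
    using measurable_compose[OF measurable_Pair1'[of t lborel M] Ym[OF that]] by simp
  let ?p = "2^q :: nat"
  define \<kappa> where "\<kappa> = T powr \<alpha> / \<alpha>"
  have \<kappa>: "0 \<le> \<kappa>" using \<alpha> by (simp add: \<kappa>_def)
  \<comment> \<open>Factor with which one application of the inequality multiplies a weighted
    moment, the first \<open>2 ^ ?p\<close> coming from splitting the sum. Choosing \<epsilon> with
    \<open>a * \<epsilon> \<le> 1/2\<close> makes the step a contraction.\<close>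
  define a where "a = 2 ^ ?p * A ^ ?p * \<kappa> ^ (?p - 1)"
  have a: "0 \<le> a" using A \<kappa> by (simp add: a_def)
  define \<epsilon> where "\<epsilon> = 1 / (2 * (a + 1))"
  have \<epsilon>: "0 < \<epsilon>" "a * \<epsilon> \<le> 1/2" using a by (auto simp: \<epsilon>_def field_simps)
  obtain l where l: "0 < l" "\<And>t. t \<in> {0..T} \<Longrightarrow> ibound lborel (\<lambda>s. fk \<alpha> t s * exp (l * s)) (\<epsilon> * exp (l * t))"
    using fk_exp_weight[OF \<alpha> T \<epsilon>(1)] by blast
  define c where "c = 2 ^ ?p * C"
  have c: "0 \<le> c" using C by (simp add: c_def)
  show "\<exists>C\<ge>0. \<forall>j\<in>I \<times> {0..T}. ibound M (\<lambda>w. \<bar>(case j of (i, t) \<Rightarrow> Y i t) w\<bar> ^ ?p) (C * (case j of (i, t) \<Rightarrow> r i) ^ ?p)"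
  proof (intro exI[of _ "exp (l * T) * (2 * c)"] conjI ballI)
    show "0 \<le> exp (l * T) * (2 * c)" using c by simp
    fix j assume "j \<in> I \<times> {0..T}"
    then obtain i t0 where j: "j = (i, t0)" "i \<in> I" "t0 \<in> {0..T}" by auto
    note i = j(2)
    note [measurable] = Yt[OF i] Bm[OF i]
    have r0: "0 \<le> r i" using rp[OF i] by simp
    \<comment> \<open>The cutoff depends on the path through \<open>B\<close> but not on time, so it
      passes inside the Volterra integral unchanged.\<close>
    define S where "S k = {w \<in> space M. B i w \<le> real k}" for k :: nat
    have [measurable]: "S k \<in> sets M" for k unfolding S_def by measurable
    define U where "U k t = (\<integral>\<^sup>+w. ennreal (indicator (S k) w * \<bar>Y i t w\<bar> ^ ?p) \<partial>M)" for k t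
    have step: "U k t \<le> ennreal (exp (l * t) * (D / 2 + c * r i ^ ?p))"
      if t: "t \<in> {0..T}" and D: "0 \<le> D" and U: "\<And>s. s \<in> {0..T} \<Longrightarrow> U k s \<le> ennreal (exp (l * s) * D)" for k t D
    proof -
      \<comment> \<open>The kernel may end at an earlier time than t: the weight
        \<open>exp (l * t)\<close> is increasing, so the contraction survives. This lag is what the
        grid version needs.\<close>
      have tt: "\<tau> i t \<in> {0..T}" "\<tau> i t \<le> t" using \<tau>[OF i t] t by auto
      let ?X = "\<lambda>w. LBINT s. fk \<alpha> (\<tau> i t) s * \<bar>Y i s w\<bar>"
      have X0: "0 \<le> ?X w" for w by (intro Bochner_Integration.integral_nonneg) auto
      have "(\<lambda>p. \<bar>Y i (fst p) (snd p)\<bar>) \<in> borel_measurable (lborel \<Otimes>\<^sub>M M)" using Ym[OF i] by measurable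
      then have [measurable]: "?X \<in> borel_measurable M" by (intro measurable_volterra) auto
      have [measurable]: "Z i t \<in> borel_measurable M" by (rule Zm[OF i t])
      have kb: "ibound lborel (fk \<alpha> (\<tau> i t)) \<kappa>"
      proof (rule ibound_mono[OF ibound_fk])
        show "\<tau> i t powr \<alpha> / \<alpha> \<le> \<kappa>" unfolding \<kappa>_def using tt \<alpha> by (intro divide_right_mono powr_mono2) auto
      qed (use \<alpha> tt in auto)
      have "U k t \<le> (\<integral>\<^sup>+w. ennreal (2 ^ ?p * A ^ ?p) * ennreal (indicator (S k) w * ?X w ^ ?p) + ennreal (2 ^ ?p) * ennreal (\<bar>Z i t w\<bar> ^ ?p) \<partial>M)"
        unfolding U_def
      proof (intro nn_integral_mono_AE, use le[OF i t] in \<open>eventually_elim\<close>)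
        fix w assume w: "\<bar>Y i t w\<bar> \<le> A * ?X w + \<bar>Z i t w\<bar>"
        have "\<bar>Y i t w\<bar> ^ ?p \<le> \<bar>A * ?X w + \<bar>Z i t w\<bar>\<bar> ^ ?p"
          using w by (intro power_mono) auto
        also have "\<dots> \<le> 2 ^ ?p * (\<bar>A * ?X w\<bar> ^ ?p + \<bar>\<bar>Z i t w\<bar>\<bar> ^ ?p)" by (rule abs_add_power_le)
        also have "\<dots> = 2 ^ ?p * A ^ ?p * ?X w ^ ?p + 2 ^ ?p * \<bar>Z i t w\<bar> ^ ?p"
          using A X0[of w] by (simp add: power_mult_distrib distrib_left abs_mult del: power_abs)
        finally have 1: "\<bar>Y i t w\<bar> ^ ?p \<le> 2 ^ ?p * A ^ ?p * ?X w ^ ?p + 2 ^ ?p * \<bar>Z i t w\<bar> ^ ?p" .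
        have 2: "0 \<le> 2 ^ ?p * \<bar>Z i t w\<bar> ^ ?p" "0 \<le> 2 ^ ?p * A ^ ?p" using A by auto
        have "indicator (S k) w * \<bar>Y i t w\<bar> ^ ?p \<le> (2 ^ ?p * A ^ ?p) * (indicator (S k) w * ?X w ^ ?p) + 2 ^ ?p * \<bar>Z i t w\<bar> ^ ?p"
          using 1 2(1) by (cases "w \<in> S k") (simp_all del: power_abs)
        then have "ennreal (indicator (S k) w * \<bar>Y i t w\<bar> ^ ?p) \<le> ennreal ((2 ^ ?p * A ^ ?p) * (indicator (S k) w * ?X w ^ ?p) + 2 ^ ?p * \<bar>Z i t w\<bar> ^ ?p)"
          by (rule ennreal_leI)
        also have "\<dots> = ennreal ((2 ^ ?p * A ^ ?p) * (indicator (S k) w * ?X w ^ ?p)) + ennreal (2 ^ ?p * \<bar>Z i t w\<bar> ^ ?p)"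
          using 2 A X0[of w] by (intro ennreal_plus mult_nonneg_nonneg) auto
        also have "ennreal ((2 ^ ?p * A ^ ?p) * (indicator (S k) w * ?X w ^ ?p)) = ennreal (2 ^ ?p * A ^ ?p) * ennreal (indicator (S k) w * ?X w ^ ?p)"
          using 2(2) A X0[of w] by (intro ennreal_mult mult_nonneg_nonneg) auto
        also have "ennreal (2 ^ ?p * \<bar>Z i t w\<bar> ^ ?p) = ennreal (2 ^ ?p) * ennreal (\<bar>Z i t w\<bar> ^ ?p)"
          by (intro ennreal_mult) auto
        finally show "ennreal (indicator (S k) w * \<bar>Y i t w\<bar> ^ ?p) \<le> ennreal (2 ^ ?p * A ^ ?p) * ennreal (indicator (S k) w * ?X w ^ ?p) + ennreal (2 ^ ?p) * ennreal (\<bar>Z i t w\<bar> ^ ?p)" .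
      qed
      also have "\<dots> = (\<integral>\<^sup>+w. ennreal (2 ^ ?p * A ^ ?p) * ennreal (indicator (S k) w * ?X w ^ ?p) \<partial>M) + (\<integral>\<^sup>+w. ennreal (2 ^ ?p) * ennreal (\<bar>Z i t w\<bar> ^ ?p) \<partial>M)"
        by (intro nn_integral_add) measurable
      also have "\<dots> = ennreal (2 ^ ?p * A ^ ?p) * (\<integral>\<^sup>+w. ennreal (indicator (S k) w * ?X w ^ ?p) \<partial>M) + ennreal (2 ^ ?p) * (\<integral>\<^sup>+w. ennreal (\<bar>Z i t w\<bar> ^ ?p) \<partial>M)"
        by (intro arg_cong2[where f="(+)"] nn_integral_cmult) measurable
      also have "\<dots> \<le> ennreal (2 ^ ?p * A ^ ?p) * ennreal (\<kappa> ^ (?p - 1) * (\<epsilon> * exp (l * t) * D)) + ennreal (2 ^ ?p) * ennreal (C * r i ^ ?p)"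
      proof (intro add_mono mult_left_mono)
        have "(\<integral>\<^sup>+w. ennreal (indicator (S k) w * ?X w ^ ?p) \<partial>M) \<le> ennreal (\<kappa> ^ (?p - 1)) * (\<integral>\<^sup>+s. ennreal (fk \<alpha> (\<tau> i t) s) * U k s \<partial>lborel)"
          unfolding U_def by (intro volterra_moment_le kb Ym i) measurable
        also have "\<dots> \<le> ennreal (\<kappa> ^ (?p - 1)) * (\<integral>\<^sup>+s. ennreal (fk \<alpha> (\<tau> i t) s * exp (l * s)) * ennreal D \<partial>lborel)"
        proof (intro mult_left_mono nn_integral_mono)
          fix s
          show "ennreal (fk \<alpha> (\<tau> i t) s) * U k s \<le> ennreal (fk \<alpha> (\<tau> i t) s * exp (l * s)) * ennreal D"
          proof (cases "0 \<le> s \<and> s < \<tau> i t")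
            case True
            then have "U k s \<le> ennreal (exp (l * s) * D)" using tt by (intro U) auto
            then have "ennreal (fk \<alpha> (\<tau> i t) s) * U k s \<le> ennreal (fk \<alpha> (\<tau> i t) s) * ennreal (exp (l * s) * D)"
              by (intro mult_left_mono) simp_all
            also have "\<dots> = ennreal (fk \<alpha> (\<tau> i t) s * exp (l * s)) * ennreal D"
              using D by (simp add: ennreal_mult[symmetric] mult.assoc)
            finally show ?thesis .
          next
            case False
            then have "fk \<alpha> (\<tau> i t) s = 0" by (auto simp: fk_def)
            then show ?thesis by simp
          qed
        qed simp
        also have "\<dots> = ennreal (\<kappa> ^ (?p - 1)) * ((\<integral>\<^sup>+s. ennreal (fk \<alpha> (\<tau> i t) s * exp (l * s)) \<partial>lborel) * ennreal D)"
          by (subst nn_integral_multc) auto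
        also have "\<dots> \<le> ennreal (\<kappa> ^ (?p - 1)) * (ennreal (\<epsilon> * exp (l * t)) * ennreal D)"
        proof (intro mult_left_mono mult_right_mono)
          have "(\<integral>\<^sup>+s. ennreal (fk \<alpha> (\<tau> i t) s * exp (l * s)) \<partial>lborel) \<le> ennreal (\<epsilon> * exp (l * \<tau> i t))"
            using l(2)[OF tt(1)] by (simp add: ibound_def)
          also have "\<dots> \<le> ennreal (\<epsilon> * exp (l * t))"
            using tt(2) l(1) \<epsilon>(1) by (intro ennreal_leI mult_left_mono) auto
          finally show "(\<integral>\<^sup>+s. ennreal (fk \<alpha> (\<tau> i t) s * exp (l * s)) \<partial>lborel) \<le> ennreal (\<epsilon> * exp (l * t))" .
        qed simp_all
        also have "\<dots> = ennreal (\<kappa> ^ (?p - 1) * (\<epsilon> * exp (l * t) * D))"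
          using \<kappa> \<epsilon> D by (simp add: ennreal_mult)
        finally show "(\<integral>\<^sup>+w. ennreal (indicator (S k) w * ?X w ^ ?p) \<partial>M) \<le> ennreal (\<kappa> ^ (?p - 1) * (\<epsilon> * exp (l * t) * D))" .
        show "(\<integral>\<^sup>+w. ennreal (\<bar>Z i t w\<bar> ^ ?p) \<partial>M) \<le> ennreal (C * r i ^ ?p)"
          using C(2)[OF i t] by (simp add: ibound_def)
      qed simp_all
      also have "\<dots> = ennreal (a * \<epsilon> * (exp (l * t) * D) + c * r i ^ ?p)"
      proof -
        have "ennreal (2 ^ ?p * A ^ ?p) * ennreal (\<kappa> ^ (?p - 1) * (\<epsilon> * exp (l * t) * D)) = ennreal (a * \<epsilon> * (exp (l * t) * D))"
          unfolding a_def using A \<kappa> \<epsilon> D by (subst ennreal_mult[symmetric]) (auto simp: mult_ac)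
        moreover have "ennreal (2 ^ ?p) * ennreal (C * r i ^ ?p) = ennreal (c * r i ^ ?p)"
          unfolding c_def using C(1) r0 by (subst ennreal_mult[symmetric]) (auto simp: mult_ac)
        moreover have "0 \<le> a * \<epsilon> * (exp (l * t) * D)" "0 \<le> c * r i ^ ?p" using a \<epsilon> D c r0 by auto
        ultimately show ?thesis by (simp only: ennreal_plus)
      qed
      also have "\<dots> \<le> ennreal (exp (l * t) * (D / 2 + c * r i ^ ?p))"
      proof (intro ennreal_leI)
        have "a * \<epsilon> * (exp (l * t) * D) \<le> 1/2 * (exp (l * t) * D)" using \<epsilon>(2) D by (intro mult_right_mono) auto
        moreover have "1 * (c * r i ^ ?p) \<le> exp (l * t) * (c * r i ^ ?p)"
          using l(1) t c r0 by (intro mult_right_mono) auto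
        ultimately have "a * \<epsilon> * (exp (l * t) * D) + c * r i ^ ?p \<le> 1/2 * (exp (l * t) * D) + exp (l * t) * (c * r i ^ ?p)"
          by linarith
        then show "a * \<epsilon> * (exp (l * t) * D) + c * r i ^ ?p \<le> exp (l * t) * (D / 2 + c * r i ^ ?p)"
          by (simp add: distrib_left)
      qed
      finally show ?thesis .
    qed
    \<comment> \<open>The map sending D to \<open>D / 2 + c * r i ^ ?p\<close> has fixed point
      \<open>2 * c * r i ^ ?p\<close>. Starting from the crude cutoff bound, the excess is halved
      each time; only in the limit does the dependence on k disappear.\<close>
    have iter: "\<forall>t\<in>{0..T}. U k t \<le> ennreal (exp (l * t) * (2 * c * r i ^ ?p + real k ^ ?p / 2 ^ m))" for k m
    proof (induction m)
      case 0
      show ?case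
      proof
        fix t assume t: "t \<in> {0..T}"
        have "U k t \<le> (\<integral>\<^sup>+w. ennreal (real k ^ ?p) \<partial>M)"
          unfolding U_def
        proof (intro nn_integral_mono ennreal_leI)
          fix w assume w: "w \<in> space M"
          show "indicator (S k) w * \<bar>Y i t w\<bar> ^ ?p \<le> real k ^ ?p"
          proof (cases "w \<in> S k")
            case True
            then have "\<bar>Y i t w\<bar> \<le> real k" using B[OF i t w] by (simp add: S_def)
            then have "\<bar>Y i t w\<bar> ^ ?p \<le> real k ^ ?p" by (intro power_mono) auto
            then show ?thesis using True by (simp del: power_abs)
          qed simp
        qed
        also have "\<dots> = ennreal (real k ^ ?p)" by (simp add: emeasure_space_1)
        also have "\<dots> \<le> ennreal (exp (l * t) * (2 * c * r i ^ ?p + real k ^ ?p / 2 ^ 0))"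
        proof (intro ennreal_leI)
          have "1 * real k ^ ?p \<le> exp (l * t) * (2 * c * r i ^ ?p + real k ^ ?p / 2 ^ 0)"
            using l(1) t c r0 by (intro mult_mono) auto
          then show "real k ^ ?p \<le> exp (l * t) * (2 * c * r i ^ ?p + real k ^ ?p / 2 ^ 0)" by simp
        qed
        finally show "U k t \<le> ennreal (exp (l * t) * (2 * c * r i ^ ?p + real k ^ ?p / 2 ^ 0))" .
      qed
    next
      case (Suc m)
      show ?case
      proof
        fix t assume t: "t \<in> {0..T}"
        have "U k t \<le> ennreal (exp (l * t) * ((2 * c * r i ^ ?p + real k ^ ?p / 2 ^ m) / 2 + c * r i ^ ?p))"
          using Suc c r0 by (intro step t) auto
        then show "U k t \<le> ennreal (exp (l * t) * (2 * c * r i ^ ?p + real k ^ ?p / 2 ^ Suc m))"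
          by (simp add: add_divide_distrib algebra_simps)
      qed
    qed
    have Uk: "U k t0 \<le> ennreal (exp (l * t0) * (2 * c * r i ^ ?p))" for k
    proof (rule LIMSEQ_le_const)
      have "(\<lambda>m. real k ^ ?p * (1/2) ^ m) \<longlonglongrightarrow> real k ^ ?p * 0"
        by (intro tendsto_mult tendsto_const LIMSEQ_power_zero) simp
      then have z: "(\<lambda>m. real k ^ ?p / 2 ^ m) \<longlonglongrightarrow> 0" by (simp add: power_divide)
      have "(\<lambda>m. exp (l * t0) * (2 * c * r i ^ ?p + real k ^ ?p / 2 ^ m)) \<longlonglongrightarrow> exp (l * t0) * (2 * c * r i ^ ?p + 0)"
        by (intro tendsto_mult tendsto_add tendsto_const z)
      then show "(\<lambda>m. ennreal (exp (l * t0) * (2 * c * r i ^ ?p + real k ^ ?p / 2 ^ m))) \<longlonglongrightarrow> ennreal (exp (l * t0) * (2 * c * r i ^ ?p))"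
        using tendsto_ennrealI by fastforce
      show "\<exists>N. \<forall>m\<ge>N. U k t0 \<le> ennreal (exp (l * t0) * (2 * c * r i ^ ?p + real k ^ ?p / 2 ^ m))"
        using iter j(3) by blast
    qed
    have lim: "(\<lambda>k. U k t0) \<longlonglongrightarrow> (\<integral>\<^sup>+w. ennreal (\<bar>Y i t0 w\<bar> ^ ?p) \<partial>M)"
    proof -
      have U': "U k t0 = (\<integral>\<^sup>+w. (if B i w \<le> real k then ennreal (\<bar>Y i t0 w\<bar> ^ ?p) else 0) \<partial>M)" for k
        unfolding U_def by (intro nn_integral_cong) (simp add: S_def indicator_def)
      show ?thesis unfolding U'
      proof (rule nn_integral_LIMSEQ)
        show "incseq (\<lambda>k w. if B i w \<le> real k then ennreal (\<bar>Y i t0 w\<bar> ^ ?p) else 0)"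
          by (auto simp: incseq_def le_fun_def)
        show "(\<lambda>w. if B i w \<le> real k then ennreal (\<bar>Y i t0 w\<bar> ^ ?p) else 0) \<in> borel_measurable M" for k by measurable
        fix w
        show "(\<lambda>k. if B i w \<le> real k then ennreal (\<bar>Y i t0 w\<bar> ^ ?p) else 0) \<longlonglongrightarrow> ennreal (\<bar>Y i t0 w\<bar> ^ ?p)"
        proof (rule tendsto_eventually)
          obtain n where n: "B i w \<le> real n" using real_arch_simple by blast
          have "B i w \<le> real k" if "n \<le> k" for k using n of_nat_mono[OF that, where 'a=real] by linarith
          then show "\<forall>\<^sub>F k in sequentially. (if B i w \<le> real k then ennreal (\<bar>Y i t0 w\<bar> ^ ?p) else 0) = ennreal (\<bar>Y i t0 w\<bar> ^ ?p)"
            unfolding eventually_sequentially by (intro exI[of _ n]) simp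
        qed
      qed
    qed
    have "(\<integral>\<^sup>+w. ennreal (\<bar>Y i t0 w\<bar> ^ ?p) \<partial>M) \<le> ennreal (exp (l * t0) * (2 * c * r i ^ ?p))"
      by (rule LIMSEQ_le_const2[OF lim]) (use Uk in blast)
    also have "\<dots> \<le> ennreal (exp (l * T) * (2 * c) * r i ^ ?p)"
    proof (intro ennreal_leI)
      have "exp (l * t0) * (2 * c * r i ^ ?p) \<le> exp (l * T) * (2 * c * r i ^ ?p)"
        using l(1) j(3) c r0 by (intro mult_right_mono) auto
      then show "exp (l * t0) * (2 * c * r i ^ ?p) \<le> exp (l * T) * (2 * c) * r i ^ ?p" by (simp only: mult.assoc)
    qed
    finally show "ibound M (\<lambda>w. \<bar>(case j of (i, t) \<Rightarrow> Y i t) w\<bar> ^ ?p) (exp (l * T) * (2 * c) * (case j of (i, t) \<Rightarrow> r i) ^ ?p)"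
      unfolding ibound_def j(1) using c r0 by (intro conjI allI) auto
  qed
qed

lemma (in prob_space) moms_gronwall:
  fixes Y Z :: "'i \<Rightarrow> real \<Rightarrow> 'a \<Rightarrow> real" and \<tau> :: "'i \<Rightarrow> real \<Rightarrow> real" and B :: "'i \<Rightarrow> 'a \<Rightarrow> real"
  assumes \<alpha>: "0 < \<alpha>" "\<alpha> < 1" and T: "0 < T" and A: "0 \<le> A"
    and Ym: "\<And>i. i \<in> I \<Longrightarrow> jointly_measurable M (Y i)"
    and Bm: "\<And>i. i \<in> I \<Longrightarrow> B i \<in> borel_measurable M"
    and B: "\<And>i t w. i \<in> I \<Longrightarrow> t \<in> {0..T} \<Longrightarrow> w \<in> space M \<Longrightarrow> \<bar>Y i t w\<bar> \<le> B i w"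
    and \<tau>: "\<And>i t. i \<in> I \<Longrightarrow> t \<in> {0..T} \<Longrightarrow> 0 \<le> \<tau> i t \<and> \<tau> i t \<le> t"
    and le: "\<And>i t. i \<in> I \<Longrightarrow> t \<in> {0..T} \<Longrightarrow>
       AE w in M. \<bar>Y i t w\<bar> \<le> A * (LBINT s. fk \<alpha> (\<tau> i t) s * \<bar>Y i s w\<bar>) + \<bar>Z i t w\<bar>"
    and Z: "moms M (I \<times> {0..T}) (\<lambda>(i, t). Z i t) (\<lambda>(i, t). r i)"
  shows "moms M (I \<times> {0..T}) (\<lambda>(i, t). Y i t) (\<lambda>(i, t). r i)"
proof (rule momsI)
  have Yt: "Y i t \<in> borel_measurable M" if "i \<in> I" for i t
    using measurable_compose[OF measurable_Pair1'[of t lborel M] Ym[OF that]] by simp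
  have rp: "0 < r i" if "i \<in> I" for i
    using momsD(2)[OF Z, of "(i, 0)"] that T by simp
  show "(case j of (i, t) \<Rightarrow> Y i t) \<in> borel_measurable M" if "j \<in> I \<times> {0..T}" for j using that Yt by auto
  show "0 < (case j of (i, t) \<Rightarrow> r i)" if "j \<in> I \<times> {0..T}" for j using that rp by auto
  fix q :: nat
  obtain C where C: "0 \<le> C" "\<And>i t. i \<in> I \<Longrightarrow> t \<in> {0..T} \<Longrightarrow> ibound M (\<lambda>w. \<bar>Z i t w\<bar> ^ (2^q)) (C * r i ^ (2^q))"
    using momsD(3)[OF Z, of q] by auto
  have Zm: "Z i t \<in> borel_measurable M" if "i \<in> I" "t \<in> {0..T}" for i t
    using momsD(1)[OF Z, of "(i, t)"] that by simp
  show "\<exists>C\<ge>0. \<forall>j\<in>I \<times> {0..T}. ibound M (\<lambda>w. \<bar>(case j of (i, t) \<Rightarrow> Y i t) w\<bar> ^ (2^q)) (C * (case j of (i, t) \<Rightarrow> r i) ^ (2^q))"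
    by (rule moment_gronwall[OF \<alpha> T A Ym Bm B \<tau> le rp Zm C])
qed

section \<open>Time grids\<close>

lemma joint_measurable:
  fixes Y :: "real \<Rightarrow> 'a \<Rightarrow> real"
  assumes Y: "\<And>t. Y t \<in> borel_measurable M" and c: "\<And>w. w \<in> space M \<Longrightarrow> continuous_on UNIV (\<lambda>t. Y t w)"
  shows "jointly_measurable M Y"
proof (rule borel_measurable_LIMSEQ_real)
  define a where "a n t = real_of_int \<lfloor>real (Suc n) * t\<rfloor> / real (Suc n)" for n and t :: real
  show "(\<lambda>p. Y (a n (fst p)) (snd p)) \<in> borel_measurable (lborel \<Otimes>\<^sub>M M)" for n
    unfolding a_def
  proof (rule measurable_compose_countable[where f="\<lambda>i p. Y (real_of_int i / real (Suc n)) (snd p)" and g="\<lambda>p. \<lfloor>real (Suc n) * fst p\<rfloor>"])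
    show "(\<lambda>p. Y (real_of_int i / real (Suc n)) (snd p)) \<in> borel_measurable (lborel \<Otimes>\<^sub>M M)" for i
      by (rule measurable_compose[OF measurable_snd Y])
    show "(\<lambda>p. \<lfloor>real (Suc n) * fst p\<rfloor>) \<in> measurable (lborel \<Otimes>\<^sub>M M) (count_space UNIV)" by measurable
  qed
  fix p :: "real \<times> 'a" assume "p \<in> space (lborel \<Otimes>\<^sub>M M)"
  then have w: "snd p \<in> space M" by (auto simp: space_pair_measure)
  have "(\<lambda>n. a n (fst p)) \<longlonglongrightarrow> fst p"
  proof (rule tendsto_sandwich)
    have "(\<lambda>n. fst p - 1 / real (Suc n)) \<longlonglongrightarrow> fst p - 0"
      by (intro tendsto_diff tendsto_const LIMSEQ_Suc[OF lim_1_over_n])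
    then show "(\<lambda>n. fst p - 1 / real (Suc n)) \<longlonglongrightarrow> fst p" by simp
    have "fst p - 1 / real (Suc n) \<le> a n (fst p) \<and> a n (fst p) \<le> fst p" for n
    proof -
      have "real_of_int \<lfloor>real (Suc n) * fst p\<rfloor> \<le> real (Suc n) * fst p" "real (Suc n) * fst p - 1 \<le> real_of_int \<lfloor>real (Suc n) * fst p\<rfloor>"
        by linarith+
      note fl = this
      have 1: "(real (Suc n) * fst p - 1) / real (Suc n) \<le> a n (fst p)"
        unfolding a_def by (rule divide_right_mono[OF fl(2)]) simp
      have 2: "a n (fst p) \<le> real (Suc n) * fst p / real (Suc n)"
        unfolding a_def by (rule divide_right_mono[OF fl(1)]) simp
      have "(real (Suc n) * fst p - 1) / real (Suc n) = fst p - 1 / real (Suc n)" by (simp add: diff_divide_distrib del: of_nat_Suc)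
      moreover have "real (Suc n) * fst p / real (Suc n) = fst p" by (simp del: of_nat_Suc)
      ultimately show ?thesis using 1 2 by linarith
    qed
    then show "\<forall>\<^sub>F n in sequentially. fst p - 1 / real (Suc n) \<le> a n (fst p)" "\<forall>\<^sub>F n in sequentially. a n (fst p) \<le> fst p"
      by simp_all
  qed simp
  moreover have "isCont (\<lambda>t. Y t (snd p)) (fst p)"
    using c[OF w] by (simp add: continuous_on_eq_continuous_at)
  ultimately show "(\<lambda>n. Y (a n (fst p)) (snd p)) \<longlonglongrightarrow> Y (fst p) (snd p)"
    by (intro isCont_tendsto_compose[where g="\<lambda>t. Y t (snd p)"])
qed

lemma volterra_joint_measurable:
  fixes Y :: "real \<Rightarrow> 'a \<Rightarrow> real"
  assumes Y: "jointly_measurable M Y"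
  shows "(\<lambda>p. LBINT s. fk \<alpha> (fst p) s * Y s (snd p)) \<in> borel_measurable (lborel \<Otimes>\<^sub>M M)"
proof -
  have sw: "(\<lambda>z. (snd z, snd (fst z))) \<in> measurable ((borel \<Otimes>\<^sub>M M) \<Otimes>\<^sub>M borel) (lborel \<Otimes>\<^sub>M M)" by measurable
  have [measurable]: "(\<lambda>z. Y (snd z) (snd (fst z))) \<in> borel_measurable ((borel \<Otimes>\<^sub>M M) \<Otimes>\<^sub>M borel)"
    using measurable_compose[OF sw Y] by simp
  have sw2: "(\<lambda>z. (fst (fst z), snd z)) \<in> measurable ((borel \<Otimes>\<^sub>M M) \<Otimes>\<^sub>M borel) (borel \<Otimes>\<^sub>M borel :: (real \<times> real) measure)" by measurable
  have [measurable]: "(\<lambda>z. fk \<alpha> (fst (fst z)) (snd z)) \<in> borel_measurable ((borel \<Otimes>\<^sub>M M) \<Otimes>\<^sub>M borel)"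
    using measurable_compose[OF sw2 fk_measurable_pair] by simp
  have "(\<lambda>z. fk \<alpha> (fst (fst z)) (snd z) * Y (snd z) (snd (fst z))) \<in> borel_measurable ((borel \<Otimes>\<^sub>M M) \<Otimes>\<^sub>M borel)" by measurable
  then have "(\<lambda>(p, s). fk \<alpha> (fst p) s * Y s (snd p)) \<in> borel_measurable ((lborel \<Otimes>\<^sub>M M) \<Otimes>\<^sub>M lborel)"
    by (simp add: case_prod_beta')
  then show ?thesis by (rule lborel.borel_measurable_lebesgue_integral)
qed

lemma integrable_kernel_bounded:
  fixes f :: "real \<Rightarrow> real"
  assumes k: "ibound lborel k A" and f: "f \<in> borel_measurable borel" "\<And>s. \<bar>f s\<bar> \<le> C"
  shows "integrable lborel (\<lambda>s. k s * f s)"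
proof (rule Bochner_Integration.integrable_bound[where f="\<lambda>s. C * k s"])
  have k': "k \<in> borel_measurable borel" "\<And>s. 0 \<le> k s" using k by (auto simp: ibound_def)
  show "integrable lborel (\<lambda>s. C * k s)" using ibound_integrable(1)[OF k] by simp
  show "(\<lambda>s. k s * f s) \<in> borel_measurable lborel" using k' f by measurable
  show "AE s in lborel. norm (k s * f s) \<le> norm (C * k s)"
  proof (intro AE_I2)
    fix s
    have "k s * \<bar>f s\<bar> \<le> k s * \<bar>C\<bar>" using k'(2)[of s] f(2)[of s] by (intro mult_left_mono) auto
    then show "norm (k s * f s) \<le> norm (C * k s)" using k'(2)[of s] by (simp add: abs_mult mult.commute)
  qed
qed

text \<open>Integrability is asked of the majorant only: if the left integrand is not integrable,
  its integral is 0.\<close>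

lemma kernel_integral_abs_le:
  fixes f g :: "real \<Rightarrow> real"
  assumes k: "\<And>s. 0 \<le> k s" and fg: "\<And>s. \<bar>f s\<bar> \<le> g s" and g: "integrable lborel (\<lambda>s. k s * g s)"
  shows "\<bar>LBINT s. k s * f s\<bar> \<le> (LBINT s. k s * g s)"
proof -
  show ?thesis
  proof (cases "integrable lborel (\<lambda>s. k s * f s)")
    case True
    have "\<bar>LBINT s. k s * f s\<bar> \<le> (LBINT s. \<bar>k s * f s\<bar>)" by (rule integral_abs_bound)
    also have "\<dots> \<le> (LBINT s. k s * g s)"
      using True k fg by (intro integral_mono g integrable_abs) (auto simp: abs_mult intro!: mult_left_mono)
    finally show ?thesis .
  next
    case False
    have "0 \<le> g s" for s using fg[of s] by linarith
    then have "0 \<le> (LBINT s. k s * g s)" using k by (intro Bochner_Integration.integral_nonneg) auto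
    then show ?thesis using False by (simp add: not_integrable_integral_eq)
  qed
qed

lemma real_mvt:
  fixes f f' :: "real \<Rightarrow> real"
  assumes "\<And>x. (f has_real_derivative f' x) (at x)"
  shows "\<exists>z. min x y \<le> z \<and> z \<le> max x y \<and> f y - f x = (y - x) * f' z"
proof -
  consider "x < y" | "x = y" | "y < x" by linarith
  then show ?thesis
  proof cases
    case 1
    then obtain z where "x < z" "z < y" "f y - f x = (y - x) * f' z" using MVT2[of x y f f'] assms by blast
    then show ?thesis using 1 by (intro exI[of _ z]) auto
  next
    case 2 then show ?thesis by (intro exI[of _ x]) auto
  next
    case 3
    then obtain z where "y < z" "z < x" "f x - f y = (x - y) * f' z" using MVT2[of y x f f'] assms by blast
    then show ?thesis using 3 by (intro exI[of _ z]) (auto simp: algebra_simps)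
  qed
qed

text \<open>Compare f at a with f at the fourth corner c + d - e: the mean value theorem gives the
  term with B. On the exact parallelogram c + d - e, c, d, e two further applications give f2 times
  the product of the sides. \<open>S\<close> dominates every intermediate point, by the crude
  triangle inequality that yields \<open>3 * \<bar>e\<bar>\<close>.\<close>

lemma mixed_difference_bound:
  fixes f f1 f2 :: "real \<Rightarrow> real" and a c d e :: real
  assumes f: "\<And>x. (f has_real_derivative f1 x) (at x)" and f1: "\<And>x. (f1 has_real_derivative f2 x) (at x)"
    and g1: "\<And>z. \<bar>z\<bar> \<le> S \<Longrightarrow> \<bar>f1 z\<bar> \<le> B" and g2: "\<And>x. \<bar>f2 x\<bar> \<le> K * (1 + \<bar>x\<bar> ^ m)" and K: "0 \<le> K"
    and S: "S = \<bar>a\<bar> + \<bar>c\<bar> + \<bar>d\<bar> + 3 * \<bar>e\<bar>"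
  shows "\<bar>f a - f c - f d + f e\<bar> \<le> B * \<bar>a - c - d + e\<bar> + K * (1 + S ^ m) * (\<bar>c - e\<bar> * \<bar>d - e\<bar>)"
proof -
  have g: "\<bar>f2 x\<bar> \<le> K * (1 + S ^ m)" if "\<bar>x\<bar> \<le> S" for x
  proof -
    have "K * (1 + \<bar>x\<bar> ^ m) \<le> K * (1 + S ^ m)" using that K by (intro mult_left_mono add_left_mono power_mono) auto
    then show ?thesis using g2[of x] by linarith
  qed
  obtain z where z: "min (c + d - e) a \<le> z" "z \<le> max (c + d - e) a" "f a - f (c + d - e) = (a - (c + d - e)) * f1 z"
    using real_mvt[of f f1 "c + d - e" a] f by blast
  have "\<bar>z\<bar> \<le> S" using z(1,2) unfolding S by (auto simp: min_def max_def abs_if split: if_splits)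
  then have 1: "\<bar>f a - f (c + d - e)\<bar> \<le> B * \<bar>a - c - d + e\<bar>"
    unfolding z(3) abs_mult using mult_left_mono[OF g1[of z], of "\<bar>a - c - d + e\<bar>"] by (simp add: algebra_simps)
  define p where "p = c - e"
  define q where "q = d - e"
  have "((\<lambda>y. f (y + q) - f y) has_real_derivative (f1 (y + q) - f1 y)) (at y)" for y
    by (intro DERIV_diff f DERIV_shift[THEN iffD1] f)
  then obtain y where y: "min e (e + p) \<le> y" "y \<le> max e (e + p)" "(f (e + p + q) - f (e + p)) - (f (e + q) - f e) = (e + p - e) * (f1 (y + q) - f1 y)"
    using real_mvt[of "\<lambda>y. f (y + q) - f y" "\<lambda>y. f1 (y + q) - f1 y" e "e + p"] by blast
  obtain x where x: "min y (y + q) \<le> x" "x \<le> max y (y + q)" "f1 (y + q) - f1 y = (y + q - y) * f2 x"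
    using real_mvt[of f1 f2 y "y + q"] f1 by blast
  have "\<bar>x\<bar> \<le> S" using x(1,2) y(1,2) unfolding S p_def q_def by (auto simp: min_def max_def abs_if split: if_splits)
  have "f (c + d - e) - f c - f d + f e = (f (e + p + q) - f (e + p)) - (f (e + q) - f e)"
    by (simp add: p_def q_def algebra_simps)
  also have "\<dots> = p * (q * f2 x)" using y(3) x(3) by simp
  finally have "\<bar>f (c + d - e) - f c - f d + f e\<bar> = \<bar>p\<bar> * (\<bar>q\<bar> * \<bar>f2 x\<bar>)" by (simp add: abs_mult)
  also have "\<dots> \<le> \<bar>p\<bar> * (\<bar>q\<bar> * (K * (1 + S ^ m)))"
    using g[OF \<open>\<bar>x\<bar> \<le> S\<close>] by (intro mult_left_mono) auto
  finally have 2: "\<bar>f (c + d - e) - f c - f d + f e\<bar> \<le> \<bar>p\<bar> * (\<bar>q\<bar> * (K * (1 + S ^ m)))" .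
  have "\<bar>f a - f c - f d + f e\<bar> \<le> \<bar>f a - f (c + d - e)\<bar> + \<bar>f (c + d - e) - f c - f d + f e\<bar>" by linarith
  also have "\<dots> \<le> B * \<bar>a - c - d + e\<bar> + \<bar>p\<bar> * (\<bar>q\<bar> * (K * (1 + S ^ m)))" using 1 2 by linarith
  also have "\<dots> = B * \<bar>a - c - d + e\<bar> + K * (1 + S ^ m) * (\<bar>p\<bar> * \<bar>q\<bar>)" by (simp only: mult_ac)
  finally show ?thesis unfolding p_def q_def .
qed

section \<open>The time grid, step processes and the discrete Gronwall inequality\<close>

context fpar
begin

definition tg :: "nat \<Rightarrow> nat \<Rightarrow> real" where "tg N k = real k * (T / real N)"

text \<open>Index of the last grid point not after s; the final time T gets index N, so indices
  range over N+1 values.\<close>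

definition fl :: "nat \<Rightarrow> real \<Rightarrow> nat" where "fl N s = nat \<lfloor>s * real N / T\<rfloor>"

lemma fl_props:
  assumes s: "s \<in> {0..T}" and N: "2 \<le> N"
  shows "fl N s \<le> N" "tg N (fl N s) \<le> s" "s - tg N (fl N s) \<le> T / real N" "0 \<le> tg N (fl N s)" "tg N (fl N s) \<in> {0..T}"
proof -
  have y: "0 \<le> s * real N / T" using s T by simp
  have 1: "real (fl N s) \<le> s * real N / T" "s * real N / T < real (fl N s) + 1" using y by (auto simp: fl_def)
  have "s * real N / T \<le> real N" using s T N by (simp add: field_simps)
  then show "fl N s \<le> N" using 1(1) by linarith
  show 2: "tg N (fl N s) \<le> s" using 1(1) T N by (simp add: tg_def field_simps)
  show "s - tg N (fl N s) \<le> T / real N"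
  proof -
    have "s < (real (fl N s) + 1) * (T / real N)" using 1(2) T N by (simp add: field_simps)
    then show ?thesis by (simp only: tg_def distrib_right)
  qed
  show 3: "0 \<le> tg N (fl N s)" using T by (simp add: tg_def)
  show "tg N (fl N s) \<in> {0..T}" using 2 3 s by simp
qed

lemma fl_eq:
  assumes N: "2 \<le> N" and s: "tg N k \<le> s" "s < tg N (Suc k)"
  shows "fl N s = k"
proof -
  have "real k \<le> s * real N / T" "s * real N / T < real k + 1" using s T N by (auto simp: tg_def field_simps)
  then have "\<lfloor>s * real N / T\<rfloor> = int k" by (intro floor_unique) auto
  then show ?thesis by (simp add: fl_def)
qed

lemma fl_tg: "2 \<le> N \<Longrightarrow> fl N (tg N k) = k"
  by (rule fl_eq) (use T in \<open>auto simp: tg_def field_simps\<close>)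

lemma tg_mem: "k \<le> N \<Longrightarrow> 2 \<le> N \<Longrightarrow> tg N k \<in> {0..T}"
  using T by (auto simp: tg_def field_simps mult_left_mono)

lemma tg_mono: "2 \<le> N \<Longrightarrow> j \<le> k \<Longrightarrow> tg N j \<le> tg N k"
  unfolding tg_def using T by (intro mult_right_mono) auto

lemma fl_measurable: "fl N \<in> measurable borel (count_space UNIV)"
  unfolding fl_def[abs_def] by measurable

lemma step_joint_measurable:
  assumes "\<And>k. D k \<in> borel_measurable M"
  shows "(\<lambda>p. D (fl N (fst p)) (snd p) :: real) \<in> borel_measurable (lborel \<Otimes>\<^sub>M M)"
proof (rule measurable_compose_countable[where f="\<lambda>k p. D k (snd p)" and g="\<lambda>p. fl N (fst p)"])
  show "(\<lambda>p. D k (snd p)) \<in> borel_measurable (lborel \<Otimes>\<^sub>M M)" for k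
    by (rule measurable_compose[OF measurable_snd assms])
  have "fst \<in> measurable (lborel \<Otimes>\<^sub>M M) borel" by measurable
  then show "(\<lambda>p. fl N (fst p)) \<in> measurable (lborel \<Otimes>\<^sub>M M) (count_space UNIV)"
    by (rule measurable_compose[OF _ fl_measurable])
qed

definition wt :: "nat \<Rightarrow> nat \<Rightarrow> nat \<Rightarrow> real" where
  "wt N n j = (LBINT s. fk \<alpha> (tg N n) s * indicator {tg N j..tg N (Suc j)} s)"

text \<open>Off the grid points, a null set, exactly one cell contains s. The Euler sum becomes a
  Volterra integral of a step process, so the kernel estimates for continuous time serve the scheme
  as well.\<close>

lemma wt_sum:
  assumes N: "2 \<le> N" and n: "n \<le> N"
  shows "(\<Sum>j<n. wt N n j * y j) = (LBINT s. fk \<alpha> (tg N n) s * y (fl N s))"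
proof -
  have tn: "0 \<le> tg N n" using tg_mem[OF n N] by simp
  have i: "integrable lborel (\<lambda>s. fk \<alpha> (tg N n) s * indicator {tg N j..tg N (Suc j)} s * y j)" for j
    by (intro integrable_mult_left integrable_kernel_bounded[OF ibound_fk[OF \<alpha>0 tn], of _ 1]) (auto simp: indicator_def)
  have "(\<Sum>j<n. wt N n j * y j) = (LBINT s. (\<Sum>j<n. fk \<alpha> (tg N n) s * indicator {tg N j..tg N (Suc j)} s * y j))"
    unfolding wt_def using i by (subst Bochner_Integration.integral_sum) auto
  also have "\<dots> = (LBINT s. fk \<alpha> (tg N n) s * y (fl N s))"
  proof (rule integral_cong_AE)
    have "y \<in> measurable (count_space UNIV) borel" by simp
    then have "(\<lambda>s. y (fl N s)) \<in> borel_measurable borel" by (rule measurable_compose[OF fl_measurable])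
    then show "(\<lambda>s. fk \<alpha> (tg N n) s * y (fl N s)) \<in> borel_measurable lborel" by measurable
    have "countable (range (tg N))" by simp
    then have "AE s in lborel. s \<notin> range (tg N)"
      by (intro AE_not_in null_setsI countable_imp_null_set_lborel[THEN null_setsD1]) (auto intro: sets.countable)
    then show "AE s in lborel. (\<Sum>j<n. fk \<alpha> (tg N n) s * indicator {tg N j..tg N (Suc j)} s * y j) = fk \<alpha> (tg N n) s * y (fl N s)"
    proof eventually_elim
      case (elim s)
      show ?case
      proof (cases "0 \<le> s \<and> s < tg N n")
        case False
        then have "fk \<alpha> (tg N n) s = 0" by (auto simp: fk_def)
        then show ?thesis by simp
      next
        case True
        then have sT: "s \<in> {0..T}" using tg_mem[OF n N] by auto
        define k where "k = fl N s"
        have k: "tg N k < s" using fl_props(2)[OF sT N] elim by (metis k_def less_le rangeI)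
        have k2: "s < tg N (Suc k)"
        proof -
          have "s \<le> tg N (Suc k)" using fl_props(3)[OF sT N] by (simp add: k_def tg_def algebra_simps)
          then show ?thesis using elim by (metis less_le rangeI)
        qed
        have kn: "k < n"
        proof (rule ccontr)
          assume "\<not> k < n"
          then have "tg N n \<le> tg N k" by (intro tg_mono N) auto
          then show False using k True by linarith
        qed
        have "(\<Sum>j<n. fk \<alpha> (tg N n) s * indicator {tg N j..tg N (Suc j)} s * y j) = (\<Sum>j\<in>{k}. fk \<alpha> (tg N n) s * indicator {tg N j..tg N (Suc j)} s * y j)"
        proof (rule sum.mono_neutral_right)
          show "\<forall>j\<in>{..<n} - {k}. fk \<alpha> (tg N n) s * indicator {tg N j..tg N (Suc j)} s * y j = 0"
          proof
            fix j assume j: "j \<in> {..<n} - {k}"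
            have "s \<notin> {tg N j..tg N (Suc j)}"
            proof (cases "j < k")
              case True
              then have "tg N (Suc j) \<le> tg N k" by (intro tg_mono N) auto
              then show ?thesis using k by auto
            next
              case False
              then have "tg N (Suc k) \<le> tg N j" using j by (intro tg_mono N) auto
              then show ?thesis using k2 by auto
            qed
            then show "fk \<alpha> (tg N n) s * indicator {tg N j..tg N (Suc j)} s * y j = 0" by simp
          qed
        qed (use kn in auto)
        also have "\<dots> = fk \<alpha> (tg N n) s * y k" using k k2 by simp
        finally show ?thesis by (simp only: k_def)
      qed
    qed
  qed measurable
  finally show ?thesis .
qed

text \<open>Bridge from the gauge integrals in which the scheme is formulated to the Lebesgue
  weights.\<close>

lemma wt_henstock:
  assumes N: "2 \<le> N" and n: "n \<le> N" and j: "j < n"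
  shows "integral {tg N j..tg N (Suc j)} (\<lambda>s. (tg N n - s) powr (\<alpha> - 1)) = wt N n j"
proof -
  have tn: "0 \<le> tg N n" using tg_mem[OF n N] by simp
  let ?S = "{tg N j..tg N (Suc j)}"
  have i: "integrable lborel (\<lambda>s. fk \<alpha> (tg N n) s * indicator ?S s)"
    by (intro integrable_kernel_bounded[OF ibound_fk[OF \<alpha>0 tn], of _ 1]) (auto simp: indicator_def)
  have "((\<lambda>s. fk \<alpha> (tg N n) s * indicator ?S s) has_integral wt N n j) UNIV"
    unfolding wt_def by (rule has_integral_integral_lborel[OF i])
  moreover have "(\<lambda>s. fk \<alpha> (tg N n) s * indicator ?S s) = (\<lambda>s. if s \<in> ?S then (tg N n - s) powr (\<alpha> - 1) else 0)"
  proof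
    fix s
    have "tg N (Suc j) \<le> tg N n" using j by (intro tg_mono N) auto
    moreover have "0 \<le> tg N j" using T by (simp add: tg_def)
    ultimately show "fk \<alpha> (tg N n) s * indicator ?S s = (if s \<in> ?S then (tg N n - s) powr (\<alpha> - 1) else 0)"
      by (auto simp: fk_def indicator_def)
  qed
  ultimately have "((\<lambda>s. (tg N n - s) powr (\<alpha> - 1)) has_integral wt N n j) ?S"
    by (simp only: has_integral_restrict_UNIV)
  then show ?thesis by (rule integral_unique)
qed

text \<open>The discrete Gronwall inequality is the continuous one for step processes.\<close>
lemma euler_gronwall:
  fixes D Z :: "'i \<Rightarrow> nat \<Rightarrow> 'a \<Rightarrow> real" and N :: "'i \<Rightarrow> nat"
  assumes M: "prob_space M" and N: "\<And>i. i \<in> I \<Longrightarrow> 2 \<le> N i" and A: "0 \<le> A"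
    and D: "\<And>i k. i \<in> I \<Longrightarrow> D i k \<in> borel_measurable M"
    and le: "\<And>i n. i \<in> I \<Longrightarrow> n \<le> N i \<Longrightarrow>
       AE w in M. \<bar>D i n w\<bar> \<le> A * (LBINT s. fk \<alpha> (tg (N i) n) s * \<bar>D i (fl (N i) s) w\<bar>) + \<bar>Z i n w\<bar>"
    and Z: "moms M (SIGMA i:I. {..N i}) (\<lambda>(i, n). Z i n) (\<lambda>(i, n). r i)"
  shows "moms M (SIGMA i:I. {..N i}) (\<lambda>(i, n). D i n) (\<lambda>(i, n). r i)"
proof -
  interpret prob_space M by fact
  have Z': "moms M (I \<times> {0..T}) (\<lambda>(i, t). Z i (fl (N i) t)) (\<lambda>(i, t). r i)"
    using moms_reindex[OF Z, of "I \<times> {0..T}" "\<lambda>(i, t). (i, fl (N i) t)"] fl_props(1) N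
    by (auto simp: case_prod_beta')
  have "moms M (I \<times> {0..T}) (\<lambda>(i, t). D i (fl (N i) t)) (\<lambda>(i, t). r i)"
  \<comment> \<open>A step process at time t is governed by the inequality at the last grid point,
    which serves as the lag \<tau>. Finitely many grid values make up the pathwise bound
    \<open>B\<close>.\<close>
  proof (rule moms_gronwall[OF \<alpha>0 \<alpha>(2) T A _ _ _ _ _ Z', where \<tau>="\<lambda>i t. tg (N i) (fl (N i) t)" and B="\<lambda>i w. \<Sum>k\<le>N i. \<bar>D i k w\<bar>"])
    fix i assume i: "i \<in> I"
    show "(\<lambda>p. D i (fl (N i) (fst p)) (snd p)) \<in> borel_measurable (lborel \<Otimes>\<^sub>M M)"
      by (intro step_joint_measurable D i)
    show "(\<lambda>w. \<Sum>k\<le>N i. \<bar>D i k w\<bar>) \<in> borel_measurable M"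
      by (intro borel_measurable_sum borel_measurable_abs D i)
    fix t assume t: "t \<in> {0..T}"
    show "0 \<le> tg (N i) (fl (N i) t) \<and> tg (N i) (fl (N i) t) \<le> t" using fl_props[OF t N[OF i]] by simp
    show "AE w in M. \<bar>D i (fl (N i) t) w\<bar> \<le> A * (LBINT s. fk \<alpha> (tg (N i) (fl (N i) t)) s * \<bar>D i (fl (N i) s) w\<bar>) + \<bar>Z i (fl (N i) t) w\<bar>"
      by (intro le i fl_props t N)
    fix w
    show "\<bar>D i (fl (N i) t) w\<bar> \<le> (\<Sum>k\<le>N i. \<bar>D i k w\<bar>)"
      by (rule member_le_sum[where f="\<lambda>k. \<bar>D i k w\<bar>"]) (use fl_props(1)[OF t N[OF i]] in auto)
  qed
  from moms_reindex[OF this, of "SIGMA i:I. {..N i}" "\<lambda>(i, n). (i, tg (N i) n)"] tg_mem N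
  have "moms M (SIGMA i:I. {..N i}) (\<lambda>j. case j of (i, n) \<Rightarrow> D i (fl (N i) (tg (N i) n))) (\<lambda>(i, n). r i)"
    by (auto simp: case_prod_beta')
  then show ?thesis
  proof (rule moms_mono[where K=1])
    fix j assume j: "j \<in> (SIGMA i:I. {..N i})"
    show "(case j of (i, n) \<Rightarrow> D i n) \<in> borel_measurable M" using j D by auto
    show "0 < (case j of (i, n) \<Rightarrow> r i)" by (rule momsD(2)[OF Z j])
    show "AE w in M. \<bar>(case j of (i, n) \<Rightarrow> D i n) w\<bar> \<le> \<bar>(case j of (i, n) \<Rightarrow> D i (fl (N i) (tg (N i) n))) w\<bar>"
      using j N fl_tg by auto
  qed auto
qed

end

section \<open>The Euler map\<close>

lemma moms_abs:
  assumes "moms M J Y r"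
  shows "moms M J (\<lambda>j w. \<bar>Y j w\<bar>) r"
  by (rule moms_mono[OF assms, where K=1]) (auto intro!: borel_measurable_abs momsD(1)[OF assms] momsD(2)[OF assms])

lemma moms_mult1: "moms M J a (\<lambda>_. 1) \<Longrightarrow> moms M J c r \<Longrightarrow> moms M J (\<lambda>j w. a j w * c j w) r"
  using moms_mult[of M J a "\<lambda>_. 1" c r] by simp

lemma L2_lim_cong:
  assumes "L2_lim M Y X" "AE w in M. X' w = X w" "X' \<in> borel_measurable M"
  shows "L2_lim M Y X'"
proof -
  have "(\<integral>\<^sup>+w. ennreal ((Y n w - X' w)\<^sup>2) \<partial>M) = (\<integral>\<^sup>+w. ennreal ((Y n w - X w)\<^sup>2) \<partial>M)" for n
    by (rule nn_integral_cong_AE) (use assms(2) in \<open>eventually_elim, simp\<close>)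
  then show ?thesis using assms unfolding L2_lim_def by simp
qed

section \<open>The equation, its paths and the noise read off from it\<close>

locale vol = fbm_setting +
  fixes b b1 b2 b3 :: "real \<Rightarrow> real" and L K :: real and m :: nat and x0 :: real and x :: "real \<Rightarrow> 'a \<Rightarrow> real"
  assumes db: "\<And>y. (b has_real_derivative b1 y) (at y)"
    and db1: "\<And>y. (b1 has_real_derivative b2 y) (at y)"
    and db2: "\<And>y. (b2 has_real_derivative b3 y) (at y)"
    and L: "\<And>y. \<bar>b1 y\<bar> \<le> L"
    and K2: "\<And>y. \<bar>b2 y\<bar> \<le> K * (1 + \<bar>y\<bar> ^ m)"
    and K3: "\<And>y. \<bar>b3 y\<bar> \<le> K * (1 + \<bar>y\<bar> ^ m)"
    and K: "0 \<le> K"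
    and x_meas: "\<And>t. t \<in> {0..T} \<Longrightarrow> x t \<in> borel_measurable M"
    and x_cont: "\<And>w. w \<in> space M \<Longrightarrow> continuous_on {0..T} (\<lambda>t. x t w)"
    and x_sol: "\<And>t. t \<in> {0..T} \<Longrightarrow> AE w in M.
        x t w = x0 + 1 / Gamma \<alpha> * integral {0..t} (\<lambda>s. (t - s) powr (\<alpha> - 1) * b (x s w)) + G t w"
begin

lemma L0: "0 \<le> L" using L[of 0] by linarith

definition "g0 = 1 / Gamma \<alpha>"

lemma g0: "0 < g0" unfolding g0_def using \<alpha>0 by (simp add: Gamma_real_pos)

lemma b_lip: "\<bar>b u - b v\<bar> \<le> L * \<bar>u - v\<bar>"
proof -
  obtain z where "b u - b v = (u - v) * b1 z" using real_mvt[of b b1 v u] db by blast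
  then show ?thesis using mult_right_mono[OF L[of z], of "\<bar>u - v\<bar>"] by (simp add: abs_mult mult.commute)
qed

lemma b_growth: "\<bar>b u\<bar> \<le> \<bar>b 0\<bar> + L * \<bar>u\<bar>"
  using b_lip[of u 0] by simp

lemma b1_diff: "\<bar>b1 u - b1 v\<bar> \<le> K * (1 + (\<bar>u\<bar> + \<bar>v\<bar>) ^ m) * \<bar>u - v\<bar>"
proof -
  obtain z where z: "min v u \<le> z" "z \<le> max v u" "b1 u - b1 v = (u - v) * b2 z" using real_mvt[of b1 b2 v u] db1 by blast
  have "\<bar>z\<bar> \<le> \<bar>u\<bar> + \<bar>v\<bar>" using z(1,2) by (auto simp: min_def max_def split: if_splits)
  then have "K * (1 + \<bar>z\<bar> ^ m) \<le> K * (1 + (\<bar>u\<bar> + \<bar>v\<bar>) ^ m)" using K by (intro mult_left_mono add_left_mono power_mono) auto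
  then have "\<bar>b2 z\<bar> \<le> K * (1 + (\<bar>u\<bar> + \<bar>v\<bar>) ^ m)" using K2[of z] by linarith
  then have "\<bar>b2 z\<bar> * \<bar>u - v\<bar> \<le> K * (1 + (\<bar>u\<bar> + \<bar>v\<bar>) ^ m) * \<bar>u - v\<bar>" by (intro mult_right_mono) auto
  moreover have "\<bar>b1 u - b1 v\<bar> = \<bar>b2 z\<bar> * \<bar>u - v\<bar>" unfolding z(3) by (simp add: abs_mult mult.commute)
  ultimately show ?thesis by simp
qed

lemma b_measurable [measurable]: "b \<in> borel_measurable borel" "b1 \<in> borel_measurable borel"
  using db db1 by (auto intro!: borel_measurable_continuous_onI continuous_at_imp_continuous_on dest: DERIV_isCont)

text \<open>Freezing x outside [0,T] gives paths continuous on the whole line, hence joint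
  measurability and pathwise boundedness without restricting the time domain.\<close>

definition xe :: "real \<Rightarrow> 'a \<Rightarrow> real" where "xe t = x (max 0 (min T t))"

lemma xe_eq: "t \<in> {0..T} \<Longrightarrow> xe t = x t"
  by (simp add: xe_def)

lemma clamp_mem: "max 0 (min T t) \<in> {0..T}" using T by auto

lemma xe_meas [measurable]: "xe t \<in> borel_measurable M"
  unfolding xe_def by (rule x_meas[OF clamp_mem])

lemma xe_cont: "w \<in> space M \<Longrightarrow> continuous_on UNIV (\<lambda>t. xe t w)"
  unfolding xe_def using clamp_mem
  by (intro continuous_on_compose2[OF x_cont, of w UNIV "\<lambda>t. max 0 (min T t)"] continuous_intros) auto

lemma xe_joint: "jointly_measurable M xe"
  by (rule joint_measurable[OF xe_meas xe_cont])

lemma xe_bounded: "w \<in> space M \<Longrightarrow> \<exists>C. \<forall>t. \<bar>xe t w\<bar> \<le> C"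
proof -
  assume w: "w \<in> space M"
  have "compact ((\<lambda>t. x t w) ` {0..T})" by (intro compact_continuous_image x_cont w) simp
  then obtain C where "\<forall>y\<in>(\<lambda>t. x t w) ` {0..T}. \<bar>y\<bar> \<le> C" using compact_imp_bounded bounded_real by metis
  then have "\<forall>t. \<bar>xe t w\<bar> \<le> C" unfolding xe_def using clamp_mem by blast
  then show ?thesis by blast
qed

definition bx :: "real \<Rightarrow> 'a \<Rightarrow> real" where "bx s w = b (xe s w)"

lemma bx_joint: "jointly_measurable M bx"
  unfolding bx_def by (rule measurable_compose[OF xe_joint b_measurable(1)])

lemma bx_path:
  assumes w: "w \<in> space M"
  shows "(\<lambda>s. bx s w) \<in> borel_measurable borel" "\<exists>C. \<forall>s. \<bar>bx s w\<bar> \<le> C"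
proof -
  have "(\<lambda>s. xe s w) \<in> borel_measurable borel" by (intro borel_measurable_continuous_onI xe_cont w)
  then show "(\<lambda>s. bx s w) \<in> borel_measurable borel" unfolding bx_def by (rule measurable_compose[OF _ b_measurable(1)])
  obtain C where C: "\<And>t. \<bar>xe t w\<bar> \<le> C" using xe_bounded[OF w] by blast
  have "\<bar>bx s w\<bar> \<le> \<bar>b 0\<bar> + L * C" for s
    using b_growth[of "xe s w"] mult_left_mono[OF C L0, of s] unfolding bx_def by linarith
  then show "\<exists>C. \<forall>s. \<bar>bx s w\<bar> \<le> C" by blast
qed

lemma fk_bx_integrable: "w \<in> space M \<Longrightarrow> 0 \<le> t \<Longrightarrow> integrable lborel (\<lambda>s. fk \<alpha> t s * bx s w)"
  using bx_path[of w] integrable_kernel_bounded[OF ibound_fk[OF \<alpha>0, of t]] by blast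

text \<open>A jointly measurable version of \<open>G\<close>, read off from the equation.\<close>
definition Gt :: "real \<Rightarrow> 'a \<Rightarrow> real" where
  "Gt t w = xe t w - x0 - g0 * (LBINT s. fk \<alpha> t s * bx s w)"

lemma Gt_joint: "jointly_measurable M Gt"
  unfolding Gt_def using xe_joint volterra_joint_measurable[OF bx_joint, of \<alpha>] by measurable

lemma Gt_meas [measurable]: "Gt t \<in> borel_measurable M"
  using measurable_compose[OF measurable_Pair1'[of t lborel M] Gt_joint] by simp

lemma Gt_path:
  assumes w: "w \<in> space M"
  shows "(\<lambda>s. Gt s w) \<in> borel_measurable borel" "\<exists>C. \<forall>s\<in>{0..T}. \<bar>Gt s w\<bar> \<le> C"
proof -
  show "(\<lambda>s. Gt s w) \<in> borel_measurable borel"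
    using measurable_compose[OF measurable_Pair2'[OF w, of lborel] Gt_joint] by simp
  obtain C where C: "\<And>t. \<bar>xe t w\<bar> \<le> C" using xe_bounded[OF w] by blast
  obtain D where D: "\<And>t. \<bar>bx t w\<bar> \<le> D" using bx_path(2)[OF w] by blast
  have D0: "0 \<le> D" using D[of 0] by linarith
  have "\<bar>Gt s w\<bar> \<le> C + \<bar>x0\<bar> + g0 * (D * (T powr \<alpha> / \<alpha>))" if s: "s \<in> {0..T}" for s
  proof -
    have ib: "ibound lborel (\<lambda>r. D * fk \<alpha> s r) (D * (s powr \<alpha> / \<alpha>))"
      using s D0 by (intro ibound_cmult ibound_fk \<alpha>0) auto
    have "\<bar>LBINT r. fk \<alpha> s r * bx r w\<bar> \<le> (LBINT r. fk \<alpha> s r * D)"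
      using ibound_integrable(1)[OF ib] by (intro kernel_integral_abs_le D) (auto simp: mult.commute)
    also have "\<dots> \<le> D * (s powr \<alpha> / \<alpha>)" using ibound_integrable(2)[OF ib] by (simp add: mult.commute)
    also have "\<dots> \<le> D * (T powr \<alpha> / \<alpha>)" using s D0 \<alpha>0 by (intro mult_left_mono divide_right_mono powr_mono2) auto
    finally have "g0 * \<bar>LBINT r. fk \<alpha> s r * bx r w\<bar> \<le> g0 * (D * (T powr \<alpha> / \<alpha>))" using g0 by (intro mult_left_mono) auto
    then have "\<bar>g0 * (LBINT r. fk \<alpha> s r * bx r w)\<bar> \<le> g0 * (D * (T powr \<alpha> / \<alpha>))" using g0 by (simp add: abs_mult)
    then show ?thesis unfolding Gt_def using C[of s] by linarith
  qed
  then show "\<exists>C. \<forall>s\<in>{0..T}. \<bar>Gt s w\<bar> \<le> C" by blast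
qed

lemma Gt_AE: "t \<in> {0..T} \<Longrightarrow> AE w in M. Gt t w = G t w"
proof -
  assume t: "t \<in> {0..T}"
  show ?thesis using x_sol[OF t]
  proof (rule AE_mp, intro AE_I2 impI)
    fix w assume w: "w \<in> space M" and eq: "x t w = x0 + 1 / Gamma \<alpha> * integral {0..t} (\<lambda>s. (t - s) powr (\<alpha> - 1) * b (x s w)) + G t w"
    have "0 \<le> t" using t by simp
    have "((\<lambda>s. fk \<alpha> t s * bx s w) has_integral (LBINT s. fk \<alpha> t s * bx s w)) UNIV"
      by (rule has_integral_integral_lborel[OF fk_bx_integrable[OF w \<open>0 \<le> t\<close>]])
    moreover have "(\<lambda>s. fk \<alpha> t s * bx s w) = (\<lambda>s. if s \<in> {0..t} then (t - s) powr (\<alpha> - 1) * b (x s w) else 0)"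
      using t by (auto simp: fk_def bx_def xe_def fun_eq_iff)
    ultimately have "((\<lambda>s. (t - s) powr (\<alpha> - 1) * b (x s w)) has_integral (LBINT s. fk \<alpha> t s * bx s w)) {0..t}"
      by (simp only: has_integral_restrict_UNIV)
    then have "integral {0..t} (\<lambda>s. (t - s) powr (\<alpha> - 1) * b (x s w)) = (LBINT s. fk \<alpha> t s * bx s w)" by (rule integral_unique)
    then show "Gt t w = G t w" using eq t by (simp add: Gt_def g0_def xe_eq)
  qed
qed

lemma Gt_VV: "t \<in> {0..T} \<Longrightarrow> Gt t \<in> VV"
  unfolding fbm_space_def mem_Collect_eq
  by (intro exI[of _ "Y t"] conjI allI Y_span L2_lim_cong[OF L2_lim_G Gt_AE]) auto

lemma Gt_variance: "\<exists>C>0. \<forall>t\<in>{0..T}. expectation (\<lambda>w. (Gt t w)\<^sup>2) \<le> C"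
proof -
  obtain C where C: "0 < C" "\<And>t. t \<in> {0..T} \<Longrightarrow> expectation (\<lambda>w. (G t w)\<^sup>2) \<le> C" using G_variance_bound by blast
  have "expectation (\<lambda>w. (Gt t w)\<^sup>2) \<le> C" if t: "t \<in> {0..T}" for t
  proof -
    have [measurable]: "G t \<in> borel_measurable M" using V_measurable[OF G_VV[OF t]] .
    have "expectation (\<lambda>w. (Gt t w)\<^sup>2) = expectation (\<lambda>w. (G t w)\<^sup>2)"
      using Gt_AE[OF t] by (intro integral_cong_AE) auto
    then show ?thesis using C(2)[OF t] by simp
  qed
  then show ?thesis using C(1) by blast
qed

definition dl :: "nat \<Rightarrow> real \<Rightarrow> 'a \<Rightarrow> real" where
  "dl N s w = Gt s w - Gt (tg N (fl N s)) w"

lemma dl_VV: "2 \<le> N \<Longrightarrow> s \<in> {0..T} \<Longrightarrow> dl N s \<in> VV"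
  unfolding dl_def[abs_def] by (intro V_diff Gt_VV fl_props)

lemma step_h: "2 \<le> N \<Longrightarrow> 0 < T / real N \<and> T / real N \<le> T/2"
  using T divide_left_mono[of 2 "real N" T] by simp

lemma dl_cov: "\<exists>C>0. \<forall>N s u. 2 \<le> N \<and> s \<in> {0..T} \<and> u \<in> {0..T} \<longrightarrow> \<bar>expectation (\<lambda>w. Gt u w * dl N s w)\<bar> \<le> C * rt N"
proof -
  obtain C where C: "0 < C" "\<And>h r s u. 0 < h \<Longrightarrow> h \<le> T/2 \<Longrightarrow> 0 \<le> r \<Longrightarrow> r \<le> s \<Longrightarrow> s \<le> T \<Longrightarrow> s - r \<le> h \<Longrightarrow> u \<in> {0..T} \<Longrightarrow>
     \<bar>expectation (\<lambda>w. G u w * (G s w - G r w))\<bar> \<le> C * \<rho> h" using G_incr_cov by blast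
  have "\<bar>expectation (\<lambda>w. Gt u w * dl N s w)\<bar> \<le> C * rt N" if N: "2 \<le> N" and s: "s \<in> {0..T}" and u: "u \<in> {0..T}" for N s u
  proof -
    note r = fl_props[OF s N]
    have [measurable]: "G u \<in> borel_measurable M" "G s \<in> borel_measurable M" "G (tg N (fl N s)) \<in> borel_measurable M"
      using V_measurable[OF G_VV] s u r(5) by auto
    have "expectation (\<lambda>w. Gt u w * dl N s w) = expectation (\<lambda>w. G u w * (G s w - G (tg N (fl N s)) w))"
      unfolding dl_def using Gt_AE[OF u] Gt_AE[OF s] Gt_AE[OF r(5)] by (intro integral_cong_AE) auto
    then show ?thesis using C(2)[of "T / real N" "tg N (fl N s)" s u] step_h[OF N] r s u by simp
  qed
  then show ?thesis using C(1) by blast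
qed

lemma dl_dl_cov: "\<exists>C>0. \<forall>N s s'. 2 \<le> N \<and> s \<in> {0..T} \<and> s' \<in> {0..T} \<and> s \<noteq> s' \<longrightarrow>
   \<bar>expectation (\<lambda>w. dl N s w * dl N s' w)\<bar> \<le> C * (rt N)\<^sup>2 * \<bar>s - s'\<bar> powr (-(2-2*H))"
proof -
  obtain C where C: "0 < C" "\<And>h r s r' s'. 0 < h \<Longrightarrow> h \<le> T/2 \<Longrightarrow> 0 \<le> r \<Longrightarrow> r \<le> s \<Longrightarrow> s \<le> T \<Longrightarrow> s - r \<le> h \<Longrightarrow>
     0 \<le> r' \<Longrightarrow> r' \<le> s' \<Longrightarrow> s' \<le> T \<Longrightarrow> s' - r' \<le> h \<Longrightarrow> s \<noteq> s' \<Longrightarrow>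
     \<bar>expectation (\<lambda>w. (G s w - G r w) * (G s' w - G r' w))\<bar> \<le> C * (\<rho> h)\<^sup>2 * \<bar>s - s'\<bar> powr (-(2-2*H))" using G_incr_incr_cov by blast
  have "\<bar>expectation (\<lambda>w. dl N s w * dl N s' w)\<bar> \<le> C * (rt N)\<^sup>2 * \<bar>s - s'\<bar> powr (-(2-2*H))"
    if N: "2 \<le> N" and s: "s \<in> {0..T}" and s': "s' \<in> {0..T}" and ne: "s \<noteq> s'" for N s s'
  proof -
    note r = fl_props[OF s N] and r' = fl_props[OF s' N]
    have [measurable]: "G s \<in> borel_measurable M" "G (tg N (fl N s)) \<in> borel_measurable M" "G s' \<in> borel_measurable M" "G (tg N (fl N s')) \<in> borel_measurable M"
      using V_measurable[OF G_VV] s s' r(5) r'(5) by auto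
    have "expectation (\<lambda>w. dl N s w * dl N s' w) = expectation (\<lambda>w. (G s w - G (tg N (fl N s)) w) * (G s' w - G (tg N (fl N s')) w))"
      unfolding dl_def using Gt_AE[OF s] Gt_AE[OF s'] Gt_AE[OF r(5)] Gt_AE[OF r'(5)] by (intro integral_cong_AE) auto
    then show ?thesis using C(2)[of "T / real N" "tg N (fl N s)" s "tg N (fl N s')" s'] step_h[OF N] r r' s s' ne by simp
  qed
  then show ?thesis using C(1) by blast
qed

text \<open>The increment is itself a difference of two values of \<open>Gt\<close>, so its variance
  is a difference of two covariances of order \<open>rt N\<close>. Its L2 size is the square root of
  the rate, no better.\<close>

lemma dl_variance: "\<exists>C>0. \<forall>N s. 2 \<le> N \<and> s \<in> {0..T} \<longrightarrow> expectation (\<lambda>w. (dl N s w)\<^sup>2) \<le> C * rt N"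
proof -
  obtain C where C: "0 < C" "\<And>N s u. 2 \<le> N \<Longrightarrow> s \<in> {0..T} \<Longrightarrow> u \<in> {0..T} \<Longrightarrow> \<bar>expectation (\<lambda>w. Gt u w * dl N s w)\<bar> \<le> C * rt N" using dl_cov by blast
  have "expectation (\<lambda>w. (dl N s w)\<^sup>2) \<le> (2 * C) * rt N" if N: "2 \<le> N" and s: "s \<in> {0..T}" for N s
  proof -
    note r = fl_props[OF s N]
    have "expectation (\<lambda>w. (dl N s w)\<^sup>2) = expectation (\<lambda>w. Gt s w * dl N s w - Gt (tg N (fl N s)) w * dl N s w)"
      by (intro Bochner_Integration.integral_cong) (auto simp: dl_def power2_eq_square algebra_simps)
    also have "\<dots> = expectation (\<lambda>w. Gt s w * dl N s w) - expectation (\<lambda>w. Gt (tg N (fl N s)) w * dl N s w)"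
      by (intro Bochner_Integration.integral_diff V_prod_integrable Gt_VV dl_VV s N r)
    finally show ?thesis using C(2)[OF N s s] C(2)[OF N s r(5)] by linarith
  qed
  then show ?thesis using C(1) by (intro exI[of _ "2 * C"]) auto
qed

text \<open>The scheme as a deterministic map of the noise values on the grid, so that it can also
  be evaluated at reflected noise.\<close>

fun eul :: "nat \<Rightarrow> (nat \<Rightarrow> real) \<Rightarrow> nat \<Rightarrow> real" where
  "eul N g n = x0 + g0 * (\<Sum>j<n. wt N n j * b (eul N g j)) + g n"

declare eul.simps [simp del]

lemma eul_eq: "2 \<le> N \<Longrightarrow> n \<le> N \<Longrightarrow> eul N g n = x0 + g0 * (LBINT s. fk \<alpha> (tg N n) s * b (eul N g (fl N s))) + g n"
  by (subst eul.simps) (simp only: wt_sum)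

lemma eul_cong: "(\<And>k. k \<le> n \<Longrightarrow> g k = g' k) \<Longrightarrow> eul N g n = eul N g' n"
proof (induction n rule: less_induct)
  case (less n)
  have "eul N g j = eul N g' j" if "j < n" for j using less that by auto
  then show ?case using less(2)[of n] by (subst (1 2) eul.simps) simp
qed

lemma eul_measurable: "(\<And>k. k \<le> n \<Longrightarrow> (\<lambda>w. g k w) \<in> borel_measurable S) \<Longrightarrow> (\<lambda>w. eul N (\<lambda>k. g k w) n) \<in> borel_measurable S"
proof (induction n rule: less_induct)
  case (less n)
  have [measurable]: "(\<lambda>w. eul N (\<lambda>k. g k w) j) \<in> borel_measurable S" if "j < n" for j using less that by auto
  have [measurable]: "(\<lambda>w. b (eul N (\<lambda>k. g k w) j)) \<in> borel_measurable S" if "j \<in> {..<n}" for j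
    using that by (intro measurable_compose[OF _ b_measurable(1)]) auto
  have [measurable]: "(\<lambda>w. g n w) \<in> borel_measurable S" using less(2) by simp
  show ?case by (subst eul.simps) (intro borel_measurable_add borel_measurable_times borel_measurable_sum borel_measurable_const; measurable)
qed

lemma fk_step_integrable:
  fixes y :: "nat \<Rightarrow> real"
  assumes t: "t \<in> {0..T}" and N: "2 \<le> N"
  shows "integrable lborel (\<lambda>s. fk \<alpha> t s * y (fl N s))"
proof -
  have t0: "0 \<le> t" using t by simp
  \<comment> \<open>\<open>fl N s\<close> is unbounded in s, so the step function is cut off to
    [0,T], outside of which the kernel vanishes anyway.\<close>
  define z where "z s = (if s \<in> {0..T} then y (fl N s) else 0)" for s
  have "y \<in> measurable (count_space UNIV) borel" by simp
  then have "(\<lambda>s. y (fl N s)) \<in> borel_measurable borel" by (rule measurable_compose[OF fl_measurable])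
  then have zm: "z \<in> borel_measurable borel" unfolding z_def by measurable
  have "\<bar>z s\<bar> \<le> (\<Sum>k\<le>N. \<bar>y k\<bar>)" for s
  proof (cases "s \<in> {0..T}")
    case True
    then show ?thesis unfolding z_def using fl_props(1)[OF True N] by (auto intro!: member_le_sum[where f="\<lambda>k. \<bar>y k\<bar>"])
  qed (auto simp: z_def sum_nonneg)
  then have "integrable lborel (\<lambda>s. fk \<alpha> t s * z s)"
    by (rule integrable_kernel_bounded[OF ibound_fk[OF \<alpha>0 t0] zm])
  moreover have "fk \<alpha> t s * z s = fk \<alpha> t s * y (fl N s)" for s
    using t by (auto simp: z_def fk_def)
  ultimately show ?thesis by simp
qed

lemma step_path: "n \<le> N \<Longrightarrow> 2 \<le> N \<Longrightarrow> integrable lborel (\<lambda>s. fk \<alpha> (tg N n) s * (y :: nat \<Rightarrow> real) (fl N s))"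
  by (intro fk_step_integrable tg_mem)

lemma fk_total: "t \<in> {0..T} \<Longrightarrow> (LBINT s. fk \<alpha> t s) \<le> T powr \<alpha> / \<alpha>"
proof -
  assume t: "t \<in> {0..T}"
  have "(LBINT s. fk \<alpha> t s) \<le> t powr \<alpha> / \<alpha>" using t by (intro ibound_integrable ibound_fk \<alpha>0) auto
  also have "\<dots> \<le> T powr \<alpha> / \<alpha>" using t \<alpha>0 by (intro divide_right_mono powr_mono2) auto
  finally show ?thesis .
qed

section \<open>Moments, first and second differences of the Euler scheme\<close>

abbreviation "Sg I N \<equiv> (SIGMA i:I. {..N i :: nat})"

lemma euler_moments:
  fixes g :: "'i \<Rightarrow> nat \<Rightarrow> 'a \<Rightarrow> real" and N :: "'i \<Rightarrow> nat"
  assumes N: "\<And>i. i \<in> I \<Longrightarrow> 2 \<le> N i" and gm: "\<And>i k. i \<in> I \<Longrightarrow> g i k \<in> borel_measurable M"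
    and g: "moms M (Sg I N) (\<lambda>(i, k). g i k) (\<lambda>(i, k). 1)"
  shows "moms M (Sg I N) (\<lambda>(i, n) w. eul (N i) (\<lambda>k. g i k w) n) (\<lambda>(i, n). 1)"
proof -
  define c where "c = \<bar>x0\<bar> + g0 * \<bar>b 0\<bar> * (T powr \<alpha> / \<alpha>)"
  have c: "0 \<le> c" using g0 \<alpha>0 by (simp add: c_def)
  define D where "D i n w = eul (N i) (\<lambda>k. g i k w) n" for i n w
  have gn: "moms M (Sg I N) (\<lambda>j w. \<bar>(case j of (i, k) \<Rightarrow> g i k) w\<bar>) (\<lambda>(i, k). 1)"
    by (rule moms_mono[OF g, where K=1]) (auto intro!: borel_measurable_abs gm)
  have "moms M (Sg I N) (\<lambda>j w. c + \<bar>(case j of (i, k) \<Rightarrow> g i k) w\<bar>) (\<lambda>(i, k). 1)"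
    using moms_add[OF moms_const[of "Sg I N" c] ] gn by (simp add: case_prod_beta')
  then have Z: "moms M (Sg I N) (\<lambda>(i, n). \<lambda>w. c + \<bar>g i n w\<bar>) (\<lambda>(i, n). 1)" by (simp add: case_prod_beta')
  have "moms M (Sg I N) (\<lambda>(i, n). D i n) (\<lambda>(i, n). 1)"
  proof (rule euler_gronwall[where A="g0 * L" and Z="\<lambda>i n w. c + \<bar>g i n w\<bar>" and r="\<lambda>_. 1", OF prob_space_axioms N _ _ _ Z])
    show "0 \<le> g0 * L" using g0 L0 by simp
    show "D i k \<in> borel_measurable M" if "i \<in> I" for i k
      unfolding D_def[abs_def] using gm[OF that] by (intro eul_measurable) auto
    fix i n assume i: "i \<in> I" and n: "n \<le> N i"
    note tn = tg_mem[OF n N[OF i]]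
    show "AE w in M. \<bar>D i n w\<bar> \<le> g0 * L * (LBINT s. fk \<alpha> (tg (N i) n) s * \<bar>D i (fl (N i) s) w\<bar>) + \<bar>c + \<bar>g i n w\<bar>\<bar>"
    proof (intro AE_I2)
      fix w
      have i1: "integrable lborel (\<lambda>s. fk \<alpha> (tg (N i) n) s * \<bar>D i (fl (N i) s) w\<bar>)"
        by (rule step_path[OF n N[OF i], of "\<lambda>k. \<bar>D i k w\<bar>"])
      have i2: "integrable lborel (fk \<alpha> (tg (N i) n))" using tn by (intro ibound_integrable(1)[OF ibound_fk[OF \<alpha>0]]) auto
      have i3: "integrable lborel (\<lambda>s. fk \<alpha> (tg (N i) n) s * (\<bar>b 0\<bar> + L * \<bar>D i (fl (N i) s) w\<bar>))"
        by (rule step_path[OF n N[OF i], of "\<lambda>k. \<bar>b 0\<bar> + L * \<bar>D i k w\<bar>"])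
      have "\<bar>LBINT s. fk \<alpha> (tg (N i) n) s * b (D i (fl (N i) s) w)\<bar> \<le> (LBINT s. fk \<alpha> (tg (N i) n) s * (\<bar>b 0\<bar> + L * \<bar>D i (fl (N i) s) w\<bar>))"
        by (intro kernel_integral_abs_le b_growth i3) simp
      also have "\<dots> = (LBINT s. \<bar>b 0\<bar> * fk \<alpha> (tg (N i) n) s + L * (fk \<alpha> (tg (N i) n) s * \<bar>D i (fl (N i) s) w\<bar>))"
        by (intro Bochner_Integration.integral_cong) (auto simp: algebra_simps)
      also have "\<dots> = \<bar>b 0\<bar> * (LBINT s. fk \<alpha> (tg (N i) n) s) + L * (LBINT s. fk \<alpha> (tg (N i) n) s * \<bar>D i (fl (N i) s) w\<bar>)"
        using i1 i2 by simp
      also have "\<dots> \<le> \<bar>b 0\<bar> * (T powr \<alpha> / \<alpha>) + L * (LBINT s. fk \<alpha> (tg (N i) n) s * \<bar>D i (fl (N i) s) w\<bar>)"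
        by (intro add_right_mono mult_left_mono fk_total tn) simp
      finally have "g0 * \<bar>LBINT s. fk \<alpha> (tg (N i) n) s * b (D i (fl (N i) s) w)\<bar> \<le> g0 * (\<bar>b 0\<bar> * (T powr \<alpha> / \<alpha>) + L * (LBINT s. fk \<alpha> (tg (N i) n) s * \<bar>D i (fl (N i) s) w\<bar>))"
        using g0 by (intro mult_left_mono) auto
      then have 1: "\<bar>g0 * (LBINT s. fk \<alpha> (tg (N i) n) s * b (D i (fl (N i) s) w))\<bar> \<le> g0 * \<bar>b 0\<bar> * (T powr \<alpha> / \<alpha>) + g0 * L * (LBINT s. fk \<alpha> (tg (N i) n) s * \<bar>D i (fl (N i) s) w\<bar>)"
        using g0 by (simp add: abs_mult distrib_left mult.assoc)
      have "D i n w = x0 + g0 * (LBINT s. fk \<alpha> (tg (N i) n) s * b (D i (fl (N i) s) w)) + g i n w"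
        unfolding D_def by (rule eul_eq[OF N[OF i] n])
      then show "\<bar>D i n w\<bar> \<le> g0 * L * (LBINT s. fk \<alpha> (tg (N i) n) s * \<bar>D i (fl (N i) s) w\<bar>) + \<bar>c + \<bar>g i n w\<bar>\<bar>"
        using 1 c unfolding c_def by linarith
    qed
  qed
  then show ?thesis unfolding D_def by (simp add: case_prod_beta')
qed

text \<open>The scheme depends on its driving noise in a Lipschitz way, for all moments and
  uniformly in the grid; the scale \<open>r i\<close> of the perturbation is inherited
  unchanged.\<close>

lemma euler_difference:
  fixes g g' :: "'i \<Rightarrow> nat \<Rightarrow> 'a \<Rightarrow> real" and N :: "'i \<Rightarrow> nat"
  assumes N: "\<And>i. i \<in> I \<Longrightarrow> 2 \<le> N i" and gm: "\<And>i k. i \<in> I \<Longrightarrow> g i k \<in> borel_measurable M" "\<And>i k. i \<in> I \<Longrightarrow> g' i k \<in> borel_measurable M"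
    and g: "moms M (Sg I N) (\<lambda>(i, k). \<lambda>w. g i k w - g' i k w) (\<lambda>(i, k). r i)"
  shows "moms M (Sg I N) (\<lambda>(i, n) w. eul (N i) (\<lambda>k. g i k w) n - eul (N i) (\<lambda>k. g' i k w) n) (\<lambda>(i, n). r i)"
proof -
  define E where "E i n w = eul (N i) (\<lambda>k. g i k w) n" for i n w
  define E' where "E' i n w = eul (N i) (\<lambda>k. g' i k w) n" for i n w
  define D where "D i n w = E i n w - E' i n w" for i n w
  have "moms M (Sg I N) (\<lambda>(i, n). D i n) (\<lambda>(i, n). r i)"
  proof (rule euler_gronwall[where A="g0 * L" and Z="\<lambda>i n w. g i n w - g' i n w" and r=r, OF prob_space_axioms N _ _ _ g])
    show "0 \<le> g0 * L" using g0 L0 by simp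
    show "D i k \<in> borel_measurable M" if "i \<in> I" for i k
      unfolding D_def[abs_def] E_def E'_def using gm[OF that] by (intro borel_measurable_diff eul_measurable) auto
    fix i n assume i: "i \<in> I" and n: "n \<le> N i"
    show "AE w in M. \<bar>D i n w\<bar> \<le> g0 * L * (LBINT s. fk \<alpha> (tg (N i) n) s * \<bar>D i (fl (N i) s) w\<bar>) + \<bar>g i n w - g' i n w\<bar>"
    proof (intro AE_I2)
      fix w
      note ip = step_path[OF n N[OF i]]
      have "\<bar>LBINT s. fk \<alpha> (tg (N i) n) s * (b (E i (fl (N i) s) w) - b (E' i (fl (N i) s) w))\<bar> \<le> (LBINT s. fk \<alpha> (tg (N i) n) s * (L * \<bar>D i (fl (N i) s) w\<bar>))"
        unfolding D_def using ip[of "\<lambda>k. L * \<bar>E i k w - E' i k w\<bar>"] by (intro kernel_integral_abs_le b_lip) auto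
      also have "\<dots> = (LBINT s. L * (fk \<alpha> (tg (N i) n) s * \<bar>D i (fl (N i) s) w\<bar>))" by (simp only: mult.left_commute)
      also have "\<dots> = L * (LBINT s. fk \<alpha> (tg (N i) n) s * \<bar>D i (fl (N i) s) w\<bar>)" by simp
      finally have "g0 * \<bar>LBINT s. fk \<alpha> (tg (N i) n) s * (b (E i (fl (N i) s) w) - b (E' i (fl (N i) s) w))\<bar> \<le> g0 * (L * (LBINT s. fk \<alpha> (tg (N i) n) s * \<bar>D i (fl (N i) s) w\<bar>))"
        using g0 by (intro mult_left_mono) auto
      then have 1: "\<bar>g0 * (LBINT s. fk \<alpha> (tg (N i) n) s * (b (E i (fl (N i) s) w) - b (E' i (fl (N i) s) w)))\<bar> \<le> g0 * L * (LBINT s. fk \<alpha> (tg (N i) n) s * \<bar>D i (fl (N i) s) w\<bar>)"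
        using g0 by (simp add: abs_mult mult.assoc)
      have e1: "E i n w = x0 + g0 * (LBINT s. fk \<alpha> (tg (N i) n) s * b (E i (fl (N i) s) w)) + g i n w"
        and e2: "E' i n w = x0 + g0 * (LBINT s. fk \<alpha> (tg (N i) n) s * b (E' i (fl (N i) s) w)) + g' i n w"
        unfolding E_def E'_def by (rule eul_eq[OF N[OF i] n])+
      have e3: "(LBINT s. fk \<alpha> (tg (N i) n) s * (b (E i (fl (N i) s) w) - b (E' i (fl (N i) s) w))) =
         (LBINT s. fk \<alpha> (tg (N i) n) s * b (E i (fl (N i) s) w)) - (LBINT s. fk \<alpha> (tg (N i) n) s * b (E' i (fl (N i) s) w))"
        using ip[of "\<lambda>k. b (E i k w)"] ip[of "\<lambda>k. b (E' i k w)"] by (simp add: right_diff_distrib)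
      have "D i n w = g0 * (LBINT s. fk \<alpha> (tg (N i) n) s * (b (E i (fl (N i) s) w) - b (E' i (fl (N i) s) w))) + (g i n w - g' i n w)"
        unfolding D_def e1 e2 e3 by (simp add: algebra_simps)
      then show "\<bar>D i n w\<bar> \<le> g0 * L * (LBINT s. fk \<alpha> (tg (N i) n) s * \<bar>D i (fl (N i) s) w\<bar>) + \<bar>g i n w - g' i n w\<bar>"
        using 1 by linarith
    qed
  qed
  then show ?thesis unfolding D_def E_def E'_def by (simp add: case_prod_beta')
qed

text \<open>This polynomial weight is the coefficient occurring in
  \<open>mixed_difference_bound\<close> and dominates the growth of the derivatives at all
  intermediate points.\<close>

lemma moms_poly:
  assumes a: "moms M J a (\<lambda>_. 1)" and c: "moms M J c (\<lambda>_. 1)" and d: "moms M J d (\<lambda>_. 1)" and e: "moms M J e (\<lambda>_. 1)"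
  shows "moms M J (\<lambda>j w. K * (1 + (\<bar>a j w\<bar> + \<bar>c j w\<bar> + \<bar>d j w\<bar> + 3 * \<bar>e j w\<bar>) ^ m)) (\<lambda>_. 1)"
proof -
  have "moms M J (\<lambda>j w. (\<bar>a j w\<bar> + \<bar>c j w\<bar> + \<bar>d j w\<bar> + 3 * \<bar>e j w\<bar>) ^ m) (\<lambda>_. 1 ^ m)"
    by (intro moms_power moms_add moms_cmult moms_abs assms)
  then have "moms M J (\<lambda>j w. (\<bar>a j w\<bar> + \<bar>c j w\<bar> + \<bar>d j w\<bar> + 3 * \<bar>e j w\<bar>) ^ m) (\<lambda>_. 1)" by simp
  then show ?thesis by (intro moms_cmult moms_add moms_const)
qed

text \<open>The four noises form an exact parallelogram by \<open>eq\<close>, so the second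
  difference of the schemes is driven only by the curvature of b, that is, by products of first
  differences; Gronwall keeps the order \<open>r i * s i\<close>. Passing from the schemes to
  \<open>b1\<close> of them uses \<open>b3\<close> in the same way.\<close>

lemma euler_mixed:
  fixes ga gc gd ge :: "'i \<Rightarrow> nat \<Rightarrow> 'a \<Rightarrow> real" and N :: "'i \<Rightarrow> nat"
  assumes N: "\<And>i. i \<in> I \<Longrightarrow> 2 \<le> N i"
    and gm: "\<And>i k. i \<in> I \<Longrightarrow> ga i k \<in> borel_measurable M" "\<And>i k. i \<in> I \<Longrightarrow> gc i k \<in> borel_measurable M"
      "\<And>i k. i \<in> I \<Longrightarrow> gd i k \<in> borel_measurable M" "\<And>i k. i \<in> I \<Longrightarrow> ge i k \<in> borel_measurable M"
    and g1: "moms M (Sg I N) (\<lambda>(i, k). ga i k) (\<lambda>(i, k). 1)" "moms M (Sg I N) (\<lambda>(i, k). gc i k) (\<lambda>(i, k). 1)"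
      "moms M (Sg I N) (\<lambda>(i, k). gd i k) (\<lambda>(i, k). 1)" "moms M (Sg I N) (\<lambda>(i, k). ge i k) (\<lambda>(i, k). 1)"
    and eq: "\<And>i k w. i \<in> I \<Longrightarrow> k \<le> N i \<Longrightarrow> ga i k w - gc i k w - gd i k w + ge i k w = 0"
    and p: "moms M (Sg I N) (\<lambda>(i, k). \<lambda>w. gc i k w - ge i k w) (\<lambda>(i, k). r i)"
    and q: "moms M (Sg I N) (\<lambda>(i, k). \<lambda>w. gd i k w - ge i k w) (\<lambda>(i, k). s i)"
  defines "E \<equiv> \<lambda>g j w. eul (N (fst j)) (\<lambda>k. g (fst j) k w) (snd j)"
  shows "moms M (Sg I N) (\<lambda>j w. E ga j w - E gc j w - E gd j w + E ge j w) (\<lambda>j. r (fst j) * s (fst j))"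
    and "moms M (Sg I N) (\<lambda>j w. b1 (E ga j w) - b1 (E gc j w) - b1 (E gd j w) + b1 (E ge j w)) (\<lambda>j. r (fst j) * s (fst j))"
    and "moms M (Sg I N) (\<lambda>j w. b1 (E gc j w) - b1 (E ge j w)) (\<lambda>j. r (fst j))"
    and "moms M (Sg I N) (\<lambda>j w. b1 (E gd j w) - b1 (E ge j w)) (\<lambda>j. s (fst j))"
proof -
  have Em: "E g j \<in> borel_measurable M" if "\<And>i k. i \<in> I \<Longrightarrow> g i k \<in> borel_measurable M" "fst j \<in> I" for g j
    unfolding E_def using that by (intro eul_measurable) auto
  have E1: "moms M (Sg I N) (E ga) (\<lambda>_. 1)" "moms M (Sg I N) (E gc) (\<lambda>_. 1)" "moms M (Sg I N) (E gd) (\<lambda>_. 1)" "moms M (Sg I N) (E ge) (\<lambda>_. 1)"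
    using euler_moments[OF N gm(1) g1(1)] euler_moments[OF N gm(2) g1(2)] euler_moments[OF N gm(3) g1(3)] euler_moments[OF N gm(4) g1(4)]
    by (simp_all add: E_def[abs_def] case_prod_beta')
  have P: "moms M (Sg I N) (\<lambda>j w. E gc j w - E ge j w) (\<lambda>j. r (fst j))"
    using euler_difference[OF N gm(2) gm(4) p] by (simp add: E_def[abs_def] case_prod_beta')
  have Q: "moms M (Sg I N) (\<lambda>j w. E gd j w - E ge j w) (\<lambda>j. s (fst j))"
    using euler_difference[OF N gm(3) gm(4) q] by (simp add: E_def[abs_def] case_prod_beta')
  define S where "S j w = \<bar>E ga j w\<bar> + \<bar>E gc j w\<bar> + \<bar>E gd j w\<bar> + 3 * \<bar>E ge j w\<bar>" for j w
  have KS: "moms M (Sg I N) (\<lambda>j w. K * (1 + S j w ^ m)) (\<lambda>_. 1)"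
    unfolding S_def by (intro moms_poly E1)
  \<comment> \<open>Curvature term: the part of the second difference of b not controlled by the
    second difference of its arguments. It acts as the inhomogeneity of the Gronwall
    inequality.\<close>
  define R where "R j w = K * (1 + S j w ^ m) * (\<bar>E gc j w - E ge j w\<bar> * \<bar>E gd j w - E ge j w\<bar>)" for j w
  have R: "moms M (Sg I N) R (\<lambda>j. r (fst j) * s (fst j))"
    unfolding R_def[abs_def] by (intro moms_mult1[OF KS] moms_mult moms_abs P Q)
  have Rm: "R j \<in> borel_measurable M" if "fst j \<in> I" for j
  proof -
    note [measurable] = Em[OF gm(1) that] Em[OF gm(2) that] Em[OF gm(3) that] Em[OF gm(4) that]
    show ?thesis unfolding R_def[abs_def] S_def by measurable
  qed
  define \<kappa> where "\<kappa> = T powr \<alpha> / \<alpha>"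
  have \<kappa>: "0 < \<kappa>" using T \<alpha>0 by (simp add: \<kappa>_def)
  have V: "moms M (Sg I N) (\<lambda>j w. LBINT t. fk \<alpha> (tg (N (fst j)) (snd j)) t * \<bar>R (fst j, fl (N (fst j)) t) w\<bar>) (\<lambda>j. \<kappa> * (r (fst j) * s (fst j)))"
  proof (rule moms_volterra[where S="{0..T}"])
    show "moms M (Sg I N \<times> {0..T}) (\<lambda>(j, t). R (fst j, fl (N (fst j)) t)) (\<lambda>(j, t). r (fst j) * s (fst j))"
      using moms_reindex[OF R, of "Sg I N \<times> {0..T}" "\<lambda>(j, t). (fst j, fl (N (fst j)) t)"] fl_props(1) N
      by (auto simp: case_prod_beta')
    fix j assume j: "j \<in> Sg I N"
    then have n: "snd j \<le> N (fst j)" "2 \<le> N (fst j)" "fst j \<in> I" using N by auto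
    show "(\<lambda>p. R (fst j, fl (N (fst j)) (fst p)) (snd p)) \<in> borel_measurable (lborel \<Otimes>\<^sub>M M)"
      using step_joint_measurable[of "\<lambda>k. R (fst j, k)" M "N (fst j)"] Rm n(3) by simp
    show "ibound lborel (fk \<alpha> (tg (N (fst j)) (snd j))) \<kappa>"
    proof (rule ibound_mono[OF ibound_fk])
      show "tg (N (fst j)) (snd j) powr \<alpha> / \<alpha> \<le> \<kappa>"
        unfolding \<kappa>_def using tg_mem[OF n(1,2)] \<alpha>0 by (intro divide_right_mono powr_mono2) auto
    qed (use \<alpha>0 tg_mem[OF n(1,2)] in auto)
    show "fk \<alpha> (tg (N (fst j)) (snd j)) t = 0" if "t \<notin> {0..T}" for t
      using that tg_mem[OF n(1,2)] by (auto simp: fk_def)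
  qed (use \<kappa> T in auto)
  have Z: "moms M (Sg I N) (\<lambda>j w. g0 * (LBINT t. fk \<alpha> (tg (N (fst j)) (snd j)) t * \<bar>R (fst j, fl (N (fst j)) t) w\<bar>)) (\<lambda>j. r (fst j) * s (fst j))"
    by (rule moms_mono[OF moms_cmult[OF V, of g0], where K=\<kappa>]) (auto simp: momsD(1)[OF moms_cmult[OF V, of g0]] intro: momsD(2)[OF R])
  define D where "D i n w = E ga (i, n) w - E gc (i, n) w - E gd (i, n) w + E ge (i, n) w" for i n w
  have "moms M (Sg I N) (\<lambda>(i, n). D i n) (\<lambda>(i, n). r i * s i)"
  proof (rule euler_gronwall[where A="g0 * L" and Z="\<lambda>i n w. g0 * (LBINT t. fk \<alpha> (tg (N i) n) t * \<bar>R (i, fl (N i) t) w\<bar>)", OF prob_space_axioms N])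
    show "0 \<le> g0 * L" using g0 L0 by simp
    show "moms M (Sg I N) (\<lambda>(i, n). \<lambda>w. g0 * (LBINT t. fk \<alpha> (tg (N i) n) t * \<bar>R (i, fl (N i) t) w\<bar>)) (\<lambda>(i, n). r i * s i)"
      using Z by (simp add: case_prod_beta')
    show "D i k \<in> borel_measurable M" if "i \<in> I" for i k
    proof -
      have [measurable]: "E ga (i, k) \<in> borel_measurable M" "E gc (i, k) \<in> borel_measurable M" "E gd (i, k) \<in> borel_measurable M" "E ge (i, k) \<in> borel_measurable M"
        using that by (auto intro!: Em gm)
      show ?thesis unfolding D_def[abs_def] by measurable
    qed
    fix i n assume i: "i \<in> I" and n: "n \<le> N i"
    show "AE w in M. \<bar>D i n w\<bar> \<le> g0 * L * (LBINT t. fk \<alpha> (tg (N i) n) t * \<bar>D i (fl (N i) t) w\<bar>) + \<bar>g0 * (LBINT t. fk \<alpha> (tg (N i) n) t * \<bar>R (i, fl (N i) t) w\<bar>)\<bar>"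
    proof (intro AE_I2)
      fix w
      note ip = step_path[OF n N[OF i]]
      let ?k = "fk \<alpha> (tg (N i) n)"
      define B where "B g t = b (E g (i, fl (N i) t) w)" for g t
      have iB: "integrable lborel (\<lambda>t. ?k t * B g t)" for g unfolding B_def by (rule ip[of "\<lambda>k. b (E g (i, k) w)"])
      have iD: "integrable lborel (\<lambda>t. ?k t * \<bar>D i (fl (N i) t) w\<bar>)" by (rule ip[of "\<lambda>k. \<bar>D i k w\<bar>"])
      have iR: "integrable lborel (\<lambda>t. ?k t * \<bar>R (i, fl (N i) t) w\<bar>)" by (rule ip[of "\<lambda>k. \<bar>R (i, k) w\<bar>"])
      have bb: "\<bar>B ga t - B gc t - B gd t + B ge t\<bar> \<le> L * \<bar>D i (fl (N i) t) w\<bar> + \<bar>R (i, fl (N i) t) w\<bar>" for t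
      proof -
        have "\<bar>B ga t - B gc t - B gd t + B ge t\<bar> \<le> L * \<bar>D i (fl (N i) t) w\<bar> + R (i, fl (N i) t) w"
          unfolding B_def D_def R_def by (rule mixed_difference_bound[OF db db1 L K2 K S_def])
        then show ?thesis by linarith
      qed
      have i3: "integrable lborel (\<lambda>t. ?k t * (L * \<bar>D i (fl (N i) t) w\<bar> + \<bar>R (i, fl (N i) t) w\<bar>))"
        by (rule ip[of "\<lambda>k. L * \<bar>D i k w\<bar> + \<bar>R (i, k) w\<bar>"])
      have "\<bar>LBINT t. ?k t * (B ga t - B gc t - B gd t + B ge t)\<bar> \<le> (LBINT t. ?k t * (L * \<bar>D i (fl (N i) t) w\<bar> + \<bar>R (i, fl (N i) t) w\<bar>))"
        by (rule kernel_integral_abs_le[OF _ bb i3]) simp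
      also have "\<dots> = (LBINT t. L * (?k t * \<bar>D i (fl (N i) t) w\<bar>) + ?k t * \<bar>R (i, fl (N i) t) w\<bar>)"
        by (simp only: distrib_left mult.left_commute)
      also have "\<dots> = L * (LBINT t. ?k t * \<bar>D i (fl (N i) t) w\<bar>) + (LBINT t. ?k t * \<bar>R (i, fl (N i) t) w\<bar>)"
        using iD iR by simp
      finally have "g0 * \<bar>LBINT t. ?k t * (B ga t - B gc t - B gd t + B ge t)\<bar> \<le> g0 * (L * (LBINT t. ?k t * \<bar>D i (fl (N i) t) w\<bar>) + (LBINT t. ?k t * \<bar>R (i, fl (N i) t) w\<bar>))"
        using g0 by (intro mult_left_mono) auto
      then have 1: "\<bar>g0 * (LBINT t. ?k t * (B ga t - B gc t - B gd t + B ge t))\<bar> \<le> g0 * L * (LBINT t. ?k t * \<bar>D i (fl (N i) t) w\<bar>) + g0 * (LBINT t. ?k t * \<bar>R (i, fl (N i) t) w\<bar>)"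
        using g0 by (simp only: abs_mult distrib_left mult.assoc abs_of_pos)
      have Eq: "E g (i, n) w = x0 + g0 * (LBINT t. ?k t * B g t) + g i n w" for g
        unfolding B_def E_def fst_conv snd_conv by (rule eul_eq[OF N[OF i] n])
      have I4: "(LBINT t. ?k t * (B ga t - B gc t - B gd t + B ge t)) =
          (LBINT t. ?k t * B ga t) - (LBINT t. ?k t * B gc t) - (LBINT t. ?k t * B gd t) + (LBINT t. ?k t * B ge t)"
        unfolding distrib_left right_diff_distrib using iB by simp
      have "D i n w = g0 * (LBINT t. ?k t * (B ga t - B gc t - B gd t + B ge t)) + (ga i n w - gc i n w - gd i n w + ge i n w)"
        unfolding D_def Eq I4 by (simp add: algebra_simps)
      \<comment> \<open>The noises cancel, so no term of first order in the perturbations is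
        left.\<close>
      then have "D i n w = g0 * (LBINT t. ?k t * (B ga t - B gc t - B gd t + B ge t))" using eq[OF i n] by simp
      then show "\<bar>D i n w\<bar> \<le> g0 * L * (LBINT t. ?k t * \<bar>D i (fl (N i) t) w\<bar>) + \<bar>g0 * (LBINT t. ?k t * \<bar>R (i, fl (N i) t) w\<bar>)\<bar>"
        using 1 by linarith
    qed
  qed
  then show DD: "moms M (Sg I N) (\<lambda>j w. E ga j w - E gc j w - E gd j w + E ge j w) (\<lambda>j. r (fst j) * s (fst j))"
    by (simp add: D_def[abs_def] case_prod_beta')
  have b1m: "(\<lambda>w. b1 (E g j w)) \<in> borel_measurable M" if "\<And>i k. i \<in> I \<Longrightarrow> g i k \<in> borel_measurable M" "fst j \<in> I" for g j
    by (rule measurable_compose[OF Em[OF that] b_measurable(2)])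
  have M1: "moms M (Sg I N) (\<lambda>j w. K * (1 + S j w ^ m) * \<bar>E ga j w - E gc j w - E gd j w + E ge j w\<bar> + R j w) (\<lambda>j. r (fst j) * s (fst j))"
    by (intro moms_add moms_mult1[OF KS] moms_abs DD R)
  show "moms M (Sg I N) (\<lambda>j w. b1 (E ga j w) - b1 (E gc j w) - b1 (E gd j w) + b1 (E ge j w)) (\<lambda>j. r (fst j) * s (fst j))"
  proof (rule moms_mono[OF M1, where K=1])
    fix j assume j: "j \<in> Sg I N"
    then have fj: "fst j \<in> I" by auto
    note [measurable] = b1m[OF gm(1) fj] b1m[OF gm(2) fj] b1m[OF gm(3) fj] b1m[OF gm(4) fj]
    show "(\<lambda>w. b1 (E ga j w) - b1 (E gc j w) - b1 (E gd j w) + b1 (E ge j w)) \<in> borel_measurable M" by measurable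
    show "AE w in M. \<bar>b1 (E ga j w) - b1 (E gc j w) - b1 (E gd j w) + b1 (E ge j w)\<bar> \<le> \<bar>K * (1 + S j w ^ m) * \<bar>E ga j w - E gc j w - E gd j w + E ge j w\<bar> + R j w\<bar>"
    proof (intro AE_I2)
      fix w
      have "\<bar>b2 z\<bar> \<le> K * (1 + S j w ^ m)" if "\<bar>z\<bar> \<le> S j w" for z
      proof -
        have "K * (1 + \<bar>z\<bar> ^ m) \<le> K * (1 + S j w ^ m)" using that K by (intro mult_left_mono add_left_mono power_mono) auto
        then show ?thesis using K2[of z] by linarith
      qed
      then have "\<bar>b1 (E ga j w) - b1 (E gc j w) - b1 (E gd j w) + b1 (E ge j w)\<bar> \<le> K * (1 + S j w ^ m) * \<bar>E ga j w - E gc j w - E gd j w + E ge j w\<bar> + R j w"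
        unfolding R_def by (intro mixed_difference_bound[OF db1 db2 _ K3 K S_def])
      then show "\<bar>b1 (E ga j w) - b1 (E gc j w) - b1 (E gd j w) + b1 (E ge j w)\<bar> \<le> \<bar>K * (1 + S j w ^ m) * \<bar>E ga j w - E gc j w - E gd j w + E ge j w\<bar> + R j w\<bar>" by linarith
    qed
    show "0 < r (fst j) * s (fst j)" by (rule momsD(2)[OF R j])
  qed auto
  have first: "moms M (Sg I N) (\<lambda>j w. b1 (E g j w) - b1 (E ge j w)) (\<lambda>j. v (fst j))"
    if g: "\<And>i k. i \<in> I \<Longrightarrow> g i k \<in> borel_measurable M" and gi: "\<And>j w. \<bar>E g j w\<bar> + \<bar>E ge j w\<bar> \<le> S j w"
     and P: "moms M (Sg I N) (\<lambda>j w. E g j w - E ge j w) (\<lambda>j. v (fst j))" for g v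
  proof (rule moms_mono[OF moms_mult1[OF KS P], where K=1])
    fix j assume j: "j \<in> Sg I N"
    then have fj: "fst j \<in> I" by auto
    note [measurable] = b1m[OF g fj] b1m[OF gm(4) fj]
    show "(\<lambda>w. b1 (E g j w) - b1 (E ge j w)) \<in> borel_measurable M" by measurable
    show "AE w in M. \<bar>b1 (E g j w) - b1 (E ge j w)\<bar> \<le> \<bar>K * (1 + S j w ^ m) * (E g j w - E ge j w)\<bar>"
    proof (intro AE_I2)
      fix w
      have "\<bar>b1 (E g j w) - b1 (E ge j w)\<bar> \<le> K * (1 + (\<bar>E g j w\<bar> + \<bar>E ge j w\<bar>) ^ m) * \<bar>E g j w - E ge j w\<bar>" by (rule b1_diff)
      also have "\<dots> \<le> K * (1 + S j w ^ m) * \<bar>E g j w - E ge j w\<bar>"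
        using K gi by (intro mult_right_mono mult_left_mono add_left_mono power_mono) auto
      also have "\<dots> = \<bar>K * (1 + S j w ^ m) * (E g j w - E ge j w)\<bar>"
        using K by (simp add: abs_mult S_def)
      finally show "\<bar>b1 (E g j w) - b1 (E ge j w)\<bar> \<le> \<bar>K * (1 + S j w ^ m) * (E g j w - E ge j w)\<bar>" .
    qed
    show "0 < v (fst j)" by (rule momsD(2)[OF P j])
  qed auto
  show "moms M (Sg I N) (\<lambda>j w. b1 (E gc j w) - b1 (E ge j w)) (\<lambda>j. r (fst j))"
    by (rule first[OF gm(2) _ P]) (auto simp: S_def)
  show "moms M (Sg I N) (\<lambda>j w. b1 (E gd j w) - b1 (E ge j w)) (\<lambda>j. s (fst j))"
    by (rule first[OF gm(3) _ Q]) (auto simp: S_def)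
qed

end

section \<open>Decorrelation of the weighted increments\<close>

context vol
begin

definition Xh :: "nat \<Rightarrow> nat \<Rightarrow> 'a \<Rightarrow> real" where
  "Xh N n w = eul N (\<lambda>k. Gt (tg N k) w) n"

definition Fb :: "nat \<Rightarrow> real \<Rightarrow> 'a \<Rightarrow> real" where
  "Fb N s w = b1 (Xh N (fl N s) w)"

lemma Xh_meas [measurable]: "Xh N n \<in> borel_measurable M"
  unfolding Xh_def[abs_def] by (intro eul_measurable Gt_meas)

lemma Fb_meas [measurable]: "Fb N s \<in> borel_measurable M"
  unfolding Fb_def[abs_def] by (rule measurable_compose[OF Xh_meas b_measurable(2)])

lemma dl_meas [measurable]: "dl N s \<in> borel_measurable M"
  unfolding dl_def[abs_def] by measurable

definition vr :: "nat \<Rightarrow> real \<Rightarrow> real" where "vr N s = expectation (\<lambda>w. (dl N s w)\<^sup>2)"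

definition rc :: "nat \<Rightarrow> real \<Rightarrow> real \<Rightarrow> real" where
  "rc N s s' = expectation (\<lambda>w. dl N s w * dl N s' w) / vr N s"

definition ep :: "nat \<Rightarrow> real \<Rightarrow> real \<Rightarrow> 'a \<Rightarrow> real" where
  "ep N s s' w = dl N s' w - rc N s s' * dl N s w"

lemma ep_VV: "2 \<le> N \<Longrightarrow> s \<in> {0..T} \<Longrightarrow> s' \<in> {0..T} \<Longrightarrow> ep N s s' \<in> VV"
  unfolding ep_def[abs_def] by (intro V_diff V_mult dl_VV)

lemma ep_meas [measurable]: "ep N s s' \<in> borel_measurable M"
  unfolding ep_def[abs_def] by measurable

lemma ep_orthogonal:
  assumes "2 \<le> N" "s \<in> {0..T}" "s' \<in> {0..T}" "vr N s \<noteq> 0"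
  shows "expectation (\<lambda>w. ep N s s' w * dl N s w) = 0"
proof -
  have "expectation (\<lambda>w. ep N s s' w * dl N s w) = expectation (\<lambda>w. dl N s w * dl N s' w - rc N s s' * (dl N s w)\<^sup>2)"
    by (intro Bochner_Integration.integral_cong) (auto simp: ep_def power2_eq_square algebra_simps)
  also have "\<dots> = expectation (\<lambda>w. dl N s w * dl N s' w) - rc N s s' * vr N s"
    unfolding vr_def using assms by (subst Bochner_Integration.integral_diff) (auto intro!: V_prod_integrable V_sq dl_VV)
  finally show ?thesis using assms(4) by (simp add: rc_def)
qed

lemma vr_nonneg: "0 \<le> vr N s" by (simp add: vr_def)

text \<open>By Cauchy-Schwarz the squared covariance is at most the product of the variances, hence
  at most the square of the larger one, which is the denominator.\<close>

lemma rc_le_1: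
  assumes "2 \<le> N" "s \<in> {0..T}" "s' \<in> {0..T}" "0 < vr N s" "vr N s' \<le> vr N s"
  shows "\<bar>rc N s s'\<bar> \<le> 1"
proof -
  have "(expectation (\<lambda>w. dl N s w * dl N s' w))\<^sup>2 \<le> vr N s * vr N s'"
    unfolding vr_def using assms by (intro integral_cauchy_schwarz V_sq dl_VV) auto
  also have "\<dots> \<le> (vr N s)\<^sup>2" using assms by (simp add: power2_eq_square mult_left_mono)
  finally have "\<bar>expectation (\<lambda>w. dl N s w * dl N s' w)\<bar> \<le> \<bar>vr N s\<bar>" by (simp add: abs_le_square_iff)
  then show ?thesis using assms(4) by (simp add: rc_def)
qed

text \<open>Reflection moves X by 2a/v times d, with a the covariance of X and d and v the variance
  of d; the second moment of this displacement is 4 a^2 / v.\<close>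

lemma refl_diff_sq:
  assumes d: "d \<in> VV" and v: "expectation (\<lambda>w. (d w)\<^sup>2) \<noteq> 0" and c: "\<bar>expectation (\<lambda>w. X w * d w)\<bar> \<le> c"
  shows "expectation (\<lambda>w. (refl d X w - X w)\<^sup>2) \<le> 4 * c\<^sup>2 / expectation (\<lambda>w. (d w)\<^sup>2)"
proof -
  define a where "a = expectation (\<lambda>w. X w * d w)"
  define v where "v = expectation (\<lambda>w. (d w)\<^sup>2)"
  have v0: "0 < v" using v unfolding v_def by (simp add: less_le)
  have "expectation (\<lambda>w. (refl d X w - X w)\<^sup>2) = expectation (\<lambda>w. (2 * a / v)\<^sup>2 * (d w)\<^sup>2)"
    unfolding refl_def a_def v_def by (intro Bochner_Integration.integral_cong) (auto simp: power_mult_distrib power_divide)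
  also have "\<dots> = (2 * a / v)\<^sup>2 * v" by (simp add: v_def)
  also have "\<dots> = 4 * a\<^sup>2 / v" using v0 by (simp add: power2_eq_square field_simps)
  also have "\<dots> \<le> 4 * c\<^sup>2 / v"
  proof (intro divide_right_mono mult_left_mono)
    have "\<bar>a\<bar> \<le> \<bar>c\<bar>" using c unfolding a_def by linarith
    then show "a\<^sup>2 \<le> c\<^sup>2" by (simp add: abs_le_square_iff)
  qed (use v0 in auto)
  finally show ?thesis by (simp add: v_def)
qed

lemma refl_meas: "d \<in> borel_measurable M \<Longrightarrow> X \<in> borel_measurable M \<Longrightarrow> refl d X \<in> borel_measurable M"
  unfolding refl_def by (intro borel_measurable_diff borel_measurable_times borel_measurable_const)

text \<open>Leibniz rule for mixed second differences: second difference of one factor times the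
  other, plus the two products of first differences.\<close>

lemma product_mixed_difference:
  fixes a c d e a' c' d' e' :: real
  shows "a * a' - c * c' - d * d' + e * e' = (a - c - d + e) * a' + (a' - c' - d' + e') * (c + d - e) + (c - e) * (d' - e') + (d - e) * (c' - e')"
  by (simp add: algebra_simps)

text \<open>The expectation is a quarter of that of a mixed difference of the weights times d and e.
  The difference has size \<open>rt N / sqrt v\<close> times \<open>rt N / sqrt u\<close>, the
  factors d and e have sizes sqrt v and sqrt u, and the variances cancel. So the constant is uniform
  however small v and u are.\<close>

lemma cov_core:
  "\<exists>C\<ge>0. \<forall>N s s'. 2 \<le> N \<and> s \<in> {0..T} \<and> s' \<in> {0..T} \<and> 0 < vr N s \<and> vr N s' \<le> vr N s \<and> 0 < expectation (\<lambda>w. (ep N s s' w)\<^sup>2) \<longrightarrow>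
     \<bar>expectation (\<lambda>w. Fb N s w * Fb N s' w * dl N s w * ep N s s' w)\<bar> \<le> C * (rt N)\<^sup>2"
proof -
  \<comment> \<open>Grid and both times are put into the index set, so that one moment estimate is
    uniform in all of them.\<close>
  define I where "I = {(N, s, s'). 2 \<le> N \<and> s \<in> {0..T} \<and> s' \<in> {0..T} \<and> 0 < vr N s \<and> vr N s' \<le> vr N s \<and> 0 < expectation (\<lambda>w. (ep N s s' w)\<^sup>2)}"
  define n where "n i = fst i" for i :: "nat \<times> real \<times> real"
  define d where "d i = dl (fst i) (fst (snd i))" for i :: "nat \<times> real \<times> real"
  define e where "e i = ep (fst i) (fst (snd i)) (snd (snd i))" for i :: "nat \<times> real \<times> real"
  define v where "v i = expectation (\<lambda>w. (d i w)\<^sup>2)" for i :: "nat \<times> real \<times> real"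
  define u where "u i = expectation (\<lambda>w. (e i w)\<^sup>2)" for i :: "nat \<times> real \<times> real"
  define R where "R i = rt (n i)" for i :: "nat \<times> real \<times> real"
  \<comment> \<open>Within this proof \<open>g0\<close> is the unreflected noise on the grid and
    hides the constant of that name. \<open>gc\<close> and \<open>gd\<close> are its reflections
    along d and along e, \<open>ga\<close> the reflection along both.\<close>
  define g0 where "g0 i k = Gt (tg (n i) k)" for i :: "nat \<times> real \<times> real" and k
  define gc where "gc i k = refl (d i) (g0 i k)" for i :: "nat \<times> real \<times> real" and k
  define gd where "gd i k = refl (e i) (g0 i k)" for i :: "nat \<times> real \<times> real" and k
  define ga where "ga i k = refl (e i) (gc i k)" for i :: "nat \<times> real \<times> real" and k
  have I: "2 \<le> n i" "d i \<in> VV" "e i \<in> VV" "0 < v i" "0 < u i" "0 < R i" if "i \<in> I" for i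
    using that dl_VV ep_VV rate_pos step_h by (auto simp: I_def n_def d_def e_def v_def u_def vr_def R_def)
  have dm: "d i \<in> borel_measurable M" and em: "e i \<in> borel_measurable M" for i by (auto simp: d_def e_def)
  have orth: "expectation (\<lambda>w. e i w * d i w) = 0" if "i \<in> I" for i
    using that ep_orthogonal by (auto simp: I_def d_def e_def)
  have gm: "g0 i k \<in> borel_measurable M" "gc i k \<in> borel_measurable M" "gd i k \<in> borel_measurable M" "ga i k \<in> borel_measurable M" for i k
    by (auto simp: g0_def gc_def gd_def ga_def intro!: refl_meas dm em)
  have gV: "g0 i k \<in> VV" "gc i k \<in> VV" "gd i k \<in> VV" "ga i k \<in> VV" if "i \<in> I" "k \<le> n i" for i k
    using that I[OF that(1)] by (auto simp: g0_def gc_def gd_def ga_def intro!: refl_V Gt_VV tg_mem)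
  obtain Cv where Cv: "0 < Cv" "\<And>t. t \<in> {0..T} \<Longrightarrow> expectation (\<lambda>w. (Gt t w)\<^sup>2) \<le> Cv" using Gt_variance by blast
  have var_refl: "expectation (\<lambda>w. (refl z Y w)\<^sup>2) = expectation (\<lambda>w. (Y w)\<^sup>2)"
    if "z \<in> VV" "Y \<in> VV" "expectation (\<lambda>w. (z w)\<^sup>2) \<noteq> 0" for z Y
    using expectation_refl[OF that(1,2,2,3)] by (simp add: power2_eq_square)
  have var: "expectation (\<lambda>w. (g0 i k w)\<^sup>2) \<le> Cv" "expectation (\<lambda>w. (gc i k w)\<^sup>2) \<le> Cv" "expectation (\<lambda>w. (gd i k w)\<^sup>2) \<le> Cv" "expectation (\<lambda>w. (ga i k w)\<^sup>2) \<le> Cv"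
    if ik: "i \<in> I" "k \<le> n i" for i k
  proof -
    note Ii = I[OF ik(1)] and gVi = gV[OF ik]
    have v0: "expectation (\<lambda>w. (d i w)\<^sup>2) \<noteq> 0" "expectation (\<lambda>w. (e i w)\<^sup>2) \<noteq> 0" using Ii by (auto simp: v_def u_def)
    show 0: "expectation (\<lambda>w. (g0 i k w)\<^sup>2) \<le> Cv" unfolding g0_def using Ii ik by (intro Cv tg_mem)
    show 1: "expectation (\<lambda>w. (gc i k w)\<^sup>2) \<le> Cv" unfolding gc_def var_refl[OF Ii(2) gVi(1) v0(1)] by (rule 0)
    show "expectation (\<lambda>w. (gd i k w)\<^sup>2) \<le> Cv" unfolding gd_def var_refl[OF Ii(3) gVi(1) v0(2)] by (rule 0)
    show "expectation (\<lambda>w. (ga i k w)\<^sup>2) \<le> Cv" unfolding ga_def var_refl[OF Ii(3) gVi(2) v0(2)] by (rule 1)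
  qed
  have g1: "moms M (Sg I n) (\<lambda>(i, k). h i k) (\<lambda>(i, k). 1)"
    if "\<And>i k. i \<in> I \<Longrightarrow> k \<le> n i \<Longrightarrow> h i k \<in> VV" "\<And>i k. i \<in> I \<Longrightarrow> k \<le> n i \<Longrightarrow> expectation (\<lambda>w. (h i k w)\<^sup>2) \<le> Cv" for h
    using that Cv(1) by (intro moms_gauss[where K=Cv]) auto
  obtain C where C: "0 < C" "\<And>N s u. 2 \<le> N \<Longrightarrow> s \<in> {0..T} \<Longrightarrow> u \<in> {0..T} \<Longrightarrow> \<bar>expectation (\<lambda>w. Gt u w * dl N s w)\<bar> \<le> C * rt N" using dl_cov by blast
  have cd: "\<bar>expectation (\<lambda>w. g0 i k w * d i w)\<bar> \<le> C * R i" if "i \<in> I" "k \<le> n i" for i k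
    using that unfolding g0_def d_def R_def n_def by (intro C tg_mem) (auto simp: I_def)
  \<comment> \<open>The residual is a combination of two increments with coefficients 1 and at most
    1 in modulus, so the constant only doubles.\<close>
  have ce: "\<bar>expectation (\<lambda>w. g0 i k w * e i w)\<bar> \<le> 2 * C * R i" if ik: "i \<in> I" "k \<le> n i" for i k
  proof -
    obtain N s s' where i: "i = (N, s, s')" by (cases i)
    have h: "2 \<le> N" "s \<in> {0..T}" "s' \<in> {0..T}" "0 < vr N s" "vr N s' \<le> vr N s" using ik(1) i by (auto simp: I_def)
    have t: "tg N k \<in> {0..T}" using ik i h by (intro tg_mem) (auto simp: n_def)
    have "expectation (\<lambda>w. g0 i k w * e i w) = expectation (\<lambda>w. Gt (tg N k) w * dl N s' w - rc N s s' * (Gt (tg N k) w * dl N s w))"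
      by (intro Bochner_Integration.integral_cong) (auto simp: g0_def e_def ep_def n_def i algebra_simps)
    also have "\<dots> = expectation (\<lambda>w. Gt (tg N k) w * dl N s' w) - rc N s s' * expectation (\<lambda>w. Gt (tg N k) w * dl N s w)"
      using V_prod_integrable[OF Gt_VV[OF t] dl_VV[OF h(1,2)]] V_prod_integrable[OF Gt_VV[OF t] dl_VV[OF h(1,3)]] by simp
    finally have eq: "expectation (\<lambda>w. g0 i k w * e i w) = expectation (\<lambda>w. Gt (tg N k) w * dl N s' w) - rc N s s' * expectation (\<lambda>w. Gt (tg N k) w * dl N s w)" .
    have "\<bar>rc N s s' * expectation (\<lambda>w. Gt (tg N k) w * dl N s w)\<bar> \<le> 1 * (C * rt N)"
      unfolding abs_mult by (intro mult_mono rc_le_1 C h t) auto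
    then have "\<bar>expectation (\<lambda>w. g0 i k w * e i w)\<bar> \<le> 2 * C * rt N"
      using C(2)[OF h(1,3) t] unfolding eq by linarith
    moreover have "R i = rt N" by (simp add: R_def n_def i)
    ultimately show ?thesis by (simp only:)
  qed
  \<comment> \<open>Sizes of the displacements under the two reflections, from
    \<open>refl_diff_sq\<close> and the covariances of order \<open>R i\<close>.\<close>
  define r where "r i = R i / sqrt (v i)" for i :: "nat \<times> real \<times> real"
  define s where "s i = R i / sqrt (u i)" for i :: "nat \<times> real \<times> real"
  have rs: "0 < r i" "0 < s i" if "i \<in> I" for i using I[OF that] by (auto simp: r_def s_def)
  have p: "moms M (Sg I n) (\<lambda>(i, k). \<lambda>w. gc i k w - g0 i k w) (\<lambda>(i, k). r i)"
  proof (rule moms_gauss[where K="4 * C\<^sup>2"])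
    fix j assume "j \<in> Sg I n"
    then obtain i k where j: "j = (i, k)" "i \<in> I" "k \<le> n i" by auto
    show "(case j of (i, k) \<Rightarrow> \<lambda>w. gc i k w - g0 i k w) \<in> VV" unfolding j(1) using gV[OF j(2,3)] by (simp add: V_diff)
    show "0 < (case j of (i, k) \<Rightarrow> r i)" unfolding j(1) using rs[OF j(2)] by simp
    have "expectation (\<lambda>w. (gc i k w - g0 i k w)\<^sup>2) \<le> 4 * (C * R i)\<^sup>2 / v i"
      unfolding gc_def v_def using I[OF j(2)] cd[OF j(2,3)] by (intro refl_diff_sq) (auto simp: v_def)
    also have "\<dots> = 4 * C\<^sup>2 * (r i)\<^sup>2" using I[OF j(2)] by (simp add: r_def power_mult_distrib power_divide)
    finally show "expectation (\<lambda>w. ((case j of (i, k) \<Rightarrow> \<lambda>w. gc i k w - g0 i k w) w)\<^sup>2) \<le> 4 * C\<^sup>2 * (case j of (i, k) \<Rightarrow> r i)\<^sup>2" by (simp add: j(1))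
  qed simp
  have q: "moms M (Sg I n) (\<lambda>(i, k). \<lambda>w. gd i k w - g0 i k w) (\<lambda>(i, k). s i)"
  proof (rule moms_gauss[where K="4 * (2 * C)\<^sup>2"])
    fix j assume "j \<in> Sg I n"
    then obtain i k where j: "j = (i, k)" "i \<in> I" "k \<le> n i" by auto
    show "(case j of (i, k) \<Rightarrow> \<lambda>w. gd i k w - g0 i k w) \<in> VV" unfolding j(1) using gV[OF j(2,3)] by (simp add: V_diff)
    show "0 < (case j of (i, k) \<Rightarrow> s i)" unfolding j(1) using rs[OF j(2)] by simp
    have "expectation (\<lambda>w. (gd i k w - g0 i k w)\<^sup>2) \<le> 4 * (2 * C * R i)\<^sup>2 / u i"
      unfolding gd_def u_def using I[OF j(2)] ce[OF j(2,3)] by (intro refl_diff_sq) (auto simp: u_def)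
    also have "\<dots> = 4 * (2 * C)\<^sup>2 * (s i)\<^sup>2" using I[OF j(2)] by (simp add: s_def power_mult_distrib power_divide)
    finally show "expectation (\<lambda>w. ((case j of (i, k) \<Rightarrow> \<lambda>w. gd i k w - g0 i k w) w)\<^sup>2) \<le> 4 * (2 * C)\<^sup>2 * (case j of (i, k) \<Rightarrow> s i)\<^sup>2" by (simp add: j(1))
  qed simp
  \<comment> \<open>As d and e are orthogonal, reflecting along d does not change the covariance
    with e. The displacement along e is therefore the same before and after, and the four noises
    form a parallelogram.\<close>
  have eq: "ga i k w - gc i k w - gd i k w + g0 i k w = 0" if "i \<in> I" "k \<le> n i" for i k w
  proof -
    have "expectation (\<lambda>w. gc i k w * e i w) = expectation (\<lambda>w. g0 i k w * e i w - (2 * expectation (\<lambda>w. g0 i k w * d i w) / v i) * (e i w * d i w))"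
      unfolding gc_def refl_def v_def by (intro Bochner_Integration.integral_cong) (auto simp: algebra_simps)
    also have "\<dots> = expectation (\<lambda>w. g0 i k w * e i w)"
      using V_prod_integrable[OF gV(1)[OF that] I(3)[OF that(1)]] V_prod_integrable[OF I(3)[OF that(1)] I(2)[OF that(1)]] orth[OF that(1)] by simp
    finally have e: "expectation (\<lambda>w. gc i k w * e i w) = expectation (\<lambda>w. g0 i k w * e i w)" .
    show ?thesis unfolding ga_def gd_def refl_def[of "e i"] e by simp
  qed
  define E where "E = (\<lambda>(g :: nat \<times> real \<times> real \<Rightarrow> nat \<Rightarrow> 'a \<Rightarrow> real) j w. eul (n (fst j)) (\<lambda>k. g (fst j) k w) (snd j))"
  note mixed = euler_mixed[OF I(1) gm(4) gm(2) gm(3) gm(1) g1[OF gV(4) var(4)] g1[OF gV(2) var(2)] g1[OF gV(3) var(3)] g1[OF gV(1) var(1)] eq p q]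
  define f where "f i = (i, fl (n i) (fst (snd i)))" for i :: "nat \<times> real \<times> real"
  define f' where "f' i = (i, fl (n i) (snd (snd i)))" for i :: "nat \<times> real \<times> real"
  have f: "f i \<in> Sg I n" "f' i \<in> Sg I n" if "i \<in> I" for i
    using that fl_props(1) by (auto simp: f_def f'_def I_def n_def)
  define B where "B g j w = b1 (E g j w)" for g :: "nat \<times> real \<times> real \<Rightarrow> nat \<Rightarrow> 'a \<Rightarrow> real" and j w
  have mB: "moms M (Sg I n) (\<lambda>j w. B ga j w - B gc j w - B gd j w + B g0 j w) (\<lambda>j. r (fst j) * s (fst j))"
    "moms M (Sg I n) (\<lambda>j w. B gc j w - B g0 j w) (\<lambda>j. r (fst j))" "moms M (Sg I n) (\<lambda>j w. B gd j w - B g0 j w) (\<lambda>j. s (fst j))"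
    using mixed(2-4) by (simp_all only: B_def E_def)
  have m1: "moms M I (\<lambda>i w. B ga (h i) w - B gc (h i) w - B gd (h i) w + B g0 (h i) w) (\<lambda>i. r i * s i)"
    "moms M I (\<lambda>i w. B gc (h i) w - B g0 (h i) w) r" "moms M I (\<lambda>i w. B gd (h i) w - B g0 (h i) w) s" if h: "h = f \<or> h = f'" for h
  proof -
    have hI: "\<And>i. i \<in> I \<Longrightarrow> h i \<in> Sg I n" "\<And>i. fst (h i) = i" using h f by (auto simp: f_def f'_def)
    show "moms M I (\<lambda>i w. B ga (h i) w - B gc (h i) w - B gd (h i) w + B g0 (h i) w) (\<lambda>i. r i * s i)"
      using moms_reindex[OF mB(1), where f=h and J=I] hI(1) unfolding hI(2) by blast
    show "moms M I (\<lambda>i w. B gc (h i) w - B g0 (h i) w) r"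
      using moms_reindex[OF mB(2), where f=h and J=I] hI(1) unfolding hI(2) by blast
    show "moms M I (\<lambda>i w. B gd (h i) w - B g0 (h i) w) s"
      using moms_reindex[OF mB(3), where f=h and J=I] hI(1) unfolding hI(2) by blast
  qed
  have Em: "E g j \<in> borel_measurable M" if "\<And>i k. g i k \<in> borel_measurable M" for g j
    unfolding E_def using that by (intro eul_measurable) auto
  have Bm: "B g j \<in> borel_measurable M" if "\<And>i k. g i k \<in> borel_measurable M" for g j
    unfolding B_def[abs_def] by (rule measurable_compose[OF Em[OF that] b_measurable(2)])
  have B1: "moms M I (\<lambda>i w. B g (h i) w) (\<lambda>_. 1)" if "\<And>i k. g i k \<in> borel_measurable M" for g h
  proof (rule moms_mono[OF moms_const[of I L], where K=1])
    show "(\<lambda>w. B g (h i) w) \<in> borel_measurable M" for i using Bm[OF that] by simp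
    show "AE w in M. \<bar>B g (h i) w\<bar> \<le> \<bar>L\<bar>" for i using L L0 by (auto simp: B_def)
  qed auto
  have ff: "f = f \<or> f = f'" "f' = f \<or> f' = f'" by auto
  have sw: "moms M I (\<lambda>i w. (B gd (f i) w - B g0 (f i) w) * (B gc (f' i) w - B g0 (f' i) w)) (\<lambda>i. r i * s i)"
    using moms_mult[OF m1(3)[OF ff(1)] m1(2)[OF ff(2)]] by (simp add: mult.commute[of "r _"])
  have "moms M I (\<lambda>i w. (B ga (f i) w - B gc (f i) w - B gd (f i) w + B g0 (f i) w) * B ga (f' i) w
      + (B ga (f' i) w - B gc (f' i) w - B gd (f' i) w + B g0 (f' i) w) * (B gc (f i) w + B gd (f i) w - B g0 (f i) w)
      + (B gc (f i) w - B g0 (f i) w) * (B gd (f' i) w - B g0 (f' i) w)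
      + (B gd (f i) w - B g0 (f i) w) * (B gc (f' i) w - B g0 (f' i) w)) (\<lambda>i. r i * s i)"
  proof (intro moms_add sw)
    have mr: "moms M I (\<lambda>i w. a i w * c i w) t" if "moms M I a t" "moms M I c (\<lambda>_. 1)" for a c t
      using moms_mult[OF that] by simp
    have "moms M I (\<lambda>i w. (-1) * B g0 (f i) w) (\<lambda>_. 1)" by (intro moms_cmult B1 gm)
    moreover have "moms M I (\<lambda>i w. B gc (f i) w) (\<lambda>_. 1)" "moms M I (\<lambda>i w. B gd (f i) w) (\<lambda>_. 1)" by (intro B1 gm)+
    ultimately have "moms M I (\<lambda>i w. B gc (f i) w + B gd (f i) w + (-1) * B g0 (f i) w) (\<lambda>_. 1)" by (intro moms_add)
    then have B3: "moms M I (\<lambda>i w. B gc (f i) w + B gd (f i) w - B g0 (f i) w) (\<lambda>_. 1)" by simp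
    show "moms M I (\<lambda>i w. (B ga (f i) w - B gc (f i) w - B gd (f i) w + B g0 (f i) w) * B ga (f' i) w) (\<lambda>i. r i * s i)"
      by (intro mr m1 ff B1 gm)
    show "moms M I (\<lambda>i w. (B ga (f' i) w - B gc (f' i) w - B gd (f' i) w + B g0 (f' i) w) * (B gc (f i) w + B gd (f i) w - B g0 (f i) w)) (\<lambda>i. r i * s i)"
      by (intro mr m1 ff B3)
    show "moms M I (\<lambda>i w. (B gc (f i) w - B g0 (f i) w) * (B gd (f' i) w - B g0 (f' i) w)) (\<lambda>i. r i * s i)"
      by (intro moms_mult m1 ff)
  qed
  then have PM: "moms M I (\<lambda>i w. B ga (f i) w * B ga (f' i) w - B gc (f i) w * B gc (f' i) w - B gd (f i) w * B gd (f' i) w + B g0 (f i) w * B g0 (f' i) w) (\<lambda>i. r i * s i)"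
    by (simp only: product_mixed_difference)
  have dM: "moms M I d (\<lambda>i. sqrt (v i))" and eM: "moms M I e (\<lambda>i. sqrt (u i))"
    using I by (auto intro!: moms_gauss[where K=1] simp: v_def u_def)
  \<comment> \<open>Multiplying by d and e restores the square roots that the displacements carry in
    their denominators.\<close>
  have PM2: "moms M I (\<lambda>i w. (B ga (f i) w * B ga (f' i) w - B gc (f i) w * B gc (f' i) w - B gd (f i) w * B gd (f' i) w + B g0 (f i) w * B g0 (f' i) w) * d i w * e i w)
     (\<lambda>i. r i * s i * sqrt (v i) * sqrt (u i))"
    by (intro moms_mult PM dM eM)
  obtain Cf where Cf: "0 \<le> Cf" "\<And>i. i \<in> I \<Longrightarrow> integrable M (\<lambda>w. (B ga (f i) w * B ga (f' i) w - B gc (f i) w * B gc (f' i) w - B gd (f i) w * B gd (f' i) w + B g0 (f i) w * B g0 (f' i) w) * d i w * e i w) \<and>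
      expectation (\<lambda>w. \<bar>(B ga (f i) w * B ga (f' i) w - B gc (f i) w * B gc (f' i) w - B gd (f i) w * B gd (f' i) w + B g0 (f i) w * B g0 (f' i) w) * d i w * e i w\<bar>) \<le> Cf * (r i * s i * sqrt (v i) * sqrt (u i))"
    using moms_expectation[OF PM2] by blast
  have main: "\<bar>expectation (\<lambda>w. Fb N x w * Fb N x' w * dl N x w * ep N x x' w)\<bar> \<le> Cf * (rt N)\<^sup>2" if iI: "(N, x, x') \<in> I" for N x x'
  proof -
    let ?i = "(N, x, x')"
    note Ii = I[OF iI]
    define kx where "kx = fl N x"
    define kx' where "kx' = fl N x'"
    have k: "kx \<le> N" "kx' \<le> N" using f[OF iI] by (auto simp: f_def f'_def n_def kx_def kx'_def)
    \<comment> \<open>The weights see only grid values up to index N, so they are functionals of N+1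
      Gaussian coordinates, as \<open>mixed_difference\<close> demands.\<close>
    define \<Psi> where "\<Psi> y = b1 (eul N y kx) * b1 (eul N y kx')" for y
    have Psim: "\<Psi> \<in> borel_measurable (PiM {..<Suc N} (\<lambda>_. borel))"
    proof -
      have e: "(\<lambda>y. eul N (\<lambda>k. y k) l) \<in> borel_measurable (PiM {..<Suc N} (\<lambda>_. borel))" if "l \<le> N" for l
        using that by (intro eul_measurable measurable_component_singleton) auto
      show ?thesis unfolding \<Psi>_def
        by (intro borel_measurable_times measurable_compose[OF e[OF k(1)] b_measurable(2)] measurable_compose[OF e[OF k(2)] b_measurable(2)])
    qed
    have Psib: "\<bar>\<Psi> y\<bar> \<le> L * L" for y unfolding \<Psi>_def abs_mult using L L0 by (intro mult_mono) auto
    have F: "\<Psi> (\<lambda>k\<in>{..<Suc N}. g ?i k w) = B g (f ?i) w * B g (f' ?i) w" for g :: "nat \<times> real \<times> real \<Rightarrow> nat \<Rightarrow> 'a \<Rightarrow> real" and w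
    proof -
      have "eul N (\<lambda>k\<in>{..<Suc N}. g ?i k w) l = eul N (\<lambda>k. g ?i k w) l" if "l \<le> N" for l
        using that by (intro eul_cong) auto
      then show ?thesis using k by (simp add: \<Psi>_def B_def E_def f_def f'_def n_def kx_def kx'_def)
    qed
    have v0: "expectation (\<lambda>w. (d ?i w)\<^sup>2) \<noteq> 0" "expectation (\<lambda>w. (e ?i w)\<^sup>2) \<noteq> 0" using Ii by (auto simp: v_def u_def)
    have "expectation (\<lambda>w. \<Psi> (\<lambda>k\<in>{..<Suc N}. g0 ?i k w) * d ?i w * e ?i w) =
      expectation (\<lambda>w. (\<Psi> (\<lambda>k\<in>{..<Suc N}. g0 ?i k w) - \<Psi> (\<lambda>k\<in>{..<Suc N}. gc ?i k w) - \<Psi> (\<lambda>k\<in>{..<Suc N}. gd ?i k w) + \<Psi> (\<lambda>k\<in>{..<Suc N}. ga ?i k w)) * d ?i w * e ?i w) / 4"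
      unfolding gc_def gd_def ga_def
      by (rule mixed_difference[OF _ Ii(2) Ii(3) orth[OF iI] v0 Psim Psib]) (use gV(1)[OF iI] in \<open>auto simp: n_def\<close>)
    then have MD: "expectation (\<lambda>w. B g0 (f ?i) w * B g0 (f' ?i) w * d ?i w * e ?i w) =
      expectation (\<lambda>w. (B ga (f ?i) w * B ga (f' ?i) w - B gc (f ?i) w * B gc (f' ?i) w - B gd (f ?i) w * B gd (f' ?i) w + B g0 (f ?i) w * B g0 (f' ?i) w) * d ?i w * e ?i w) / 4"
      unfolding F by (simp add: algebra_simps)
    have "\<bar>expectation (\<lambda>w. (B ga (f ?i) w * B ga (f' ?i) w - B gc (f ?i) w * B gc (f' ?i) w - B gd (f ?i) w * B gd (f' ?i) w + B g0 (f ?i) w * B g0 (f' ?i) w) * d ?i w * e ?i w)\<bar>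
      \<le> Cf * (r ?i * s ?i * sqrt (v ?i) * sqrt (u ?i))"
      by (rule order_trans[OF integral_abs_bound]) (use Cf(2)[OF iI] in blast)
    moreover have "r ?i * s ?i * sqrt (v ?i) * sqrt (u ?i) = (rt N)\<^sup>2"
      using Ii by (simp add: r_def s_def R_def n_def power2_eq_square)
    moreover have "0 \<le> Cf * (rt N)\<^sup>2" using Cf(1) by simp
    moreover have "expectation (\<lambda>w. Fb N x w * Fb N x' w * dl N x w * ep N x x' w) = expectation (\<lambda>w. B g0 (f ?i) w * B g0 (f' ?i) w * d ?i w * e ?i w)"
      by (simp add: Fb_def Xh_def B_def E_def g0_def f_def f'_def n_def d_def e_def)
    ultimately show ?thesis using MD by simp
  qed
  show ?thesis using Cf(1) main unfolding I_def by blast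
qed

lemma Fb_bound: "\<bar>Fb N s w * Fb N s' w\<bar> \<le> L * L"
  unfolding Fb_def abs_mult using L L0 by (intro mult_mono) auto

lemma FF_integrable:
  assumes "2 \<le> N" "s \<in> {0..T}" "s' \<in> {0..T}" "X \<in> VV" "X' \<in> VV"
  shows "integrable M (\<lambda>w. Fb N s w * Fb N s' w * X w * X' w)"
proof (rule Bochner_Integration.integrable_bound)
  show "integrable M (\<lambda>w. (L * L) * (X w * X' w))" using V_prod_integrable[OF assms(4,5)] by simp
  show "(\<lambda>w. Fb N s w * Fb N s' w * X w * X' w) \<in> borel_measurable M"
    using V_measurable[OF assms(4)] V_measurable[OF assms(5)] by measurable
  show "AE w in M. norm (Fb N s w * Fb N s' w * X w * X' w) \<le> norm ((L * L) * (X w * X' w))"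
  proof (intro AE_I2)
    fix w
    have "\<bar>Fb N s w * Fb N s' w\<bar> * \<bar>X w * X' w\<bar> \<le> (L * L) * \<bar>X w * X' w\<bar>" by (intro mult_right_mono Fb_bound) simp
    then show "norm (Fb N s w * Fb N s' w * X w * X' w) \<le> norm ((L * L) * (X w * X' w))"
      using L0 by (simp add: abs_mult mult.assoc)
  qed
qed

text \<open>The increment of smaller variance is regressed on the other one: the regression coefficient is then at
  most 1, and the residual \<open>ep\<close> is orthogonal, so that the reflections of \<open>mixed_difference\<close> commute.\<close>
lemma cov_half:
  "\<exists>C\<ge>0. \<forall>N s s'. 2 \<le> N \<and> s \<in> {0..T} \<and> s' \<in> {0..T} \<and> vr N s' \<le> vr N s \<longrightarrow>
     \<bar>expectation (\<lambda>w. Fb N s w * Fb N s' w * dl N s w * dl N s' w)\<bar> \<le> C * (\<bar>expectation (\<lambda>w. dl N s w * dl N s' w)\<bar> + (rt N)\<^sup>2)"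
proof -
  obtain C where C: "0 \<le> C" "\<And>N s s'. 2 \<le> N \<Longrightarrow> s \<in> {0..T} \<Longrightarrow> s' \<in> {0..T} \<Longrightarrow> 0 < vr N s \<Longrightarrow> vr N s' \<le> vr N s \<Longrightarrow> 0 < expectation (\<lambda>w. (ep N s s' w)\<^sup>2) \<Longrightarrow>
     \<bar>expectation (\<lambda>w. Fb N s w * Fb N s' w * dl N s w * ep N s s' w)\<bar> \<le> C * (rt N)\<^sup>2" using cov_core by blast
  have zero: "AE w in M. X w = 0" if "X \<in> VV" "expectation (\<lambda>w. (X w)\<^sup>2) = 0" for X
  proof -
    have "AE w in M. (X w)\<^sup>2 = 0" using that integral_nonneg_eq_0_iff_AE[OF V_sq[OF that(1)]] by simp
    then show ?thesis by eventually_elim simp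
  qed
  have "\<bar>expectation (\<lambda>w. Fb N s w * Fb N s' w * dl N s w * dl N s' w)\<bar> \<le> (L * L + C) * (\<bar>expectation (\<lambda>w. dl N s w * dl N s' w)\<bar> + (rt N)\<^sup>2)"
    if h: "2 \<le> N" "s \<in> {0..T}" "s' \<in> {0..T}" "vr N s' \<le> vr N s" for N s s'
  proof (cases "vr N s = 0")
    case True
    have "AE w in M. dl N s w = 0" using True by (intro zero dl_VV h) (simp add: vr_def)
    then have "expectation (\<lambda>w. Fb N s w * Fb N s' w * dl N s w * dl N s' w) = 0" by (intro integral_eq_zero_AE) auto
    then show ?thesis using C(1) L0 by simp
  next
    case False
    then have v: "0 < vr N s" using vr_nonneg[of N s] by simp
    note d = dl_VV[OF h(1,2)] and e = ep_VV[OF h(1,2,3)]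
    have 1: "\<bar>expectation (\<lambda>w. Fb N s w * Fb N s' w * dl N s w * ep N s s' w)\<bar> \<le> C * (rt N)\<^sup>2"
    proof (cases "expectation (\<lambda>w. (ep N s s' w)\<^sup>2) = 0")
      case True
      have "AE w in M. ep N s s' w = 0" using True by (intro zero e)
      then have "expectation (\<lambda>w. Fb N s w * Fb N s' w * dl N s w * ep N s s' w) = 0" by (intro integral_eq_zero_AE) auto
      then show ?thesis using C(1) by simp
    next
      case False
      moreover have "0 \<le> expectation (\<lambda>w. (ep N s s' w)\<^sup>2)" by simp
      ultimately show ?thesis by (intro C h v) linarith
    qed
    have 2: "\<bar>expectation (\<lambda>w. Fb N s w * Fb N s' w * dl N s w * dl N s w)\<bar> \<le> L * L * vr N s"
    proof -
      have "\<bar>expectation (\<lambda>w. Fb N s w * Fb N s' w * dl N s w * dl N s w)\<bar> \<le> expectation (\<lambda>w. \<bar>Fb N s w * Fb N s' w * dl N s w * dl N s w\<bar>)"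
        by (rule integral_abs_bound)
      also have "\<dots> \<le> expectation (\<lambda>w. (L * L) * (dl N s w)\<^sup>2)"
      proof (intro integral_mono integrable_abs FF_integrable h d)
        show "integrable M (\<lambda>w. (L * L) * (dl N s w)\<^sup>2)" using V_sq[OF d] by simp
        fix w
        have "\<bar>Fb N s w * Fb N s' w\<bar> * (dl N s w)\<^sup>2 \<le> (L * L) * (dl N s w)\<^sup>2" by (intro mult_right_mono Fb_bound) simp
        then show "\<bar>Fb N s w * Fb N s' w * dl N s w * dl N s w\<bar> \<le> (L * L) * (dl N s w)\<^sup>2"
          by (simp add: abs_mult power2_eq_square mult.assoc)
      qed
      finally show ?thesis by (simp add: vr_def)
    qed
    have "expectation (\<lambda>w. Fb N s w * Fb N s' w * dl N s w * dl N s' w) =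
        expectation (\<lambda>w. rc N s s' * (Fb N s w * Fb N s' w * dl N s w * dl N s w) + Fb N s w * Fb N s' w * dl N s w * ep N s s' w)"
      by (intro Bochner_Integration.integral_cong) (auto simp: ep_def algebra_simps)
    also have "\<dots> = rc N s s' * expectation (\<lambda>w. Fb N s w * Fb N s' w * dl N s w * dl N s w) + expectation (\<lambda>w. Fb N s w * Fb N s' w * dl N s w * ep N s s' w)"
      using FF_integrable[OF h(1-3) d d] FF_integrable[OF h(1-3) d e] by simp
    finally have eq: "expectation (\<lambda>w. Fb N s w * Fb N s' w * dl N s w * dl N s' w) = rc N s s' * expectation (\<lambda>w. Fb N s w * Fb N s' w * dl N s w * dl N s w) + expectation (\<lambda>w. Fb N s w * Fb N s' w * dl N s w * ep N s s' w)" .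
    \<comment> \<open>The regression coefficient times the variance is the covariance of the two
      increments, so this part keeps the decay of the unweighted covariance.\<close>
    have "\<bar>rc N s s' * expectation (\<lambda>w. Fb N s w * Fb N s' w * dl N s w * dl N s w)\<bar> \<le> \<bar>rc N s s'\<bar> * (L * L * vr N s)"
      unfolding abs_mult[of "rc N s s'"] by (intro mult_left_mono 2) simp
    also have "\<dots> = L * L * \<bar>expectation (\<lambda>w. dl N s w * dl N s' w)\<bar>" using v by (simp add: rc_def)
    finally have 3: "\<bar>rc N s s' * expectation (\<lambda>w. Fb N s w * Fb N s' w * dl N s w * dl N s w)\<bar> \<le> L * L * \<bar>expectation (\<lambda>w. dl N s w * dl N s' w)\<bar>" .
    have "0 \<le> C * \<bar>expectation (\<lambda>w. dl N s w * dl N s' w)\<bar>" "0 \<le> L * L * (rt N)\<^sup>2" using C(1) L0 by auto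
    then have "L * L * \<bar>expectation (\<lambda>w. dl N s w * dl N s' w)\<bar> + C * (rt N)\<^sup>2 \<le> (L * L + C) * (\<bar>expectation (\<lambda>w. dl N s w * dl N s' w)\<bar> + (rt N)\<^sup>2)"
      by (simp add: algebra_simps)
    then show ?thesis unfolding eq using 1 3 by linarith
  qed
  then show ?thesis using C(1) L0 by (intro exI[of _ "L * L + C"]) auto
qed

text \<open>The estimate is symmetric in the two times, so the one of larger variance may be taken
  as regressor. The residual part contributes the square of the rate without decay, hence the
  summand 1.\<close>

lemma cov_bound:
  "\<exists>C\<ge>0. \<forall>N s s'. 2 \<le> N \<and> s \<in> {0..T} \<and> s' \<in> {0..T} \<and> s \<noteq> s' \<longrightarrow>
     \<bar>expectation (\<lambda>w. (Fb N s w * dl N s w) * (Fb N s' w * dl N s' w))\<bar> \<le> C * (rt N)\<^sup>2 * (1 + \<bar>s - s'\<bar> powr (-(2-2*H)))"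
proof -
  obtain C where C: "0 \<le> C" "\<And>N s s'. 2 \<le> N \<Longrightarrow> s \<in> {0..T} \<Longrightarrow> s' \<in> {0..T} \<Longrightarrow> vr N s' \<le> vr N s \<Longrightarrow>
     \<bar>expectation (\<lambda>w. Fb N s w * Fb N s' w * dl N s w * dl N s' w)\<bar> \<le> C * (\<bar>expectation (\<lambda>w. dl N s w * dl N s' w)\<bar> + (rt N)\<^sup>2)" using cov_half by blast
  obtain D where D: "0 < D" "\<And>N s s'. 2 \<le> N \<Longrightarrow> s \<in> {0..T} \<Longrightarrow> s' \<in> {0..T} \<Longrightarrow> s \<noteq> s' \<Longrightarrow>
    \<bar>expectation (\<lambda>w. dl N s w * dl N s' w)\<bar> \<le> D * (rt N)\<^sup>2 * \<bar>s - s'\<bar> powr (-(2-2*H))" using dl_dl_cov by blast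
  have half: "\<bar>expectation (\<lambda>w. (Fb N s w * dl N s w) * (Fb N s' w * dl N s' w))\<bar> \<le> (C * (D + 1)) * (rt N)\<^sup>2 * (1 + \<bar>s - s'\<bar> powr (-(2-2*H)))"
    if h: "2 \<le> N" "s \<in> {0..T}" "s' \<in> {0..T}" "s \<noteq> s'" "vr N s' \<le> vr N s" for N s s'
  proof -
    define P where "P = (rt N)\<^sup>2"
    define Q where "Q = \<bar>s - s'\<bar> powr (-(2-2*H))"
    have PQ: "0 \<le> P" "0 \<le> Q" by (auto simp: P_def Q_def)
    have "expectation (\<lambda>w. (Fb N s w * dl N s w) * (Fb N s' w * dl N s' w)) = expectation (\<lambda>w. Fb N s w * Fb N s' w * dl N s w * dl N s' w)"
      by (intro Bochner_Integration.integral_cong) auto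
    moreover have "\<bar>expectation (\<lambda>w. Fb N s w * Fb N s' w * dl N s w * dl N s' w)\<bar> \<le> C * (D * P * Q + P)"
      unfolding P_def Q_def by (rule order_trans[OF C(2)[OF h(1,2,3,5)] mult_left_mono[OF add_right_mono[OF D(2)[OF h(1-4)]] C(1)]])
    moreover have "C * (D * P * Q + P) \<le> (C * (D + 1)) * P * (1 + Q)"
    proof -
      have "0 \<le> D * P + P * Q" using D(1) PQ by simp
      then have "D * P * Q + P \<le> (D + 1) * P * (1 + Q)" by (simp add: algebra_simps)
      then have "C * (D * P * Q + P) \<le> C * ((D + 1) * P * (1 + Q))" using C(1) by (rule mult_left_mono)
      then show ?thesis by (simp only: mult.assoc)
    qed
    ultimately show ?thesis unfolding P_def Q_def by linarith
  qed
  have "\<bar>expectation (\<lambda>w. (Fb N s w * dl N s w) * (Fb N s' w * dl N s' w))\<bar> \<le> (C * (D + 1)) * (rt N)\<^sup>2 * (1 + \<bar>s - s'\<bar> powr (-(2-2*H)))"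
    if h: "2 \<le> N" "s \<in> {0..T}" "s' \<in> {0..T}" "s \<noteq> s'" for N s s'
  proof (cases "vr N s' \<le> vr N s")
    case True then show ?thesis by (intro half h)
  next
    case False
    then have "\<bar>expectation (\<lambda>w. (Fb N s' w * dl N s' w) * (Fb N s w * dl N s w))\<bar> \<le> (C * (D + 1)) * (rt N)\<^sup>2 * (1 + \<bar>s' - s\<bar> powr (-(2-2*H)))"
      using h by (intro half) auto
    then show ?thesis by (simp only: mult.commute[of "Fb N s' _ * dl N s' _"] abs_minus_commute)
  qed
  then show ?thesis using C(1) D(1) by (intro exI[of _ "C * (D + 1)"]) auto
qed

end

section \<open>The error of the Euler scheme\<close>

lemma ennreal_abs_integral_le:
  fixes f :: "'a \<Rightarrow> real"
  shows "ennreal \<bar>integral\<^sup>L N f\<bar> \<le> (\<integral>\<^sup>+x. ennreal \<bar>f x\<bar> \<partial>N)"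
proof (cases "integrable N f")
  case True
  then show ?thesis using integral_norm_bound_ennreal[OF True] by simp
qed (simp add: not_integrable_integral_eq)

text \<open>Fubini; absolute integrability follows from
  \<open>\<bar>\<phi> Z\<bar> \<le> \<phi>^2 + Z^2\<close>, the uniform second moment on the set S
  carrying the kernel, and the finite kernel mass.\<close>

lemma (in prob_space) volterra_expectation:
  fixes k :: "real \<Rightarrow> real" and \<phi> :: "real \<Rightarrow> 'a \<Rightarrow> real"
  assumes k: "ibound lborel k \<kappa>" "\<And>s. s \<notin> S \<Longrightarrow> k s = 0"
    and \<phi>: "jointly_measurable M \<phi>"
    and B: "\<And>s. s \<in> S \<Longrightarrow> ibound M (\<lambda>w. (\<phi> s w)\<^sup>2) B"
    and Z: "Z \<in> borel_measurable M" "integrable M (\<lambda>w. (Z w)\<^sup>2)"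
  shows "expectation (\<lambda>w. (LBINT s. k s * \<phi> s w) * Z w) = (LBINT s. k s * expectation (\<lambda>w. \<phi> s w * Z w))"
proof -
  interpret P: pair_sigma_finite lborel M ..
  have [measurable]: "k \<in> borel_measurable borel" and k0: "\<And>s. 0 \<le> k s" and kk: "(\<integral>\<^sup>+s. ennreal (k s) \<partial>lborel) \<le> ennreal \<kappa>"
    using k(1) by (auto simp: ibound_def)
  note [measurable] = \<phi> Z(1)
  define f where "f p = k (fst p) * (\<phi> (fst p) (snd p) * Z (snd p))" for p
  have fm [measurable]: "f \<in> borel_measurable (lborel \<Otimes>\<^sub>M M)" unfolding f_def[abs_def] by measurable
  define D where "D = ennreal B + ennreal (expectation (\<lambda>w. (Z w)\<^sup>2))"
  have in1: "(\<integral>\<^sup>+w. ennreal (norm (f (s, w))) \<partial>M) \<le> ennreal (k s) * D" for s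
  proof (cases "s \<in> S")
    case True
    have [measurable]: "(\<lambda>w. (\<phi> s w)\<^sup>2) \<in> borel_measurable M" using B[OF True] by (simp add: ibound_def)
    have "ennreal (norm (f (s, w))) \<le> ennreal (k s) * (ennreal ((\<phi> s w)\<^sup>2) + ennreal ((Z w)\<^sup>2))" for w
    proof -
      have "0 \<le> (\<bar>\<phi> s w\<bar> - \<bar>Z w\<bar>)\<^sup>2" by simp
      then have "2 * (\<bar>\<phi> s w\<bar> * \<bar>Z w\<bar>) \<le> (\<phi> s w)\<^sup>2 + (Z w)\<^sup>2" by (simp add: power2_diff)
      moreover have "0 \<le> \<bar>\<phi> s w\<bar> * \<bar>Z w\<bar>" by simp
      ultimately have "\<bar>\<phi> s w * Z w\<bar> \<le> (\<phi> s w)\<^sup>2 + (Z w)\<^sup>2" unfolding abs_mult by linarith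
      then have "norm (f (s, w)) \<le> k s * ((\<phi> s w)\<^sup>2 + (Z w)\<^sup>2)" using k0[of s] by (simp add: f_def abs_mult[of "k s"] mult_left_mono)
      then have "ennreal (norm (f (s, w))) \<le> ennreal (k s * ((\<phi> s w)\<^sup>2 + (Z w)\<^sup>2))" by (rule ennreal_leI)
      then show ?thesis using k0[of s] by (simp add: ennreal_mult ennreal_plus)
    qed
    then have "(\<integral>\<^sup>+w. ennreal (norm (f (s, w))) \<partial>M) \<le> (\<integral>\<^sup>+w. ennreal (k s) * (ennreal ((\<phi> s w)\<^sup>2) + ennreal ((Z w)\<^sup>2)) \<partial>M)"
      by (rule nn_integral_mono)
    also have "\<dots> = ennreal (k s) * ((\<integral>\<^sup>+w. ennreal ((\<phi> s w)\<^sup>2) \<partial>M) + (\<integral>\<^sup>+w. ennreal ((Z w)\<^sup>2) \<partial>M))"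
      by (simp add: nn_integral_cmult nn_integral_add)
    also have "\<dots> \<le> ennreal (k s) * D"
      unfolding D_def using B[OF True] nn_integral_eq_integral[OF Z(2)] by (intro mult_left_mono add_mono) (auto simp: ibound_def)
    finally show ?thesis .
  qed (simp add: f_def k(2))
  have "(\<integral>\<^sup>+p. ennreal (norm (f p)) \<partial>(lborel \<Otimes>\<^sub>M M)) = (\<integral>\<^sup>+s. (\<integral>\<^sup>+w. ennreal (norm (f (s, w))) \<partial>M) \<partial>lborel)"
    by (subst nn_integral_fst[symmetric]) auto
  also have "\<dots> \<le> (\<integral>\<^sup>+s. ennreal (k s) * D \<partial>lborel)" by (intro nn_integral_mono in1)
  also have "\<dots> = (\<integral>\<^sup>+s. ennreal (k s) \<partial>lborel) * D" by (rule nn_integral_multc) simp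
  also have "\<dots> \<le> ennreal \<kappa> * D" by (rule mult_right_mono[OF kk]) simp
  also have "\<dots> < \<infinity>" by (simp add: D_def ennreal_mult_less_top)
  finally have fi: "integrable (lborel \<Otimes>\<^sub>M M) f" by (intro integrableI_bounded fm)
  then have fi': "integrable (lborel \<Otimes>\<^sub>M M) (\<lambda>(s, w). f (s, w))" by simp
  have "expectation (\<lambda>w. (LBINT s. k s * \<phi> s w) * Z w) = expectation (\<lambda>w. (LBINT s. f (s, w)))"
    by (simp add: f_def mult.assoc[symmetric])
  also have "\<dots> = (LBINT s. expectation (\<lambda>w. f (s, w)))" by (rule P.Fubini_integral[OF fi'])
  also have "\<dots> = (LBINT s. k s * expectation (\<lambda>w. \<phi> s w * Z w))" by (simp add: f_def)
  finally show ?thesis .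
qed

context vol
begin

lemma volterra_second_moment:
  assumes k: "ibound lborel k \<kappa>" "\<And>s. s \<notin> S \<Longrightarrow> k s = 0"
    and \<phi>: "jointly_measurable M \<phi>"
    and B: "\<And>s. s \<in> S \<Longrightarrow> ibound M (\<lambda>w. (\<phi> s w)\<^sup>2) B"
    and \<Lambda>: "integrable M (\<lambda>w. (LBINT s. k s * \<phi> s w)\<^sup>2)"
    and cov: "\<And>s s'. s \<in> S \<Longrightarrow> s' \<in> S \<Longrightarrow> s \<noteq> s' \<Longrightarrow> \<bar>expectation (\<lambda>w. \<phi> s w * \<phi> s' w)\<bar> \<le> D * (1 + \<bar>s - s'\<bar> powr (-(2-2*H)))"
    and D: "0 \<le> D" and C: "0 \<le> C" "en k k \<le> ennreal C"
  shows "expectation (\<lambda>w. (LBINT s. k s * \<phi> s w)\<^sup>2) \<le> D * (\<kappa>\<^sup>2 + C)"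
proof -
  define \<Lambda> where "\<Lambda> w = (LBINT s. k s * \<phi> s w)" for w
  have [measurable]: "k \<in> borel_measurable borel" and k0: "\<And>s. 0 \<le> k s" and kk: "(\<integral>\<^sup>+s. ennreal (k s) \<partial>lborel) \<le> ennreal \<kappa>" and \<kappa>: "0 \<le> \<kappa>"
    using k(1) by (auto simp: ibound_def)
  have \<Lambda>m: "\<Lambda> \<in> borel_measurable M" unfolding \<Lambda>_def by (rule measurable_volterra[OF \<phi>]) simp
  have \<phi>m: "\<phi> s \<in> borel_measurable M" for s
    using measurable_compose[OF measurable_Pair1'[of s lborel M] \<phi>] by simp
  have 1: "expectation (\<lambda>w. \<phi> s w * \<Lambda> w) = (LBINT s'. k s' * expectation (\<lambda>w. \<phi> s' w * \<phi> s w))" if s: "s \<in> S" for s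
  proof -
    have "integrable M (\<lambda>w. (\<phi> s w)\<^sup>2)" by (rule ibound_integrable(1)[OF B[OF s]])
    from volterra_expectation[OF k \<phi> B \<phi>m this] show ?thesis unfolding \<Lambda>_def by (simp only: mult.commute)
  qed
  have b1: "ennreal \<bar>k s * expectation (\<lambda>w. \<phi> s w * \<Lambda> w)\<bar> \<le>
      (\<integral>\<^sup>+s'. ennreal D * (ennreal (k s) * ennreal (k s')) + ennreal D * ennreal (k s' * k s * \<bar>s' - s\<bar> powr (-(2-2*H))) \<partial>lborel)" for s
  proof (cases "s \<in> S")
    case True
    have "ennreal \<bar>k s * expectation (\<lambda>w. \<phi> s w * \<Lambda> w)\<bar> = ennreal (k s) * ennreal \<bar>LBINT s'. k s' * expectation (\<lambda>w. \<phi> s' w * \<phi> s w)\<bar>"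
      unfolding 1[OF True] using k0[of s] by (simp add: abs_mult ennreal_mult)
    also have "\<dots> \<le> ennreal (k s) * (\<integral>\<^sup>+s'. ennreal (D * (k s' * (1 + \<bar>s' - s\<bar> powr (-(2-2*H))))) \<partial>lborel)"
    proof (intro mult_left_mono order_trans[OF ennreal_abs_integral_le] nn_integral_mono_AE)
      show "AE s' in lborel. ennreal \<bar>k s' * expectation (\<lambda>w. \<phi> s' w * \<phi> s w)\<bar> \<le> ennreal (D * (k s' * (1 + \<bar>s' - s\<bar> powr (-(2-2*H)))))"
        using AE_lborel_singleton[of s]
      proof eventually_elim
        case (elim s')
        show ?case
        proof (cases "s' \<in> S")
          case s': True
          have "k s' * \<bar>expectation (\<lambda>w. \<phi> s' w * \<phi> s w)\<bar> \<le> k s' * (D * (1 + \<bar>s' - s\<bar> powr (-(2-2*H))))"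
            by (intro mult_left_mono cov s' True elim k0)
          then show ?thesis using k0[of s'] by (intro ennreal_leI) (simp only: abs_mult abs_of_nonneg mult.left_commute)
        qed (simp add: k(2))
      qed
    qed simp
    also have "\<dots> = (\<integral>\<^sup>+s'. ennreal (k s) * ennreal (D * (k s' * (1 + \<bar>s' - s\<bar> powr (-(2-2*H))))) \<partial>lborel)"
      by (rule nn_integral_cmult[symmetric]) measurable
    also have "\<dots> = (\<integral>\<^sup>+s'. ennreal D * (ennreal (k s) * ennreal (k s')) + ennreal D * ennreal (k s' * k s * \<bar>s' - s\<bar> powr (-(2-2*H))) \<partial>lborel)"
    proof (rule nn_integral_cong)
      fix s'
      define q where "q = \<bar>s' - s\<bar> powr (-(2-2*H))"
      have q: "0 \<le> q" by (simp add: q_def)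
      have "ennreal (k s) * ennreal (D * (k s' * (1 + q))) = ennreal (k s * (D * (k s' * (1 + q))))" using k0 D q by (simp add: ennreal_mult)
      also have "k s * (D * (k s' * (1 + q))) = D * (k s * k s') + D * (k s' * k s * q)" by (simp add: algebra_simps)
      also have "ennreal \<dots> = ennreal (D * (k s * k s')) + ennreal (D * (k s' * k s * q))" using k0 D q by (intro ennreal_plus) auto
      also have "\<dots> = ennreal D * (ennreal (k s) * ennreal (k s')) + ennreal D * ennreal (k s' * k s * q)" using k0 D q by (simp add: ennreal_mult)
      finally show "ennreal (k s) * ennreal (D * (k s' * (1 + \<bar>s' - s\<bar> powr (-(2-2*H))))) = ennreal D * (ennreal (k s) * ennreal (k s')) + ennreal D * ennreal (k s' * k s * \<bar>s' - s\<bar> powr (-(2-2*H)))"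
        unfolding q_def .
    qed
    finally show ?thesis .
  qed (simp add: k(2))
  have i1: "(\<integral>\<^sup>+s'. ennreal D * (ennreal (k s) * ennreal (k s')) + ennreal D * ennreal (k s' * k s * \<bar>s' - s\<bar> powr (-(2-2*H))) \<partial>lborel)
     = ennreal D * (ennreal (k s) * (\<integral>\<^sup>+s'. ennreal (k s') \<partial>lborel)) + ennreal D * (\<integral>\<^sup>+s'. ennreal (k s' * k s * \<bar>s' - s\<bar> powr (-(2-2*H))) \<partial>lborel)" for s
    by (subst nn_integral_add) (simp_all add: nn_integral_cmult)
  have i2: "(\<integral>\<^sup>+s. ennreal D * (ennreal (k s) * (\<integral>\<^sup>+s'. ennreal (k s') \<partial>lborel)) + ennreal D * (\<integral>\<^sup>+s'. ennreal (k s' * k s * \<bar>s' - s\<bar> powr (-(2-2*H))) \<partial>lborel) \<partial>lborel)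
     = ennreal D * ((\<integral>\<^sup>+s. ennreal (k s) \<partial>lborel) * (\<integral>\<^sup>+s'. ennreal (k s') \<partial>lborel)) + ennreal D * en k k"
    unfolding en_def by (subst nn_integral_add) (simp_all add: nn_integral_cmult nn_integral_multc)
  have "expectation (\<lambda>w. (\<Lambda> w)\<^sup>2) = expectation (\<lambda>w. (LBINT s. k s * \<phi> s w) * \<Lambda> w)"
    unfolding power2_eq_square \<Lambda>_def ..
  also have "\<dots> = (LBINT s. k s * expectation (\<lambda>w. \<phi> s w * \<Lambda> w))"
    by (rule volterra_expectation[OF k \<phi> B \<Lambda>m]) (use \<Lambda> in \<open>simp_all add: \<Lambda>_def\<close>)
  finally have "ennreal \<bar>expectation (\<lambda>w. (\<Lambda> w)\<^sup>2)\<bar> \<le> (\<integral>\<^sup>+s. ennreal \<bar>k s * expectation (\<lambda>w. \<phi> s w * \<Lambda> w)\<bar> \<partial>lborel)"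
    by (simp only: ennreal_abs_integral_le)
  also have "\<dots> \<le> (\<integral>\<^sup>+s. (\<integral>\<^sup>+s'. ennreal D * (ennreal (k s) * ennreal (k s')) + ennreal D * ennreal (k s' * k s * \<bar>s' - s\<bar> powr (-(2-2*H))) \<partial>lborel) \<partial>lborel)"
    by (intro nn_integral_mono b1)
  also have "\<dots> = ennreal D * ((\<integral>\<^sup>+s. ennreal (k s) \<partial>lborel) * (\<integral>\<^sup>+s'. ennreal (k s') \<partial>lborel)) + ennreal D * en k k"
    unfolding i1 i2 ..
  also have "\<dots> \<le> ennreal D * (ennreal \<kappa> * ennreal \<kappa>) + ennreal D * ennreal C"
    by (intro add_mono mult_left_mono mult_mono kk C(2)) simp_all
  also have "\<dots> = ennreal (D * (\<kappa>\<^sup>2 + C))"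
    using D C(1) \<kappa> by (simp add: ennreal_mult[symmetric] ennreal_plus[symmetric] power2_eq_square distrib_left del: ennreal_plus)
  finally have "\<bar>expectation (\<lambda>w. (\<Lambda> w)\<^sup>2)\<bar> \<le> D * (\<kappa>\<^sup>2 + C)"
    using D C(1) by (subst (asm) ennreal_le_iff) auto
  then show ?thesis unfolding \<Lambda>_def by simp
qed

section \<open>Moments uniform over all grids and times, and the leading error term\<close>

abbreviation "J \<equiv> {2::nat..} \<times> {0..T}"

lemma rate_step: "2 \<le> N \<Longrightarrow> 0 < rt N"
  using rate_pos step_h by blast

lemma Gt_moms: "moms M {0..T} Gt (\<lambda>_. 1)"
proof -
  obtain C where "0 < C" "\<And>t. t \<in> {0..T} \<Longrightarrow> expectation (\<lambda>w. (Gt t w)\<^sup>2) \<le> C" using Gt_variance by blast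
  then show ?thesis by (intro moms_gauss[where K=C] Gt_VV) auto
qed

lemma dl_moms: "moms M J (\<lambda>j. dl (fst j) (snd j)) (\<lambda>j. sqrt (rt (fst j)))"
proof -
  obtain C where C: "0 < C" "\<And>N s. 2 \<le> N \<Longrightarrow> s \<in> {0..T} \<Longrightarrow> expectation (\<lambda>w. (dl N s w)\<^sup>2) \<le> C * rt N" using dl_variance by blast
  show ?thesis
  proof (rule moms_gauss[where K=C])
    fix j assume j: "j \<in> J"
    then have N: "2 \<le> fst j" "snd j \<in> {0..T}" by auto
    show "dl (fst j) (snd j) \<in> VV" by (rule dl_VV[OF N])
    show "0 < sqrt (rt (fst j))" using rate_step[OF N(1)] by simp
    show "expectation (\<lambda>w. (dl (fst j) (snd j) w)\<^sup>2) \<le> C * (sqrt (rt (fst j)))\<^sup>2"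
      using C(2)[OF N] rate_step[OF N(1)] by simp
  qed (use C in simp)
qed

lemma Xh_moms: "moms M J (\<lambda>j. Xh (fst j) (fl (fst j) (snd j))) (\<lambda>_. 1)"
proof -
  have "moms M (Sg {2..} (\<lambda>N. N)) (\<lambda>j. Gt (tg (fst j) (snd j))) (\<lambda>_. 1)"
    using tg_mem by (intro moms_reindex[OF Gt_moms]) auto
  then have "moms M (Sg {2..} (\<lambda>N. N)) (\<lambda>(N, k). Gt (tg N k)) (\<lambda>(N, k). 1)" by (simp add: case_prod_beta')
  then have "moms M (Sg {2..} (\<lambda>N. N)) (\<lambda>(N, n) w. eul N (\<lambda>k. Gt (tg N k) w) n) (\<lambda>(N, n). 1)"
    by (intro euler_moments) auto
  then have X: "moms M (Sg {2..} (\<lambda>N. N)) (\<lambda>j. Xh (fst j) (snd j)) (\<lambda>_. 1)"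
    by (simp add: Xh_def[abs_def] case_prod_beta')
  have "moms M J (\<lambda>j. Xh (fst (fst j, fl (fst j) (snd j))) (snd (fst j, fl (fst j) (snd j)))) (\<lambda>j. 1)"
    by (rule moms_reindex[OF X]) (use fl_props(1) in auto)
  then show ?thesis by simp
qed

lemma bX_moms: "moms M J (\<lambda>j w. b (Xh (fst j) (fl (fst j) (snd j)) w)) (\<lambda>_. 1)"
proof (rule moms_mono[where K=1])
  show "moms M J (\<lambda>j w. \<bar>b 0\<bar> + L * \<bar>Xh (fst j) (fl (fst j) (snd j)) w\<bar>) (\<lambda>_. 1)"
    by (intro moms_add moms_const moms_cmult moms_abs Xh_moms)
  show "(\<lambda>w. b (Xh (fst j) (fl (fst j) (snd j)) w)) \<in> borel_measurable M" for j
    by (rule measurable_compose[OF Xh_meas b_measurable(1)])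
  have "\<bar>b u\<bar> \<le> \<bar>\<bar>b 0\<bar> + L * \<bar>u\<bar>\<bar>" for u using b_growth[of u] by linarith
  then show "AE w in M. \<bar>b (Xh (fst j) (fl (fst j) (snd j)) w)\<bar> \<le> \<bar>\<bar>b 0\<bar> + L * \<bar>Xh (fst j) (fl (fst j) (snd j)) w\<bar>\<bar>" for j by simp
qed auto

lemma moms_volterra_signed:
  fixes Z :: "'i \<Rightarrow> real \<Rightarrow> 'a \<Rightarrow> real" and k :: "'i \<Rightarrow> real \<Rightarrow> real"
  assumes Z: "moms M (I \<times> S) (\<lambda>(i, s). Z i s) (\<lambda>(i, s). r i)"
    and Zm: "\<And>i. i \<in> I \<Longrightarrow> jointly_measurable M (Z i)"
    and k: "\<And>i. i \<in> I \<Longrightarrow> ibound lborel (k i) (\<kappa> i)" "\<And>i s. i \<in> I \<Longrightarrow> s \<notin> S \<Longrightarrow> k i s = 0"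
    and \<kappa>: "\<And>i. i \<in> I \<Longrightarrow> 0 < \<kappa> i" and S: "S \<noteq> {}"
  shows "moms M I (\<lambda>i w. LBINT s. k i s * Z i s w) (\<lambda>i. \<kappa> i * r i)"
proof -
  note V = moms_volterra[OF assms]
  show ?thesis
  proof (rule moms_mono[OF V, where K=1])
    fix i assume i: "i \<in> I"
    have kb: "k i \<in> borel_measurable borel" "\<And>s. 0 \<le> k i s" using k(1)[OF i] by (auto simp: ibound_def)
    show "(\<lambda>w. LBINT s. k i s * Z i s w) \<in> borel_measurable M" by (rule measurable_volterra[OF Zm[OF i] kb(1)])
    show "AE w in M. \<bar>LBINT s. k i s * Z i s w\<bar> \<le> \<bar>LBINT s. k i s * \<bar>Z i s w\<bar>\<bar>"
    proof (intro AE_I2)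
      fix w
      have "\<bar>LBINT s. k i s * Z i s w\<bar> \<le> (LBINT s. \<bar>k i s * Z i s w\<bar>)" by (rule integral_abs_bound)
      also have "\<dots> = (LBINT s. k i s * \<bar>Z i s w\<bar>)" using kb(2) by (simp only: abs_mult abs_of_nonneg)
      finally show "\<bar>LBINT s. k i s * Z i s w\<bar> \<le> \<bar>LBINT s. k i s * \<bar>Z i s w\<bar>\<bar>" by linarith
    qed
    show "0 < \<kappa> i * r i" by (rule momsD(2)[OF V i])
  qed auto
qed

definition \<kappa> :: real where "\<kappa> = T powr \<alpha> / \<alpha>"

lemma \<kappa>: "0 < \<kappa>" using T \<alpha>0 by (simp add: \<kappa>_def)

lemma ibound_fk': "t \<in> {0..T} \<Longrightarrow> ibound lborel (fk \<alpha> t) \<kappa>"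
proof -
  assume t: "t \<in> {0..T}"
  show ?thesis
  proof (rule ibound_mono[OF ibound_fk[OF \<alpha>0, of t]])
    show "t powr \<alpha> / \<alpha> \<le> \<kappa>" unfolding \<kappa>_def using t \<alpha>0 by (intro divide_right_mono powr_mono2) auto
  qed (use t in auto)
qed

lemma fk_eq_0: "t \<in> {0..T} \<Longrightarrow> s \<notin> {0..T} \<Longrightarrow> fk \<alpha> t s = 0"
  by (auto simp: fk_def)

lemma volterra_moms:
  fixes Z :: "nat \<Rightarrow> real \<Rightarrow> 'a \<Rightarrow> real"
  assumes Z: "moms M J (\<lambda>j. Z (fst j) (snd j)) (\<lambda>j. r (fst j))"
    and Zm: "\<And>N. 2 \<le> N \<Longrightarrow> jointly_measurable M (Z N)"
  shows "moms M J (\<lambda>j w. LBINT s. fk \<alpha> (snd j) s * Z (fst j) s w) (\<lambda>j. r (fst j))"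
    "moms M J (\<lambda>j w. LBINT s. fk \<alpha> (snd j) s * \<bar>Z (fst j) s w\<bar>) (\<lambda>j. r (fst j))"
proof -
  have A: "moms M (J \<times> {0..T}) (\<lambda>(j, s). Z (fst j) s) (\<lambda>(j, s). r (fst j))"
    using moms_reindex[OF Z, of "J \<times> {0..T}" "\<lambda>(j, s). (fst j, s)"] by (auto simp: case_prod_beta')
  have ne: "{0..T} \<noteq> {}" using T by auto
  have k1: "ibound lborel (fk \<alpha> (snd j)) \<kappa>" if "j \<in> J" for j using that by (intro ibound_fk') auto
  have k2: "fk \<alpha> (snd j) s = 0" if "j \<in> J" "s \<notin> {0..T}" for j s using that by (intro fk_eq_0) auto
  have m: "(\<lambda>p. Z (fst j) (fst p) (snd p)) \<in> borel_measurable (lborel \<Otimes>\<^sub>M M)" if "j \<in> J" for j using that by (intro Zm) auto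
  have B: "moms M J (\<lambda>j w. LBINT s. fk \<alpha> (snd j) s * Z (fst j) s w) (\<lambda>j. \<kappa> * r (fst j))"
    by (rule moms_volterra_signed[OF A m k1 k2 \<kappa> ne])
  have B': "moms M J (\<lambda>j w. LBINT s. fk \<alpha> (snd j) s * \<bar>Z (fst j) s w\<bar>) (\<lambda>j. \<kappa> * r (fst j))"
    by (rule moms_volterra[OF A m k1 k2 \<kappa> ne])
  show "moms M J (\<lambda>j w. LBINT s. fk \<alpha> (snd j) s * Z (fst j) s w) (\<lambda>j. r (fst j))"
    by (rule moms_mono[OF B momsD(1)[OF B], where K=\<kappa>]) (auto intro: momsD(2)[OF Z])
  show "moms M J (\<lambda>j w. LBINT s. fk \<alpha> (snd j) s * \<bar>Z (fst j) s w\<bar>) (\<lambda>j. r (fst j))"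
    by (rule moms_mono[OF B' momsD(1)[OF B'], where K=\<kappa>]) (auto intro: momsD(2)[OF Z])
qed

definition ph :: "nat \<Rightarrow> real \<Rightarrow> 'a \<Rightarrow> real" where "ph N s w = Fb N s w * dl N s w"

lemma step_joint: "(\<lambda>p. Xh N (fl N (fst p)) (snd p)) \<in> borel_measurable (lborel \<Otimes>\<^sub>M M)"
  by (rule step_joint_measurable) (rule Xh_meas)

lemma ph_joint: "jointly_measurable M (ph N)"
proof -
  have [measurable]: "jointly_measurable M (Fb N)"
    unfolding Fb_def by (rule measurable_compose[OF step_joint b_measurable(2)])
  have [measurable]: "(\<lambda>p. Gt (tg N (fl N (fst p))) (snd p)) \<in> borel_measurable (lborel \<Otimes>\<^sub>M M)"
    by (rule step_joint_measurable[of "\<lambda>k. Gt (tg N k)"]) (rule Gt_meas)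
  note [measurable] = Gt_joint
  show ?thesis unfolding ph_def dl_def by measurable
qed

lemma ph_moms: "moms M J (\<lambda>j. ph (fst j) (snd j)) (\<lambda>j. sqrt (rt (fst j)))"
proof (rule moms_mono[where K=1])
  show "moms M J (\<lambda>j w. L * dl (fst j) (snd j) w) (\<lambda>j. sqrt (rt (fst j)))" by (intro moms_cmult dl_moms)
  show "ph (fst j) (snd j) \<in> borel_measurable M" for j unfolding ph_def[abs_def] by measurable
  have "\<bar>ph N s w\<bar> \<le> \<bar>L * dl N s w\<bar>" for N s w
    using L[of "Xh N (fl N s) w"] by (auto simp: ph_def Fb_def abs_mult intro: mult_right_mono)
  then show "AE w in M. \<bar>ph (fst j) (snd j) w\<bar> \<le> \<bar>L * dl (fst j) (snd j) w\<bar>" for j by simp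
qed (auto intro: rate_step)

definition Lam :: "nat \<Rightarrow> real \<Rightarrow> 'a \<Rightarrow> real" where "Lam N t w = (LBINT s. fk \<alpha> t s * ph N s w)"

text \<open>The decorrelation estimate at work: moment bounds alone would give \<open>Lam\<close>
  the size of one increment, the square root of the rate, whereas its second moment, a double
  integral of covariances, is of the order of the squared rate.\<close>

lemma Lam_bound: "\<exists>C\<ge>0. \<forall>N t. 2 \<le> N \<and> t \<in> {0..T} \<longrightarrow> ibound M (\<lambda>w. (Lam N t w)\<^sup>2) (C * (rt N)\<^sup>2)"
proof -
  obtain C where C: "0 \<le> C" "\<And>N s s'. 2 \<le> N \<Longrightarrow> s \<in> {0..T} \<Longrightarrow> s' \<in> {0..T} \<Longrightarrow> s \<noteq> s' \<Longrightarrow>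
     \<bar>expectation (\<lambda>w. (Fb N s w * dl N s w) * (Fb N s' w * dl N s' w))\<bar> \<le> C * (rt N)\<^sup>2 * (1 + \<bar>s - s'\<bar> powr (-(2-2*H)))" using cov_bound by blast
  obtain E where E: "0 < E" "\<And>t. t \<in> {0..T} \<Longrightarrow> en (fk \<alpha> t) (fk \<alpha> t) \<le> ennreal E" using en_fk_fk by blast
  obtain A where A: "\<And>j. j \<in> J \<Longrightarrow> ibound M (\<lambda>w. (ph (fst j) (snd j) w)\<^sup>2) (A * (sqrt (rt (fst j)))\<^sup>2)"
    using moms_sq[OF ph_moms] by blast
  have Lm: "moms M J (\<lambda>j. Lam (fst j) (snd j)) (\<lambda>j. sqrt (rt (fst j)))"
    unfolding Lam_def[abs_def] by (rule volterra_moms(1)[OF ph_moms ph_joint])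
  \<comment> \<open>This crude bound of the wrong order serves only to make the square
    integrable.\<close>
  obtain A' where A': "\<And>j. j \<in> J \<Longrightarrow> ibound M (\<lambda>w. (Lam (fst j) (snd j) w)\<^sup>2) (A' * (sqrt (rt (fst j)))\<^sup>2)"
    using moms_sq[OF Lm] by blast
  have "ibound M (\<lambda>w. (Lam N t w)\<^sup>2) ((C * (\<kappa>\<^sup>2 + E)) * (rt N)\<^sup>2)" if h: "2 \<le> N" "t \<in> {0..T}" for N t
  proof (rule integral_ibound)
    show i: "integrable M (\<lambda>w. (Lam N t w)\<^sup>2)" using ibound_integrable(1)[OF A'[of "(N, t)"]] h by simp
    have "expectation (\<lambda>w. (LBINT s. fk \<alpha> t s * ph N s w)\<^sup>2) \<le> (C * (rt N)\<^sup>2) * (\<kappa>\<^sup>2 + E)"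
    proof (rule volterra_second_moment[where S="{0..T}" and \<kappa>=\<kappa> and B="A * (sqrt (rt N))\<^sup>2", OF ibound_fk'[OF h(2)] fk_eq_0[OF h(2)] ph_joint])
      show "ibound M (\<lambda>w. (ph N s w)\<^sup>2) (A * (sqrt (rt N))\<^sup>2)" if "s \<in> {0..T}" for s using A[of "(N, s)"] h that by simp
      show "integrable M (\<lambda>w. (LBINT s. fk \<alpha> t s * ph N s w)\<^sup>2)" using i unfolding Lam_def .
      show "\<bar>expectation (\<lambda>w. ph N s w * ph N s' w)\<bar> \<le> C * (rt N)\<^sup>2 * (1 + \<bar>s - s'\<bar> powr (-(2-2*H)))"
        if "s \<in> {0..T}" "s' \<in> {0..T}" "s \<noteq> s'" for s s' unfolding ph_def by (rule C(2)[OF h(1) that])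
    qed (use C(1) E h in auto)
    then show "expectation (\<lambda>w. (Lam N t w)\<^sup>2) \<le> (C * (\<kappa>\<^sup>2 + E)) * (rt N)\<^sup>2" unfolding Lam_def by (simp only: mult_ac)
  qed simp
  then show ?thesis using C(1) E(1) by (intro exI[of _ "C * (\<kappa>\<^sup>2 + E)"]) auto
qed

section \<open>Pathwise integrability of the terms of the error equation\<close>

lemma volterra_path:
  assumes f: "f \<in> borel_measurable borel" "\<And>s. s \<in> {0..T} \<Longrightarrow> \<bar>f s\<bar> \<le> C" and t: "t \<in> {0..T}"
  shows "integrable lborel (\<lambda>s. fk \<alpha> t s * f s)" "\<bar>LBINT s. fk \<alpha> t s * f s\<bar> \<le> \<kappa> * C"
proof -
  define z where "z s = (if s \<in> {0..T} then f s else 0)" for s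
  have z: "fk \<alpha> t s * f s = fk \<alpha> t s * z s" for s using fk_eq_0[OF t] by (auto simp: z_def)
  have zm: "z \<in> borel_measurable borel" unfolding z_def using f(1) by measurable
  have "\<bar>f 0\<bar> \<le> C" using T by (intro f(2)) auto
  then have C: "0 \<le> C" by linarith
  then have zC: "\<bar>z s\<bar> \<le> C" for s using f(2) by (auto simp: z_def)
  note kb = ibound_fk'[OF t]
  show "integrable lborel (\<lambda>s. fk \<alpha> t s * f s)" unfolding z by (rule integrable_kernel_bounded[OF kb zm zC])
  have "\<bar>LBINT s. fk \<alpha> t s * z s\<bar> \<le> (LBINT s. fk \<alpha> t s * C)"
    using ibound_integrable(1)[OF kb] by (intro kernel_integral_abs_le zC) auto
  also have "\<dots> \<le> \<kappa> * C" using ibound_integrable(2)[OF kb] C by (simp add: mult_right_mono)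
  finally show "\<bar>LBINT s. fk \<alpha> t s * f s\<bar> \<le> \<kappa> * C" unfolding z .
qed

text \<open>A class of paths, measurable and bounded on [0,T], stable under all the operations that
  occur, including Volterra integration; membership replaces separate integrability proofs for each
  term.\<close>

definition pb :: "(real \<Rightarrow> real) \<Rightarrow> bool" where
  "pb f \<longleftrightarrow> f \<in> borel_measurable borel \<and> (\<exists>C. \<forall>s\<in>{0..T}. \<bar>f s\<bar> \<le> C)"

lemma pb_integrable: "pb f \<Longrightarrow> t \<in> {0..T} \<Longrightarrow> integrable lborel (\<lambda>s. fk \<alpha> t s * f s)"
  using volterra_path(1) unfolding pb_def by blast

lemma pb_add: "pb f \<Longrightarrow> pb g \<Longrightarrow> pb (\<lambda>s. f s + g s)"
proof -
  assume f: "pb f" and g: "pb g"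
  obtain C where C: "\<And>s. s \<in> {0..T} \<Longrightarrow> \<bar>f s\<bar> \<le> C" using f unfolding pb_def by blast
  obtain D where D: "\<And>s. s \<in> {0..T} \<Longrightarrow> \<bar>g s\<bar> \<le> D" using g unfolding pb_def by blast
  have "\<bar>f s + g s\<bar> \<le> C + D" if "s \<in> {0..T}" for s using C[OF that] D[OF that] by linarith
  then show ?thesis using f g unfolding pb_def by (intro conjI exI[of _ "C + D"]) auto
qed

lemma pb_mult: "pb f \<Longrightarrow> pb g \<Longrightarrow> pb (\<lambda>s. f s * g s)"
proof -
  assume f: "pb f" and g: "pb g"
  obtain C where C: "\<And>s. s \<in> {0..T} \<Longrightarrow> \<bar>f s\<bar> \<le> C" using f unfolding pb_def by blast
  obtain D where D: "\<And>s. s \<in> {0..T} \<Longrightarrow> \<bar>g s\<bar> \<le> D" using g unfolding pb_def by blast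
  have "\<bar>f s * g s\<bar> \<le> \<bar>C\<bar> * \<bar>D\<bar>" if "s \<in> {0..T}" for s
    unfolding abs_mult using C[OF that] D[OF that] by (intro mult_mono) auto
  then show ?thesis using f g unfolding pb_def by (intro conjI exI[of _ "\<bar>C\<bar> * \<bar>D\<bar>"]) auto
qed

lemma pb_const: "pb (\<lambda>s. c)" unfolding pb_def by auto

lemma pb_diff: "pb f \<Longrightarrow> pb g \<Longrightarrow> pb (\<lambda>s. f s - g s)"
  using pb_add[of f "\<lambda>s. (-1) * g s"] pb_mult[OF pb_const[of "-1"], of g] by simp

lemma pb_abs: "pb f \<Longrightarrow> pb (\<lambda>s. \<bar>f s\<bar>)"
  unfolding pb_def by auto

lemma pb_b: "pb f \<Longrightarrow> pb (\<lambda>s. b (f s))"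
proof -
  assume f: "pb f"
  obtain C where C: "\<And>s. s \<in> {0..T} \<Longrightarrow> \<bar>f s\<bar> \<le> C" using f unfolding pb_def by blast
  have "\<bar>b (f s)\<bar> \<le> \<bar>b 0\<bar> + L * C" if "s \<in> {0..T}" for s
    using b_growth[of "f s"] mult_left_mono[OF C[OF that] L0] by linarith
  moreover have "(\<lambda>s. b (f s)) \<in> borel_measurable borel" using f by (intro measurable_compose[OF _ b_measurable(1)]) (simp add: pb_def)
  ultimately show ?thesis unfolding pb_def by blast
qed

lemma pb_step:
  fixes y :: "nat \<Rightarrow> real"
  assumes N: "2 \<le> N"
  shows "pb (\<lambda>s. y (fl N s))"
proof -
  have "y \<in> measurable (count_space UNIV) borel" by simp
  then have "(\<lambda>s. y (fl N s)) \<in> borel_measurable borel" by (rule measurable_compose[OF fl_measurable])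
  moreover have "\<bar>y (fl N s)\<bar> \<le> (\<Sum>k\<le>N. \<bar>y k\<bar>)" if "s \<in> {0..T}" for s
    using fl_props(1)[OF that N] by (auto intro!: member_le_sum[where f="\<lambda>k. \<bar>y k\<bar>"])
  ultimately show ?thesis unfolding pb_def by blast
qed

lemma pb_volterra: "pb f \<Longrightarrow> pb (\<lambda>t. LBINT s. fk \<alpha> t s * f s)"
proof -
  assume f: "pb f"
  then have fm [measurable]: "f \<in> borel_measurable borel" by (simp add: pb_def)
  obtain C where "\<And>s. s \<in> {0..T} \<Longrightarrow> \<bar>f s\<bar> \<le> C" using f unfolding pb_def by blast
  then have "\<bar>LBINT s. fk \<alpha> t s * f s\<bar> \<le> \<kappa> * C" if "t \<in> {0..T}" for t using volterra_path(2)[OF fm] that by blast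
  moreover have "(\<lambda>t. LBINT s. fk \<alpha> t s * f s) \<in> borel_measurable borel"
  proof -
    note [measurable] = fk_measurable_pair[of \<alpha>]
    have sw: "(\<lambda>z. (fst z, snd z)) \<in> measurable (borel \<Otimes>\<^sub>M lborel) (borel \<Otimes>\<^sub>M borel :: (real \<times> real) measure)" by measurable
    have [measurable]: "(\<lambda>z. fk \<alpha> (fst z) (snd z)) \<in> borel_measurable (borel \<Otimes>\<^sub>M lborel)"
      using measurable_compose[OF sw fk_measurable_pair] by simp
    have "(\<lambda>(t, s). fk \<alpha> t s * f s) \<in> borel_measurable (borel \<Otimes>\<^sub>M lborel)" unfolding case_prod_beta' by measurable
    then show ?thesis by (rule lborel.borel_measurable_lebesgue_integral)
  qed
  ultimately show ?thesis unfolding pb_def by blast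
qed

lemma pb_xe: "w \<in> space M \<Longrightarrow> pb (\<lambda>s. xe s w)"
  unfolding pb_def using xe_bounded[of w] by (auto intro: borel_measurable_continuous_onI xe_cont)

lemma pb_Gt: "w \<in> space M \<Longrightarrow> pb (\<lambda>s. Gt s w)"
  unfolding pb_def using Gt_path by blast

text \<open>Interpolation of the scheme by the equation with frozen drift. It agrees with the scheme
  on the grid but carries the noise at the current time, so it can be subtracted from the solution
  at every t.\<close>

definition Xt :: "nat \<Rightarrow> real \<Rightarrow> 'a \<Rightarrow> real" where
  "Xt N t w = x0 + Gt t w + g0 * (LBINT s. fk \<alpha> t s * b (Xh N (fl N s) w))"

lemma Xt_tg: "2 \<le> N \<Longrightarrow> n \<le> N \<Longrightarrow> Xt N (tg N n) w = Xh N n w"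
  unfolding Xt_def Xh_def by (subst (2) eul_eq) auto

lemma bX_joint: "(\<lambda>p. b (Xh N (fl N (fst p)) (snd p))) \<in> borel_measurable (lborel \<Otimes>\<^sub>M M)"
  by (rule measurable_compose[OF step_joint b_measurable(1)])

lemma Xt_joint: "jointly_measurable M (Xt N)"
proof -
  note [measurable] = Gt_joint volterra_joint_measurable[where \<alpha>=\<alpha> and Y="\<lambda>s w. b (Xh N (fl N s) w)", OF bX_joint]
  show ?thesis unfolding Xt_def by measurable
qed

lemma Xt_meas [measurable]: "Xt N t \<in> borel_measurable M"
  using measurable_compose[OF measurable_Pair1'[of t lborel M] Xt_joint] by simp

lemma pb_bX: "2 \<le> N \<Longrightarrow> pb (\<lambda>s. b (Xh N (fl N s) w))"
  by (rule pb_step[of N "\<lambda>k. b (Xh N k w)"])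

lemma pb_Xt: "2 \<le> N \<Longrightarrow> w \<in> space M \<Longrightarrow> pb (\<lambda>s. Xt N s w)"
  unfolding Xt_def by (intro pb_add pb_mult pb_const pb_Gt pb_volterra pb_bX)

lemma pb_ph: "2 \<le> N \<Longrightarrow> w \<in> space M \<Longrightarrow> pb (\<lambda>s. ph N s w)"
  unfolding ph_def dl_def Fb_def
  by (intro pb_mult pb_diff pb_Gt pb_step[of N "\<lambda>k. b1 (Xh N k w)"] pb_step[of N "\<lambda>k. Gt (tg N k) w"])

lemma Xt_moms: "moms M J (\<lambda>j. Xt (fst j) (snd j)) (\<lambda>_. 1)"
proof -
  have G: "moms M J (\<lambda>j. Gt (snd j)) (\<lambda>_. 1)" by (rule moms_reindex[OF Gt_moms]) auto
  have V: "moms M J (\<lambda>j w. LBINT s. fk \<alpha> (snd j) s * b (Xh (fst j) (fl (fst j) s) w)) (\<lambda>_. 1)"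
    by (rule volterra_moms(1)[where Z="\<lambda>N s w. b (Xh N (fl N s) w)" and r="\<lambda>_. 1", OF bX_moms bX_joint])
  show ?thesis unfolding Xt_def[abs_def] by (intro moms_add moms_const moms_cmult G V)
qed

text \<open>The drift part of the increment of \<open>Xt\<close> since the last grid point. By
  \<open>ze_le\<close> it is the integral of a kernel increment, of mass of order
  \<open>h powr \<alpha>\<close>, against values of b along the scheme.\<close>

definition ze :: "nat \<Rightarrow> real \<Rightarrow> 'a \<Rightarrow> real" where
  "ze N s w = Xt N s w - Xh N (fl N s) w - dl N s w"

lemma ze_meas: "ze N s \<in> borel_measurable M"
  unfolding ze_def[abs_def] by measurable

lemma ze_le:
  assumes N: "2 \<le> N" and s: "s \<in> {0..T}"
  shows "\<bar>ze N s w\<bar> \<le> \<bar>g0 * (LBINT a. fd \<alpha> (tg N (fl N s)) s a * \<bar>b (Xh N (fl N a) w)\<bar>)\<bar>"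
proof -
  note f = fl_props[OF s N]
  let ?r = "tg N (fl N s)" and ?B = "\<lambda>a. b (Xh N (fl N a) w)"
  have i: "integrable lborel (\<lambda>a. fk \<alpha> s a * ?B a)" "integrable lborel (\<lambda>a. fk \<alpha> ?r a * ?B a)"
    using s f by (intro pb_integrable pb_bX N; simp)+
  have "ze N s w = g0 * ((LBINT a. fk \<alpha> s a * ?B a) - (LBINT a. fk \<alpha> ?r a * ?B a))"
    unfolding ze_def dl_def Xt_tg[OF N f(1), symmetric] Xt_def by (simp add: algebra_simps)
  also have "\<dots> = g0 * (LBINT a. (fk \<alpha> s a - fk \<alpha> ?r a) * ?B a)" using i by (simp add: left_diff_distrib)
  finally have 1: "ze N s w = g0 * (LBINT a. (fk \<alpha> s a - fk \<alpha> ?r a) * ?B a)" .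
  have "\<bar>LBINT a. (fk \<alpha> s a - fk \<alpha> ?r a) * ?B a\<bar> \<le> (LBINT a. \<bar>(fk \<alpha> s a - fk \<alpha> ?r a) * ?B a\<bar>)" by (rule integral_abs_bound)
  also have "\<dots> = (LBINT a. fd \<alpha> ?r s a * \<bar>?B a\<bar>)" unfolding fd_def abs_mult ..
  finally have 2: "\<bar>LBINT a. (fk \<alpha> s a - fk \<alpha> ?r a) * ?B a\<bar> \<le> \<bar>LBINT a. fd \<alpha> ?r s a * \<bar>?B a\<bar>\<bar>" by linarith
  show ?thesis unfolding 1 abs_mult[of g0] by (intro mult_left_mono 2) simp
qed

lemma ze_moms: "moms M J (\<lambda>j. ze (fst j) (snd j)) (\<lambda>j. (T / real (fst j)) powr \<alpha>)"
proof -
  define \<kappa>' where "\<kappa>' j = 2 * (T / real (fst j)) powr \<alpha> / \<alpha>" for j :: "nat \<times> real"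
  have \<kappa>': "0 < \<kappa>' j" if "j \<in> J" for j
  proof -
    have "2 \<le> fst j" using that by auto
    then have "0 < T / real (fst j)" using step_h by blast
    then have "0 < (T / real (fst j)) powr \<alpha>" by (metis powr_gt_zero less_irrefl)
    then show ?thesis unfolding \<kappa>'_def using \<alpha>0 by (intro divide_pos_pos mult_pos_pos) auto
  qed
  have V: "moms M J (\<lambda>j w. LBINT a. fd \<alpha> (tg (fst j) (fl (fst j) (snd j))) (snd j) a * \<bar>b (Xh (fst j) (fl (fst j) a) w)\<bar>) (\<lambda>j. \<kappa>' j * 1)"
  proof (rule moms_volterra[where Y="\<lambda>j a w. b (Xh (fst j) (fl (fst j) a) w)" and S="{0..T}"])
    show "moms M (J \<times> {0..T}) (\<lambda>(j, a) w. b (Xh (fst j) (fl (fst j) a) w)) (\<lambda>(j, a). 1)"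
      using moms_reindex[OF bX_moms, of "J \<times> {0..T}" "\<lambda>(j, s). (fst j, s)"] by (auto simp: case_prod_beta')
    show "{0..T} \<noteq> {}" using T by auto
    fix j assume j: "j \<in> J"
    then have N: "2 \<le> fst j" "snd j \<in> {0..T}" by auto
    note f = fl_props[OF N(2,1)]
    show "ibound lborel (fd \<alpha> (tg (fst j) (fl (fst j) (snd j))) (snd j)) (\<kappa>' j)"
      unfolding \<kappa>'_def by (intro ibound_fd_h \<alpha>0 \<alpha> f)
    show "fd \<alpha> (tg (fst j) (fl (fst j) (snd j))) (snd j) a = 0" if "a \<notin> {0..T}" for a
      using that N(2) by (intro fd_eq_0 f) auto
  qed (use \<kappa>' bX_joint in auto)
  show ?thesis
  proof (rule moms_mono[OF moms_cmult[OF V, of g0], where K="2/\<alpha>"])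
    fix j assume j: "j \<in> J"
    then have N: "2 \<le> fst j" "snd j \<in> {0..T}" by auto
    show "AE w in M. \<bar>ze (fst j) (snd j) w\<bar> \<le> \<bar>g0 * (LBINT a. fd \<alpha> (tg (fst j) (fl (fst j) (snd j))) (snd j) a * \<bar>b (Xh (fst j) (fl (fst j) a) w)\<bar>)\<bar>"
      using ze_le[OF N] by simp
    show "0 < (T / real (fst j)) powr \<alpha>" using step_h[OF N(1)] by (metis powr_gt_zero less_irrefl)
    show "\<kappa>' j * 1 \<le> 2 / \<alpha> * (T / real (fst j)) powr \<alpha>" by (simp add: \<kappa>'_def)
  qed (rule ze_meas)
qed

text \<open>Two scales for the same quantity: at the rate it enters the Taylor expansion linearly,
  at its square root it joins the noise increment inside the quadratic term.\<close>

lemma ze_moms':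
  "moms M J (\<lambda>j. ze (fst j) (snd j)) (\<lambda>j. rt (fst j))"
  "moms M J (\<lambda>j. ze (fst j) (snd j)) (\<lambda>j. sqrt (rt (fst j)))"
proof -
  obtain C where C: "0 < C" "\<And>h. 0 < h \<Longrightarrow> h \<le> T/2 \<Longrightarrow> h powr \<alpha> \<le> C * \<rho> h" using rate_ge by blast
  show "moms M J (\<lambda>j. ze (fst j) (snd j)) (\<lambda>j. rt (fst j))"
  proof (rule moms_mono[OF ze_moms, where K=C])
    fix j assume "j \<in> J"
    then have N: "2 \<le> fst j" by auto
    show "(T / real (fst j)) powr \<alpha> \<le> C * rt (fst j)" using C(2) step_h[OF N] by blast
    show "0 < rt (fst j)" by (rule rate_step[OF N])
  qed (auto simp: ze_meas)
  show "moms M J (\<lambda>j. ze (fst j) (snd j)) (\<lambda>j. sqrt (rt (fst j)))"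
  proof (rule moms_mono[OF ze_moms, where K="sqrt (T powr \<alpha>) * sqrt C"])
    fix j assume "j \<in> J"
    then have N: "2 \<le> fst j" by auto
    let ?h = "T / real (fst j)"
    have h: "0 < ?h" "?h \<le> T/2" using step_h[OF N] by auto
    have hT: "?h \<le> T" using h(2) T by linarith
    have "?h powr \<alpha> = sqrt (?h powr \<alpha>) * sqrt (?h powr \<alpha>)" by simp
    also have "\<dots> \<le> sqrt (T powr \<alpha>) * sqrt (C * \<rho> ?h)"
      using h(1) hT C(2)[OF h] T \<alpha>0 by (intro mult_mono real_sqrt_le_mono powr_mono2) auto
    finally show "?h powr \<alpha> \<le> sqrt (T powr \<alpha>) * sqrt C * sqrt (\<rho> ?h)" by (simp only: real_sqrt_mult mult.assoc)
    show "0 < sqrt (\<rho> ?h)" using rate_step[OF N] by simp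
  qed (auto simp: ze_meas)
qed

definition Re :: "nat \<Rightarrow> real \<Rightarrow> 'a \<Rightarrow> real" where
  "Re N s w = b (Xt N s w) - b (Xh N (fl N s) w) - ph N s w"

lemma Re_joint: "jointly_measurable M (Re N)"
proof -
  note [measurable] = measurable_compose[OF Xt_joint[of N] b_measurable(1)] bX_joint[of N] ph_joint[of N]
  show ?thesis unfolding Re_def by measurable
qed

lemma Re_meas: "Re N t \<in> borel_measurable M"
  using measurable_compose[OF measurable_Pair1'[of t lborel M] Re_joint] by simp

lemma pb_Re: "2 \<le> N \<Longrightarrow> w \<in> space M \<Longrightarrow> pb (\<lambda>s. Re N s w)"
  unfolding Re_def by (intro pb_diff pb_b pb_Xt pb_ph pb_bX)

text \<open>Expansion at v in which only d, later the noise increment, is kept in the linear term;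
  the rest of u - v is charged to the Lipschitz bound. The repeated \<open>\<bar>v\<bar>\<close>
  brings the weight into the shape of \<open>moms_poly\<close>.\<close>

lemma taylor_bound:
  "\<bar>b u - b v - b1 v * d\<bar> \<le> L * \<bar>u - v - d\<bar> + K * (1 + (\<bar>u\<bar> + \<bar>v\<bar> + \<bar>v\<bar> + 3 * \<bar>v\<bar>) ^ m) * ((u - v) * (u - v))"
proof -
  obtain z where z: "min v u \<le> z" "z \<le> max v u" "b u - b v = (u - v) * b1 z" using real_mvt[of b b1 v u] db by blast
  have zb: "\<bar>z\<bar> \<le> \<bar>u\<bar> + \<bar>v\<bar>" "\<bar>z - v\<bar> \<le> \<bar>u - v\<bar>" using z(1,2) by (auto simp: min_def max_def split: if_splits)
  let ?S = "K * (1 + (\<bar>u\<bar> + \<bar>v\<bar> + \<bar>v\<bar> + 3 * \<bar>v\<bar>) ^ m)"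
  have "\<bar>b1 z - b1 v\<bar> \<le> K * (1 + (\<bar>z\<bar> + \<bar>v\<bar>) ^ m) * \<bar>z - v\<bar>" by (rule b1_diff)
  also have "\<dots> \<le> ?S * \<bar>u - v\<bar>"
    using zb K by (intro mult_mono mult_left_mono add_left_mono power_mono) auto
  finally have "\<bar>b1 z - b1 v\<bar> * \<bar>u - v\<bar> \<le> ?S * \<bar>u - v\<bar> * \<bar>u - v\<bar>" by (intro mult_right_mono) auto
  then have 1: "\<bar>(b1 z - b1 v) * (u - v)\<bar> \<le> ?S * ((u - v) * (u - v))" by (simp only: abs_mult mult.assoc abs_mult_self_eq)
  have 2: "\<bar>b1 v * (u - v - d)\<bar> \<le> L * \<bar>u - v - d\<bar>" unfolding abs_mult by (intro mult_right_mono L) simp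
  have "b u - b v - b1 v * d = b1 v * (u - v - d) + (b1 z - b1 v) * (u - v)" unfolding z(3) by (simp add: algebra_simps)
  then show ?thesis using 1 2 by linarith
qed

text \<open>The full increment of \<open>Xt\<close> has the size of the square root of the rate, so
  its square is of the order of the rate; the drift part is so by itself.\<close>

lemma Re_moms: "moms M J (\<lambda>j. Re (fst j) (snd j)) (\<lambda>j. rt (fst j))"
proof -
  let ?X = "\<lambda>j w. Xt (fst j) (snd j) w" and ?Y = "\<lambda>j w. Xh (fst j) (fl (fst j) (snd j)) w"
  have D: "moms M J (\<lambda>j w. ?X j w - ?Y j w) (\<lambda>j. sqrt (rt (fst j)))"
    using moms_add[OF dl_moms ze_moms'(2)] by (simp add: ze_def)
  have "moms M J (\<lambda>j w. (?X j w - ?Y j w) * (?X j w - ?Y j w)) (\<lambda>j. sqrt (rt (fst j)) * sqrt (rt (fst j)))"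
    by (intro moms_mult D)
  then have DD: "moms M J (\<lambda>j w. (?X j w - ?Y j w) * (?X j w - ?Y j w)) (\<lambda>j. rt (fst j))"
    by (rule moms_mono[where K=1]) (auto simp: rate_step less_imp_le[OF rate_step])
  have P: "moms M J (\<lambda>j w. L * \<bar>ze (fst j) (snd j) w\<bar> + K * (1 + (\<bar>?X j w\<bar> + \<bar>?Y j w\<bar> + \<bar>?Y j w\<bar> + 3 * \<bar>?Y j w\<bar>) ^ m) * ((?X j w - ?Y j w) * (?X j w - ?Y j w)))
     (\<lambda>j. rt (fst j))"
    by (intro moms_add moms_cmult moms_abs ze_moms' moms_mult1[OF _ DD] moms_poly Xt_moms Xh_moms)
  show ?thesis
  proof (rule moms_mono[OF P, where K=1])
    fix j
    have "\<bar>Re (fst j) (snd j) w\<bar> \<le> L * \<bar>ze (fst j) (snd j) w\<bar> + K * (1 + (\<bar>?X j w\<bar> + \<bar>?Y j w\<bar> + \<bar>?Y j w\<bar> + 3 * \<bar>?Y j w\<bar>) ^ m) * ((?X j w - ?Y j w) * (?X j w - ?Y j w))" for w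
      unfolding Re_def ph_def Fb_def ze_def by (rule taylor_bound)
    then show "AE w in M. \<bar>Re (fst j) (snd j) w\<bar> \<le> \<bar>L * \<bar>ze (fst j) (snd j) w\<bar> + K * (1 + (\<bar>?X j w\<bar> + \<bar>?Y j w\<bar> + \<bar>?Y j w\<bar> + 3 * \<bar>?Y j w\<bar>) ^ m) * ((?X j w - ?Y j w) * (?X j w - ?Y j w))\<bar>"
      by (intro AE_I2 order_trans[OF _ abs_ge_self])
  qed (use rate_step Re_meas in auto)
qed

section \<open>The error equation and its Gronwall estimate\<close>

definition er :: "nat \<Rightarrow> real \<Rightarrow> 'a \<Rightarrow> real" where "er N t w = xe t w - Xt N t w"

lemma er_joint: "jointly_measurable M (er N)"
proof -
  note [measurable] = xe_joint Xt_joint[of N]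
  show ?thesis unfolding er_def by measurable
qed

lemma pb_bx: "w \<in> space M \<Longrightarrow> pb (\<lambda>s. bx s w)"
  unfolding bx_def by (intro pb_b pb_xe)

text \<open>\<open>Gt\<close> is defined from the solution and also drives \<open>Xt\<close>, so the
  noise cancels on every path, without exceptional sets.\<close>

lemma er_eq:
  assumes "2 \<le> N" "t \<in> {0..T}" "w \<in> space M"
  shows "er N t w = g0 * (LBINT s. fk \<alpha> t s * (bx s w - b (Xh N (fl N s) w)))"
  using pb_integrable[OF pb_bx[OF assms(3)] assms(2)] pb_integrable[OF pb_bX[OF assms(1)] assms(2), of w]
  by (simp add: er_def Xt_def Gt_def right_diff_distrib algebra_simps)

text \<open>The drift difference splits at \<open>b (Xt N s w)\<close>: the first part is Lipschitz
  in the error and feeds Gronwall, the second is the linear noise term, integrated to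
  \<open>Lam\<close>, plus the Taylor remainder. \<open>Lam\<close> must be kept as a signed
  integral, since its smallness lies in cancellation.\<close>

lemma er_le:
  assumes N: "2 \<le> N" and t: "t \<in> {0..T}" and w: "w \<in> space M"
  shows "\<bar>er N t w\<bar> \<le> g0 * L * (LBINT s. fk \<alpha> t s * \<bar>er N s w\<bar>) + \<bar>g0 * (\<bar>Lam N t w\<bar> + (LBINT s. fk \<alpha> t s * \<bar>Re N s w\<bar>))\<bar>"
proof -
  let ?k = "fk \<alpha> t"
  note i = pb_integrable[OF _ t]
  have pe: "pb (\<lambda>s. er N s w)" unfolding er_def by (intro pb_diff pb_xe pb_Xt N w)
  define A where "A s = bx s w - b (Xt N s w)" for s
  have pA: "pb A" unfolding A_def by (intro pb_diff pb_bx pb_b pb_Xt N w)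
  have "(LBINT s. ?k s * (bx s w - b (Xh N (fl N s) w))) = (LBINT s. ?k s * A s + (?k s * ph N s w + ?k s * Re N s w))"
    by (intro Bochner_Integration.integral_cong) (auto simp: A_def Re_def algebra_simps)
  also have "\<dots> = (LBINT s. ?k s * A s) + (Lam N t w + (LBINT s. ?k s * Re N s w))"
    unfolding Lam_def using i[OF pA] i[OF pb_ph[OF N w]] i[OF pb_Re[OF N w]] by simp
  finally have eq: "er N t w = g0 * ((LBINT s. ?k s * A s) + (Lam N t w + (LBINT s. ?k s * Re N s w)))"
    using er_eq[OF N t w] by simp
  have "\<bar>LBINT s. ?k s * A s\<bar> \<le> (LBINT s. ?k s * (L * \<bar>er N s w\<bar>))"
  proof (rule kernel_integral_abs_le)
    show "\<bar>A s\<bar> \<le> L * \<bar>er N s w\<bar>" for s unfolding A_def bx_def er_def by (rule b_lip)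
    show "integrable lborel (\<lambda>s. ?k s * (L * \<bar>er N s w\<bar>))" by (intro i pb_mult pb_const pb_abs pe)
  qed simp
  also have "\<dots> = (LBINT s. L * (?k s * \<bar>er N s w\<bar>))" by (simp only: mult.left_commute)
  also have "\<dots> = L * (LBINT s. ?k s * \<bar>er N s w\<bar>)" by simp
  finally have 1: "\<bar>LBINT s. ?k s * A s\<bar> \<le> L * (LBINT s. ?k s * \<bar>er N s w\<bar>)" .
  have 2: "\<bar>LBINT s. ?k s * Re N s w\<bar> \<le> (LBINT s. ?k s * \<bar>Re N s w\<bar>)"
    by (intro kernel_integral_abs_le i pb_abs pb_Re N w) auto
  have "\<bar>er N t w\<bar> = g0 * \<bar>(LBINT s. ?k s * A s) + (Lam N t w + (LBINT s. ?k s * Re N s w))\<bar>"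
    unfolding eq using g0 by (simp add: abs_mult)
  also have "\<dots> \<le> g0 * (L * (LBINT s. ?k s * \<bar>er N s w\<bar>) + (\<bar>Lam N t w\<bar> + (LBINT s. ?k s * \<bar>Re N s w\<bar>)))"
    using 1 2 g0 by (intro mult_left_mono) linarith+
  also have "\<dots> = g0 * L * (LBINT s. ?k s * \<bar>er N s w\<bar>) + g0 * (\<bar>Lam N t w\<bar> + (LBINT s. ?k s * \<bar>Re N s w\<bar>))"
    by (simp only: distrib_left mult.assoc)
  finally show ?thesis by linarith
qed

text \<open>The running supremum of the solution, over rational times only so that it is measurable;
  by continuity it dominates all times.\<close>

definition Q :: "'a \<Rightarrow> real" where "Q w = (SUP t\<in>\<rat>. \<bar>xe t w\<bar>)"

lemma xe_sup:
  shows "Q \<in> borel_measurable M" "w \<in> space M \<Longrightarrow> \<bar>xe t w\<bar> \<le> Q w"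
proof -
  have bdd: "bdd_above ((\<lambda>t. \<bar>xe t w\<bar>) ` \<rat>)" if "w \<in> space M" for w
    using xe_bounded[OF that] by (auto intro: bdd_aboveI2)
  show "Q \<in> borel_measurable M" unfolding Q_def[abs_def]
    by (rule borel_measurable_cSUP) (use bdd countable_rat in auto)
  show "\<bar>xe t w\<bar> \<le> Q w" if w: "w \<in> space M"
  proof -
    have "norm (xe t w) \<le> Q w"
    proof (rule continuous_on_closure_norm_le[where s="\<rat> :: real set" and f="\<lambda>t. xe t w"])
      show "continuous_on (closure \<rat>) (\<lambda>t. xe t w)" using xe_cont[OF w] by (rule continuous_on_subset) simp
      show "\<forall>t\<in>\<rat>. norm (xe t w) \<le> Q w" unfolding Q_def using bdd[OF w] by (auto intro!: cSUP_upper)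
      show "t \<in> closure \<rat>" by (simp add: Rats_closure_real)
    qed
    then show ?thesis by simp
  qed
qed

text \<open>Supplies the measurable pathwise bound for the cutoffs of
  \<open>moment_gronwall\<close>, since no moments of the solution are available.\<close>

lemma er_bounded:
  assumes N: "2 \<le> N" and t: "t \<in> {0..T}" and w: "w \<in> space M"
  shows "\<bar>er N t w\<bar> \<le> g0 * (\<kappa> * (2 * \<bar>b 0\<bar> + L * (Q w + (\<Sum>k\<le>N. \<bar>Xh N k w\<bar>))))"
proof -
  have "\<bar>LBINT s. fk \<alpha> t s * (bx s w - b (Xh N (fl N s) w))\<bar> \<le> \<kappa> * (2 * \<bar>b 0\<bar> + L * (Q w + (\<Sum>k\<le>N. \<bar>Xh N k w\<bar>)))"
  proof (rule volterra_path(2)[OF _ _ t])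
    show "(\<lambda>s. bx s w - b (Xh N (fl N s) w)) \<in> borel_measurable borel"
      using pb_diff[OF pb_bx[OF w] pb_bX[OF N]] by (simp add: pb_def)
    fix s assume s: "s \<in> {0..T}"
    have "\<bar>Xh N (fl N s) w\<bar> \<le> (\<Sum>k\<le>N. \<bar>Xh N k w\<bar>)"
      using fl_props(1)[OF s N] by (auto intro!: member_le_sum[where f="\<lambda>k. \<bar>Xh N k w\<bar>"])
    then have "L * (\<bar>xe s w\<bar> + \<bar>Xh N (fl N s) w\<bar>) \<le> L * (Q w + (\<Sum>k\<le>N. \<bar>Xh N k w\<bar>))"
      using xe_sup(2)[OF w, of s] L0 by (intro mult_left_mono) linarith+
    then show "\<bar>bx s w - b (Xh N (fl N s) w)\<bar> \<le> 2 * \<bar>b 0\<bar> + L * (Q w + (\<Sum>k\<le>N. \<bar>Xh N k w\<bar>))"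
      using b_growth[of "xe s w"] b_growth[of "Xh N (fl N s) w"] unfolding bx_def distrib_left by linarith
  qed
  then show ?thesis unfolding er_eq[OF N t w] abs_mult[of g0] using g0 by (simp add: mult_left_mono)
qed

text \<open>\<open>Lam\<close> is known to be of the order of the rate in second moment only, its
  other moments being bounded just at the square root of the rate. So Gronwall is applied to the
  single exponent \<open>2^1\<close> rather than to the class \<open>moms\<close>.\<close>

lemma er_bound: "\<exists>C\<ge>0. \<forall>N t. 2 \<le> N \<and> t \<in> {0..T} \<longrightarrow> ibound M (\<lambda>w. (er N t w)\<^sup>2) (C * (rt N)\<^sup>2)"
proof -
  obtain C1 where C1: "0 \<le> C1" "\<And>N t. 2 \<le> N \<Longrightarrow> t \<in> {0..T} \<Longrightarrow> ibound M (\<lambda>w. (Lam N t w)\<^sup>2) (C1 * (rt N)\<^sup>2)" using Lam_bound by blast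
  have Vm: "moms M J (\<lambda>j w. LBINT s. fk \<alpha> (snd j) s * \<bar>Re (fst j) s w\<bar>) (\<lambda>j. rt (fst j))"
    by (rule volterra_moms(2)[OF Re_moms Re_joint])
  obtain C2 where C2: "0 \<le> C2" "\<And>j. j \<in> J \<Longrightarrow> ibound M (\<lambda>w. (LBINT s. fk \<alpha> (snd j) s * \<bar>Re (fst j) s w\<bar>)\<^sup>2) (C2 * (rt (fst j))\<^sup>2)"
    using moms_sq[OF Vm] by blast
  define V where "V N t w = (LBINT s. fk \<alpha> t s * \<bar>Re N s w\<bar>)" for N t w
  define Z where "Z N t w = g0 * (\<bar>Lam N t w\<bar> + V N t w)" for N t w
  have Lm: "Lam N t \<in> borel_measurable M" for N t
    unfolding Lam_def[abs_def] by (rule measurable_volterra[OF ph_joint]) simp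
  have Vmeas: "V N t \<in> borel_measurable M" if "2 \<le> N" "t \<in> {0..T}" for N t
    using momsD(1)[OF Vm, of "(N, t)"] that unfolding V_def by simp
  have "\<exists>C\<ge>0. \<forall>j\<in>{2..} \<times> {0..T}. ibound M (\<lambda>w. \<bar>(case j of (i, t) \<Rightarrow> er i t) w\<bar> ^ (2^1)) (C * (case j of (i, t) \<Rightarrow> rt i) ^ (2^1))"
  proof (rule moment_gronwall[where A="g0 * L" and Z=Z and \<tau>="\<lambda>i t. t" and C="2 * g0\<^sup>2 * (C1 + C2)"
        and B="\<lambda>N w. g0 * (\<kappa> * (2 * \<bar>b 0\<bar> + L * (Q w + (\<Sum>k\<le>N. \<bar>Xh N k w\<bar>))))", OF \<alpha>0 \<alpha>(2) T])
    show "0 \<le> g0 * L" using g0 L0 by simp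
    show "jointly_measurable M (er i)" for i by (rule er_joint)
    note [measurable] = xe_sup(1)
    show "(\<lambda>w. g0 * (\<kappa> * (2 * \<bar>b 0\<bar> + L * (Q w + (\<Sum>k\<le>i. \<bar>Xh i k w\<bar>))))) \<in> borel_measurable M" for i by measurable
    fix i t assume i: "i \<in> {2::nat..}" and t: "t \<in> {0..T}"
    then have N: "2 \<le> i" by simp
    note [measurable] = Lm Vmeas[OF N t]
    show "\<bar>er i t w\<bar> \<le> g0 * (\<kappa> * (2 * \<bar>b 0\<bar> + L * (Q w + (\<Sum>k\<le>i. \<bar>Xh i k w\<bar>))))" if "w \<in> space M" for w by (rule er_bounded[OF N t that])
    show "AE w in M. \<bar>er i t w\<bar> \<le> g0 * L * (LBINT s. fk \<alpha> t s * \<bar>er i s w\<bar>) + \<bar>Z i t w\<bar>"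
      unfolding Z_def V_def by (intro AE_I2 er_le N t)
    show "0 \<le> t \<and> t \<le> t" using t by simp
    show Zm: "Z i t \<in> borel_measurable M" unfolding Z_def[abs_def] by measurable
    show "ibound M (\<lambda>w. \<bar>Z i t w\<bar> ^ (2^1)) (2 * g0\<^sup>2 * (C1 + C2) * rt i ^ (2^1))"
    proof (rule ibound_mono)
      show "ibound M (\<lambda>w. (2 * g0\<^sup>2) * ((Lam i t w)\<^sup>2 + (V i t w)\<^sup>2)) ((2 * g0\<^sup>2) * (C1 * (rt i)\<^sup>2 + C2 * (rt i)\<^sup>2))"
        using C1(2)[OF N t] C2(2)[of "(i, t)"] N t by (intro ibound_cmult ibound_add) (auto simp: V_def)
      show "AE w in M. \<bar>Z i t w\<bar> ^ (2^1) \<le> (2 * g0\<^sup>2) * ((Lam i t w)\<^sup>2 + (V i t w)\<^sup>2)"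
      proof (intro AE_I2)
        fix w
        have "0 \<le> (\<bar>Lam i t w\<bar> - V i t w)\<^sup>2" by simp
        then have "(\<bar>Lam i t w\<bar> + V i t w)\<^sup>2 \<le> 2 * ((Lam i t w)\<^sup>2 + (V i t w)\<^sup>2)" by (simp add: power2_sum power2_diff)
        then have "g0\<^sup>2 * (\<bar>Lam i t w\<bar> + V i t w)\<^sup>2 \<le> g0\<^sup>2 * (2 * ((Lam i t w)\<^sup>2 + (V i t w)\<^sup>2))" by (rule mult_left_mono) simp
        then show "\<bar>Z i t w\<bar> ^ (2^1) \<le> (2 * g0\<^sup>2) * ((Lam i t w)\<^sup>2 + (V i t w)\<^sup>2)"
          unfolding Z_def power_mult_distrib abs_mult by (simp only: power_one_right power2_abs power_mult_distrib mult.left_commute mult.assoc)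
      qed
    qed (use Zm in \<open>auto simp: distrib_left distrib_right mult.assoc\<close>)
  next
    show "0 \<le> 2 * g0\<^sup>2 * (C1 + C2)" using C1 C2 by simp
    show "0 < rt i" if "i \<in> {2..}" for i using rate_step that by simp
  qed
  then show ?thesis by auto
qed

text \<open>The scheme starts at x0 by prescription, whereas \<open>eul\<close> adds the noise at
  index 0; the two agree because the energy of the zero kernel vanishes.\<close>

lemma G_0: "AE w in M. G 0 w = 0"
proof -
  have z: "0 \<in> {0..T}" using T by simp
  have "eR (fk \<alpha> 0) (fk \<alpha> 0) p = 0" for p by (simp add: eR_def fk_def)
  then have "expectation (\<lambda>w. (G 0 w)\<^sup>2) = 0" using expectation_G(2)[OF z z] by (simp add: power2_eq_square)
  then have "AE w in M. (G 0 w)\<^sup>2 = 0" using integral_nonneg_eq_0_iff_AE[OF V_sq[OF G_VV[OF z]]] by simp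
  then show ?thesis by eventually_elim simp
qed

text \<open>The recursion determines the scheme from the noise on the grid, so strong induction
  suffices. The identity is almost sure only because \<open>Gt\<close> may differ from
  \<open>G\<close> on a null set at each of the finitely many grid points.\<close>

lemma euler_unique:
  fixes X :: "nat \<Rightarrow> 'a \<Rightarrow> real"
  assumes N: "2 \<le> N" and X0: "\<And>w. X 0 w = x0"
    and Xn: "\<And>n w. n \<in> {1..N} \<Longrightarrow> X n w = x0 + 1 / Gamma \<alpha> *
          (\<Sum>j=1..n. b (X (j - 1) w) *
              integral {real (j - 1) * (T / real N) .. real j * (T / real N)}
                (\<lambda>s. (real n * (T / real N) - s) powr (\<alpha> - 1)))
          + G (real n * (T / real N)) w"
  shows "AE w in M. \<forall>n\<le>N. X n w = Xh N n w"
proof -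
  have "AE w in M. \<forall>k\<in>{..N}. Gt (tg N k) w = G (tg N k) w"
    by (intro AE_finite_allI Gt_AE) (use tg_mem N in auto)
  with G_0 show ?thesis
  proof eventually_elim
    fix w assume z: "G 0 w = 0" and g: "\<forall>k\<in>{..N}. Gt (tg N k) w = G (tg N k) w"
    have "X n w = eul N (\<lambda>k. G (tg N k) w) n" if "n \<le> N" for n
      using that
    proof (induction n rule: less_induct)
      case (less n)
      show ?case
      proof (cases "n = 0")
        case True
        then show ?thesis using z by (subst eul.simps) (simp add: X0 tg_def)
      next
        case False
        have "(\<Sum>j=1..n. b (X (j - 1) w) * integral {real (j - 1) * (T / real N) .. real j * (T / real N)} (\<lambda>s. (real n * (T / real N) - s) powr (\<alpha> - 1)))
          = (\<Sum>j<n. b (X j w) * integral {tg N j..tg N (Suc j)} (\<lambda>s. (tg N n - s) powr (\<alpha> - 1)))"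
          unfolding tg_def One_nat_def sum.atLeast1_atMost_eq by simp
        also have "\<dots> = (\<Sum>j<n. wt N n j * b (eul N (\<lambda>k. G (tg N k) w) j))"
        proof (rule sum.cong[OF refl])
          fix j assume "j \<in> {..<n}"
          then have j: "j < n" by simp
          then have "X j w = eul N (\<lambda>k. G (tg N k) w) j" using less by simp
          then show "b (X j w) * integral {tg N j..tg N (Suc j)} (\<lambda>s. (tg N n - s) powr (\<alpha> - 1)) = wt N n j * b (eul N (\<lambda>k. G (tg N k) w) j)"
            unfolding wt_henstock[OF N less.prems j] by simp
        qed
        finally show ?thesis using False less.prems Xn[of n w] by (subst eul.simps) (simp add: g0_def tg_def)
      qed
    qed
    moreover have "eul N (\<lambda>k. G (tg N k) w) n = Xh N n w" if "n \<le> N" for n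
      unfolding Xh_def using that g by (intro eul_cong) auto
    ultimately show "\<forall>n\<le>N. X n w = Xh N n w" by simp
  qed
qed

text \<open>On the grid the interpolation coincides with the scheme, so the bound for
  \<open>er\<close> is the claim. Adding 1 to the root of the constant makes it positive.\<close>

lemma euler_error:
  fixes X :: "nat \<Rightarrow> nat \<Rightarrow> 'a \<Rightarrow> real"
  assumes X: "\<And>N. 2 \<le> N \<Longrightarrow> AE w in M. \<forall>n\<le>N. X N n w = Xh N n w"
  shows "\<exists>C>0. \<forall>N\<ge>2. \<forall>n\<le>N. (\<integral>\<^sup>+w. ennreal ((X N n w - x (real n * (T / real N)) w)\<^sup>2) \<partial>M) \<le> ennreal ((C * rt N)\<^sup>2)"
proof -
  obtain C where C: "0 \<le> C" "\<And>N t. 2 \<le> N \<Longrightarrow> t \<in> {0..T} \<Longrightarrow> ibound M (\<lambda>w. (er N t w)\<^sup>2) (C * (rt N)\<^sup>2)" using er_bound by blast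
  have "(\<integral>\<^sup>+w. ennreal ((X N n w - x (real n * (T / real N)) w)\<^sup>2) \<partial>M) \<le> ennreal (((sqrt C + 1) * rt N)\<^sup>2)"
    if N: "2 \<le> N" and n: "n \<le> N" for N n
  proof -
    note t = tg_mem[OF n N]
    have "(\<integral>\<^sup>+w. ennreal ((X N n w - x (real n * (T / real N)) w)\<^sup>2) \<partial>M) = (\<integral>\<^sup>+w. ennreal ((er N (tg N n) w)\<^sup>2) \<partial>M)"
    proof (rule nn_integral_cong_AE, use X[OF N] in eventually_elim)
      fix w assume "\<forall>n\<le>N. X N n w = Xh N n w"
      then have "er N (tg N n) w = x (tg N n) w - X N n w"
        using n by (simp add: er_def Xt_tg[OF N n] xe_eq[OF t])
      then have "er N (tg N n) w = x (real n * (T / real N)) w - X N n w" by (simp only: tg_def)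
      then show "ennreal ((X N n w - x (real n * (T / real N)) w)\<^sup>2) = ennreal ((er N (tg N n) w)\<^sup>2)" by (simp only: power2_commute)
    qed
    also have "\<dots> \<le> ennreal (C * (rt N)\<^sup>2)" using C(2)[OF N t] by (simp add: ibound_def)
    also have "\<dots> \<le> ennreal (((sqrt C + 1) * rt N)\<^sup>2)"
    proof (rule ennreal_leI)
      have "C = (sqrt C)\<^sup>2" using C(1) by simp
      also have "\<dots> \<le> (sqrt C + 1)\<^sup>2" using C(1) by (intro power_mono) auto
      finally show "C * (rt N)\<^sup>2 \<le> ((sqrt C + 1) * rt N)\<^sup>2"
        unfolding power_mult_distrib by (rule mult_right_mono) simp
    qed
    finally show ?thesis .
  qed
  moreover have "0 < sqrt C + 1" using real_sqrt_ge_zero[OF C(1)] by linarith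
  ultimately show ?thesis by blast
qed

end

text \<open>The L2 norm enters through its square as a nonnegative integral, so that its finiteness
  is part of the claim.\<close>

theorem theorem2p1:
  fixes M :: "'a measure" and W :: "real \<Rightarrow> 'a \<Rightarrow> real"
    and H \<alpha> T \<sigma> x0 :: real and b :: "real \<Rightarrow> real"
    and G :: "real \<Rightarrow> 'a \<Rightarrow> real" and x :: "real \<Rightarrow> 'a \<Rightarrow> real"
    and X :: "nat \<Rightarrow> nat \<Rightarrow> 'a \<Rightarrow> real"
  assumes H: "1/2 < H" "H < 1"
    and \<alpha>: "1 - H < \<alpha>" "\<alpha> < 1"
    and T: "T > 0" and \<sigma>: "\<sigma> > 0"
    and b: "C13bp b"
    and W: "is_fbm M H W"
    and G: "\<forall>t\<in>{0..T}. is_wiener_integral M W (\<lambda>s. \<sigma> / Gamma \<alpha> * (t - s) powr (\<alpha> - 1)) 0 t (G t)"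
    and x_meas: "\<forall>t\<in>{0..T}. x t \<in> borel_measurable M"
    and x_cont: "\<forall>\<omega>\<in>space M. continuous_on {0..T} (\<lambda>t. x t \<omega>)"
    and x_sol: "\<forall>t\<in>{0..T}. AE \<omega> in M.
        x t \<omega> = x0 + 1 / Gamma \<alpha> * integral {0..t} (\<lambda>s. (t - s) powr (\<alpha> - 1) * b (x s \<omega>)) + G t \<omega>"
    and X0: "\<forall>N\<ge>2. \<forall>\<omega>. X N 0 \<omega> = x0"
    and Xn: "\<forall>N\<ge>2. \<forall>n\<in>{1..N}. \<forall>\<omega>.
        X N n \<omega> = x0 + 1 / Gamma \<alpha> *
          (\<Sum>j=1..n. b (X N (j - 1) \<omega>) *
              integral {real (j - 1) * (T / real N) .. real j * (T / real N)}
                (\<lambda>s. (real n * (T / real N) - s) powr (\<alpha> - 1)))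
          + G (real n * (T / real N)) \<omega>"
  shows "\<exists>C>0. \<forall>N\<ge>2. \<forall>n\<le>N.
     (\<integral>\<^sup>+\<omega>. ennreal ((X N n \<omega> - x (real n * (T / real N)) \<omega>)\<^sup>2) \<partial>M)
        \<le> ennreal ((C * rate H \<alpha> T (T / real N))\<^sup>2)"
proof -
  obtain b1 b2 b3 K and m :: nat where db: "\<And>x. (b has_real_derivative b1 x) (at x)"
    and db1: "\<And>x. (b1 has_real_derivative b2 x) (at x)" and db2: "\<And>x. (b2 has_real_derivative b3 x) (at x)"
    and bd: "bounded (range b1)"
    and K: "\<And>x. \<bar>b1 x\<bar> \<le> K * (1 + \<bar>x\<bar> ^ m)" "\<And>x. \<bar>b2 x\<bar> \<le> K * (1 + \<bar>x\<bar> ^ m)" "\<And>x. \<bar>b3 x\<bar> \<le> K * (1 + \<bar>x\<bar> ^ m)"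
    using b unfolding C13bp_def by blast
  obtain L where L: "\<And>y. \<bar>b1 y\<bar> \<le> L" using bd unfolding bounded_real by blast
  \<comment> \<open>Evaluating the growth bound at a point shows that the constant is nonnegative,
    which \<open>C13bp\<close> does not state.\<close>
  have "0 \<le> K * (1 + \<bar>1\<bar> ^ m)" using K(1)[of 1] by linarith
  then have K0: "0 \<le> K" by simp
  interpret vol H \<alpha> T M W \<sigma> G b b1 b2 b3 L K m x0 x
    by unfold_locales (use H \<alpha> T \<sigma> W G db db1 db2 K K0 L x_meas x_cont x_sol in blast)+
  show ?thesis
    by (intro euler_error euler_unique) (use X0 Xn in blast)+
qed

end
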